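(* Let $Q$ be a Dynkin quiver, $k=\mathbb{F}_q$, $A=kQ$, and let $P,L,M,N$ be indecomposable $A$-modules with $P$ projective. (1) If $\mathrm{Hom}_A(M,N)=0$, then there exists a short exact sequence $0\to C_N\to C_L\to C_M\to0$ in $C^1(\mathscr{P})$ if and only if $P_L\cong P_M\oplus P_N$ and there exists a short exact sequence $0\to N\to L\to M\to0$ in $\mathrm{mod}\,A$. Moreover, in this case, $$F^{C_L}_{C_MC_N}=q^{\dim\mathrm{Hom}_A(P_N,\Omega_M)+\dim\mathrm{Hom}_A(\Omega_N,P_M)}\,F^L_{MN}.$$ (2) If $M\ncong N$ and $\mathrm{Ext}^1_A(M,N)=0$, then there exists a short exact sequence $0\to C_N\to C_L\to C_M\to0$ in $C^1(\mathscr{P})$ if and only if $P_L\oplus\Omega_L\cong P_M\oplus P_N\oplus\Omega_M\oplus\Omega_N$ and there exists a monomorphism $f:M\to N$ such that $\mathrm{Coker}\,f\cong L$. Moreover, in this case, $F^{C_L}_{C_MC_N}=q^{t}\frac{a_L}{a_N}F^N_{LM}$, where $$t=(\underline{\dim}P_L,\underline{\dim}\Omega_L)-(\underline{\dim}P_M,\underline{\dim}\Omega_M)-(\underline{\dim}P_N,\underline{\dim}\Omega_N)-\langle\underline{\dim}P_M,\underline{\dim}P_N\rangle-\langle\underline{\dim}\Omega_M,\underline{\dim}\Omega_N\rangle.$$ (3) There exists a short exact sequence $0\to C_M\to K_P\to C_M\to0$ in $C^1(\mathscr{P})$ if and only if $M\cong P$. Moreover, $F^{K_P}_{C_PC_P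}=1$.
   Context: A Dynkin quiver is a quiver whose underlying graph is of type $\mathbb{A}_n$, $\mathbb{D}_n$ or $\mathbb{E}_{6,7,8}$. $\mathrm{mod}\,A$ is the category of finite-dimensional $A$-modules, $\mathscr{P}$ that of finite-dimensional projective $A$-modules. For each $A$-module $M$ fix a minimal projective resolution $0\to\Omega_M\xrightarrow{\delta_M}P_M\to M\to0$. $C^1(\mathscr{P})$ (1-cyclic complexes): objects are pairs $(M,d)$, $M\in\mathscr{P}$, $d\in\mathrm{End}_A(M)$, $d^2=0$; morphisms are $A$-homomorphisms commuting with the $d$'s; conflations (short exact sequences) are the sequences whose underlying sequences of $A$-modules are short exact. $C_M=\left(P_M\oplus\Omega_M,\begin{pmatrix}0&\delta_M\\0&0\end{pmatrix}\right)$; $K_P=\left(P\oplus P,\begin{pmatrix}0&\mathrm{Id}\\0&0\end{pmatrix}\right)$ for $P\in\mathscr{P}$. $a_X=|\mathrm{Aut}(X)|$. In either exact category $\mathrm{mod}\,A$ or $C^1(\mathscr{P})$, $F^Z_{XY}=|W^Z_{XY}|/(a_Xa_Y)$ with $W^Z_{XY}$ the set of short exact sequences $0\to Y\to Z\to X\to0$ (pairs of maps); in $\mathrm{mod}\,A$ this is the number of submodules $Z'\subseteq Z$ with $Z'\cong Y$ and $Z/Z'\cong X$. $\underline{\dim}$ is the dimension vector; $\langle\mathbf x,\mathbf y\rangle=\sum_ix_iy_i-\sum_{\rho:i\to j}x_iy_j$ is the Euler form (sum over arrows of $Q$), with $\langle\underline{\dim}M,\underline{\dim}N\rangle=\dim\mathrm{Hom}_A(M,N)-\dim\mathrm{Ext}^1_A(M,N)$;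 $(\mathbf x,\mathbf y)=\langle\mathbf x,\mathbf y\rangle+\langle\mathbf y,\mathbf x\rangle$. *)

theory Defs
  imports
    "HOL-Algebra.AbelCoset"
    "Graph_Theory.Arc_Walk"
    "Jordan_Normal_Form.Missing_VectorSpace"
begin

section \<open>Dynkin quivers\<close>

text \<open>
  A quiver is a \<^typ>\<open>('v, 'e) pre_digraph\<close>: multiple arrows and loops are allowed and an arrow
  \<open>\<rho>\<close> goes from \<open>tail Q \<rho>\<close> to \<open>head Q \<rho>\<close>.
\<close>

datatype dynkin_type = Dynkin_A nat | Dynkin_D nat | Dynkin_E nat

fun dynkin_rank :: "dynkin_type \<Rightarrow> nat" where
  "dynkin_rank (Dynkin_A n) = n"
| "dynkin_rank (Dynkin_D n) = n"
| "dynkin_rank (Dynkin_E n) = n"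

fun dynkin_admissible :: "dynkin_type \<Rightarrow> bool" where
  "dynkin_admissible (Dynkin_A n) \<longleftrightarrow> n \<ge> 1"
| "dynkin_admissible (Dynkin_D n) \<longleftrightarrow> n \<ge> 4"
| "dynkin_admissible (Dynkin_E n) \<longleftrightarrow> n \<in> {6, 7, 8}"

text \<open>
  The diagrams live on the vertices \<open>0, \<dots>, n - 1\<close>.  For \<open>D\<^sub>n\<close> and \<open>E\<^sub>n\<close> the vertex \<open>n - 1\<close> is
  the one attached to the chain \<open>0 - 1 - \<dots> - (n - 2)\<close>: at its penultimate vertex for \<open>D\<^sub>n\<close>, at
  its third vertex for \<open>E\<^sub>n\<close>.
\<close>
fun dynkin_edges :: "dynkin_type \<Rightarrow> nat set set" where
  "dynkin_edges (Dynkin_A n) = {{i, Suc i} | i. Suc i < n}"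
| "dynkin_edges (Dynkin_D n) = insert {n - 3, n - 1} {{i, Suc i} | i. Suc i < n - 1}"
| "dynkin_edges (Dynkin_E n) = insert {2, n - 1} {{i, Suc i} | i. Suc i < n - 1}"

definition dynkin_quiver :: "('v, 'e) pre_digraph \<Rightarrow> bool" where
  "dynkin_quiver Q \<longleftrightarrow> wf_digraph Q \<and>
     (\<exists>D f. dynkin_admissible D \<and> bij_betw f (verts Q) {..<dynkin_rank D} \<and>
        bij_betw (\<lambda>\<rho>. {f (tail Q \<rho>), f (head Q \<rho>)}) (arcs Q) (dynkin_edges D))"


section \<open>The path algebra\<close>

text \<open>
  A path is a pair \<open>(u, es)\<close> of its starting vertex and its list of arrows in the order in which they
  are traversed; \<open>(u, [])\<close> is the trivial path at \<open>u\<close>.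
\<close>
definition qpaths :: "('v, 'e) pre_digraph \<Rightarrow> ('v \<times> 'e list) set" where
  "qpaths Q = {(u, es). \<exists>v. pre_digraph.awalk Q u es v}"

text \<open>\<open>c \<cdot> 1\<close>, where \<open>1\<close> is the sum of all trivial paths.\<close>
definition pa_scalar :: "'k ring \<Rightarrow> ('v, 'e) pre_digraph \<Rightarrow> 'k \<Rightarrow> ('v \<times> 'e list \<Rightarrow> 'k)" where
  "pa_scalar K Q c = (\<lambda>(u, es). if u \<in> verts Q \<and> es = [] then c else \<zero>\<^bsub>K\<^esub>)"

definition pa_vertex :: "'k ring \<Rightarrow> 'v \<Rightarrow> ('v \<times> 'e list \<Rightarrow> 'k)" where
  "pa_vertex K i = (\<lambda>p. if p = (i, []) then \<one>\<^bsub>K\<^esub> else \<zero>\<^bsub>K\<^esub>)"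

text \<open>
  Elements are finitely supported coefficient functions on the paths.  Paths are multiplied like
  functions: \<open>x y\<close> is ``first \<open>y\<close>, then \<open>x\<close>'', so that in a \<^emph>\<open>left\<close> module an arrow \<open>i \<rightarrow> j\<close> maps
  \<open>e\<^sub>i M\<close> to \<open>e\<^sub>j M\<close>, and left modules are representations of \<open>Q\<close> (this is the convention matching
  the sign pattern of the Euler form below).
\<close>
definition path_algebra :: "'k ring \<Rightarrow> ('v, 'e) pre_digraph \<Rightarrow> ('v \<times> 'e list \<Rightarrow> 'k) ring" where
  "path_algebra K Q = \<lparr>
     carrier = {f. (\<forall>p \<in> qpaths Q. f p \<in> carrier K) \<and> (\<forall>p. p \<notin> qpaths Q \<longrightarrow> f p = \<zero>\<^bsub>K\<^esub>) \<and>
                   finite {p. f p \<noteq> \<zero>\<^bsub>K\<^esub>}},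
     mult = (\<lambda>f g (u, es). if (u, es) \<in> qpaths Q
               then (\<Oplus>\<^bsub>K\<^esub> n \<in> {..length es}.
                       f (last (pre_digraph.awalk_verts Q u (take n es)), drop n es) \<otimes>\<^bsub>K\<^esub> g (u, take n es))
               else \<zero>\<^bsub>K\<^esub>),
     one = pa_scalar K Q \<one>\<^bsub>K\<^esub>,
     zero = (\<lambda>p. \<zero>\<^bsub>K\<^esub>),
     add = (\<lambda>f g p. f p \<oplus>\<^bsub>K\<^esub> g p)\<rparr>"


section \<open>Modules over a not necessarily commutative ring\<close>

text \<open>
  The library locale \<^locale>\<open>module\<close> demands a commutative ring; its record type and the notions
  \<^const>\<open>submodule\<close>, \<^const>\<open>module_hom\<close> and \<^const>\<open>direct_sum\<close> do not.
\<close>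
locale left_module = R?: ring R + M?: abelian_group M
  for R :: "('a, 'r) ring_scheme" (structure) and M :: "('a, 'm, 'z) module_scheme" (structure) +
  assumes smult_closed: "\<lbrakk>a \<in> carrier R; x \<in> carrier M\<rbrakk> \<Longrightarrow> a \<odot>\<^bsub>M\<^esub> x \<in> carrier M"
    and smult_l_distr: "\<lbrakk>a \<in> carrier R; b \<in> carrier R; x \<in> carrier M\<rbrakk> \<Longrightarrow>
      (a \<oplus>\<^bsub>R\<^esub> b) \<odot>\<^bsub>M\<^esub> x = a \<odot>\<^bsub>M\<^esub> x \<oplus>\<^bsub>M\<^esub> b \<odot>\<^bsub>M\<^esub> x"
    and smult_r_distr: "\<lbrakk>a \<in> carrier R; x \<in> carrier M; y \<in> carrier M\<rbrakk> \<Longrightarrow>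
      a \<odot>\<^bsub>M\<^esub> (x \<oplus>\<^bsub>M\<^esub> y) = a \<odot>\<^bsub>M\<^esub> x \<oplus>\<^bsub>M\<^esub> a \<odot>\<^bsub>M\<^esub> y"
    and smult_assoc: "\<lbrakk>a \<in> carrier R; b \<in> carrier R; x \<in> carrier M\<rbrakk> \<Longrightarrow>
      (a \<otimes>\<^bsub>R\<^esub> b) \<odot>\<^bsub>M\<^esub> x = a \<odot>\<^bsub>M\<^esub> (b \<odot>\<^bsub>M\<^esub> x)"
    and smult_one: "x \<in> carrier M \<Longrightarrow> \<one>\<^bsub>R\<^esub> \<odot>\<^bsub>M\<^esub> x = x"

text \<open>Restricted to the carrier, so that homomorphisms can be counted.\<close>
definition mod_homs :: "'a ring \<Rightarrow> ('a, 'm) module \<Rightarrow> ('a, 'n) module \<Rightarrow> ('m \<Rightarrow> 'n) set" where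
  "mod_homs R M N = module_hom R M N \<inter> extensional (carrier M)"

definition mod_iso :: "'a ring \<Rightarrow> ('a, 'm) module \<Rightarrow> ('a, 'n) module \<Rightarrow> bool" where
  "mod_iso R M N \<longleftrightarrow> (\<exists>f \<in> module_hom R M N. bij_betw f (carrier M) (carrier N))"

definition mod_auts :: "'a ring \<Rightarrow> ('a, 'm) module \<Rightarrow> ('m \<Rightarrow> 'm) set" where
  "mod_auts R M = {f \<in> mod_homs R M M. bij_betw f (carrier M) (carrier M)}"

definition indecomposable :: "'a ring \<Rightarrow> ('a, 'm) module \<Rightarrow> bool" where
  "indecomposable R M \<longleftrightarrow> carrier M \<noteq> {\<zero>\<^bsub>M\<^esub>} \<and>
     (\<forall>U V. Module.submodule U R M \<and> Module.submodule V R M \<and>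
        U \<inter> V = {\<zero>\<^bsub>M\<^esub>} \<and> U <+>\<^bsub>M\<^esub> V = carrier M
        \<longrightarrow> U = {\<zero>\<^bsub>M\<^esub>} \<or> V = {\<zero>\<^bsub>M\<^esub>})"

text \<open>Exactness of \<open>0 \<rightarrow> Y \<rightarrow> Z \<rightarrow> X \<rightarrow> 0\<close> with maps \<open>f\<close> and \<open>g\<close>.\<close>
definition short_exact ::
  "('a, 'y) module \<Rightarrow> ('y \<Rightarrow> 'z) \<Rightarrow> ('a, 'z) module \<Rightarrow> ('z \<Rightarrow> 'x) \<Rightarrow> ('a, 'x) module \<Rightarrow> bool" where
  "short_exact Y f Z g X \<longleftrightarrow> inj_on f (carrier Y) \<and> g ` carrier Z = carrier X \<and>
     f ` carrier Y = {z \<in> carrier Z. g z = \<zero>\<^bsub>X\<^esub>}"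

text \<open>
  Scalar multiplication sends a coset \<open>x + U\<close> to \<open>U + a (x + U)\<close>, i.e. to \<open>a x + U\<close>; the fields
  \<open>mult\<close> and \<open>one\<close> of a module record carry no meaning.
\<close>
definition quot_module :: "('a, 'm) module \<Rightarrow> 'm set \<Rightarrow> ('a, 'm set) module" where
  "quot_module M U = \<lparr>
     carrier = a_rcosets\<^bsub>M\<^esub> U, mult = (\<lambda>_ _. U), one = U, zero = U,
     add = (\<lambda>X Y. X <+>\<^bsub>M\<^esub> Y),
     smult = (\<lambda>a X. U <+>\<^bsub>M\<^esub> ((\<lambda>x. a \<odot>\<^bsub>M\<^esub> x) ` X))\<rparr>"

definition coker :: "('a, 'm) module \<Rightarrow> ('a, 'n) module \<Rightarrow> ('m \<Rightarrow> 'n) \<Rightarrow> ('a, 'n set) module" where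
  "coker M N f = quot_module N (f ` carrier M)"


section \<open>Finite-dimensional modules over the path algebra\<close>

type_synonym ('v, 'e, 'k, 'm) pa_module = "('v \<times> 'e list \<Rightarrow> 'k, 'm) module"

text \<open>The underlying vector space over the ground field.\<close>
definition k_space ::
  "'k ring \<Rightarrow> ('v, 'e) pre_digraph \<Rightarrow> ('v, 'e, 'k, 'm) pa_module \<Rightarrow> ('k, 'm) module" where
  "k_space K Q M = \<lparr>
     carrier = carrier M, mult = (\<lambda>_ _. \<zero>\<^bsub>M\<^esub>), one = \<zero>\<^bsub>M\<^esub>, zero = \<zero>\<^bsub>M\<^esub>,
     add = (\<lambda>x y. x \<oplus>\<^bsub>M\<^esub> y), smult = (\<lambda>c x. pa_scalar K Q c \<odot>\<^bsub>M\<^esub> x)\<rparr>"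

definition fd_module :: "'k ring \<Rightarrow> ('v, 'e) pre_digraph \<Rightarrow> ('v, 'e, 'k, 'm) pa_module \<Rightarrow> bool" where
  "fd_module K Q M \<longleftrightarrow>
     left_module (path_algebra K Q) M \<and> vectorspace.fin_dim K (k_space K Q M)"

definition dim_vec ::
  "'k ring \<Rightarrow> ('v, 'e) pre_digraph \<Rightarrow> ('v, 'e, 'k, 'm) pa_module \<Rightarrow> 'v \<Rightarrow> int" where
  "dim_vec K Q M i = int (vectorspace.dim K
     (k_space K Q M \<lparr>carrier := (\<lambda>x. pa_vertex K i \<odot>\<^bsub>M\<^esub> x) ` carrier M\<rparr>))"

definition euler_form :: "('v, 'e) pre_digraph \<Rightarrow> ('v \<Rightarrow> int) \<Rightarrow> ('v \<Rightarrow> int) \<Rightarrow> int" where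
  "euler_form Q x y =
     (\<Sum>i \<in> verts Q. x i * y i) - (\<Sum>\<rho> \<in> arcs Q. x (tail Q \<rho>) * y (head Q \<rho>))"

definition sym_euler_form :: "('v, 'e) pre_digraph \<Rightarrow> ('v \<Rightarrow> int) \<Rightarrow> ('v \<Rightarrow> int) \<Rightarrow> int" where
  "sym_euler_form Q x y = euler_form Q x y + euler_form Q y x"

definition hom_space ::
  "'k ring \<Rightarrow> ('v, 'e) pre_digraph \<Rightarrow> ('v, 'e, 'k, 'm) pa_module \<Rightarrow> ('v, 'e, 'k, 'n) pa_module
     \<Rightarrow> ('k, 'm \<Rightarrow> 'n) module" where
  "hom_space K Q M N = \<lparr>
     carrier = mod_homs (path_algebra K Q) M N,
     mult = (\<lambda>_ _. \<lambda>x \<in> carrier M. \<zero>\<^bsub>N\<^esub>), one = (\<lambda>x \<in> carrier M. \<zero>\<^bsub>N\<^esub>),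
     zero = (\<lambda>x \<in> carrier M. \<zero>\<^bsub>N\<^esub>),
     add = (\<lambda>f g. \<lambda>x \<in> carrier M. f x \<oplus>\<^bsub>N\<^esub> g x),
     smult = (\<lambda>c f. \<lambda>x \<in> carrier M. pa_scalar K Q c \<odot>\<^bsub>N\<^esub> f x)\<rparr>"

definition hom_dim ::
  "'k ring \<Rightarrow> ('v, 'e) pre_digraph \<Rightarrow> ('v, 'e, 'k, 'm) pa_module \<Rightarrow> ('v, 'e, 'k, 'n) pa_module
     \<Rightarrow> nat" where
  "hom_dim K Q M N = vectorspace.dim K (hom_space K Q M N)"

text \<open>
  Projective objects of the category of finite-dimensional modules.  HOL cannot quantify over the
  carrier types of the test modules inside a definition; \<^typ>\<open>nat \<Rightarrow> 'k\<close> is no restriction, since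
  it contains all the coordinate spaces \<open>K\<^sup>n\<close> and hence a copy of every finite-dimensional module.
\<close>
definition projective :: "'k ring \<Rightarrow> ('v, 'e) pre_digraph \<Rightarrow> ('v, 'e, 'k, 'm) pa_module \<Rightarrow> bool" where
  "projective K Q P \<longleftrightarrow> fd_module K Q P \<and>
     (\<forall>(X :: ('v, 'e, 'k, nat \<Rightarrow> 'k) pa_module) (Y :: ('v, 'e, 'k, nat \<Rightarrow> 'k) pa_module).
        fd_module K Q X \<and> fd_module K Q Y \<longrightarrow>
        (\<forall>g \<in> module_hom (path_algebra K Q) X Y. \<forall>f \<in> module_hom (path_algebra K Q) P Y.
           g ` carrier X = carrier Y \<longrightarrow>
           (\<exists>h \<in> module_hom (path_algebra K Q) P X. \<forall>p \<in> carrier P. g (h p) = f p)))"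


section \<open>Minimal projective resolutions and \<open>Ext\<close>\<close>

text \<open>The data \<open>0 \<rightarrow> \<Omega> \<rightarrow> P \<rightarrow> M \<rightarrow> 0\<close>, with maps \<open>\<delta>\<close> and \<open>\<pi>\<close>.\<close>
record ('a, 'p, 'm) resolution =
  res_P :: "('a, 'p) module"
  res_Omega :: "('a, 'p) module"
  res_delta :: "'p \<Rightarrow> 'p"
  res_pi :: "'p \<Rightarrow> 'm"

text \<open>
  Minimality: \<open>\<pi>\<close> is a projective cover, i.e. its kernel \<open>\<delta>(\<Omega>)\<close> is superfluous in \<open>P\<close>.
\<close>
definition minimal_resolution ::
  "'k ring \<Rightarrow> ('v, 'e) pre_digraph \<Rightarrow> ('v, 'e, 'k, 'm) pa_module
     \<Rightarrow> ('v \<times> 'e list \<Rightarrow> 'k, 'p, 'm) resolution \<Rightarrow> bool" where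
  "minimal_resolution K Q M r \<longleftrightarrow>
     projective K Q (res_P r) \<and> projective K Q (res_Omega r) \<and>
     res_delta r \<in> module_hom (path_algebra K Q) (res_Omega r) (res_P r) \<and>
     res_pi r \<in> module_hom (path_algebra K Q) (res_P r) M \<and>
     short_exact (res_Omega r) (res_delta r) (res_P r) (res_pi r) M \<and>
     (\<forall>U. Module.submodule U (path_algebra K Q) (res_P r) \<and>
          U <+>\<^bsub>res_P r\<^esub> (res_delta r ` carrier (res_Omega r)) = carrier (res_P r)
          \<longrightarrow> U = carrier (res_P r))"

text \<open>
  \<open>Ext\<^sup>1(M, N)\<close> as the first cohomology of \<open>Hom(-, N)\<close> applied to a projective resolution of \<open>M\<close>
  of length one: the cokernel of \<open>\<delta>\<^sup>* : Hom(P, N) \<rightarrow> Hom(\<Omega>, N)\<close>.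
\<close>
definition Ext1 ::
  "'k ring \<Rightarrow> ('v, 'e) pre_digraph \<Rightarrow> ('v \<times> 'e list \<Rightarrow> 'k, 'p, 'm) resolution
     \<Rightarrow> ('v, 'e, 'k, 'n) pa_module \<Rightarrow> ('k, ('p \<Rightarrow> 'n) set) module" where
  "Ext1 K Q r N = coker (hom_space K Q (res_P r) N) (hom_space K Q (res_Omega r) N)
     (\<lambda>h. compose (carrier (res_Omega r)) h (res_delta r))"

text \<open>Sets of short exact sequences \<open>0 \<rightarrow> Y \<rightarrow> Z \<rightarrow> X \<rightarrow> 0\<close> and Hall numbers \<open>F\<^sup>Z\<^sub>X\<^sub>Y\<close>.\<close>

definition mod_ses ::
  "'k ring \<Rightarrow> ('v, 'e) pre_digraph \<Rightarrow> ('v, 'e, 'k, 'x) pa_module \<Rightarrow> ('v, 'e, 'k, 'y) pa_module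
     \<Rightarrow> ('v, 'e, 'k, 'z) pa_module \<Rightarrow> (('y \<Rightarrow> 'z) \<times> ('z \<Rightarrow> 'x)) set" where
  "mod_ses K Q X Y Z = {(f, g).
     fd_module K Q X \<and> fd_module K Q Y \<and> fd_module K Q Z \<and>
     f \<in> mod_homs (path_algebra K Q) Y Z \<and> g \<in> mod_homs (path_algebra K Q) Z X \<and>
     short_exact Y f Z g X}"

definition mod_hall ::
  "'k ring \<Rightarrow> ('v, 'e) pre_digraph \<Rightarrow> ('v, 'e, 'k, 'x) pa_module \<Rightarrow> ('v, 'e, 'k, 'y) pa_module
     \<Rightarrow> ('v, 'e, 'k, 'z) pa_module \<Rightarrow> real" where
  "mod_hall K Q X Y Z = real (card (mod_ses K Q X Y Z)) /
     (real (card (mod_auts (path_algebra K Q) X)) * real (card (mod_auts (path_algebra K Q) Y)))"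


section \<open>1-cyclic complexes of projectives\<close>

text \<open>A complex is a pair \<open>(M, d)\<close>; only the values of \<open>d\<close> on the carrier of \<open>M\<close> matter.\<close>
type_synonym ('v, 'e, 'k, 'm) complex1 = "('v, 'e, 'k, 'm) pa_module \<times> ('m \<Rightarrow> 'm)"

definition c1_object :: "'k ring \<Rightarrow> ('v, 'e) pre_digraph \<Rightarrow> ('v, 'e, 'k, 'm) complex1 \<Rightarrow> bool" where
  "c1_object K Q X \<longleftrightarrow> projective K Q (fst X) \<and>
     snd X \<in> module_hom (path_algebra K Q) (fst X) (fst X) \<and>
     (\<forall>x \<in> carrier (fst X). snd X (snd X x) = \<zero>\<^bsub>fst X\<^esub>)"

definition c1_homs ::
  "'k ring \<Rightarrow> ('v, 'e) pre_digraph \<Rightarrow> ('v, 'e, 'k, 'm) complex1 \<Rightarrow> ('v, 'e, 'k, 'n) complex1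
     \<Rightarrow> ('m \<Rightarrow> 'n) set" where
  "c1_homs K Q X Y = {f \<in> mod_homs (path_algebra K Q) (fst X) (fst Y).
     \<forall>x \<in> carrier (fst X). f (snd X x) = snd Y (f x)}"

definition c1_auts ::
  "'k ring \<Rightarrow> ('v, 'e) pre_digraph \<Rightarrow> ('v, 'e, 'k, 'm) complex1 \<Rightarrow> ('m \<Rightarrow> 'm) set" where
  "c1_auts K Q X = {f \<in> c1_homs K Q X X. bij_betw f (carrier (fst X)) (carrier (fst X))}"

definition c1_ses ::
  "'k ring \<Rightarrow> ('v, 'e) pre_digraph \<Rightarrow> ('v, 'e, 'k, 'x) complex1 \<Rightarrow> ('v, 'e, 'k, 'y) complex1
     \<Rightarrow> ('v, 'e, 'k, 'z) complex1 \<Rightarrow> (('y \<Rightarrow> 'z) \<times> ('z \<Rightarrow> 'x)) set" where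
  "c1_ses K Q X Y Z = {(f, g).
     c1_object K Q X \<and> c1_object K Q Y \<and> c1_object K Q Z \<and>
     f \<in> c1_homs K Q Y Z \<and> g \<in> c1_homs K Q Z X \<and>
     short_exact (fst Y) f (fst Z) g (fst X)}"

definition c1_hall ::
  "'k ring \<Rightarrow> ('v, 'e) pre_digraph \<Rightarrow> ('v, 'e, 'k, 'x) complex1 \<Rightarrow> ('v, 'e, 'k, 'y) complex1
     \<Rightarrow> ('v, 'e, 'k, 'z) complex1 \<Rightarrow> real" where
  "c1_hall K Q X Y Z = real (card (c1_ses K Q X Y Z)) /
     (real (card (c1_auts K Q X)) * real (card (c1_auts K Q Y)))"

text \<open>The complex \<open>C\<^sub>M\<close> attached to a chosen minimal resolution of \<open>M\<close>, and \<open>K\<^sub>P\<close>.\<close>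

definition C_cplx ::
  "('v \<times> 'e list \<Rightarrow> 'k, 'p, 'm) resolution \<Rightarrow> ('v, 'e, 'k, 'p \<times> 'p) complex1" where
  "C_cplx r = (direct_sum (res_P r) (res_Omega r),
     \<lambda>(p, w). (res_delta r w, \<zero>\<^bsub>res_Omega r\<^esub>))"

definition K_cplx ::
  "('v, 'e, 'k, 'm) pa_module \<Rightarrow> ('v, 'e, 'k, 'm \<times> 'm) complex1" where
  "K_cplx P = (direct_sum P P, \<lambda>(x, y). (y, \<zero>\<^bsub>P\<^esub>))"

end

theory Submission
  imports Defs
begin

text \<open>
  Let \<open>C\<^sub>X\<close> be the complex of the resolution \<open>0 \<rightarrow> \<Omega>\<^sub>X \<rightarrow> P\<^sub>X \<rightarrow> X \<rightarrow> 0\<close>.  Its cycles are \<open>P\<^sub>X\<close>, its boundaries are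
  \<open>\<delta>(\<Omega>\<^sub>X)\<close>, and its homology is \<open>X\<close>.  A chain map \<open>C\<^sub>X \<rightarrow> C\<^sub>Y\<close> is an upper triangular matrix, and it is determined
  by its effect \<open>X \<rightarrow> Y\<close> on homology up to arbitrary elements of \<open>Hom(P\<^sub>X, \<Omega>\<^sub>Y)\<close> and \<open>Hom(\<Omega>\<^sub>X, P\<^sub>Y)\<close>
  (\<open>card_homology_fibre\<close>).  By minimality it is an automorphism if its effect is one, which gives the order of the
  automorphism group of \<open>C\<^sub>X\<close> (\<open>card_c1_auts_C\<close>).  Up to this order a Hall number counts the deflations or the
  inflations of a conflation (\<open>c1_hall_eq\<close>), so it remains to see which homomorphisms they induce on homology.
  Since the quiver has only finitely many paths and \<open>K\<close> is finite, all modules are finite sets, and exactness can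
  be established by counting elements.

  A conflation \<open>C\<^sub>N \<rightarrow> C\<^sub>L \<rightarrow> C\<^sub>M\<close> has an exact homology triangle whose third map is a connecting homomorphism
  \<open>M \<rightarrow> N\<close>.  If \<open>Hom(M, N) = 0\<close>, this map vanishes, and the sequences of cycles, of syzygies and of homology are
  exact (\<open>conflation_homology\<close>).  Conversely, an extension of \<open>M\<close> by \<open>N\<close> with \<open>P\<^sub>L = P\<^sub>M \<oplus> P\<^sub>N\<close> lifts to a
  conflation by the horseshoe lemma, and every lift of its epimorphism is a deflation
  (\<open>horseshoe_conflation\<close>).  The Hall numbers thus differ by the quotient of the sizes of the fibres over
  \<open>Hom(L, M)\<close> and \<open>Hom(M, M)\<close>, which is the power of \<open>q\<close> in question (\<open>conflation_iff_extension\<close>).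

  If \<open>Ext\<^sup>1(M, N) = 0\<close>, then the image of \<open>N\<close> in \<open>L\<close> has a complement (\<open>image_has_complement\<close>).  Minimality excludes
  that the image is zero, so for indecomposable \<open>L\<close> the map \<open>N \<rightarrow> L\<close> is onto; this forces \<open>P\<^sub>N = P\<^sub>L\<close>, \<open>\<Omega>\<^sub>M = 0\<close> and
  \<open>\<Omega>\<^sub>L = \<Omega>\<^sub>N \<oplus> P\<^sub>M\<close>, and the connecting homomorphism identifies \<open>M\<close> with the kernel of \<open>N \<rightarrow> L\<close>
  (\<open>rigid_conflation\<close>, \<open>rigid_homology\<close>).  Conversely, the isomorphism of the middle terms leads to the same
  situation by a comparison of cardinalities, and every lift of the epimorphism \<open>N \<rightarrow> L\<close> is an inflation
  (\<open>quotient_conflation\<close>).  The quotient of the sizes of the fibres is \<open>|Hom(P\<^sub>N, P\<^sub>M)|\<close>, and the exponent in terms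
  of dimension vectors collapses to \<open>\<langle>P\<^sub>N, P\<^sub>M\<rangle>\<close> (\<open>rigid_exponent\<close>).  That these agree is the Euler formula
  for projective modules (\<open>card_homs_projective\<close>): the Euler form bounds the number of homomorphisms from below, the
  bound is attained for free modules, and hence for their direct summands.

  A conflation \<open>C\<^sub>M \<rightarrow> K\<^sub>P \<rightarrow> C\<^sub>M\<close> yields a split exact sequence \<open>0 \<rightarrow> P\<^sub>M \<rightarrow> P \<rightarrow> \<Omega>\<^sub>M \<rightarrow> 0\<close>, so that \<open>\<Omega>\<^sub>M = 0\<close> and
  \<open>M = P\<close> if \<open>P\<close> is indecomposable (\<open>contractible_conflation_iso\<close>).  All inflations \<open>C\<^sub>P \<rightarrow> K\<^sub>P\<close> have the cycles of
  \<open>K\<^sub>P\<close> as image, which leaves a single subobject to be counted (\<open>contractible_conflations\<close>).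
\<close>

section \<open>Modules and homomorphisms over an arbitrary ring\<close>

text \<open>
  One collection of rewrite rules for all modules in a proof, so that none of them has to be interpreted
  as a locale; the arithmetic of several modules is then decided by one call of the simplifier.
\<close>
lemma left_module_rules:
  assumes "left_module R M"
  shows "\<zero>\<^bsub>M\<^esub> \<in> carrier M"
    and "\<And>x y. \<lbrakk>x \<in> carrier M; y \<in> carrier M\<rbrakk> \<Longrightarrow> x \<oplus>\<^bsub>M\<^esub> y \<in> carrier M"
    and "\<And>x. x \<in> carrier M \<Longrightarrow> \<ominus>\<^bsub>M\<^esub> x \<in> carrier M"
    and "\<And>x y. \<lbrakk>x \<in> carrier M; y \<in> carrier M\<rbrakk> \<Longrightarrow> x \<ominus>\<^bsub>M\<^esub> y \<in> carrier M"
    and "\<And>a x. \<lbrakk>a \<in> carrier R; x \<in> carrier M\<rbrakk> \<Longrightarrow> a \<odot>\<^bsub>M\<^esub> x \<in> carrier M"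
    and "\<And>x. x \<in> carrier M \<Longrightarrow> x \<oplus>\<^bsub>M\<^esub> \<zero>\<^bsub>M\<^esub> = x"
    and "\<And>x. x \<in> carrier M \<Longrightarrow> \<zero>\<^bsub>M\<^esub> \<oplus>\<^bsub>M\<^esub> x = x"
    and "\<And>x. x \<in> carrier M \<Longrightarrow> x \<ominus>\<^bsub>M\<^esub> x = \<zero>\<^bsub>M\<^esub>"
    and "\<And>x. x \<in> carrier M \<Longrightarrow> x \<ominus>\<^bsub>M\<^esub> \<zero>\<^bsub>M\<^esub> = x"
    and "\<And>x. x \<in> carrier M \<Longrightarrow> \<zero>\<^bsub>M\<^esub> \<ominus>\<^bsub>M\<^esub> x = \<ominus>\<^bsub>M\<^esub> x"
    and "\<ominus>\<^bsub>M\<^esub> \<zero>\<^bsub>M\<^esub> = \<zero>\<^bsub>M\<^esub>"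
    and "\<And>x. x \<in> carrier M \<Longrightarrow> \<ominus>\<^bsub>M\<^esub> (\<ominus>\<^bsub>M\<^esub> x) = x"
    and "\<And>x. x \<in> carrier M \<Longrightarrow> \<one>\<^bsub>R\<^esub> \<odot>\<^bsub>M\<^esub> x = x"
proof -
  interpret left_module R M by fact
  show "\<And>x. x \<in> carrier M \<Longrightarrow> x \<ominus>\<^bsub>M\<^esub> x = \<zero>\<^bsub>M\<^esub>"
    by (simp add: M.r_neg M.minus_eq)
  show "\<And>x. x \<in> carrier M \<Longrightarrow> \<zero>\<^bsub>M\<^esub> \<ominus>\<^bsub>M\<^esub> x = \<ominus>\<^bsub>M\<^esub> x"
    by (simp add: M.minus_eq)
  show "\<And>x. x \<in> carrier M \<Longrightarrow> x \<ominus>\<^bsub>M\<^esub> \<zero>\<^bsub>M\<^esub> = x"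
    by (simp add: M.minus_eq)
  show "\<ominus>\<^bsub>M\<^esub> \<zero>\<^bsub>M\<^esub> = \<zero>\<^bsub>M\<^esub>"
    using M.r_neg[OF M.zero_closed] M.l_zero[OF M.a_inv_closed[OF M.zero_closed]] by simp
  show "\<And>a x. \<lbrakk>a \<in> carrier R; x \<in> carrier M\<rbrakk> \<Longrightarrow> a \<odot>\<^bsub>M\<^esub> x \<in> carrier M"
    by (rule smult_closed)
  show "\<And>x. x \<in> carrier M \<Longrightarrow> \<one>\<^bsub>R\<^esub> \<odot>\<^bsub>M\<^esub> x = x"
    by (rule smult_one)
qed (simp_all add: left_module.axioms(2)[OF assms] abelian_group.minus_closed abelian_group.a_inv_closed
    abelian_group.minus_minus abelian_group.axioms(1) abelian_monoid.a_closed
    abelian_monoid.l_zero abelian_monoid.r_zero abelian_monoid.zero_closed)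

text \<open>The rewrite rules that decide equations of an abelian group up to reordering.\<close>
lemma left_module_arith:
  assumes "left_module R M"
  shows "\<And>x y z. \<lbrakk>x \<in> carrier M; y \<in> carrier M; z \<in> carrier M\<rbrakk> \<Longrightarrow>
      (x \<oplus>\<^bsub>M\<^esub> y) \<oplus>\<^bsub>M\<^esub> z = x \<oplus>\<^bsub>M\<^esub> (y \<oplus>\<^bsub>M\<^esub> z)"
    and "\<And>x y. \<lbrakk>x \<in> carrier M; y \<in> carrier M\<rbrakk> \<Longrightarrow> x \<oplus>\<^bsub>M\<^esub> y = y \<oplus>\<^bsub>M\<^esub> x"
    and "\<And>x y z. \<lbrakk>x \<in> carrier M; y \<in> carrier M; z \<in> carrier M\<rbrakk> \<Longrightarrow>
      x \<oplus>\<^bsub>M\<^esub> (y \<oplus>\<^bsub>M\<^esub> z) = y \<oplus>\<^bsub>M\<^esub> (x \<oplus>\<^bsub>M\<^esub> z)"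
    and "\<And>x y. x \<ominus>\<^bsub>M\<^esub> y = x \<oplus>\<^bsub>M\<^esub> (\<ominus>\<^bsub>M\<^esub> y)"
    and "\<And>x y. \<lbrakk>x \<in> carrier M; y \<in> carrier M\<rbrakk> \<Longrightarrow>
      \<ominus>\<^bsub>M\<^esub> (x \<oplus>\<^bsub>M\<^esub> y) = \<ominus>\<^bsub>M\<^esub> x \<oplus>\<^bsub>M\<^esub> \<ominus>\<^bsub>M\<^esub> y"
    and "\<And>x. x \<in> carrier M \<Longrightarrow> x \<oplus>\<^bsub>M\<^esub> \<ominus>\<^bsub>M\<^esub> x = \<zero>\<^bsub>M\<^esub>"
    and "\<And>x. x \<in> carrier M \<Longrightarrow> \<ominus>\<^bsub>M\<^esub> x \<oplus>\<^bsub>M\<^esub> x = \<zero>\<^bsub>M\<^esub>"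
    and "\<And>x y. \<lbrakk>x \<in> carrier M; y \<in> carrier M\<rbrakk> \<Longrightarrow> x \<oplus>\<^bsub>M\<^esub> (\<ominus>\<^bsub>M\<^esub> x \<oplus>\<^bsub>M\<^esub> y) = y"
    and "\<And>x y. \<lbrakk>x \<in> carrier M; y \<in> carrier M\<rbrakk> \<Longrightarrow> \<ominus>\<^bsub>M\<^esub> x \<oplus>\<^bsub>M\<^esub> (x \<oplus>\<^bsub>M\<^esub> y) = y"
proof -
  interpret left_module R M by fact
  show "\<And>x y z. \<lbrakk>x \<in> carrier M; y \<in> carrier M; z \<in> carrier M\<rbrakk> \<Longrightarrow>
      x \<oplus>\<^bsub>M\<^esub> (y \<oplus>\<^bsub>M\<^esub> z) = y \<oplus>\<^bsub>M\<^esub> (x \<oplus>\<^bsub>M\<^esub> z)" by (rule M.a_lcomm)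
qed (use left_module.axioms(2)[OF assms] in \<open>simp_all add: abelian_group.r_neg abelian_group.l_neg
   abelian_group.minus_add abelian_group.r_neg1 abelian_group.r_neg2 abelian_group_def
   abelian_monoid.a_assoc abelian_monoid.a_comm a_minus_def\<close>)

text \<open>
  Ordered rewriting sorts a sum by the size of its terms, which puts \<open>x\<close> and \<open>\<ominus> x\<close> apart; these rules
  cancel them across up to three terms.
\<close>
lemma left_module_cancel:
  assumes M: "left_module R M"
  shows "\<And>x a. \<lbrakk>x \<in> carrier M; a \<in> carrier M\<rbrakk> \<Longrightarrow> x \<oplus>\<^bsub>M\<^esub> (a \<oplus>\<^bsub>M\<^esub> \<ominus>\<^bsub>M\<^esub> x) = a"
    and "\<And>x a b. \<lbrakk>x \<in> carrier M; a \<in> carrier M; b \<in> carrier M\<rbrakk> \<Longrightarrow>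
      x \<oplus>\<^bsub>M\<^esub> (a \<oplus>\<^bsub>M\<^esub> (\<ominus>\<^bsub>M\<^esub> x \<oplus>\<^bsub>M\<^esub> b)) = a \<oplus>\<^bsub>M\<^esub> b"
    and "\<And>x a b. \<lbrakk>x \<in> carrier M; a \<in> carrier M; b \<in> carrier M\<rbrakk> \<Longrightarrow>
      x \<oplus>\<^bsub>M\<^esub> (a \<oplus>\<^bsub>M\<^esub> (b \<oplus>\<^bsub>M\<^esub> \<ominus>\<^bsub>M\<^esub> x)) = a \<oplus>\<^bsub>M\<^esub> b"
    and "\<And>x a b c. \<lbrakk>x \<in> carrier M; a \<in> carrier M; b \<in> carrier M; c \<in> carrier M\<rbrakk> \<Longrightarrow>
      x \<oplus>\<^bsub>M\<^esub> (a \<oplus>\<^bsub>M\<^esub> (b \<oplus>\<^bsub>M\<^esub> (\<ominus>\<^bsub>M\<^esub> x \<oplus>\<^bsub>M\<^esub> c))) = a \<oplus>\<^bsub>M\<^esub> (b \<oplus>\<^bsub>M\<^esub> c)"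
    and "\<And>x a b c. \<lbrakk>x \<in> carrier M; a \<in> carrier M; b \<in> carrier M; c \<in> carrier M\<rbrakk> \<Longrightarrow>
      x \<oplus>\<^bsub>M\<^esub> (a \<oplus>\<^bsub>M\<^esub> (b \<oplus>\<^bsub>M\<^esub> (c \<oplus>\<^bsub>M\<^esub> \<ominus>\<^bsub>M\<^esub> x))) = a \<oplus>\<^bsub>M\<^esub> (b \<oplus>\<^bsub>M\<^esub> c)"
    and "\<And>x a b c d. \<lbrakk>x \<in> carrier M; a \<in> carrier M; b \<in> carrier M; c \<in> carrier M; d \<in> carrier M\<rbrakk> \<Longrightarrow>
      x \<oplus>\<^bsub>M\<^esub> (a \<oplus>\<^bsub>M\<^esub> (b \<oplus>\<^bsub>M\<^esub> (c \<oplus>\<^bsub>M\<^esub> (\<ominus>\<^bsub>M\<^esub> x \<oplus>\<^bsub>M\<^esub> d)))) = a \<oplus>\<^bsub>M\<^esub> (b \<oplus>\<^bsub>M\<^esub> (c \<oplus>\<^bsub>M\<^esub> d))"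
proof -
  note [simp] = left_module_rules[OF M] and ar = left_module_arith[OF M]
  show 1: "\<And>x a. \<lbrakk>x \<in> carrier M; a \<in> carrier M\<rbrakk> \<Longrightarrow> x \<oplus>\<^bsub>M\<^esub> (a \<oplus>\<^bsub>M\<^esub> \<ominus>\<^bsub>M\<^esub> x) = a"
    using ar(6) ar(3) by (metis left_module_rules(3,6)[OF M])
  show 2: "\<And>x a b. \<lbrakk>x \<in> carrier M; a \<in> carrier M; b \<in> carrier M\<rbrakk> \<Longrightarrow>
      x \<oplus>\<^bsub>M\<^esub> (a \<oplus>\<^bsub>M\<^esub> (\<ominus>\<^bsub>M\<^esub> x \<oplus>\<^bsub>M\<^esub> b)) = a \<oplus>\<^bsub>M\<^esub> b"
    using ar(8) ar(3) by (metis left_module_rules(2,3)[OF M])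
  show 3: "\<And>x a b. \<lbrakk>x \<in> carrier M; a \<in> carrier M; b \<in> carrier M\<rbrakk> \<Longrightarrow>
      x \<oplus>\<^bsub>M\<^esub> (a \<oplus>\<^bsub>M\<^esub> (b \<oplus>\<^bsub>M\<^esub> \<ominus>\<^bsub>M\<^esub> x)) = a \<oplus>\<^bsub>M\<^esub> b"
    using 1 ar(3) by (metis left_module_rules(2,3)[OF M])
  show 4: "\<And>x a b c. \<lbrakk>x \<in> carrier M; a \<in> carrier M; b \<in> carrier M; c \<in> carrier M\<rbrakk> \<Longrightarrow>
      x \<oplus>\<^bsub>M\<^esub> (a \<oplus>\<^bsub>M\<^esub> (b \<oplus>\<^bsub>M\<^esub> (\<ominus>\<^bsub>M\<^esub> x \<oplus>\<^bsub>M\<^esub> c))) = a \<oplus>\<^bsub>M\<^esub> (b \<oplus>\<^bsub>M\<^esub> c)"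
    using 2 ar(3) by (metis left_module_rules(2,3)[OF M])
  show 5: "\<And>x a b c. \<lbrakk>x \<in> carrier M; a \<in> carrier M; b \<in> carrier M; c \<in> carrier M\<rbrakk> \<Longrightarrow>
      x \<oplus>\<^bsub>M\<^esub> (a \<oplus>\<^bsub>M\<^esub> (b \<oplus>\<^bsub>M\<^esub> (c \<oplus>\<^bsub>M\<^esub> \<ominus>\<^bsub>M\<^esub> x))) = a \<oplus>\<^bsub>M\<^esub> (b \<oplus>\<^bsub>M\<^esub> c)"
    using 3 ar(3) by (metis left_module_rules(2,3)[OF M])
  show "\<And>x a b c d. \<lbrakk>x \<in> carrier M; a \<in> carrier M; b \<in> carrier M; c \<in> carrier M; d \<in> carrier M\<rbrakk> \<Longrightarrow>
      x \<oplus>\<^bsub>M\<^esub> (a \<oplus>\<^bsub>M\<^esub> (b \<oplus>\<^bsub>M\<^esub> (c \<oplus>\<^bsub>M\<^esub> (\<ominus>\<^bsub>M\<^esub> x \<oplus>\<^bsub>M\<^esub> d)))) = a \<oplus>\<^bsub>M\<^esub> (b \<oplus>\<^bsub>M\<^esub> (c \<oplus>\<^bsub>M\<^esub> d))"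
    using 4 ar(3) by (metis left_module_rules(2,3)[OF M])
qed

lemma left_module_move:
  assumes M: "left_module R M"
  shows "\<And>x y. \<lbrakk>x \<in> carrier M; y \<in> carrier M\<rbrakk> \<Longrightarrow> x \<ominus>\<^bsub>M\<^esub> y = \<zero>\<^bsub>M\<^esub> \<longleftrightarrow> x = y"
    and "\<And>x y z. \<lbrakk>x \<in> carrier M; y \<in> carrier M; z \<in> carrier M\<rbrakk> \<Longrightarrow>
      x \<ominus>\<^bsub>M\<^esub> y = z \<longleftrightarrow> x = z \<oplus>\<^bsub>M\<^esub> y"
    and "\<And>x y. \<lbrakk>x \<in> carrier M; y \<in> carrier M\<rbrakk> \<Longrightarrow> x \<oplus>\<^bsub>M\<^esub> y = \<zero>\<^bsub>M\<^esub> \<longleftrightarrow> x = \<ominus>\<^bsub>M\<^esub> y"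
    and "\<And>x y z. \<lbrakk>x \<in> carrier M; y \<in> carrier M; z \<in> carrier M\<rbrakk> \<Longrightarrow>
      x \<oplus>\<^bsub>M\<^esub> z = y \<oplus>\<^bsub>M\<^esub> z \<longleftrightarrow> x = y"
    and "\<And>x y. \<lbrakk>x \<in> carrier M; y \<in> carrier M\<rbrakk> \<Longrightarrow> \<ominus>\<^bsub>M\<^esub> x = \<ominus>\<^bsub>M\<^esub> y \<longleftrightarrow> x = y"
proof -
  note [simp] = left_module_rules[OF M] and ar = left_module_arith[OF M]
  show *: "x \<ominus>\<^bsub>M\<^esub> y = z \<longleftrightarrow> x = z \<oplus>\<^bsub>M\<^esub> y" if "x \<in> carrier M" "y \<in> carrier M" "z \<in> carrier M" for x y z
  proof
    assume "x \<ominus>\<^bsub>M\<^esub> y = z"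
    then have "z \<oplus>\<^bsub>M\<^esub> y = (x \<ominus>\<^bsub>M\<^esub> y) \<oplus>\<^bsub>M\<^esub> y" by simp
    also have "\<dots> = x" using that by (simp add: ar)
    finally show "x = z \<oplus>\<^bsub>M\<^esub> y" by simp
  next
    assume "x = z \<oplus>\<^bsub>M\<^esub> y"
    then have "x \<ominus>\<^bsub>M\<^esub> y = (z \<oplus>\<^bsub>M\<^esub> y) \<ominus>\<^bsub>M\<^esub> y" by simp
    also have "\<dots> = z" using that by (simp add: ar left_module_cancel[OF M])
    finally show "x \<ominus>\<^bsub>M\<^esub> y = z" .
  qed
  show "x \<ominus>\<^bsub>M\<^esub> y = \<zero>\<^bsub>M\<^esub> \<longleftrightarrow> x = y" if "x \<in> carrier M" "y \<in> carrier M" for x y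
    using that by (subst *) auto
  show "x \<oplus>\<^bsub>M\<^esub> y = \<zero>\<^bsub>M\<^esub> \<longleftrightarrow> x = \<ominus>\<^bsub>M\<^esub> y" if "x \<in> carrier M" "y \<in> carrier M" for x y
    using that *[of "\<zero>\<^bsub>M\<^esub>" y x] by auto
  show "x \<oplus>\<^bsub>M\<^esub> z = y \<oplus>\<^bsub>M\<^esub> z \<longleftrightarrow> x = y"
    if "x \<in> carrier M" "y \<in> carrier M" "z \<in> carrier M" for x y z
  proof -
    have "(y \<oplus>\<^bsub>M\<^esub> z) \<ominus>\<^bsub>M\<^esub> z = y" using that by (simp add: ar left_module_cancel[OF M])
    then show ?thesis using that *[of "y \<oplus>\<^bsub>M\<^esub> z" z x] by auto
  qed
  show "\<ominus>\<^bsub>M\<^esub> x = \<ominus>\<^bsub>M\<^esub> y \<longleftrightarrow> x = y" if "x \<in> carrier M" "y \<in> carrier M" for x y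
    using that left_module_rules(12)[OF M] by metis
qed

lemma left_module_smult:
  assumes M: "left_module R M"
  shows "\<And>a x y. \<lbrakk>a \<in> carrier R; x \<in> carrier M; y \<in> carrier M\<rbrakk> \<Longrightarrow>
      a \<odot>\<^bsub>M\<^esub> (x \<oplus>\<^bsub>M\<^esub> y) = a \<odot>\<^bsub>M\<^esub> x \<oplus>\<^bsub>M\<^esub> a \<odot>\<^bsub>M\<^esub> y"
    and "\<And>a b x. \<lbrakk>a \<in> carrier R; b \<in> carrier R; x \<in> carrier M\<rbrakk> \<Longrightarrow>
      (a \<oplus>\<^bsub>R\<^esub> b) \<odot>\<^bsub>M\<^esub> x = a \<odot>\<^bsub>M\<^esub> x \<oplus>\<^bsub>M\<^esub> b \<odot>\<^bsub>M\<^esub> x"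
    and "\<And>a b x. \<lbrakk>a \<in> carrier R; b \<in> carrier R; x \<in> carrier M\<rbrakk> \<Longrightarrow>
      (a \<otimes>\<^bsub>R\<^esub> b) \<odot>\<^bsub>M\<^esub> x = a \<odot>\<^bsub>M\<^esub> (b \<odot>\<^bsub>M\<^esub> x)"
    and "\<And>a. a \<in> carrier R \<Longrightarrow> a \<odot>\<^bsub>M\<^esub> \<zero>\<^bsub>M\<^esub> = \<zero>\<^bsub>M\<^esub>"
    and "\<And>x. x \<in> carrier M \<Longrightarrow> \<zero>\<^bsub>R\<^esub> \<odot>\<^bsub>M\<^esub> x = \<zero>\<^bsub>M\<^esub>"
    and "\<And>a x. \<lbrakk>a \<in> carrier R; x \<in> carrier M\<rbrakk> \<Longrightarrow> a \<odot>\<^bsub>M\<^esub> (\<ominus>\<^bsub>M\<^esub> x) = \<ominus>\<^bsub>M\<^esub> (a \<odot>\<^bsub>M\<^esub> x)"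
proof -
  interpret left_module R M by fact
  note mv = left_module_move[OF M]
  show z: "a \<odot>\<^bsub>M\<^esub> \<zero>\<^bsub>M\<^esub> = \<zero>\<^bsub>M\<^esub>" if "a \<in> carrier R" for a
  proof -
    have "a \<odot>\<^bsub>M\<^esub> \<zero>\<^bsub>M\<^esub> \<oplus>\<^bsub>M\<^esub> a \<odot>\<^bsub>M\<^esub> \<zero>\<^bsub>M\<^esub> = \<zero>\<^bsub>M\<^esub> \<oplus>\<^bsub>M\<^esub> a \<odot>\<^bsub>M\<^esub> \<zero>\<^bsub>M\<^esub>"
      using that by (simp add: smult_closed flip: smult_r_distr)
    then show ?thesis using that mv(4) smult_closed M.zero_closed by metis
  qed
  show "\<zero>\<^bsub>R\<^esub> \<odot>\<^bsub>M\<^esub> x = \<zero>\<^bsub>M\<^esub>" if "x \<in> carrier M" for x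
  proof -
    have "\<zero>\<^bsub>R\<^esub> \<odot>\<^bsub>M\<^esub> x \<oplus>\<^bsub>M\<^esub> \<zero>\<^bsub>R\<^esub> \<odot>\<^bsub>M\<^esub> x = \<zero>\<^bsub>M\<^esub> \<oplus>\<^bsub>M\<^esub> \<zero>\<^bsub>R\<^esub> \<odot>\<^bsub>M\<^esub> x"
      using that by (simp add: smult_closed flip: smult_l_distr)
    then show ?thesis using that mv(4) smult_closed M.zero_closed R.zero_closed by metis
  qed
  show "a \<odot>\<^bsub>M\<^esub> (\<ominus>\<^bsub>M\<^esub> x) = \<ominus>\<^bsub>M\<^esub> (a \<odot>\<^bsub>M\<^esub> x)" if "a \<in> carrier R" "x \<in> carrier M" for a x
  proof -
    have "a \<odot>\<^bsub>M\<^esub> (\<ominus>\<^bsub>M\<^esub> x) \<oplus>\<^bsub>M\<^esub> a \<odot>\<^bsub>M\<^esub> x = \<zero>\<^bsub>M\<^esub>"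
      using that z by (simp add: M.l_neg flip: smult_r_distr)
    then show ?thesis using that mv(3) by (simp add: smult_closed)
  qed
qed (use left_module.smult_r_distr[OF assms] left_module.smult_l_distr[OF assms]
       left_module.smult_assoc[OF assms] in auto)

lemma hom_rules:
  assumes f: "f \<in> module_hom R M N" and M: "left_module R M" and N: "left_module R N"
  shows "\<And>x. x \<in> carrier M \<Longrightarrow> f x \<in> carrier N"
    and "\<And>x y. \<lbrakk>x \<in> carrier M; y \<in> carrier M\<rbrakk> \<Longrightarrow> f (x \<oplus>\<^bsub>M\<^esub> y) = f x \<oplus>\<^bsub>N\<^esub> f y"
    and "\<And>a x. \<lbrakk>a \<in> carrier R; x \<in> carrier M\<rbrakk> \<Longrightarrow> f (a \<odot>\<^bsub>M\<^esub> x) = a \<odot>\<^bsub>N\<^esub> f x"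
    and "f \<zero>\<^bsub>M\<^esub> = \<zero>\<^bsub>N\<^esub>"
    and "\<And>x. x \<in> carrier M \<Longrightarrow> f (\<ominus>\<^bsub>M\<^esub> x) = \<ominus>\<^bsub>N\<^esub> f x"
    and "\<And>x y. \<lbrakk>x \<in> carrier M; y \<in> carrier M\<rbrakk> \<Longrightarrow> f (x \<ominus>\<^bsub>M\<^esub> y) = f x \<ominus>\<^bsub>N\<^esub> f y"
proof -
  note [simp] = left_module_rules[OF M] left_module_rules[OF N]
  show cl: "\<And>x. x \<in> carrier M \<Longrightarrow> f x \<in> carrier N" using f by (auto simp: module_hom_def)
  show add: "\<And>x y. \<lbrakk>x \<in> carrier M; y \<in> carrier M\<rbrakk> \<Longrightarrow> f (x \<oplus>\<^bsub>M\<^esub> y) = f x \<oplus>\<^bsub>N\<^esub> f y"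
    using f by (auto simp: module_hom_def)
  show "\<And>a x. \<lbrakk>a \<in> carrier R; x \<in> carrier M\<rbrakk> \<Longrightarrow> f (a \<odot>\<^bsub>M\<^esub> x) = a \<odot>\<^bsub>N\<^esub> f x"
    using f by (auto simp: module_hom_def)
  have "\<zero>\<^bsub>N\<^esub> \<oplus>\<^bsub>N\<^esub> f \<zero>\<^bsub>M\<^esub> = f \<zero>\<^bsub>M\<^esub> \<oplus>\<^bsub>N\<^esub> f \<zero>\<^bsub>M\<^esub>"
    using cl by (simp flip: add)
  then show z: "f \<zero>\<^bsub>M\<^esub> = \<zero>\<^bsub>N\<^esub>"
    using left_module_move(4)[OF N, of "\<zero>\<^bsub>N\<^esub>" "f \<zero>\<^bsub>M\<^esub>" "f \<zero>\<^bsub>M\<^esub>"] cl by simp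
  show neg: "f (\<ominus>\<^bsub>M\<^esub> x) = \<ominus>\<^bsub>N\<^esub> f x" if "x \<in> carrier M" for x
    using that left_module_move(3)[OF N, of "f (\<ominus>\<^bsub>M\<^esub> x)" "f x"] z cl
    by (simp add: left_module_arith[OF M] flip: add)
  show "\<And>x y. \<lbrakk>x \<in> carrier M; y \<in> carrier M\<rbrakk> \<Longrightarrow> f (x \<ominus>\<^bsub>M\<^esub> y) = f x \<ominus>\<^bsub>N\<^esub> f y"
    by (simp add: a_minus_def add neg)
qed

lemma homI:
  assumes "\<And>x. x \<in> carrier M \<Longrightarrow> f x \<in> carrier N"
    and "\<And>x y. \<lbrakk>x \<in> carrier M; y \<in> carrier M\<rbrakk> \<Longrightarrow> f (x \<oplus>\<^bsub>M\<^esub> y) = f x \<oplus>\<^bsub>N\<^esub> f y"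
    and "\<And>a x. \<lbrakk>a \<in> carrier R; x \<in> carrier M\<rbrakk> \<Longrightarrow> f (a \<odot>\<^bsub>M\<^esub> x) = a \<odot>\<^bsub>N\<^esub> f x"
  shows "f \<in> module_hom R M N"
  using assms by (auto simp: module_hom_def)

lemma hom_cong:
  assumes "f \<in> module_hom R M N" "left_module R M" "\<And>x. x \<in> carrier M \<Longrightarrow> g x = f x"
  shows "g \<in> module_hom R M N"
  using assms(1,3) left_module_rules[OF assms(2)] by (auto simp: module_hom_def Pi_iff)

lemma hom_comp:
  assumes "f \<in> module_hom R M N" "g \<in> module_hom R N T"
  shows "(\<lambda>x. g (f x)) \<in> module_hom R M T"
  using assms by (auto simp: module_hom_def Pi_iff)

lemma hom_id: "(\<lambda>x. x) \<in> module_hom R M M"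
  by (auto simp: module_hom_def)

lemma hom_zero: "left_module R N \<Longrightarrow> (\<lambda>x. \<zero>\<^bsub>N\<^esub>) \<in> module_hom R M N"
  by (rule homI) (auto simp: left_module_rules left_module_smult)

lemma hom_add:
  assumes "f \<in> module_hom R M N" "g \<in> module_hom R M N" "left_module R M" "left_module R N"
  shows "(\<lambda>x. f x \<oplus>\<^bsub>N\<^esub> g x) \<in> module_hom R M N"
  using hom_rules[OF assms(1,3,4)] hom_rules[OF assms(2,3,4)]
    left_module_rules[OF assms(4)] left_module_smult(1)[OF assms(4)] left_module_arith(1-3)[OF assms(4)]
  by (intro homI) simp_all

lemma hom_neg:
  assumes "f \<in> module_hom R M N" "left_module R M" "left_module R N"
  shows "(\<lambda>x. \<ominus>\<^bsub>N\<^esub> f x) \<in> module_hom R M N"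
  using hom_rules[OF assms(1,2,3)]
    left_module_rules[OF assms(3)] left_module_smult(6)[OF assms(3)] left_module_arith(1-5)[OF assms(3)]
  by (intro homI) simp_all

lemma hom_minus:
  assumes "f \<in> module_hom R M N" "g \<in> module_hom R M N" "left_module R M" "left_module R N"
  shows "(\<lambda>x. f x \<ominus>\<^bsub>N\<^esub> g x) \<in> module_hom R M N"
  unfolding a_minus_def using assms by (intro hom_add hom_neg)

lemma inj_on_hom_iff:
  assumes f: "f \<in> module_hom R M N" and M: "left_module R M" and N: "left_module R N"
  shows "inj_on f (carrier M) \<longleftrightarrow> (\<forall>x \<in> carrier M. f x = \<zero>\<^bsub>N\<^esub> \<longrightarrow> x = \<zero>\<^bsub>M\<^esub>)"
proof
  show "inj_on f (carrier M) \<Longrightarrow> \<forall>x \<in> carrier M. f x = \<zero>\<^bsub>N\<^esub> \<longrightarrow> x = \<zero>\<^bsub>M\<^esub>"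
    using hom_rules[OF assms] left_module_rules[OF M] by (metis inj_onD)
  assume *: "\<forall>x \<in> carrier M. f x = \<zero>\<^bsub>N\<^esub> \<longrightarrow> x = \<zero>\<^bsub>M\<^esub>"
  show "inj_on f (carrier M)"
  proof (rule inj_onI)
    fix x y assume "x \<in> carrier M" "y \<in> carrier M" "f x = f y"
    then show "x = y"
      using * hom_rules[OF assms] left_module_rules(4)[OF M] left_module_rules(8)[OF N] left_module_move(1)[OF M]
      by metis
  qed
qed

lemma factor_through_injection:
  assumes d: "d \<in> module_hom R W P" and inj: "inj_on d (carrier W)" and f: "f \<in> module_hom R X P"
    and W: "left_module R W" and P: "left_module R P" and X: "left_module R X"
    and im: "f ` carrier X \<subseteq> d ` carrier W"
  shows "\<exists>h \<in> module_hom R X W. \<forall>x \<in> carrier X. d (h x) = f x"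
proof
  let ?h = "\<lambda>x. inv_into (carrier W) d (f x)"
  note [simp] = left_module_rules[OF W] left_module_rules[OF P] left_module_rules[OF X]
    hom_rules[OF d W P] hom_rules[OF f X P]
  have cl: "?h x \<in> carrier W" and eq: "d (?h x) = f x" if "x \<in> carrier X" for x
  proof -
    have "f x \<in> d ` carrier W" using that im by blast
    then show "?h x \<in> carrier W" "d (?h x) = f x" by (rule inv_into_into, rule f_inv_into_f)
  qed
  show "\<forall>x \<in> carrier X. d (?h x) = f x" using eq by auto
  show "?h \<in> module_hom R X W"
  proof (rule homI)
    show "?h (x \<oplus>\<^bsub>X\<^esub> y) = ?h x \<oplus>\<^bsub>W\<^esub> ?h y" if "x \<in> carrier X" "y \<in> carrier X" for x y
    proof (rule inj_onD[OF inj])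
      show "d (?h (x \<oplus>\<^bsub>X\<^esub> y)) = d (?h x \<oplus>\<^bsub>W\<^esub> ?h y)" using that eq[of "x \<oplus>\<^bsub>X\<^esub> y"] cl eq by simp
    qed (use that cl[of "x \<oplus>\<^bsub>X\<^esub> y"] cl in simp_all)
    show "?h (a \<odot>\<^bsub>X\<^esub> x) = a \<odot>\<^bsub>W\<^esub> ?h x" if "a \<in> carrier R" "x \<in> carrier X" for a x
    proof (rule inj_onD[OF inj])
      show "d (?h (a \<odot>\<^bsub>X\<^esub> x)) = d (a \<odot>\<^bsub>W\<^esub> ?h x)" using that eq[of "a \<odot>\<^bsub>X\<^esub> x"] cl eq by simp
    qed (use that cl[of "a \<odot>\<^bsub>X\<^esub> x"] cl in simp_all)
  qed (use cl in simp)
qed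

lemma factor_through_surjection:
  assumes p: "p \<in> module_hom R P M" and onto: "p ` carrier P = carrier M" and f: "f \<in> module_hom R P N"
    and M: "left_module R M" and P: "left_module R P" and N: "left_module R N"
    and ker: "\<And>x. \<lbrakk>x \<in> carrier P; p x = \<zero>\<^bsub>M\<^esub>\<rbrakk> \<Longrightarrow> f x = \<zero>\<^bsub>N\<^esub>"
  shows "\<exists>h \<in> module_hom R M N. \<forall>x \<in> carrier P. h (p x) = f x"
proof
  let ?s = "inv_into (carrier P) p"
  let ?h = "\<lambda>m. f (?s m)"
  note [simp] = left_module_rules[OF M] left_module_rules[OF P] left_module_rules[OF N]
    hom_rules[OF p P M] hom_rules[OF f P N]
  have same: "f x = f y" if "x \<in> carrier P" "y \<in> carrier P" "p x = p y" for x y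
    using ker[of "x \<ominus>\<^bsub>P\<^esub> y"] that left_module_move(1)[OF N, of "f x" "f y"] by simp
  have cl: "?s m \<in> carrier P" and eq: "p (?s m) = m" if "m \<in> carrier M" for m
    using that onto by (auto intro: inv_into_into f_inv_into_f)
  show *: "\<forall>x \<in> carrier P. ?h (p x) = f x"
    using cl eq by (auto intro!: same)
  have ex: "\<exists>x \<in> carrier P. p x = m" if "m \<in> carrier M" for m using cl eq that by auto
  show "?h \<in> module_hom R M N"
  proof (rule homI)
    show "?h x \<in> carrier N" if "x \<in> carrier M" for x using that cl by simp
    show "?h (x \<oplus>\<^bsub>M\<^esub> y) = ?h x \<oplus>\<^bsub>N\<^esub> ?h y" if "x \<in> carrier M" "y \<in> carrier M" for x y
    proof -
      have "?h (x \<oplus>\<^bsub>M\<^esub> y) = f (?s x \<oplus>\<^bsub>P\<^esub> ?s y)"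
        by (rule same) (auto simp: that cl eq)
      then show ?thesis using that cl by simp
    qed
    show "?h (a \<odot>\<^bsub>M\<^esub> x) = a \<odot>\<^bsub>N\<^esub> ?h x" if "a \<in> carrier R" "x \<in> carrier M" for a x
    proof -
      have "?h (a \<odot>\<^bsub>M\<^esub> x) = f (a \<odot>\<^bsub>P\<^esub> ?s x)"
        by (rule same) (auto simp: that cl eq)
      then show ?thesis using that cl by simp
    qed
  qed
qed

lemma submoduleI':
  assumes M: "left_module R M" and "U \<subseteq> carrier M" "\<zero>\<^bsub>M\<^esub> \<in> U"
    and "\<And>x y. \<lbrakk>x \<in> U; y \<in> U\<rbrakk> \<Longrightarrow> x \<oplus>\<^bsub>M\<^esub> y \<in> U" "\<And>x. x \<in> U \<Longrightarrow> \<ominus>\<^bsub>M\<^esub> x \<in> U"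
    and "\<And>a x. \<lbrakk>a \<in> carrier R; x \<in> U\<rbrakk> \<Longrightarrow> a \<odot>\<^bsub>M\<^esub> x \<in> U"
  shows "Module.submodule U R M"
  by (rule Module.submodule.intro, rule subgroup.intro)
    (use assms in \<open>auto intro!: Module.submodule_axioms.intro simp: a_inv_def\<close>)

lemma submodule_image:
  assumes f: "f \<in> module_hom R M N" and M: "left_module R M" and N: "left_module R N"
  shows "Module.submodule (f ` carrier M) R N"
proof -
  note h = hom_rules[OF f M N]
  note [simp] = left_module_rules[OF M]
  show ?thesis
    by (rule submoduleI'[OF N]) (auto simp flip: h(2-5) intro: h(1))
qed

lemma submodule_kernel:
  assumes f: "f \<in> module_hom R M N" and M: "left_module R M" and N: "left_module R N"
  shows "Module.submodule {x \<in> carrier M. f x = \<zero>\<^bsub>N\<^esub>} R M"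
  by (rule submoduleI'[OF M])
    (auto simp: hom_rules[OF assms] left_module_rules[OF M] left_module_rules[OF N] left_module_smult[OF N])

lemma submoduleD:
  assumes U: "Module.submodule U R M" and M: "left_module R M"
  shows "U \<subseteq> carrier M" "\<zero>\<^bsub>M\<^esub> \<in> U"
    and "\<And>x y. \<lbrakk>x \<in> U; y \<in> U\<rbrakk> \<Longrightarrow> x \<oplus>\<^bsub>M\<^esub> y \<in> U" "\<And>x. x \<in> U \<Longrightarrow> \<ominus>\<^bsub>M\<^esub> x \<in> U"
    and "\<And>a x. \<lbrakk>a \<in> carrier R; x \<in> U\<rbrakk> \<Longrightarrow> a \<odot>\<^bsub>M\<^esub> x \<in> U"
proof -
  have s: "subgroup U (add_monoid M)" using U by (rule Module.submodule.axioms)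
  show "U \<subseteq> carrier M" using subgroup.subset[OF s] by simp
  show "\<zero>\<^bsub>M\<^esub> \<in> U" using subgroup.one_closed[OF s] by simp
  show "\<And>x y. \<lbrakk>x \<in> U; y \<in> U\<rbrakk> \<Longrightarrow> x \<oplus>\<^bsub>M\<^esub> y \<in> U" using subgroup.m_closed[OF s] by simp
  show "\<And>x. x \<in> U \<Longrightarrow> \<ominus>\<^bsub>M\<^esub> x \<in> U" using subgroup.m_inv_closed[OF s] by (simp add: a_inv_def)
  show "\<And>a x. \<lbrakk>a \<in> carrier R; x \<in> U\<rbrakk> \<Longrightarrow> a \<odot>\<^bsub>M\<^esub> x \<in> U" using Module.submodule.smult_closed[OF U] .
qed

lemma left_module_submodule:
  assumes U: "Module.submodule U R M" and M: "left_module R M"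
  shows "left_module R (M\<lparr>carrier := U\<rparr>)"
proof -
  note sub = submoduleD[OF U M]
  note [simp] = left_module_rules[OF M] left_module_smult[OF M] left_module_arith(1-3)[OF M]
  have "abelian_group (M\<lparr>carrier := U\<rparr>)"
  proof (rule abelian_groupI, goal_cases)
    case (6 x)
    then show ?case using sub by (intro bexI[of _ "\<ominus>\<^bsub>M\<^esub> x"]) (auto simp: left_module_arith(6,7)[OF M] subset_iff)
  qed (use sub in \<open>auto simp: subset_iff\<close>)
  moreover have "ring R" using M by (rule left_module.axioms)
  ultimately show ?thesis
    by (intro left_module.intro left_module_axioms.intro) (use sub in \<open>auto simp: subset_iff\<close>)
qed

lemma direct_sum_simps [simp]:
  "carrier (direct_sum M N) = carrier M \<times> carrier N"
  "\<zero>\<^bsub>direct_sum M N\<^esub> = (\<zero>\<^bsub>M\<^esub>, \<zero>\<^bsub>N\<^esub>)"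
  "v \<oplus>\<^bsub>direct_sum M N\<^esub> w = (fst v \<oplus>\<^bsub>M\<^esub> fst w, snd v \<oplus>\<^bsub>N\<^esub> snd w)"
  "a \<odot>\<^bsub>direct_sum M N\<^esub> v = (a \<odot>\<^bsub>M\<^esub> fst v, a \<odot>\<^bsub>N\<^esub> snd v)"
  by (simp_all add: direct_sum_def)

lemma left_module_direct_sum:
  assumes M: "left_module R M" and N: "left_module R N"
  shows "left_module R (direct_sum M N)"
proof -
  note [simp] = left_module_rules[OF M] left_module_smult[OF M] left_module_rules[OF N] left_module_smult[OF N]
  have "abelian_group (direct_sum M N)"
  proof (rule abelian_groupI, goal_cases)
    case (6 v)
    then show ?case
      by (intro bexI[of _ "(\<ominus>\<^bsub>M\<^esub> fst v, \<ominus>\<^bsub>N\<^esub> snd v)"])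
        (auto simp: left_module_arith[OF M] left_module_arith[OF N])
  qed (auto simp: left_module_arith[OF M] left_module_arith[OF N])
  moreover have "ring R" using M by (rule left_module.axioms)
  ultimately show ?thesis
    by (intro left_module.intro left_module_axioms.intro) auto
qed

lemma hom_pair:
  "f \<in> module_hom R X M \<Longrightarrow> g \<in> module_hom R X N \<Longrightarrow> (\<lambda>x. (f x, g x)) \<in> module_hom R X (direct_sum M N)"
  by (auto simp: module_hom_def Pi_iff)

lemma hom_fst: "fst \<in> module_hom R (direct_sum M N) M"
  and hom_snd: "snd \<in> module_hom R (direct_sum M N) N"
  by (auto simp: module_hom_def)

lemma hom_inl: "left_module R N \<Longrightarrow> (\<lambda>x. (x, \<zero>\<^bsub>N\<^esub>)) \<in> module_hom R M (direct_sum M N)"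
  and hom_inr: "left_module R M \<Longrightarrow> (\<lambda>x. (\<zero>\<^bsub>M\<^esub>, x)) \<in> module_hom R N (direct_sum M N)"
  by (simp_all add: hom_pair hom_id hom_zero)

lemma hom_copair:
  assumes "f \<in> module_hom R M X" "g \<in> module_hom R N X" "left_module R M" "left_module R N" "left_module R X"
  shows "(\<lambda>v. f (fst v) \<oplus>\<^bsub>X\<^esub> g (snd v)) \<in> module_hom R (direct_sum M N) X"
  using hom_add[OF hom_comp[OF hom_fst assms(1)] hom_comp[OF hom_snd assms(2)]
      left_module_direct_sum[OF assms(3,4)] assms(5)] .

lemma mod_iso_sym:
  assumes iso: "mod_iso R M N" and M: "left_module R M" and N: "left_module R N"
  shows "mod_iso R N M"
proof -
  from iso obtain f where f: "f \<in> module_hom R M N" and b: "bij_betw f (carrier M) (carrier N)"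
    by (auto simp: mod_iso_def)
  obtain h where h: "h \<in> module_hom R N M" "\<And>x. x \<in> carrier N \<Longrightarrow> f (h x) = x"
    using factor_through_injection[OF f _ hom_id M N N] b by (auto simp: bij_betw_def)
  have "bij_betw h (carrier N) (carrier M)"
    by (rule bij_betw_byWitness[of _ f])
      (use h b hom_rules[OF h(1) N M] hom_rules[OF f M N] in \<open>auto simp: bij_betw_def intro: inj_onD\<close>)
  with h(1) show ?thesis by (auto simp: mod_iso_def)
qed

lemma mod_iso_trans:
  assumes "mod_iso R M N" "mod_iso R N T"
  shows "mod_iso R M T"
proof -
  from assms obtain f g where "f \<in> module_hom R M N" "bij_betw f (carrier M) (carrier N)"
    "g \<in> module_hom R N T" "bij_betw g (carrier N) (carrier T)" by (auto simp: mod_iso_def)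
  then show ?thesis
    using hom_comp[of f R M N g T] bij_betw_trans[of f _ _ g] by (auto simp: mod_iso_def o_def)
qed

section \<open>Counting in finite modules\<close>

text \<open>The fibres of a homomorphism are the cosets of its kernel.\<close>
lemma card_hom:
  assumes f: "f \<in> module_hom R M N" and M: "left_module R M" and N: "left_module R N"
    and fin: "finite (carrier M)"
  shows "card (carrier M) = card {x \<in> carrier M. f x = \<zero>\<^bsub>N\<^esub>} * card (f ` carrier M)"
proof -
  note [simp] = left_module_rules[OF M] left_module_rules[OF N] hom_rules[OF assms(1-3)]
  have "card {x \<in> carrier M. f x = y} = card {x \<in> carrier M. f x = \<zero>\<^bsub>N\<^esub>}" if y: "y \<in> f ` carrier M" for y
  proof -
    from y obtain z where z: "z \<in> carrier M" "y = f z" by auto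
    have "bij_betw (\<lambda>x. x \<ominus>\<^bsub>M\<^esub> z) {x \<in> carrier M. f x = y} {x \<in> carrier M. f x = \<zero>\<^bsub>N\<^esub>}"
      by (rule bij_betw_byWitness[of _ "\<lambda>x. x \<oplus>\<^bsub>M\<^esub> z"])
        (use z in \<open>auto simp: left_module_arith[OF M] left_module_arith(6)[OF N]\<close>)
    then show ?thesis by (rule bij_betw_same_card)
  qed
  moreover have "card (carrier M) = (\<Sum>y \<in> f ` carrier M. card {x \<in> carrier M. f x = y})"
    using fin sum.image_gen[of "carrier M" "\<lambda>_. 1::nat" f] by simp
  ultimately show ?thesis by simp
qed

lemma card_carrier_pos:
  assumes "left_module R M" "finite (carrier M)"
  shows "card (carrier M) > 0"
  using assms left_module_rules(1)[OF assms(1)] by (auto simp: card_gt_0_iff)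

lemma card_carrier_1_iff:
  assumes "left_module R M"
  shows "card (carrier M) = 1 \<longleftrightarrow> carrier M = {\<zero>\<^bsub>M\<^esub>}"
proof
  assume "card (carrier M) = 1"
  then obtain x where "carrier M = {x}" by (rule card_1_singletonE)
  then show "carrier M = {\<zero>\<^bsub>M\<^esub>}" using left_module_rules(1)[OF assms] by (metis singletonD)
qed simp

lemma card_short_exact:
  assumes f: "f \<in> module_hom R Y Z" and g: "g \<in> module_hom R Z X"
    and Z: "left_module R Z" and X: "left_module R X"
    and fin: "finite (carrier Z)" and ex: "short_exact Y f Z g X"
  shows "card (carrier Z) = card (carrier Y) * card (carrier X)"
proof -
  have "card {z \<in> carrier Z. g z = \<zero>\<^bsub>X\<^esub>} = card (carrier Y)"
    using ex card_image[of f "carrier Y"] by (simp add: short_exact_def)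
  moreover have "g ` carrier Z = carrier X" using ex by (simp add: short_exact_def)
  ultimately show ?thesis using card_hom[OF g Z X fin] by simp
qed

text \<open>
  The composite \<open>g f = 0\<close> puts the image of \<open>f\<close> inside the kernel of \<open>g\<close>; the cardinalities of the two
  then agree.
\<close>
lemma short_exactI_card:
  assumes f: "f \<in> module_hom R Y Z" and g: "g \<in> module_hom R Z X"
    and Y: "left_module R Y" and Z: "left_module R Z" and X: "left_module R X"
    and fin: "finite (carrier Z)"
    and inj: "inj_on f (carrier Y)" and onto: "g ` carrier Z = carrier X"
    and gf: "\<And>y. y \<in> carrier Y \<Longrightarrow> g (f y) = \<zero>\<^bsub>X\<^esub>"
    and card: "card (carrier Z) = card (carrier Y) * card (carrier X)"
  shows "short_exact Y f Z g X"
proof -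
  have sub: "f ` carrier Y \<subseteq> {z \<in> carrier Z. g z = \<zero>\<^bsub>X\<^esub>}"
    using gf hom_rules(1)[OF f Y Z] by auto
  have "finite (carrier X)" using onto fin by (metis finite_imageI)
  then have "card {z \<in> carrier Z. g z = \<zero>\<^bsub>X\<^esub>} = card (carrier Y)"
    using card_hom[OF g Z X fin] card card_carrier_pos[OF X] onto by auto
  then have "f ` carrier Y = {z \<in> carrier Z. g z = \<zero>\<^bsub>X\<^esub>}"
    using sub fin card_image[OF inj] by (intro card_subset_eq) auto
  then show ?thesis using inj onto by (simp add: short_exact_def)
qed

lemma hom_finsum:
  assumes f: "f \<in> module_hom R M N" and M: "left_module R M" and N: "left_module R N"
    and fin: "finite I" and g: "g \<in> I \<rightarrow> carrier M"
  shows "f (finsum M g I) = finsum N (\<lambda>i. f (g i)) I"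
proof -
  interpret M: abelian_group M using M by (rule left_module.axioms)
  interpret N: abelian_group N using N by (rule left_module.axioms)
  note [simp] = hom_rules[OF f M N]
  show ?thesis using fin g
  proof (induction I rule: finite_induct)
    case (insert i I)
    then have "f (finsum M g I) = finsum N (\<lambda>i. f (g i)) I" by simp
    moreover have "finsum M g I \<in> carrier M" using insert by (intro M.finsum_closed) auto
    moreover have "g i \<in> carrier M" "g \<in> I \<rightarrow> carrier M" "(\<lambda>i. f (g i)) \<in> I \<rightarrow> carrier N"
      using insert by (auto simp: Pi_iff)
    ultimately show ?case using insert by simp
  qed simp
qed

section \<open>Finite vector spaces\<close>

lemma left_module_of_module:
  assumes "module K V" shows "left_module K V"
proof -
  interpret module K V by fact
  show ?thesis
    by (intro left_module.intro left_module_axioms.intro)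
      (auto simp: smult_l_distr smult_r_distr smult_assoc1 R.ring_axioms M.abelian_group_axioms)
qed

context vectorspace
begin

lemma fin_dim_of_finite: "finite (carrier V) \<Longrightarrow> fin_dim"
  using in_own_span[of "carrier V"] span_is_subset2[of "carrier V"]
  by (auto simp: fin_dim_def intro!: exI[of _ "carrier V"])

lemma card_carrier_finite:
  assumes "finite (carrier V)" "finite (carrier K)"
  shows "card (carrier V) = card (carrier K) ^ dim"
proof -
  obtain B where B: "finite B" "basis B"
    using finite_basis_exists[OF fin_dim_of_finite[OF assms(1)]] by auto
  then have sub: "B \<subseteq> carrier V" by (simp add: basis_def)
  have uniq: "\<exists>!a. a \<in> B \<rightarrow>\<^sub>E carrier K \<and> lincomb a B = v" if "v \<in> carrier V" for v
    using basis_criterion[OF B(1) sub] B(2) that by auto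
  have "bij_betw (\<lambda>a. lincomb a B) (B \<rightarrow>\<^sub>E carrier K) (carrier V)"
    unfolding bij_betw_def
  proof
    have cl: "lincomb a B \<in> carrier V" if "a \<in> B \<rightarrow>\<^sub>E carrier K" for a
      using that sub by (auto intro!: lincomb_closed)
    show "inj_on (\<lambda>a. lincomb a B) (B \<rightarrow>\<^sub>E carrier K)"
      by (rule inj_onI) (metis uniq cl)
    show "(\<lambda>a. lincomb a B) ` (B \<rightarrow>\<^sub>E carrier K) = carrier V"
      using cl uniq by (auto simp: image_iff) metis
  qed
  then have "card (carrier V) = card (B \<rightarrow>\<^sub>E carrier K)" by (metis bij_betw_same_card)
  also have "\<dots> = card (carrier K) ^ card B" using B(1) by (simp add: card_PiE)
  also have "card B = dim" using dim_basis[OF B] by simp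
  finally show ?thesis .
qed

end

text \<open>A linear map is determined by arbitrary values on a basis.\<close>
lemma card_linear_maps:
  assumes V: "vectorspace K V" and W: "vectorspace K W" and fin: "finite (carrier V)"
  shows "card (mod_homs K V W) = card (carrier W) ^ vectorspace.dim K V"
proof -
  interpret V: vectorspace K V by fact
  interpret W: vectorspace K W by fact
  have lV: "left_module K V" and lW: "left_module K W"
    using V W by (auto simp: vectorspace_def intro: left_module_of_module)
  obtain B where B: "finite B" "V.basis B"
    using V.finite_basis_exists[OF V.fin_dim_of_finite[OF fin]] by auto
  then have sub: "B \<subseteq> carrier V" by (simp add: V.basis_def)
  have uniq: "\<exists>!a. a \<in> B \<rightarrow>\<^sub>E carrier K \<and> V.lincomb a B = v" if "v \<in> carrier V" for v
    using V.basis_criterion[OF B(1) sub] B(2) that by auto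
  define co where "co v = (THE a. a \<in> B \<rightarrow>\<^sub>E carrier K \<and> V.lincomb a B = v)" for v
  have co: "co v \<in> B \<rightarrow>\<^sub>E carrier K" "V.lincomb (co v) B = v" if "v \<in> carrier V" for v
    using theI'[OF uniq[OF that]] by (auto simp: co_def)
  have coI: "co v = restrict a B" if "a \<in> B \<rightarrow> carrier K" "V.lincomb a B = v" "v \<in> carrier V" for a v
  proof -
    have "V.lincomb (restrict a B) B = V.lincomb a B"
      using that sub by (intro V.lincomb_cong) auto
    then show ?thesis using that uniq[OF that(3)] co[OF that(3)] by (metis restrict_PiE)
  qed
  have co_mem: "co v b \<in> carrier K" if "v \<in> carrier V" "b \<in> B" for v b using co(1)[OF that(1)] that(2) by auto
  define ext where "ext w = (\<lambda>v \<in> carrier V. \<Oplus>\<^bsub>W\<^esub> b \<in> B. co v b \<odot>\<^bsub>W\<^esub> w b)" for w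
  have val: "f v = (\<Oplus>\<^bsub>W\<^esub> b \<in> B. co v b \<odot>\<^bsub>W\<^esub> f b)" if "f \<in> module_hom K V W" "v \<in> carrier V" for f v
  proof -
    note [simp] = hom_rules[OF that(1) lV lW]
    have "f v = f (V.lincomb (co v) B)" using co that by simp
    also have "\<dots> = (\<Oplus>\<^bsub>W\<^esub> b \<in> B. f (co v b \<odot>\<^bsub>V\<^esub> b))"
      unfolding V.lincomb_def using sub co_mem that(2) by (intro hom_finsum[OF that(1) lV lW B(1)]) auto
    also have "\<dots> = (\<Oplus>\<^bsub>W\<^esub> b \<in> B. co v b \<odot>\<^bsub>W\<^esub> f b)"
      using sub co_mem that(2) by (intro W.finsum_cong') auto
    finally show ?thesis .
  qed
  have "bij_betw (\<lambda>f. restrict f B) (mod_homs K V W) (B \<rightarrow>\<^sub>E carrier W)"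
  proof (rule bij_betw_byWitness[where f' = ext])
    show "\<forall>f \<in> mod_homs K V W. ext (restrict f B) = f"
    proof
      fix f assume f: "f \<in> mod_homs K V W"
      then have f': "f \<in> module_hom K V W" "f \<in> extensional (carrier V)" by (auto simp: mod_homs_def)
      show "ext (restrict f B) = f"
      proof (rule extensionalityI[OF _ f'(2)])
        fix v assume v: "v \<in> carrier V"
        have "ext (restrict f B) v = (\<Oplus>\<^bsub>W\<^esub> b \<in> B. co v b \<odot>\<^bsub>W\<^esub> f b)"
          using v sub co_mem hom_rules(1)[OF f'(1) lV lW] by (auto simp: ext_def intro!: W.finsum_cong')
        then show "ext (restrict f B) v = f v" using val[OF f'(1) v] by simp
      qed (simp add: ext_def)
    qed
    show "(\<lambda>f. restrict f B) ` mod_homs K V W \<subseteq> B \<rightarrow>\<^sub>E carrier W"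
      using sub by (auto simp: mod_homs_def module_hom_def Pi_iff)
    have ext_hom: "ext w \<in> mod_homs K V W" if w: "w \<in> B \<rightarrow>\<^sub>E carrier W" for w
      unfolding mod_homs_def
    proof
      have wcl: "w b \<in> carrier W" if "b \<in> B" for b using w that by auto
      show "ext w \<in> extensional (carrier V)" by (simp add: ext_def)
      show "ext w \<in> module_hom K V W"
      proof (rule homI)
        show "ext w x \<in> carrier W" if "x \<in> carrier V" for x
          using that w co_mem by (auto simp: ext_def intro!: W.finsum_closed)
        show "ext w (x \<oplus>\<^bsub>V\<^esub> y) = ext w x \<oplus>\<^bsub>W\<^esub> ext w y" if xy: "x \<in> carrier V" "y \<in> carrier V" for x y
        proof -
          have "co (x \<oplus>\<^bsub>V\<^esub> y) = restrict (\<lambda>b. co x b \<oplus>\<^bsub>K\<^esub> co y b) B"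
            using co_mem xy co by (intro coI) (auto simp: V.lincomb_sum[OF B(1) sub] Pi_iff)
          then have "ext w (x \<oplus>\<^bsub>V\<^esub> y) = (\<Oplus>\<^bsub>W\<^esub> b \<in> B. co x b \<odot>\<^bsub>W\<^esub> w b \<oplus>\<^bsub>W\<^esub> co y b \<odot>\<^bsub>W\<^esub> w b)"
            using xy wcl co_mem unfolding ext_def
            by (simp del: W.finsum_addf, intro W.finsum_cong') (auto simp: W.smult_l_distr)
          also have "\<dots> = ext w x \<oplus>\<^bsub>W\<^esub> ext w y"
            using xy wcl co_mem by (auto simp: ext_def intro!: W.finsum_addf)
          finally show ?thesis .
        qed
        show "ext w (a \<odot>\<^bsub>V\<^esub> x) = a \<odot>\<^bsub>W\<^esub> ext w x" if ax: "a \<in> carrier K" "x \<in> carrier V" for a x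
        proof -
          have "co (a \<odot>\<^bsub>V\<^esub> x) = restrict (\<lambda>b. a \<otimes>\<^bsub>K\<^esub> co x b) B"
            using co_mem ax co by (intro coI) (auto simp: V.lincomb_smult[OF sub] Pi_iff)
          then have "ext w (a \<odot>\<^bsub>V\<^esub> x) = (\<Oplus>\<^bsub>W\<^esub> b \<in> B. a \<odot>\<^bsub>W\<^esub> (co x b \<odot>\<^bsub>W\<^esub> w b))"
            using ax wcl co_mem unfolding ext_def
            by (auto intro!: W.finsum_cong' simp: W.smult_assoc1)
          also have "\<dots> = a \<odot>\<^bsub>W\<^esub> ext w x"
            using ax wcl co_mem W.finsum_smult[OF ax(1), of "\<lambda>b. co x b \<odot>\<^bsub>W\<^esub> w b" B]
            by (auto simp: ext_def Pi_iff)
          finally show ?thesis .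
        qed
      qed
    qed
    then show "ext ` (B \<rightarrow>\<^sub>E carrier W) \<subseteq> mod_homs K V W" by auto
    show "\<forall>w \<in> B \<rightarrow>\<^sub>E carrier W. restrict (ext w) B = w"
    proof
      fix w assume w: "w \<in> B \<rightarrow>\<^sub>E carrier W"
      have "ext w b = w b" if b: "b \<in> B" for b
      proof -
        let ?d = "\<lambda>c. if c = b then \<one>\<^bsub>K\<^esub> else \<zero>\<^bsub>K\<^esub>"
        have bV: "b \<in> carrier V" using b sub by auto
        have wcl: "w c \<in> carrier W" if "c \<in> B" for c using w that by auto
        have "V.lincomb ?d B = (\<Oplus>\<^bsub>V\<^esub> c \<in> B. if b = c then c else \<zero>\<^bsub>V\<^esub>)"
          unfolding V.lincomb_def using sub by (intro V.finsum_cong') auto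
        also have "\<dots> = b" using V.finsum_singleton[OF b B(1), of "\<lambda>c. c"] sub by auto
        finally have "co b = restrict ?d B" using bV by (intro coI) auto
        then have "ext w b = (\<Oplus>\<^bsub>W\<^esub> c \<in> B. if b = c then w c else \<zero>\<^bsub>W\<^esub>)"
          unfolding ext_def using bV b wcl by (auto intro!: W.finsum_cong')
        also have "\<dots> = w b" using W.finsum_singleton[OF b B(1), of w] w by auto
        finally show ?thesis .
      qed
      then show "restrict (ext w) B = w" using w by (auto simp: PiE_iff extensional_def restrict_def)
    qed
  qed
  then have "card (mod_homs K V W) = card (B \<rightarrow>\<^sub>E carrier W)" by (rule bij_betw_same_card)
  also have "\<dots> = card (carrier W) ^ card B" using B(1) by (simp add: card_PiE)
  also have "card B = V.dim" using V.dim_basis[OF B] by simp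
  finally show ?thesis .
qed

section \<open>The path algebra of a finite quiver without infinitely many paths\<close>

definition pa_arrow :: "'k ring \<Rightarrow> ('v, 'e) pre_digraph \<Rightarrow> 'e \<Rightarrow> ('v \<times> 'e list \<Rightarrow> 'k)" where
  "pa_arrow K Q \<rho> = (\<lambda>p. if p = (tail Q \<rho>, [\<rho>]) then \<one>\<^bsub>K\<^esub> else \<zero>\<^bsub>K\<^esub>)"

text \<open>
  The assumption that the path algebra is a ring is part of every hypothesis
  \<^term>\<open>left_module (path_algebra K Q) M\<close>.  The Dynkin type enters through the finiteness of the set
  of paths: the path algebra and its finite-dimensional modules are then finite sets, so that exactness can
  be verified by counting.
\<close>
locale finite_path_algebra =
  fixes K :: "'k ring" and Q :: "('v, 'e) pre_digraph"
  assumes field_K: "field K" and finite_K: "finite (carrier K)"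
    and wf_Q: "wf_digraph Q" and finite_paths: "finite (qpaths Q)"
    and ring_A: "ring (path_algebra K Q)"
begin

abbreviation "A \<equiv> path_algebra K Q"

abbreviation walk_end :: "'v \<Rightarrow> 'e list \<Rightarrow> 'v" where
  "walk_end u es \<equiv> last (pre_digraph.awalk_verts Q u es)"

sublocale K: field K by (rule field_K)
sublocale Q: wf_digraph Q by (rule wf_Q)
sublocale A: ring A by (rule ring_A)

subsection \<open>Paths\<close>

lemma path_iff: "(u, es) \<in> qpaths Q \<longleftrightarrow> Q.awalk u es (walk_end u es)"
  by (auto simp: qpaths_def)

lemma trivial_path [simp]: "(u, []) \<in> qpaths Q \<longleftrightarrow> u \<in> verts Q"
  by (auto simp: qpaths_def Q.awalk_Nil_iff)

lemma path_append:
  "(u, es @ fs) \<in> qpaths Q \<longleftrightarrow> (u, es) \<in> qpaths Q \<and> (walk_end u es, fs) \<in> qpaths Q"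
  unfolding path_iff by (simp add: Q.awlast_append)

lemma path_end: "(u, es) \<in> qpaths Q \<Longrightarrow> walk_end u es \<in> verts Q"
  unfolding path_iff by (rule Q.awalk_last_in_verts)

lemma path_arrow [simp]: "(u, [\<rho>]) \<in> qpaths Q \<longleftrightarrow> \<rho> \<in> arcs Q \<and> u = tail Q \<rho>"
  by (auto simp: qpaths_def Q.awalk_simps)

lemma finite_verts: "finite (verts Q)"
proof -
  have "verts Q \<subseteq> fst ` qpaths Q" using image_eqI[of _ fst "(_, [])" "qpaths Q"] by auto
  then show ?thesis using finite_paths by (meson finite_imageI finite_subset)
qed

lemma finite_arcs: "finite (arcs Q)"
proof -
  have "arcs Q \<subseteq> (\<lambda>p. hd (snd p)) ` qpaths Q"
  proof
    fix \<rho> assume "\<rho> \<in> arcs Q"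
    then have "(tail Q \<rho>, [\<rho>]) \<in> qpaths Q" by simp
    then show "\<rho> \<in> (\<lambda>p. hd (snd p)) ` qpaths Q" by (rule rev_image_eqI) simp
  qed
  then show ?thesis using finite_paths by (meson finite_imageI finite_subset)
qed

subsection \<open>Products in the path algebra\<close>

lemma carrier_A: "carrier A = {f. (\<forall>p \<in> qpaths Q. f p \<in> carrier K) \<and> (\<forall>p. p \<notin> qpaths Q \<longrightarrow> f p = \<zero>\<^bsub>K\<^esub>)}"
proof -
  have "finite {p. f p \<noteq> \<zero>\<^bsub>K\<^esub>}" if "\<forall>p. p \<notin> qpaths Q \<longrightarrow> f p = \<zero>\<^bsub>K\<^esub>" for f :: "'v \<times> 'e list \<Rightarrow> 'k"
    using that by (intro finite_subset[OF _ finite_paths]) auto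
  then show ?thesis by (auto simp: path_algebra_def)
qed

lemma coeff_closed: "x \<in> carrier A \<Longrightarrow> x p \<in> carrier K"
  unfolding carrier_A by (cases "p \<in> qpaths Q") (blast, metis (mono_tags, lifting) K.zero_closed mem_Collect_eq)

lemma coeff_outside: "x \<in> carrier A \<Longrightarrow> p \<notin> qpaths Q \<Longrightarrow> x p = \<zero>\<^bsub>K\<^esub>"
  unfolding carrier_A by blast

lemma A_zero: "\<zero>\<^bsub>A\<^esub> = (\<lambda>p. \<zero>\<^bsub>K\<^esub>)" and A_add: "x \<oplus>\<^bsub>A\<^esub> y = (\<lambda>p. x p \<oplus>\<^bsub>K\<^esub> y p)"
  and A_one: "\<one>\<^bsub>A\<^esub> = pa_scalar K Q \<one>\<^bsub>K\<^esub>"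
  by (simp_all add: path_algebra_def)

lemma mult_outside: "p \<notin> qpaths Q \<Longrightarrow> (x \<otimes>\<^bsub>A\<^esub> y) p = \<zero>\<^bsub>K\<^esub>"
  by (cases p) (simp add: path_algebra_def)

text \<open>
  A coefficient of a product is a sum over the factorizations of a path into two.  In all products with a
  scalar, a vertex or an arrow at most one of them contributes.
\<close>
lemma mult_single_term:
  assumes x: "x \<in> carrier A" and y: "y \<in> carrier A" and p: "(u, es) \<in> qpaths Q" and m: "m \<le> length es"
    and other: "\<And>n. \<lbrakk>n \<le> length es; n \<noteq> m\<rbrakk> \<Longrightarrow>
      x (walk_end u (take n es), drop n es) = \<zero>\<^bsub>K\<^esub> \<or> y (u, take n es) = \<zero>\<^bsub>K\<^esub>"
  shows "(x \<otimes>\<^bsub>A\<^esub> y) (u, es) = x (walk_end u (take m es), drop m es) \<otimes>\<^bsub>K\<^esub> y (u, take m es)"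
proof -
  let ?t = "\<lambda>n. x (walk_end u (take n es), drop n es) \<otimes>\<^bsub>K\<^esub> y (u, take n es)"
  have "(x \<otimes>\<^bsub>A\<^esub> y) (u, es) = finsum K ?t {..length es}" using p by (simp add: path_algebra_def)
  also have "\<dots> = finsum K (\<lambda>n. if m = n then ?t n else \<zero>\<^bsub>K\<^esub>) {..length es}"
  proof (rule K.finsum_cong')
    show "?t n = (if m = n then ?t n else \<zero>\<^bsub>K\<^esub>)" if "n \<in> {..length es}" for n
      using other[of n] that coeff_closed[OF x, of "(walk_end u (take n es), drop n es)"]
        coeff_closed[OF y, of "(u, take n es)"] by auto
  qed (use coeff_closed[OF x] coeff_closed[OF y] in auto)
  also have "\<dots> = ?t m"
    using coeff_closed[OF x] coeff_closed[OF y] m by (intro K.finsum_singleton) auto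
  finally show ?thesis .
qed

lemma scalar_closed: "c \<in> carrier K \<Longrightarrow> pa_scalar K Q c \<in> carrier A"
  by (auto simp: carrier_A pa_scalar_def split: prod.splits)

lemma vertex_closed: "i \<in> verts Q \<Longrightarrow> pa_vertex K i \<in> carrier A"
  by (auto simp: carrier_A pa_vertex_def)

lemma arrow_closed: "\<rho> \<in> arcs Q \<Longrightarrow> pa_arrow K Q \<rho> \<in> carrier A"
  by (auto simp: carrier_A pa_arrow_def)

lemma scalar_mult:
  assumes c: "c \<in> carrier K" and x: "x \<in> carrier A"
  shows "pa_scalar K Q c \<otimes>\<^bsub>A\<^esub> x = (\<lambda>p. c \<otimes>\<^bsub>K\<^esub> x p)"
proof
  fix p :: "'v \<times> 'e list" obtain u es where p: "p = (u, es)" by force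
  show "(pa_scalar K Q c \<otimes>\<^bsub>A\<^esub> x) p = c \<otimes>\<^bsub>K\<^esub> x p"
  proof (cases "(u, es) \<in> qpaths Q")
    case True
    then show ?thesis unfolding p
      using mult_single_term[OF scalar_closed[OF c] x True, of "length es"] path_end[OF True]
      by (auto simp: pa_scalar_def)
  qed (use p c coeff_outside[OF x] in \<open>simp add: mult_outside\<close>)
qed

lemma mult_scalar:
  assumes c: "c \<in> carrier K" and x: "x \<in> carrier A"
  shows "x \<otimes>\<^bsub>A\<^esub> pa_scalar K Q c = (\<lambda>p. c \<otimes>\<^bsub>K\<^esub> x p)"
proof
  fix p :: "'v \<times> 'e list" obtain u es where p: "p = (u, es)" by force
  show "(x \<otimes>\<^bsub>A\<^esub> pa_scalar K Q c) p = c \<otimes>\<^bsub>K\<^esub> x p"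
  proof (cases "(u, es) \<in> qpaths Q")
    case True
    then have "u \<in> verts Q" by (auto simp: path_iff)
    moreover have "pa_scalar K Q c (u, take n es) = \<zero>\<^bsub>K\<^esub>" if "n \<le> length es" "n \<noteq> 0" for n
      using that by (auto simp: pa_scalar_def)
    ultimately have "(x \<otimes>\<^bsub>A\<^esub> pa_scalar K Q c) (u, es) = x (u, es) \<otimes>\<^bsub>K\<^esub> c"
      using mult_single_term[OF x scalar_closed[OF c] True, of 0] by (simp add: pa_scalar_def)
    then show ?thesis unfolding p using coeff_closed[OF x] c by (simp add: K.m_comm)
  qed (use p c coeff_outside[OF x] in \<open>simp add: mult_outside\<close>)
qed

lemma scalar_central:
  assumes "c \<in> carrier K" "x \<in> carrier A"
  shows "pa_scalar K Q c \<otimes>\<^bsub>A\<^esub> x = x \<otimes>\<^bsub>A\<^esub> pa_scalar K Q c"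
  using assms by (simp add: scalar_mult mult_scalar)

lemma scalar_add: "c \<in> carrier K \<Longrightarrow> d \<in> carrier K \<Longrightarrow>
    pa_scalar K Q (c \<oplus>\<^bsub>K\<^esub> d) = pa_scalar K Q c \<oplus>\<^bsub>A\<^esub> pa_scalar K Q d"
  by (auto simp: A_add pa_scalar_def)

lemma scalar_times:
  assumes "c \<in> carrier K" "d \<in> carrier K"
  shows "pa_scalar K Q (c \<otimes>\<^bsub>K\<^esub> d) = pa_scalar K Q c \<otimes>\<^bsub>A\<^esub> pa_scalar K Q d"
  using assms by (subst scalar_mult[OF assms(1) scalar_closed[OF assms(2)]]) (auto simp: pa_scalar_def)

lemma vertex_mult:
  assumes i: "i \<in> verts Q" and x: "x \<in> carrier A"
  shows "pa_vertex K i \<otimes>\<^bsub>A\<^esub> x = (\<lambda>(u, es). if walk_end u es = i then x (u, es) else \<zero>\<^bsub>K\<^esub>)"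
proof
  fix p :: "'v \<times> 'e list" obtain u es where p: "p = (u, es)" by force
  show "(pa_vertex K i \<otimes>\<^bsub>A\<^esub> x) p = (\<lambda>(u, es). if walk_end u es = i then x (u, es) else \<zero>\<^bsub>K\<^esub>) p"
  proof (cases "(u, es) \<in> qpaths Q")
    case True
    then show ?thesis unfolding p
      using mult_single_term[OF vertex_closed[OF i] x True, of "length es"] coeff_closed[OF x]
      by (auto simp: pa_vertex_def)
  qed (use p coeff_outside[OF x] in \<open>simp add: mult_outside\<close>)
qed

lemma arrow_mult:
  assumes \<rho>: "\<rho> \<in> arcs Q" and x: "x \<in> carrier A"
  shows "pa_arrow K Q \<rho> \<otimes>\<^bsub>A\<^esub> x =
    (\<lambda>(u, es). if (u, es) \<in> qpaths Q \<and> es \<noteq> [] \<and> last es = \<rho> then x (u, butlast es) else \<zero>\<^bsub>K\<^esub>)"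
proof
  fix p :: "'v \<times> 'e list" obtain u es where p: "p = (u, es)" by force
  show "(pa_arrow K Q \<rho> \<otimes>\<^bsub>A\<^esub> x) p =
    (\<lambda>(u, es). if (u, es) \<in> qpaths Q \<and> es \<noteq> [] \<and> last es = \<rho> then x (u, butlast es) else \<zero>\<^bsub>K\<^esub>) p"
  proof (cases "(u, es) \<in> qpaths Q")
    case True
    show ?thesis
    proof (cases es rule: rev_exhaust)
      case Nil
      then show ?thesis unfolding p
        using mult_single_term[OF arrow_closed[OF \<rho>] x True, of 0] coeff_closed[OF x]
        by (auto simp: pa_arrow_def)
    next
      case (snoc fs \<sigma>)
      have "drop n es = [\<rho>] \<Longrightarrow> n = length fs" if "n \<le> length es" for n
        using that snoc by (metis append_take_drop_id butlast_snoc length_take min.absorb2)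
      then have "pa_arrow K Q \<rho> (walk_end u (take n es), drop n es) = \<zero>\<^bsub>K\<^esub>"
        if "n \<le> length es" "n \<noteq> length fs" for n
        using that by (auto simp: pa_arrow_def)
      then have "(pa_arrow K Q \<rho> \<otimes>\<^bsub>A\<^esub> x) (u, es) =
          pa_arrow K Q \<rho> (walk_end u fs, [\<sigma>]) \<otimes>\<^bsub>K\<^esub> x (u, fs)"
        using mult_single_term[OF arrow_closed[OF \<rho>] x True, of "length fs"] snoc by simp
      moreover have "walk_end u fs = tail Q \<sigma>" using True snoc by (auto simp: path_append)
      ultimately show ?thesis unfolding p
        using True snoc coeff_closed[OF x] by (auto simp: pa_arrow_def)
    qed
  qed (use p in \<open>simp add: mult_outside\<close>)
qed

subsection \<open>The underlying vector spaces\<close>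

lemma k_space_simps [simp]:
  "carrier (k_space K Q M) = carrier M" "\<zero>\<^bsub>k_space K Q M\<^esub> = \<zero>\<^bsub>M\<^esub>"
  "x \<oplus>\<^bsub>k_space K Q M\<^esub> y = x \<oplus>\<^bsub>M\<^esub> y" "c \<odot>\<^bsub>k_space K Q M\<^esub> x = pa_scalar K Q c \<odot>\<^bsub>M\<^esub> x"
  by (simp_all add: k_space_def)

lemma k_subspace:
  assumes M: "left_module A M" and "U \<subseteq> carrier M" "\<zero>\<^bsub>M\<^esub> \<in> U"
    and "\<And>x y. \<lbrakk>x \<in> U; y \<in> U\<rbrakk> \<Longrightarrow> x \<oplus>\<^bsub>M\<^esub> y \<in> U" "\<And>x. x \<in> U \<Longrightarrow> \<ominus>\<^bsub>M\<^esub> x \<in> U"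
    and "\<And>c x. \<lbrakk>c \<in> carrier K; x \<in> U\<rbrakk> \<Longrightarrow> pa_scalar K Q c \<odot>\<^bsub>M\<^esub> x \<in> U"
  shows "vectorspace K (k_space K Q M \<lparr>carrier := U\<rparr>)"
proof -
  note [simp] = left_module_rules[OF M]
  have sub: "x \<in> carrier M" if "x \<in> U" for x using assms(2) that by auto
  have "abelian_group (k_space K Q M \<lparr>carrier := U\<rparr>)"
  proof (rule abelian_groupI, goal_cases)
    case (6 x)
    then show ?case using assms(5) sub
      by (intro bexI[of _ "\<ominus>\<^bsub>M\<^esub> x"]) (auto simp: left_module_arith(7)[OF M])
  qed (use assms(3,4) sub in \<open>auto simp: left_module_arith(1-3)[OF M]\<close>)
  moreover have "cring K" by (rule K.is_cring)
  ultimately have "module K (k_space K Q M \<lparr>carrier := U\<rparr>)"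
    using assms(6) sub
    by (intro moduleI) (auto simp: left_module_smult[OF M] scalar_add scalar_times scalar_closed
        left_module_rules(13)[OF M, unfolded A_one])
  then show ?thesis using field_K by (simp add: vectorspace_def)
qed

lemma k_space_vectorspace:
  assumes M: "left_module A M"
  shows "vectorspace K (k_space K Q M)"
proof -
  have "vectorspace K (k_space K Q M \<lparr>carrier := carrier M\<rparr>)"
    by (rule k_subspace[OF M]) (auto simp: left_module_rules[OF M] scalar_closed)
  moreover have "k_space K Q M \<lparr>carrier := carrier M\<rparr> = k_space K Q M" by (simp add: k_space_def)
  ultimately show ?thesis by simp
qed

text \<open>A basis identifies a finite-dimensional module with a finite set of coefficient functions.\<close>
lemma fd_iff: "fd_module K Q M \<longleftrightarrow> left_module A M \<and> finite (carrier M)"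
proof -
  have "finite (carrier M)" if M: "left_module A M" and fd: "vectorspace.fin_dim K (k_space K Q M)"
  proof -
    interpret V: vectorspace K "k_space K Q M" by (rule k_space_vectorspace[OF M])
    obtain B where B: "finite B" "V.basis B" using V.finite_basis_exists[OF fd] by auto
    then have "carrier M \<subseteq> (\<lambda>a. V.lincomb a B) ` (B \<rightarrow>\<^sub>E carrier K)"
      using V.basis_criterion[OF B(1)] by (fastforce simp: V.basis_def)
    then show ?thesis using finite_K B(1) by (meson finite_PiE finite_imageI finite_subset)
  qed
  moreover have "vectorspace.fin_dim K (k_space K Q M)" if "left_module A M" "finite (carrier M)"
    using vectorspace.fin_dim_of_finite[OF k_space_vectorspace[OF that(1)]] that(2) by simp
  ultimately show ?thesis by (auto simp: fd_module_def)
qed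

lemma fdD: "fd_module K Q M \<Longrightarrow> left_module A M" "fd_module K Q M \<Longrightarrow> finite (carrier M)"
  by (auto simp: fd_iff)

lemma finite_homs:
  assumes "fd_module K Q M" "fd_module K Q N" shows "finite (mod_homs A M N)"
proof -
  have "mod_homs A M N \<subseteq> carrier M \<rightarrow>\<^sub>E carrier N"
    by (auto simp: mod_homs_def module_hom_def PiE_def)
  then show ?thesis using finite_PiE[OF fdD(2) fdD(2), OF assms(1) assms(2)] finite_subset by blast
qed

lemma restrict_hom:
  "f \<in> module_hom A M N \<Longrightarrow> left_module A M \<Longrightarrow> restrict f (carrier M) \<in> mod_homs A M N"
  by (auto simp: mod_homs_def intro: hom_cong)

lemma scalar_hom:
  assumes f: "f \<in> module_hom A M N" and M: "left_module A M" and N: "left_module A N" and c: "c \<in> carrier K"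
  shows "(\<lambda>x. pa_scalar K Q c \<odot>\<^bsub>N\<^esub> f x) \<in> module_hom A M N"
proof (rule homI)
  fix a x assume ax: "a \<in> carrier A" "x \<in> carrier M"
  have "pa_scalar K Q c \<odot>\<^bsub>N\<^esub> (a \<odot>\<^bsub>N\<^esub> f x) = (pa_scalar K Q c \<otimes>\<^bsub>A\<^esub> a) \<odot>\<^bsub>N\<^esub> f x"
    using ax c by (simp add: left_module_smult(3)[OF N] scalar_closed hom_rules(1)[OF f M N])
  also have "\<dots> = a \<odot>\<^bsub>N\<^esub> (pa_scalar K Q c \<odot>\<^bsub>N\<^esub> f x)"
    using ax c by (simp add: scalar_central left_module_smult(3)[OF N] scalar_closed hom_rules(1)[OF f M N])
  finally show "pa_scalar K Q c \<odot>\<^bsub>N\<^esub> f (a \<odot>\<^bsub>M\<^esub> x) = a \<odot>\<^bsub>N\<^esub> (pa_scalar K Q c \<odot>\<^bsub>N\<^esub> f x)"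
    using ax by (simp add: hom_rules[OF f M N])
qed (use c in \<open>simp_all add: hom_rules[OF f M N] left_module_rules[OF N] left_module_smult[OF N] scalar_closed\<close>)

lemma hom_space_vectorspace:
  assumes M: "left_module A M" and N: "left_module A N"
  shows "vectorspace K (hom_space K Q M N)"
proof -
  let ?H = "hom_space K Q M N"
  note [simp] = left_module_rules[OF N] left_module_smult[OF N] scalar_closed
  have cl: "f x \<in> carrier N" if "f \<in> mod_homs A M N" "x \<in> carrier M" for f x
    using that by (auto simp: mod_homs_def module_hom_def)
  have S [simp]: "carrier ?H = mod_homs A M N" "\<zero>\<^bsub>?H\<^esub> = (\<lambda>x \<in> carrier M. \<zero>\<^bsub>N\<^esub>)"
    "\<And>f g. f \<oplus>\<^bsub>?H\<^esub> g = (\<lambda>x \<in> carrier M. f x \<oplus>\<^bsub>N\<^esub> g x)"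
    "\<And>c f. c \<odot>\<^bsub>?H\<^esub> f = (\<lambda>x \<in> carrier M. pa_scalar K Q c \<odot>\<^bsub>N\<^esub> f x)"
    by (simp_all add: hom_space_def)
  have hom: "f \<in> module_hom A M N" if "f \<in> mod_homs A M N" for f using that by (simp add: mod_homs_def)
  have eqI: "f = g" if "f \<in> extensional (carrier M)" "g \<in> extensional (carrier M)"
      "\<And>x. x \<in> carrier M \<Longrightarrow> f x = g x" for f g :: "_ \<Rightarrow> _" using that by (rule extensionalityI)
  have E: "f \<in> extensional (carrier M)" if "f \<in> mod_homs A M N" for f using that by (simp add: mod_homs_def)
  have "abelian_group ?H"
  proof (rule abelian_groupI, goal_cases)
    case (1 f g)
    then show ?case by (simp add: restrict_hom hom_add hom M N)
  next
    case 2
    then show ?case by (simp add: restrict_hom hom_zero M N)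
  next
    case (6 f)
    then show ?case
      by (intro bexI[of _ "\<lambda>x \<in> carrier M. \<ominus>\<^bsub>N\<^esub> f x"])
        (auto intro!: eqI restrict_hom[OF hom_neg[OF hom]] simp: M N left_module_arith(7)[OF N] cl)
  qed (auto intro!: eqI simp: cl left_module_arith(1-3)[OF N] E)
  moreover have "cring K" by (rule K.is_cring)
  ultimately have "module K ?H"
    by (intro moduleI)
      (auto intro!: eqI restrict_hom[OF scalar_hom[OF hom]] simp: cl M N scalar_add scalar_times E
        left_module_rules(13)[OF N, unfolded A_one])
  then show ?thesis using field_K by (simp add: vectorspace_def)
qed

lemma card_homs:
  assumes M: "fd_module K Q M" and N: "fd_module K Q N"
  shows "card (mod_homs A M N) = card (carrier K) ^ hom_dim K Q M N"
proof -
  interpret V: vectorspace K "hom_space K Q M N" using M N by (intro hom_space_vectorspace fdD)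
  show ?thesis using V.card_carrier_finite finite_homs[OF M N] finite_K by (simp add: hom_dim_def hom_space_def)
qed

end

section \<open>Quotients and transport of modules\<close>

text \<open>
  The operations of quotients and of copies of modules on another type are defined through a surjection
  \<open>p\<close>, which carries the module laws over.
\<close>
lemma left_module_image:
  assumes N: "left_module R N" and p: "p \<in> module_hom R N C" and onto: "p ` carrier N = carrier C"
    and zero: "\<zero>\<^bsub>C\<^esub> = p \<zero>\<^bsub>N\<^esub>"
  shows "left_module R C"
proof -
  note [simp] = left_module_rules[OF N] left_module_smult[OF N]
  have add: "p x \<oplus>\<^bsub>C\<^esub> p y = p (x \<oplus>\<^bsub>N\<^esub> y)" if "x \<in> carrier N" "y \<in> carrier N" for x y
    using p that by (auto simp: module_hom_def)
  have smult: "a \<odot>\<^bsub>C\<^esub> p x = p (a \<odot>\<^bsub>N\<^esub> x)" if "a \<in> carrier R" "x \<in> carrier N" for a x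
    using p that by (auto simp: module_hom_def)
  interpret ring R using N by (rule left_module.axioms)
  have "abelian_group C"
  proof (rule abelian_groupI, goal_cases)
    case (6 c)
    then obtain x where "x \<in> carrier N" "c = p x" using onto by auto
    then show ?case
      using onto by (intro bexI[of _ "p (\<ominus>\<^bsub>N\<^esub> x)"]) (auto simp: add zero left_module_arith(7)[OF N])
  qed (auto simp: zero add left_module_arith(1-3)[OF N] simp flip: onto)
  then show ?thesis
    by (intro left_module.intro left_module_axioms.intro)
      (auto simp: add smult ring_axioms simp flip: onto)
qed

lemma left_module_quotient:
  assumes N: "left_module R N" and U: "Module.submodule U R N"
  shows "left_module R (quot_module N U)"
    and "(\<lambda>x. U +>\<^bsub>N\<^esub> x) \<in> module_hom R N (quot_module N U)"
    and "(\<lambda>x. U +>\<^bsub>N\<^esub> x) ` carrier N = carrier (quot_module N U)"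
    and "\<And>x. x \<in> carrier N \<Longrightarrow> U +>\<^bsub>N\<^esub> x = \<zero>\<^bsub>quot_module N U\<^esub> \<longleftrightarrow> x \<in> U"
proof -
  note [simp] = left_module_rules[OF N] left_module_smult[OF N]
  interpret N: abelian_group N using N by (rule left_module.axioms)
  have sub: "additive_subgroup U N"
    using Module.submodule.axioms(1)[OF U] by (simp add: additive_subgroup_def)
  interpret U: abelian_subgroup U N
    using sub N.abelian_group_axioms N.a_comm by (intro abelian_subgroupI3) auto
  note Ucl = submoduleD[OF U N]
  have UN: "x \<in> carrier N" if "x \<in> U" for x using Ucl(1) that by auto
  show onto: "(\<lambda>x. U +>\<^bsub>N\<^esub> x) ` carrier N = carrier (quot_module N U)"
    by (auto simp: quot_module_def A_RCOSETS_def')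
  have zero: "U +>\<^bsub>N\<^esub> \<zero>\<^bsub>N\<^esub> = U" using Ucl(1) by (simp add: N.a_coset_add_zero)
  have mem: "y \<in> U +>\<^bsub>N\<^esub> x \<longleftrightarrow> (\<exists>u \<in> U. y = u \<oplus>\<^bsub>N\<^esub> x)" for x y by (auto simp: a_r_coset_def')
  show hom: "(\<lambda>x. U +>\<^bsub>N\<^esub> x) \<in> module_hom R N (quot_module N U)"
  proof (rule homI)
    show "U +>\<^bsub>N\<^esub> x \<in> carrier (quot_module N U)" if "x \<in> carrier N" for x
      using that by (auto simp: quot_module_def A_RCOSETS_def')
    show "U +>\<^bsub>N\<^esub> (x \<oplus>\<^bsub>N\<^esub> y) = (U +>\<^bsub>N\<^esub> x) \<oplus>\<^bsub>quot_module N U\<^esub> (U +>\<^bsub>N\<^esub> y)"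
      if "x \<in> carrier N" "y \<in> carrier N" for x y
      using that by (simp add: quot_module_def U.a_rcos_sum)
    show "U +>\<^bsub>N\<^esub> (a \<odot>\<^bsub>N\<^esub> x) = a \<odot>\<^bsub>quot_module N U\<^esub> (U +>\<^bsub>N\<^esub> x)"
      if a: "a \<in> carrier R" and x: "x \<in> carrier N" for a x
    proof (rule Set.set_eqI)
      fix y
      have "y \<in> a \<odot>\<^bsub>quot_module N U\<^esub> (U +>\<^bsub>N\<^esub> x) \<longleftrightarrow> (\<exists>u \<in> U. \<exists>v \<in> U. y = u \<oplus>\<^bsub>N\<^esub> a \<odot>\<^bsub>N\<^esub> (v \<oplus>\<^bsub>N\<^esub> x))"
        by (simp add: quot_module_def set_add_def' mem Bex_def) blast
      also have "\<dots> \<longleftrightarrow> (\<exists>u \<in> U. \<exists>v \<in> U. y = (u \<oplus>\<^bsub>N\<^esub> a \<odot>\<^bsub>N\<^esub> v) \<oplus>\<^bsub>N\<^esub> a \<odot>\<^bsub>N\<^esub> x)"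
        using a x UN by (simp add: left_module_arith(1)[OF N])
      also have "\<dots> \<longleftrightarrow> (\<exists>u \<in> U. y = u \<oplus>\<^bsub>N\<^esub> a \<odot>\<^bsub>N\<^esub> x)"
      proof
        assume "\<exists>u \<in> U. \<exists>v \<in> U. y = (u \<oplus>\<^bsub>N\<^esub> a \<odot>\<^bsub>N\<^esub> v) \<oplus>\<^bsub>N\<^esub> a \<odot>\<^bsub>N\<^esub> x"
        then show "\<exists>u \<in> U. y = u \<oplus>\<^bsub>N\<^esub> a \<odot>\<^bsub>N\<^esub> x" using Ucl(3,5) a by blast
      next
        assume "\<exists>u \<in> U. y = u \<oplus>\<^bsub>N\<^esub> a \<odot>\<^bsub>N\<^esub> x"
        then obtain u where "u \<in> U" "y = u \<oplus>\<^bsub>N\<^esub> a \<odot>\<^bsub>N\<^esub> x" by auto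
        then show "\<exists>u \<in> U. \<exists>v \<in> U. y = (u \<oplus>\<^bsub>N\<^esub> a \<odot>\<^bsub>N\<^esub> v) \<oplus>\<^bsub>N\<^esub> a \<odot>\<^bsub>N\<^esub> x"
          using a UN Ucl(2) by (intro bexI[of _ u] bexI[of _ "\<zero>\<^bsub>N\<^esub>"]) auto
      qed
      also have "\<dots> \<longleftrightarrow> y \<in> U +>\<^bsub>N\<^esub> (a \<odot>\<^bsub>N\<^esub> x)" by (simp add: mem)
      finally show "y \<in> U +>\<^bsub>N\<^esub> (a \<odot>\<^bsub>N\<^esub> x) \<longleftrightarrow> y \<in> a \<odot>\<^bsub>quot_module N U\<^esub> (U +>\<^bsub>N\<^esub> x)" by simp
    qed
  qed
  show "left_module R (quot_module N U)"
    by (rule left_module_image[OF N hom onto]) (simp add: zero, simp add: quot_module_def)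
  show "U +>\<^bsub>N\<^esub> x = \<zero>\<^bsub>quot_module N U\<^esub> \<longleftrightarrow> x \<in> U" if x: "x \<in> carrier N" for x
  proof -
    have "U +>\<^bsub>N\<^esub> x = U \<longleftrightarrow> x \<in> U"
    proof
      assume "U +>\<^bsub>N\<^esub> x = U"
      moreover have "x \<in> U +>\<^bsub>N\<^esub> x" unfolding mem using x Ucl(2) by (intro bexI[of _ "\<zero>\<^bsub>N\<^esub>"]) auto
      ultimately show "x \<in> U" by simp
    next
      assume "x \<in> U"
      then show "U +>\<^bsub>N\<^esub> x = U" by (rule U.a_rcos_const)
    qed
    then show ?thesis by (simp add: quot_module_def)
  qed
qed

text \<open>
  The isomorphism theorem, which replaces the module of cosets by an epimorphism with prescribed kernel.
\<close>
lemma coker_iso_iff: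
  assumes f: "f \<in> module_hom R M N" and M: "left_module R M" and N: "left_module R N" and L: "left_module R L"
  shows "mod_iso R (coker M N f) L \<longleftrightarrow>
    (\<exists>g \<in> module_hom R N L. g ` carrier N = carrier L \<and> {n \<in> carrier N. g n = \<zero>\<^bsub>L\<^esub>} = f ` carrier M)"
proof -
  let ?U = "f ` carrier M" and ?C = "coker M N f" and ?p = "\<lambda>x. f ` carrier M +>\<^bsub>N\<^esub> x"
  have U: "Module.submodule ?U R N" by (rule submodule_image[OF f M N])
  note q = left_module_quotient[OF N U, folded coker_def]
  note [simp] = left_module_rules[OF N] left_module_rules[OF q(1)] hom_rules[OF q(2) N q(1)]
  show ?thesis
  proof
    assume "mod_iso R ?C L"
    then obtain k where k: "k \<in> module_hom R ?C L" "bij_betw k (carrier ?C) (carrier L)" by (auto simp: mod_iso_def)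
    note [simp] = hom_rules[OF k(1) q(1) L]
    have "k (?p n) = \<zero>\<^bsub>L\<^esub> \<longleftrightarrow> n \<in> ?U" if "n \<in> carrier N" for n
    proof -
      have "k (?p n) = \<zero>\<^bsub>L\<^esub> \<longleftrightarrow> ?p n = \<zero>\<^bsub>?C\<^esub>"
        using k(2) that inj_on_hom_iff[OF k(1) q(1) L] by (auto simp: bij_betw_def)
      then show ?thesis using q(4)[OF that] by simp
    qed
    moreover have "?U \<subseteq> carrier N" using submoduleD(1)[OF U N] .
    moreover have "(\<lambda>n. k (?p n)) ` carrier N = carrier L"
      using k(2) q(3) by (auto simp: bij_betw_def simp flip: image_image)
    ultimately show "\<exists>g \<in> module_hom R N L. g ` carrier N = carrier L \<and> {n \<in> carrier N. g n = \<zero>\<^bsub>L\<^esub>} = ?U"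
      using hom_comp[OF q(2) k(1)] by (intro bexI[of _ "\<lambda>n. k (?p n)"]) auto
  next
    assume "\<exists>g \<in> module_hom R N L. g ` carrier N = carrier L \<and> {n \<in> carrier N. g n = \<zero>\<^bsub>L\<^esub>} = ?U"
    then obtain g where g: "g \<in> module_hom R N L" "g ` carrier N = carrier L"
      "{n \<in> carrier N. g n = \<zero>\<^bsub>L\<^esub>} = ?U" by auto
    have "g x = \<zero>\<^bsub>L\<^esub>" if "x \<in> carrier N" "?p x = \<zero>\<^bsub>?C\<^esub>" for x
      using q(4)[OF that(1)] that g(3) by auto
    then obtain h where h: "h \<in> module_hom R ?C L" "\<And>x. x \<in> carrier N \<Longrightarrow> h (?p x) = g x"
      using factor_through_surjection[OF q(2,3) g(1) q(1) N L] by blast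
    have ex: "\<exists>x \<in> carrier N. c = ?p x" if "c \<in> carrier ?C" for c using that q(3) by auto
    have "inj_on h (carrier ?C)"
      unfolding inj_on_hom_iff[OF h(1) q(1) L]
    proof (intro ballI impI)
      fix c assume c: "c \<in> carrier ?C" "h c = \<zero>\<^bsub>L\<^esub>"
      then obtain x where x: "x \<in> carrier N" "c = ?p x" using ex by auto
      then have "x \<in> ?U" using c h(2) g(3) by auto
      then show "c = \<zero>\<^bsub>?C\<^esub>" using q(4)[OF x(1)] x(2) by simp
    qed
    moreover have "h ` carrier ?C = carrier L"
      unfolding q(3)[symmetric] image_image using g(2) h(2) by auto
    ultimately show "mod_iso R ?C L" using h(1) by (auto simp: mod_iso_def bij_betw_def)
  qed
qed

context finite_path_algebra
begin

section \<open>Projective modules and minimal resolutions\<close>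

lemma fd_direct_sum: "fd_module K Q M \<Longrightarrow> fd_module K Q N \<Longrightarrow> fd_module K Q (direct_sum M N)"
  by (simp add: fd_iff left_module_direct_sum)

lemma fd_submodule: "fd_module K Q M \<Longrightarrow> Module.submodule U A M \<Longrightarrow> fd_module K Q (M\<lparr>carrier := U\<rparr>)"
  using submoduleD(1)[of U A M] left_module_submodule[of U A M] by (auto simp: fd_iff intro: finite_subset)

lemma infinite_test_type: "infinite (UNIV :: (nat \<Rightarrow> 'k) set)"
proof -
  have "inj (\<lambda>n m. if m = n then \<one>\<^bsub>K\<^esub> else \<zero>\<^bsub>K\<^esub> :: 'k)" for n :: nat
    by (rule injI) (metis K.one_not_zero)
  then show ?thesis using finite_imageD finite_subset infinite_UNIV_nat subset_UNIV by metis
qed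

text \<open>
  The type \<^typ>\<open>nat \<Rightarrow> 'k\<close> is infinite and \<open>X\<close> is finite, so that some bijection of \<open>X\<close> with a subset
  of the type exists; it need not be linear, since the structure of \<open>X\<close> is transported along it.
\<close>
lemma transport_to_test_type:
  fixes X :: "('v, 'e, 'k, 'x) pa_module"
  assumes X: "fd_module K Q X"
  shows "\<exists>(X' :: ('v, 'e, 'k, nat \<Rightarrow> 'k) pa_module). \<exists>i \<in> module_hom A X X'.
    fd_module K Q X' \<and> bij_betw i (carrier X) (carrier X')"
proof -
  obtain B :: "(nat \<Rightarrow> 'k) set" where B: "finite B" "card B = card (carrier X)"
    using infinite_arbitrarily_large[OF infinite_test_type] by metis
  then obtain i where i: "bij_betw i (carrier X) B"
    using finite_same_card_bij[OF fdD(2)[OF X]] by metis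
  define j where "j = inv_into (carrier X) i"
  have ji: "j (i x) = x" if "x \<in> carrier X" for x
    using i that by (auto simp: j_def bij_betw_def intro: inv_into_f_f)
  define X' where "X' = \<lparr>carrier = B, mult = (\<lambda>_ _. i \<zero>\<^bsub>X\<^esub>), one = i \<zero>\<^bsub>X\<^esub>, zero = i \<zero>\<^bsub>X\<^esub>,
     add = (\<lambda>x y. i (j x \<oplus>\<^bsub>X\<^esub> j y)), smult = (\<lambda>a x. i (a \<odot>\<^bsub>X\<^esub> j x))\<rparr>"
  have hom: "i \<in> module_hom A X X'"
    using i by (intro homI) (auto simp: X'_def ji bij_betw_def)
  have "left_module A X'"
    using i by (intro left_module_image[OF fdD(1)[OF X] hom]) (auto simp: X'_def bij_betw_def)
  then have "fd_module K Q X'" using B by (simp add: fd_iff X'_def)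
  moreover have "bij_betw i (carrier X) (carrier X')" using i by (simp add: X'_def)
  ultimately show ?thesis using hom by blast
qed

lemma hom_inverse:
  assumes i: "i \<in> module_hom A X X'" and b: "bij_betw i (carrier X) (carrier X')"
    and X: "left_module A X" and X': "left_module A X'"
  shows "\<exists>j \<in> module_hom A X' X. \<forall>x \<in> carrier X'. i (j x) = x"
  using factor_through_injection[OF i _ hom_id X X' X'] b by (auto simp: bij_betw_def)

text \<open>
  Replace \<open>Y\<close> by the image of \<open>g\<close> and move both modules to the type of the test modules in the definition
  of projectivity.
\<close>
lemma projective_lift:
  assumes P: "projective K Q P" and X: "fd_module K Q X" and Y: "fd_module K Q Y"
    and g: "g \<in> module_hom A X Y" and f: "f \<in> module_hom A P Y" and im: "f ` carrier P \<subseteq> g ` carrier X"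
  shows "\<exists>h \<in> module_hom A P X. \<forall>p \<in> carrier P. g (h p) = f p"
proof -
  let ?Z = "Y\<lparr>carrier := g ` carrier X\<rparr>"
  have Z: "fd_module K Q ?Z" using fd_submodule[OF Y submodule_image[OF g fdD(1)[OF X] fdD(1)[OF Y]]] .
  have g': "g \<in> module_hom A X ?Z" and f': "f \<in> module_hom A P ?Z"
    using f g im by (auto simp: module_hom_def)
  obtain X' :: "('v, 'e, 'k, nat \<Rightarrow> 'k) pa_module" and i where
    X': "fd_module K Q X'" and i: "i \<in> module_hom A X X'" "bij_betw i (carrier X) (carrier X')"
    using transport_to_test_type[OF X] by auto
  obtain Z' :: "('v, 'e, 'k, nat \<Rightarrow> 'k) pa_module" and l where
    Z': "fd_module K Q Z'" and l: "l \<in> module_hom A ?Z Z'" "bij_betw l (carrier ?Z) (carrier Z')"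
    using transport_to_test_type[OF Z] by metis
  obtain j where j: "j \<in> module_hom A X' X" "\<And>x. x \<in> carrier X' \<Longrightarrow> i (j x) = x"
    using hom_inverse[OF i fdD(1)[OF X] fdD(1)[OF X']] by auto
  have jX: "j ` carrier X' = carrier X"
  proof -
    have "x \<in> j ` carrier X'" if x: "x \<in> carrier X" for x
    proof -
      have ix: "i x \<in> carrier X'" using i(2) x by (auto simp: bij_betw_def)
      then have "j (i x) \<in> carrier X" using j(1) by (auto simp: module_hom_def)
      then have "j (i x) = x" using j(2)[OF ix] i(2) x by (metis bij_betw_imp_inj_on inj_onD)
      then show ?thesis using ix by (metis imageI)
    qed
    then show ?thesis using j(1) by (auto simp: module_hom_def)
  qed
  have g2: "(\<lambda>x. l (g (j x))) \<in> module_hom A X' Z'" by (intro hom_comp[OF hom_comp[OF j(1) g'] l(1)])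
  have f2: "(\<lambda>p. l (f p)) \<in> module_hom A P Z'" by (rule hom_comp[OF f' l(1)])
  have onto: "(\<lambda>x. l (g (j x))) ` carrier X' = carrier Z'"
  proof -
    have "(\<lambda>x. l (g (j x))) ` carrier X' = l ` (g ` (j ` carrier X'))" by (simp add: image_image)
    then show ?thesis using jX l(2) by (simp add: bij_betw_def)
  qed
  have "\<exists>h \<in> module_hom A P X'. \<forall>p \<in> carrier P. l (g (j (h p))) = l (f p)"
    using P[unfolded projective_def, THEN conjunct2, rule_format, OF conjI[OF X' Z'] g2 f2 onto] .
  then obtain h where h: "h \<in> module_hom A P X'" "\<And>p. p \<in> carrier P \<Longrightarrow> l (g (j (h p))) = l (f p)"
    by blast
  have "g (j (h p)) = f p" if p: "p \<in> carrier P" for p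
  proof -
    have "h p \<in> carrier X'" using h(1) p by (auto simp: module_hom_def)
    then have "g (j (h p)) \<in> carrier ?Z" using jX by auto
    moreover have "f p \<in> carrier ?Z" using im p by auto
    ultimately show ?thesis using h(2)[OF p] l(2) by (metis bij_betw_imp_inj_on inj_onD)
  qed
  then show ?thesis using hom_comp[OF h(1) j(1)] by (intro bexI[of _ "\<lambda>p. j (h p)"]) auto
qed

lemma projective_fd: "projective K Q P \<Longrightarrow> fd_module K Q P"
  by (simp add: projective_def)

lemma projective_direct_sum:
  assumes P: "projective K Q P" and P': "projective K Q P'"
  shows "projective K Q (direct_sum P P')"
proof -
  note fd = projective_fd[OF P] projective_fd[OF P']
  note lm = fdD(1)[OF fd(1)] fdD(1)[OF fd(2)]
  show ?thesis
    unfolding projective_def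
  proof (intro conjI allI impI ballI fd_direct_sum fd)
    fix X Y :: "('v, 'e, 'k, nat \<Rightarrow> 'k) pa_module" and g f
    assume XY: "fd_module K Q X \<and> fd_module K Q Y" and g: "g \<in> module_hom A X Y"
      and f: "f \<in> module_hom A (direct_sum P P') Y" and onto: "g ` carrier X = carrier Y"
    have X: "fd_module K Q X" and Y: "fd_module K Q Y" using XY by auto
    note lX = fdD(1)[OF X] and lY = fdD(1)[OF Y]
    note fr = hom_rules[OF f left_module_direct_sum[OF lm] lY]
    note [simp] = left_module_rules[OF lm(1)] left_module_rules[OF lm(2)]
    have f1: "(\<lambda>p. f (p, \<zero>\<^bsub>P'\<^esub>)) \<in> module_hom A P Y" and f2: "(\<lambda>p. f (\<zero>\<^bsub>P\<^esub>, p)) \<in> module_hom A P' Y"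
      using hom_comp[OF hom_inl[OF lm(2)] f] hom_comp[OF hom_inr[OF lm(1)] f] by auto
    have im1: "(\<lambda>p. f (p, \<zero>\<^bsub>P'\<^esub>)) ` carrier P \<subseteq> g ` carrier X"
      and im2: "(\<lambda>p. f (\<zero>\<^bsub>P\<^esub>, p)) ` carrier P' \<subseteq> g ` carrier X"
      using hom_rules(1)[OF f1 lm(1) lY] hom_rules(1)[OF f2 lm(2) lY] unfolding onto by auto
    obtain h where h: "h \<in> module_hom A P X" "\<And>p. p \<in> carrier P \<Longrightarrow> g (h p) = f (p, \<zero>\<^bsub>P'\<^esub>)"
      using projective_lift[OF P X Y g f1 im1] by auto
    obtain h' where h': "h' \<in> module_hom A P' X" "\<And>p. p \<in> carrier P' \<Longrightarrow> g (h' p) = f (\<zero>\<^bsub>P\<^esub>, p)"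
      using projective_lift[OF P' X Y g f2 im2] by auto
    have "g (h (fst v) \<oplus>\<^bsub>X\<^esub> h' (snd v)) = f v" if "v \<in> carrier (direct_sum P P')" for v
      using that fr(2)[of "(fst v, \<zero>\<^bsub>P'\<^esub>)" "(\<zero>\<^bsub>P\<^esub>, snd v)"]
      by (auto simp: hom_rules[OF g lX lY] hom_rules(1)[OF h(1) lm(1) lX] hom_rules(1)[OF h'(1) lm(2) lX] h(2) h'(2))
    then show "\<exists>h \<in> module_hom A (direct_sum P P') X. \<forall>p \<in> carrier (direct_sum P P'). g (h p) = f p"
      by (intro bexI[OF _ hom_copair[OF h(1) h'(1) lm lX]] ballI)
  qed
qed

lemma resolutionD:
  assumes r: "minimal_resolution K Q M r" and M: "fd_module K Q M"
  shows "projective K Q (res_P r)" "projective K Q (res_Omega r)"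
    "left_module A (res_P r)" "left_module A (res_Omega r)" "left_module A M"
    "res_delta r \<in> module_hom A (res_Omega r) (res_P r)" "res_pi r \<in> module_hom A (res_P r) M"
    "inj_on (res_delta r) (carrier (res_Omega r))" "res_pi r ` carrier (res_P r) = carrier M"
    "\<And>p. p \<in> carrier (res_P r) \<Longrightarrow> res_pi r p = \<zero>\<^bsub>M\<^esub> \<longleftrightarrow> (\<exists>w \<in> carrier (res_Omega r). p = res_delta r w)"
    "\<And>w. w \<in> carrier (res_Omega r) \<Longrightarrow> res_pi r (res_delta r w) = \<zero>\<^bsub>M\<^esub>"
    "\<And>w. w \<in> carrier (res_Omega r) \<Longrightarrow> res_delta r w = \<zero>\<^bsub>res_P r\<^esub> \<longleftrightarrow> w = \<zero>\<^bsub>res_Omega r\<^esub>"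
    "card (carrier (res_P r)) = card (carrier (res_Omega r)) * card (carrier M)"
proof -
  show pr: "projective K Q (res_P r)" "projective K Q (res_Omega r)"
    and d: "res_delta r \<in> module_hom A (res_Omega r) (res_P r)" and p: "res_pi r \<in> module_hom A (res_P r) M"
    using r by (auto simp: minimal_resolution_def)
  note fd = projective_fd[OF pr(1)] projective_fd[OF pr(2)]
  show lm: "left_module A (res_P r)" "left_module A (res_Omega r)" "left_module A M"
    by (rule fdD(1)[OF fd(1)], rule fdD(1)[OF fd(2)], rule fdD(1)[OF M])
  have ex: "short_exact (res_Omega r) (res_delta r) (res_P r) (res_pi r) M"
    using r by (auto simp: minimal_resolution_def)
  show inj: "inj_on (res_delta r) (carrier (res_Omega r))" and "res_pi r ` carrier (res_P r) = carrier M"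
    using ex by (auto simp: short_exact_def)
  have ker: "res_delta r ` carrier (res_Omega r) = {z \<in> carrier (res_P r). res_pi r z = \<zero>\<^bsub>M\<^esub>}"
    using ex by (simp add: short_exact_def)
  show "res_pi r p = \<zero>\<^bsub>M\<^esub> \<longleftrightarrow> (\<exists>w \<in> carrier (res_Omega r). p = res_delta r w)"
    if p: "p \<in> carrier (res_P r)" for p
  proof -
    have "res_pi r p = \<zero>\<^bsub>M\<^esub> \<longleftrightarrow> p \<in> res_delta r ` carrier (res_Omega r)" unfolding ker using p by simp
    then show ?thesis by (simp add: image_iff)
  qed
  show "res_pi r (res_delta r w) = \<zero>\<^bsub>M\<^esub>" if w: "w \<in> carrier (res_Omega r)" for w
  proof -
    have "res_delta r w \<in> {z \<in> carrier (res_P r). res_pi r z = \<zero>\<^bsub>M\<^esub>}" unfolding ker[symmetric] using w by simp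
    then show ?thesis by simp
  qed
  show "res_delta r w = \<zero>\<^bsub>res_P r\<^esub> \<longleftrightarrow> w = \<zero>\<^bsub>res_Omega r\<^esub>" if "w \<in> carrier (res_Omega r)" for w
    using inj that hom_rules(4)[OF d lm(2,1)] unfolding inj_on_hom_iff[OF d lm(2,1)] by metis
  show "card (carrier (res_P r)) = card (carrier (res_Omega r)) * card (carrier M)"
    using card_short_exact[OF d p lm(1,3) fdD(2)[OF fd(1)] ex] .
qed

text \<open>
  If \<open>U\<close> meets every fibre of \<open>\<pi>\<close>, then \<open>U + \<delta>(\<Omega>) = P\<close>, and \<open>\<delta>(\<Omega>)\<close> is superfluous by minimality.
\<close>
lemma cover_submodule:
  assumes r: "minimal_resolution K Q M r" and M: "fd_module K Q M"
    and U: "Module.submodule U A (res_P r)"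
    and sum: "\<And>p. p \<in> carrier (res_P r) \<Longrightarrow> \<exists>u \<in> U. res_pi r u = res_pi r p"
  shows "U = carrier (res_P r)"
proof -
  let ?P = "res_P r"
  note R = resolutionD[OF r M]
  note [simp] = left_module_rules[OF R(3)] hom_rules[OF R(6,4,3)] hom_rules[OF R(7,3,5)]
  have sub: "U \<subseteq> carrier ?P" by (rule submoduleD(1)[OF U R(3)])
  have ge: "p \<in> U <+>\<^bsub>?P\<^esub> (res_delta r ` carrier (res_Omega r))" if p: "p \<in> carrier ?P" for p
  proof -
    obtain u where u: "u \<in> U" "res_pi r u = res_pi r p" using sum[OF p] by auto
    then have uP: "u \<in> carrier ?P" using sub by auto
    have mem: "p \<ominus>\<^bsub>?P\<^esub> u \<in> carrier ?P" using p uP by simp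
    have "res_pi r (p \<ominus>\<^bsub>?P\<^esub> u) = res_pi r p \<ominus>\<^bsub>M\<^esub> res_pi r u" using p uP by simp
    also have "\<dots> = \<zero>\<^bsub>M\<^esub>" unfolding u(2) using p by (intro left_module_rules(8)[OF R(5)]) simp
    finally obtain w where w: "w \<in> carrier (res_Omega r)" "p \<ominus>\<^bsub>?P\<^esub> u = res_delta r w"
      using R(10)[OF mem] by metis
    have "p = res_delta r w \<oplus>\<^bsub>?P\<^esub> u"
      using w left_module_move(2)[OF R(3) p uP, of "res_delta r w"] by simp
    also have "\<dots> = u \<oplus>\<^bsub>?P\<^esub> res_delta r w"
      using w uP by (intro left_module_arith(2)[OF R(3)]) simp_all
    finally have "p = u \<oplus>\<^bsub>?P\<^esub> res_delta r w" .
    moreover have "u \<oplus>\<^bsub>?P\<^esub> res_delta r w \<in> U <+>\<^bsub>?P\<^esub> (res_delta r ` carrier (res_Omega r))"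
      unfolding set_add_def' by (rule UN_I[OF u(1)], rule UN_I[OF imageI[OF w(1)]]) simp
    ultimately show ?thesis by simp
  qed
  have le: "U <+>\<^bsub>?P\<^esub> (res_delta r ` carrier (res_Omega r)) \<subseteq> carrier ?P"
    unfolding set_add_def' using sub by (auto simp: subset_iff)
  have "U <+>\<^bsub>?P\<^esub> (res_delta r ` carrier (res_Omega r)) = carrier ?P"
    by (rule equalityI[OF le subsetI[OF ge]])
  moreover have "\<forall>V. Module.submodule V A ?P \<and>
      V <+>\<^bsub>?P\<^esub> (res_delta r ` carrier (res_Omega r)) = carrier ?P \<longrightarrow> V = carrier ?P"
    using r unfolding minimal_resolution_def by (elim conjE)
  ultimately show ?thesis using U by simp
qed

lemma cover_onto:
  assumes r: "minimal_resolution K Q M r" and M: "fd_module K Q M"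
    and f: "f \<in> module_hom A X (res_P r)" and X: "left_module A X"
    and onto: "\<And>m. m \<in> carrier M \<Longrightarrow> \<exists>x \<in> carrier X. res_pi r (f x) = m"
  shows "f ` carrier X = carrier (res_P r)"
proof (rule cover_submodule[OF r M])
  note R = resolutionD[OF r M]
  show "Module.submodule (f ` carrier X) A (res_P r)" by (rule submodule_image[OF f X R(3)])
  show "\<exists>u \<in> f ` carrier X. res_pi r u = res_pi r p" if "p \<in> carrier (res_P r)" for p
    using onto[OF hom_rules(1)[OF R(7,3,5) that]] by blast
qed

text \<open>
  The extension group is the cokernel of the restriction \<open>Hom(P, N) \<rightarrow> Hom(\<Omega>, N)\<close> along \<open>\<delta>\<close>.
\<close>
lemma Ext1_zeroD:
  assumes r: "minimal_resolution K Q M r" and M: "fd_module K Q M" and N: "fd_module K Q N"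
    and vanish: "carrier (Ext1 K Q r N) = {\<zero>\<^bsub>Ext1 K Q r N\<^esub>}"
    and b: "b \<in> module_hom A (res_Omega r) N"
  shows "\<exists>h \<in> module_hom A (res_P r) N. \<forall>w \<in> carrier (res_Omega r). h (res_delta r w) = b w"
proof -
  note R = resolutionD[OF r M]
  note lN = fdD(1)[OF N]
  let ?W = "carrier (res_Omega r)" and ?HW = "hom_space K Q (res_Omega r) N"
  let ?U = "(\<lambda>h. compose ?W h (res_delta r)) ` mod_homs A (res_P r) N"
  let ?b = "restrict b ?W"
  have b': "?b \<in> mod_homs A (res_Omega r) N" by (rule restrict_hom[OF b R(4)])
  have car: "carrier (Ext1 K Q r N) = a_rcosets\<^bsub>?HW\<^esub> ?U" and zero: "\<zero>\<^bsub>Ext1 K Q r N\<^esub> = ?U"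
    by (simp_all add: Ext1_def coker_def quot_module_def hom_space_def)
  have "?U +>\<^bsub>?HW\<^esub> ?b \<in> carrier (Ext1 K Q r N)"
    using b' unfolding car by (auto simp: A_RCOSETS_def' hom_space_def)
  then have eq: "?U +>\<^bsub>?HW\<^esub> ?b = ?U" using vanish zero by auto
  let ?z = "\<lambda>w \<in> ?W. \<zero>\<^bsub>N\<^esub>"
  have "compose ?W (\<lambda>p \<in> carrier (res_P r). \<zero>\<^bsub>N\<^esub>) (res_delta r) = ?z"
    using hom_rules(1)[OF R(6,4,3)] by (auto simp: compose_def restrict_def)
  moreover have "(\<lambda>p \<in> carrier (res_P r). \<zero>\<^bsub>N\<^esub>) \<in> mod_homs A (res_P r) N"
    by (intro restrict_hom hom_zero lN R(3))
  ultimately have z: "?z \<in> ?U" by (metis imageI)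
  have "?z \<oplus>\<^bsub>?HW\<^esub> ?b = ?b"
    by (rule ext) (simp add: hom_space_def left_module_rules(7)[OF lN] hom_rules(1)[OF b R(4) lN])
  moreover have "?z \<oplus>\<^bsub>?HW\<^esub> ?b \<in> ?U +>\<^bsub>?HW\<^esub> ?b" unfolding a_r_coset_def' by (rule UN_I[OF z]) simp
  ultimately have "?b \<in> ?U +>\<^bsub>?HW\<^esub> ?b" by simp
  then obtain h where "h \<in> mod_homs A (res_P r) N" "?b = compose ?W h (res_delta r)"
    unfolding eq by auto
  moreover have "h (res_delta r w) = b w" if "w \<in> ?W" for w
    using fun_cong[OF \<open>?b = compose ?W h (res_delta r)\<close>, of w] that by (simp add: compose_def)
  ultimately show ?thesis by (intro bexI[of _ h]) (auto simp: mod_homs_def)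
qed

section \<open>Counting short exact sequences\<close>

text \<open>
  Short exact sequences of modules with an endomorphism; with zero endomorphisms these are the short
  exact sequences of modules, so that both kinds of Hall numbers are counted at once.
\<close>
definition ses_pairs ::
  "('v, 'e, 'k, 'x) complex1 \<Rightarrow> ('v, 'e, 'k, 'y) complex1 \<Rightarrow> ('v, 'e, 'k, 'z) complex1
     \<Rightarrow> (('y \<Rightarrow> 'z) \<times> ('z \<Rightarrow> 'x)) set" where
  "ses_pairs X Y Z = {(f, g). f \<in> c1_homs K Q Y Z \<and> g \<in> c1_homs K Q Z X \<and>
     short_exact (fst Y) f (fst Z) g (fst X)}"

definition diff_module :: "('v, 'e, 'k, 'x) complex1 \<Rightarrow> bool" where
  "diff_module X \<longleftrightarrow> fd_module K Q (fst X) \<and> snd X \<in> module_hom A (fst X) (fst X)"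

definition stalk :: "('v, 'e, 'k, 'x) pa_module \<Rightarrow> ('v, 'e, 'k, 'x) complex1" where
  "stalk M = (M, \<lambda>_. \<zero>\<^bsub>M\<^esub>)"

lemma c1_homsD:
  assumes "f \<in> c1_homs K Q X Y"
  shows "f \<in> module_hom A (fst X) (fst Y)" "f \<in> extensional (carrier (fst X))"
    "\<And>x. x \<in> carrier (fst X) \<Longrightarrow> f (snd X x) = snd Y (f x)"
  using assms by (auto simp: c1_homs_def mod_homs_def)

lemma finite_c1_homs:
  assumes "diff_module X" "diff_module Y" shows "finite (c1_homs K Q X Y)"
  using finite_homs[of "fst X" "fst Y"] assms
  by (auto simp: diff_module_def c1_homs_def intro: finite_subset[rotated])

lemma card_c1_auts_pos:
  assumes "diff_module X" shows "card (c1_auts K Q X) > 0"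
proof -
  have lm: "left_module A (fst X)" using assms by (auto simp: diff_module_def dest: fdD(1))
  have "restrict (\<lambda>x. x) (carrier (fst X)) \<in> c1_auts K Q X"
    using restrict_hom[OF hom_id lm] assms hom_rules(1)[OF _ lm lm, of "snd X"]
    by (auto simp: c1_auts_def c1_homs_def diff_module_def bij_betw_def)
  moreover have "finite (c1_auts K Q X)"
    using finite_c1_homs[OF assms assms] by (auto simp: c1_auts_def)
  ultimately show ?thesis by (auto simp: card_gt_0_iff)
qed

lemma compose_c1_homs:
  assumes f: "f \<in> c1_homs K Q X Y" and g: "g \<in> c1_homs K Q Y Z" and X: "diff_module X"
  shows "compose (carrier (fst X)) g f \<in> c1_homs K Q X Z"
proof -
  have lX: "left_module A (fst X)" and dX: "snd X \<in> module_hom A (fst X) (fst X)"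
    using X by (auto simp: diff_module_def dest: fdD(1))
  note F = c1_homsD[OF f] and G = c1_homsD[OF g]
  have cl: "f x \<in> carrier (fst Y)" if "x \<in> carrier (fst X)" for x using F(1) that by (auto simp: module_hom_def)
  have "compose (carrier (fst X)) g f \<in> mod_homs A (fst X) (fst Z)"
    using restrict_hom[OF hom_comp[OF F(1) G(1)] lX] by (simp add: compose_def)
  then show ?thesis
    using F(3) G(3) cl hom_rules(1)[OF dX lX lX] by (simp add: c1_homs_def compose_def)
qed

text \<open>Two monomorphisms with the same image differ by an automorphism of the source.\<close>
lemma card_monos_same_image:
  assumes Y: "diff_module Y" and Z: "diff_module Z" and f0: "f0 \<in> c1_homs K Q Y Z"
    and inj: "inj_on f0 (carrier (fst Y))"
  shows "card {f \<in> c1_homs K Q Y Z. inj_on f (carrier (fst Y)) \<and> f ` carrier (fst Y) = f0 ` carrier (fst Y)}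
    = card (c1_auts K Q Y)"
proof -
  let ?Y = "carrier (fst Y)"
  have lY: "left_module A (fst Y)" and lZ: "left_module A (fst Z)" and dY: "snd Y \<in> module_hom A (fst Y) (fst Y)"
    using Y Z by (auto simp: diff_module_def dest: fdD(1))
  note F0 = c1_homsD[OF f0]
  let ?S = "{f \<in> c1_homs K Q Y Z. inj_on f ?Y \<and> f ` ?Y = f0 ` ?Y}"
  have aut: "\<alpha> \<in> c1_homs K Q Y Y" "bij_betw \<alpha> ?Y ?Y" if "\<alpha> \<in> c1_auts K Q Y" for \<alpha>
    using that by (auto simp: c1_auts_def)
  have "bij_betw (\<lambda>\<alpha>. compose ?Y f0 \<alpha>) (c1_auts K Q Y) ?S"
    unfolding bij_betw_def
  proof (intro conjI equalityI subsetI)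
    show "inj_on (\<lambda>\<alpha>. compose ?Y f0 \<alpha>) (c1_auts K Q Y)"
    proof (rule inj_onI)
      fix \<alpha> \<beta> assume \<alpha>: "\<alpha> \<in> c1_auts K Q Y" and \<beta>: "\<beta> \<in> c1_auts K Q Y"
        and eq: "compose ?Y f0 \<alpha> = compose ?Y f0 \<beta>"
      show "\<alpha> = \<beta>"
      proof (rule extensionalityI[OF c1_homsD(2)[OF aut(1)[OF \<alpha>]] c1_homsD(2)[OF aut(1)[OF \<beta>]]])
        fix y assume y: "y \<in> ?Y"
        have "f0 (\<alpha> y) = f0 (\<beta> y)" using fun_cong[OF eq, of y] y by (simp add: compose_def)
        then show "\<alpha> y = \<beta> y"
          using inj aut(2)[OF \<alpha>] aut(2)[OF \<beta>] y by (meson bij_betwE inj_onD)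
      qed
    qed
  next
    fix f assume "f \<in> (\<lambda>\<alpha>. compose ?Y f0 \<alpha>) ` c1_auts K Q Y"
    then obtain \<alpha> where \<alpha>: "\<alpha> \<in> c1_auts K Q Y" and f: "f = compose ?Y f0 \<alpha>" by auto
    have "inj_on (\<lambda>y. f0 (\<alpha> y)) ?Y"
      using comp_inj_on[of \<alpha> ?Y f0] aut(2)[OF \<alpha>] inj by (simp add: bij_betw_def o_def)
    then have "inj_on f ?Y" unfolding f by (simp add: compose_def inj_on_def)
    moreover have "f ` ?Y = f0 ` (\<alpha> ` ?Y)" unfolding f image_image by (simp add: compose_def)
    moreover have "\<alpha> ` ?Y = ?Y" using aut(2)[OF \<alpha>] by (simp add: bij_betw_def)
    moreover have "f \<in> c1_homs K Q Y Z" unfolding f by (rule compose_c1_homs[OF aut(1)[OF \<alpha>] f0 Y])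
    ultimately show "f \<in> ?S" by simp
  next
    fix f assume "f \<in> ?S"
    then have f: "f \<in> c1_homs K Q Y Z" and fi: "inj_on f ?Y" and im: "f ` ?Y = f0 ` ?Y" by auto
    note F = c1_homsD[OF f]
    obtain h where h: "h \<in> module_hom A (fst Y) (fst Y)" "\<And>y. y \<in> ?Y \<Longrightarrow> f0 (h y) = f y"
      using factor_through_injection[OF F0(1) inj F(1) lY lZ lY] im by auto
    note [simp] = hom_rules(1)[OF h(1) lY lY] hom_rules(1)[OF dY lY lY]
    have "h (snd Y y) = snd Y (h y)" if y: "y \<in> ?Y" for y
    proof (rule inj_onD[OF inj])
      show "f0 (h (snd Y y)) = f0 (snd Y (h y))" using y by (simp add: h(2) F(3) F0(3))
    qed (use y in simp_all)
    then have c: "restrict h ?Y \<in> c1_homs K Q Y Y"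
      using restrict_hom[OF h(1) lY] by (simp add: c1_homs_def)
    have "inj_on h ?Y"
    proof (rule inj_onI)
      fix x y assume "x \<in> ?Y" "y \<in> ?Y" "h x = h y"
      then show "x = y" using h(2) fi by (metis inj_onD)
    qed
    moreover have "h ` ?Y \<subseteq> ?Y" by auto
    moreover have "finite ?Y" using Y by (simp add: diff_module_def fdD(2))
    ultimately have "bij_betw h ?Y ?Y"
      using endo_inj_surj[of ?Y h] by (simp add: bij_betw_def)
    then have "restrict h ?Y \<in> c1_auts K Q Y" using c by (simp add: c1_auts_def bij_betw_restrict_eq)
    moreover have "f = compose ?Y f0 (restrict h ?Y)"
      by (rule extensionalityI[OF F(2)]) (simp_all add: compose_def h(2))
    ultimately show "f \<in> (\<lambda>\<alpha>. compose ?Y f0 \<alpha>) ` c1_auts K Q Y" by (metis imageI)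
  qed
  then show ?thesis by (rule sym[OF bij_betw_same_card])
qed

text \<open>Two epimorphisms with the same kernel differ by an automorphism of the target.\<close>
lemma card_epis_same_kernel:
  assumes X: "diff_module X" and Z: "diff_module Z" and g0: "g0 \<in> c1_homs K Q Z X"
    and onto: "g0 ` carrier (fst Z) = carrier (fst X)"
  shows "card {g \<in> c1_homs K Q Z X. g ` carrier (fst Z) = carrier (fst X) \<and>
      {z \<in> carrier (fst Z). g z = \<zero>\<^bsub>fst X\<^esub>} = {z \<in> carrier (fst Z). g0 z = \<zero>\<^bsub>fst X\<^esub>}}
    = card (c1_auts K Q X)"
proof -
  let ?X = "carrier (fst X)" and ?Z = "carrier (fst Z)"
  have lX: "left_module A (fst X)" and lZ: "left_module A (fst Z)" and dX: "snd X \<in> module_hom A (fst X) (fst X)"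
    and dZ: "snd Z \<in> module_hom A (fst Z) (fst Z)"
    using X Z by (auto simp: diff_module_def dest: fdD(1))
  note G0 = c1_homsD[OF g0]
  note [simp] = hom_rules(1)[OF G0(1) lZ lX] hom_rules(1)[OF dX lX lX] hom_rules(1)[OF dZ lZ lZ]
  let ?S = "{g \<in> c1_homs K Q Z X. g ` ?Z = ?X \<and> {z \<in> ?Z. g z = \<zero>\<^bsub>fst X\<^esub>} = {z \<in> ?Z. g0 z = \<zero>\<^bsub>fst X\<^esub>}}"
  have aut: "\<alpha> \<in> c1_homs K Q X X" "bij_betw \<alpha> ?X ?X" if "\<alpha> \<in> c1_auts K Q X" for \<alpha>
    using that by (auto simp: c1_auts_def)
  have lift: "\<exists>z \<in> ?Z. x = g0 z" if "x \<in> ?X" for x using onto that by auto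
  have "bij_betw (\<lambda>\<alpha>. compose ?Z \<alpha> g0) (c1_auts K Q X) ?S"
    unfolding bij_betw_def
  proof (intro conjI equalityI subsetI)
    show "inj_on (\<lambda>\<alpha>. compose ?Z \<alpha> g0) (c1_auts K Q X)"
    proof (rule inj_onI)
      fix \<alpha> \<beta> assume \<alpha>: "\<alpha> \<in> c1_auts K Q X" and \<beta>: "\<beta> \<in> c1_auts K Q X"
        and eq: "compose ?Z \<alpha> g0 = compose ?Z \<beta> g0"
      show "\<alpha> = \<beta>"
      proof (rule extensionalityI[OF c1_homsD(2)[OF aut(1)[OF \<alpha>]] c1_homsD(2)[OF aut(1)[OF \<beta>]]])
        fix x assume x: "x \<in> ?X"
        then obtain z where "z \<in> ?Z" "x = g0 z" using lift by auto
        then show "\<alpha> x = \<beta> x" using fun_cong[OF eq, of z] by (simp add: compose_def)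
      qed
    qed
  next
    fix g assume "g \<in> (\<lambda>\<alpha>. compose ?Z \<alpha> g0) ` c1_auts K Q X"
    then obtain \<alpha> where \<alpha>: "\<alpha> \<in> c1_auts K Q X" and g: "g = compose ?Z \<alpha> g0" by auto
    note AL = c1_homsD[OF aut(1)[OF \<alpha>]]
    have "g ` ?Z = \<alpha> ` (g0 ` ?Z)" unfolding g image_image by (simp add: compose_def)
    moreover have "\<alpha> ` ?X = ?X" using aut(2)[OF \<alpha>] by (simp add: bij_betw_def)
    moreover have "\<alpha> x = \<zero>\<^bsub>fst X\<^esub> \<longleftrightarrow> x = \<zero>\<^bsub>fst X\<^esub>" if "x \<in> ?X" for x
      using aut(2)[OF \<alpha>] inj_on_hom_iff[OF AL(1) lX lX] hom_rules(4)[OF AL(1) lX lX] that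
      by (metis bij_betw_imp_inj_on)
    then have "{z \<in> ?Z. g z = \<zero>\<^bsub>fst X\<^esub>} = {z \<in> ?Z. g0 z = \<zero>\<^bsub>fst X\<^esub>}"
      unfolding g by (auto simp: compose_def)
    moreover have "g \<in> c1_homs K Q Z X" unfolding g by (rule compose_c1_homs[OF g0 aut(1)[OF \<alpha>] Z])
    ultimately show "g \<in> ?S" using onto by simp
  next
    fix g assume "g \<in> ?S"
    then have g: "g \<in> c1_homs K Q Z X" and go: "g ` ?Z = ?X"
      and ker: "{z \<in> ?Z. g z = \<zero>\<^bsub>fst X\<^esub>} = {z \<in> ?Z. g0 z = \<zero>\<^bsub>fst X\<^esub>}" by auto
    note G = c1_homsD[OF g]
    have "g z = \<zero>\<^bsub>fst X\<^esub>" if "z \<in> ?Z" "g0 z = \<zero>\<^bsub>fst X\<^esub>" for z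
    proof -
      have "z \<in> {z \<in> ?Z. g z = \<zero>\<^bsub>fst X\<^esub>}" unfolding ker using that by simp
      then show ?thesis by simp
    qed
    then obtain h where h: "h \<in> module_hom A (fst X) (fst X)" "\<And>z. z \<in> ?Z \<Longrightarrow> h (g0 z) = g z"
      using factor_through_surjection[OF G0(1) onto G(1) lX lZ lX] by auto
    note [simp] = hom_rules(1)[OF h(1) lX lX]
    have "h (snd X x) = snd X (h x)" if x: "x \<in> ?X" for x
    proof -
      obtain z where z: "z \<in> ?Z" "x = g0 z" using lift[OF x] by auto
      have "h (snd X (g0 z)) = g (snd Z z)" using z(1) h(2)[of "snd Z z"] G0(3)[OF z(1)] by simp
      also have "\<dots> = snd X (h (g0 z))" using z(1) h(2) G(3) by simp
      finally show ?thesis unfolding z(2) .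
    qed
    then have c: "restrict h ?X \<in> c1_homs K Q X X"
      using restrict_hom[OF h(1) lX] by (simp add: c1_homs_def)
    have "h ` ?X = (\<lambda>z. h (g0 z)) ` ?Z" unfolding onto[symmetric] image_image ..
    also have "\<dots> = ?X" using h(2) go by simp
    finally have "h ` ?X = ?X" .
    moreover have "finite ?X" using X by (simp add: diff_module_def fdD(2))
    ultimately have "bij_betw h ?X ?X"
      using finite_surj_inj[of ?X h] by (simp add: bij_betw_def)
    then have "restrict h ?X \<in> c1_auts K Q X" using c by (simp add: c1_auts_def bij_betw_restrict_eq)
    moreover have "g = compose ?Z (restrict h ?X) g0"
      by (rule extensionalityI[OF G(2)]) (simp_all add: compose_def h(2))
    ultimately show "g \<in> (\<lambda>\<alpha>. compose ?Z \<alpha> g0) ` c1_auts K Q X" by (metis (no_types, lifting) imageI)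
  qed
  then show ?thesis by (rule sym[OF bij_betw_same_card])
qed

lemma card_ses_pairs:
  assumes X: "diff_module X" and Y: "diff_module Y" and Z: "diff_module Z"
  shows "card (ses_pairs X Y Z) = card (snd ` ses_pairs X Y Z) * card (c1_auts K Q Y)"
    and "card (ses_pairs X Y Z) = card (fst ` ses_pairs X Y Z) * card (c1_auts K Q X)"
proof -
  let ?W = "ses_pairs X Y Z"
  have "?W \<subseteq> c1_homs K Q Y Z \<times> c1_homs K Q Z X" by (auto simp: ses_pairs_def)
  then have fin: "finite ?W" using finite_c1_homs X Y Z by (meson finite_SigmaI finite_subset)
  have f1: "card {v \<in> ?W. snd v = g} = card (c1_auts K Q Y)" if "g \<in> snd ` ?W" for g
  proof -
    from that obtain f0 where W: "f0 \<in> c1_homs K Q Y Z" "g \<in> c1_homs K Q Z X" "short_exact (fst Y) f0 (fst Z) g (fst X)"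
      by (auto simp: ses_pairs_def)
    let ?S = "{f \<in> c1_homs K Q Y Z. inj_on f (carrier (fst Y)) \<and> f ` carrier (fst Y) = f0 ` carrier (fst Y)}"
    have "{v \<in> ?W. snd v = g} = (\<lambda>f. (f, g)) ` ?S"
      using W by (auto simp: ses_pairs_def short_exact_def)
    then have "card {v \<in> ?W. snd v = g} = card ?S" by (simp add: card_image inj_on_def)
    then show ?thesis using card_monos_same_image[OF Y Z W(1)] W(3) by (simp add: short_exact_def)
  qed
  have f2: "card {v \<in> ?W. fst v = f} = card (c1_auts K Q X)" if "f \<in> fst ` ?W" for f
  proof -
    from that obtain g0 where W: "f \<in> c1_homs K Q Y Z" "g0 \<in> c1_homs K Q Z X" "short_exact (fst Y) f (fst Z) g0 (fst X)"
      by (auto simp: ses_pairs_def)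
    let ?S = "{g \<in> c1_homs K Q Z X. g ` carrier (fst Z) = carrier (fst X) \<and>
      {z \<in> carrier (fst Z). g z = \<zero>\<^bsub>fst X\<^esub>} = {z \<in> carrier (fst Z). g0 z = \<zero>\<^bsub>fst X\<^esub>}}"
    have "{v \<in> ?W. fst v = f} = (\<lambda>g. (f, g)) ` ?S"
      using W by (auto simp: ses_pairs_def short_exact_def)
    then have "card {v \<in> ?W. fst v = f} = card ?S" by (simp add: card_image inj_on_def)
    then show ?thesis using card_epis_same_kernel[OF X Z W(2)] W(3) by (simp add: short_exact_def)
  qed
  have "card ?W = (\<Sum>g \<in> snd ` ?W. card {v \<in> ?W. snd v = g})"
    using sum.image_gen[OF fin, of "\<lambda>_. 1::nat" snd] by simp
  then show "card ?W = card (snd ` ?W) * card (c1_auts K Q Y)" using f1 by simp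
  have "card ?W = (\<Sum>f \<in> fst ` ?W. card {v \<in> ?W. fst v = f})"
    using sum.image_gen[OF fin, of "\<lambda>_. 1::nat" fst] by simp
  then show "card ?W = card (fst ` ?W) * card (c1_auts K Q X)" using f2 by simp
qed

lemma diff_module_object: "c1_object K Q X \<Longrightarrow> diff_module X"
  by (simp add: c1_object_def diff_module_def projective_fd)

lemma c1_ses_eq:
  "c1_object K Q X \<Longrightarrow> c1_object K Q Y \<Longrightarrow> c1_object K Q Z \<Longrightarrow> c1_ses K Q X Y Z = ses_pairs X Y Z"
  by (auto simp: c1_ses_def ses_pairs_def)

lemma diff_module_stalk: "fd_module K Q M \<Longrightarrow> diff_module (stalk M)"
  by (simp add: diff_module_def stalk_def hom_zero fdD)

lemma stalk_homs:
  assumes "fd_module K Q M" "fd_module K Q N"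
  shows "c1_homs K Q (stalk M) (stalk N) = mod_homs A M N"
  using assms hom_rules(4)[OF _ fdD(1) fdD(1)] by (auto simp: c1_homs_def stalk_def mod_homs_def)

lemma stalk_auts: "fd_module K Q M \<Longrightarrow> c1_auts K Q (stalk M) = mod_auts A M"
  by (simp add: c1_auts_def mod_auts_def stalk_homs) (simp add: stalk_def)

lemma mod_ses_eq:
  assumes "fd_module K Q X" "fd_module K Q Y" "fd_module K Q Z"
  shows "mod_ses K Q X Y Z = ses_pairs (stalk X) (stalk Y) (stalk Z)"
  using assms by (simp add: mod_ses_def ses_pairs_def stalk_homs) (simp add: stalk_def)

text \<open>
  The sequences with a given epimorphism form a torsor under the automorphisms of the subobject, and dually;
  this cancels one factor of the denominator.
\<close>
lemma c1_hall_eq: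
  assumes X: "c1_object K Q X" and Y: "c1_object K Q Y" and Z: "c1_object K Q Z"
  shows "c1_hall K Q X Y Z = real (card (snd ` c1_ses K Q X Y Z)) / real (card (c1_auts K Q X))"
    and "c1_hall K Q X Y Z = real (card (fst ` c1_ses K Q X Y Z)) / real (card (c1_auts K Q Y))"
proof -
  note D = assms[THEN diff_module_object]
  have pos: "card (c1_auts K Q X) > 0" "card (c1_auts K Q Y) > 0"
    using card_c1_auts_pos[OF D(1)] card_c1_auts_pos[OF D(2)] by auto
  show "c1_hall K Q X Y Z = real (card (snd ` c1_ses K Q X Y Z)) / real (card (c1_auts K Q X))"
    unfolding c1_hall_def c1_ses_eq[OF assms] card_ses_pairs(1)[OF D] using pos by simp
  show "c1_hall K Q X Y Z = real (card (fst ` c1_ses K Q X Y Z)) / real (card (c1_auts K Q Y))"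
    unfolding c1_hall_def c1_ses_eq[OF assms] card_ses_pairs(2)[OF D] using pos by simp
qed

lemma mod_hall_eq:
  assumes X: "fd_module K Q X" and Y: "fd_module K Q Y" and Z: "fd_module K Q Z"
  shows "mod_hall K Q X Y Z = real (card (snd ` mod_ses K Q X Y Z)) / real (card (mod_auts A X))"
  unfolding mod_hall_def mod_ses_eq[OF assms] card_ses_pairs(1)[OF assms[THEN diff_module_stalk]]
  using card_c1_auts_pos[OF diff_module_stalk[OF X]] card_c1_auts_pos[OF diff_module_stalk[OF Y]]
  by (simp add: stalk_auts X Y)

end

section \<open>Chain maps between the complexes of two resolutions\<close>

text \<open>
  A chain map \<open>C\<^sub>M \<rightarrow> C\<^sub>N\<close> is upper triangular: its component \<open>P\<^sub>M \<rightarrow> \<Omega>\<^sub>N\<close> vanishes because \<open>\<delta>\<^sub>N\<close> is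
  injective.
\<close>
definition chain_map ::
  "('a, 'p, 'm) resolution \<Rightarrow> ('a, 'q, 'n) resolution \<Rightarrow> ('p \<Rightarrow> 'q) \<Rightarrow> ('p \<Rightarrow> 'q) \<Rightarrow> ('p \<Rightarrow> 'q)
     \<Rightarrow> ('p \<times> 'p \<Rightarrow> 'q \<times> 'q)" where
  "chain_map r s a b e = (\<lambda>v \<in> carrier (res_P r) \<times> carrier (res_Omega r).
     (a (fst v) \<oplus>\<^bsub>res_P s\<^esub> b (snd v), e (snd v)))"

text \<open>The cycles of \<open>C\<^sub>M\<close> are \<open>P\<^sub>M\<close> and its boundaries \<open>\<delta>(\<Omega>\<^sub>M)\<close>, so its homology is \<open>M\<close>.\<close>
definition homology_map ::
  "('a, 'm) module \<Rightarrow> ('a, 'p, 'm) resolution \<Rightarrow> ('a, 'q, 'n) resolution \<Rightarrow> ('p \<times> 'p \<Rightarrow> 'q \<times> 'q)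
     \<Rightarrow> ('m \<Rightarrow> 'n)" where
  "homology_map M r s g = (\<lambda>m \<in> carrier M.
     res_pi s (fst (g (inv_into (carrier (res_P r)) (res_pi r) m, \<zero>\<^bsub>res_Omega r\<^esub>))))"

lemma C_cplx_simps [simp]:
  "fst (C_cplx r) = direct_sum (res_P r) (res_Omega r)"
  "snd (C_cplx r) v = (res_delta r (snd v), \<zero>\<^bsub>res_Omega r\<^esub>)"
  by (simp_all add: C_cplx_def case_prod_unfold)

context finite_path_algebra
begin

lemma c1_object_C:
  assumes r: "minimal_resolution K Q M r" and M: "fd_module K Q M"
  shows "c1_object K Q (C_cplx r)"
proof -
  note R = resolutionD[OF r M]
  note [simp] = left_module_rules[OF R(4)] hom_rules[OF R(6,4,3)]
  have "(\<lambda>v. (res_delta r (snd v), \<zero>\<^bsub>res_Omega r\<^esub>)) \<in>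
      module_hom A (direct_sum (res_P r) (res_Omega r)) (direct_sum (res_P r) (res_Omega r))"
    by (intro hom_pair hom_comp[OF hom_snd R(6)] hom_zero R(4))
  then have "snd (C_cplx r) \<in> module_hom A (direct_sum (res_P r) (res_Omega r)) (direct_sum (res_P r) (res_Omega r))"
    by (rule hom_cong) (simp_all add: left_module_direct_sum R(3,4))
  then show ?thesis
    using projective_direct_sum[OF R(1,2)] by (simp add: c1_object_def)
qed

end

locale two_resolutions = finite_path_algebra K Q
  for K :: "'k ring" and Q :: "('v, 'e) pre_digraph" +
  fixes M :: "('v, 'e, 'k, 'm) pa_module" and r :: "('v \<times> 'e list \<Rightarrow> 'k, 'p, 'm) resolution"
    and N :: "('v, 'e, 'k, 'n) pa_module" and s :: "('v \<times> 'e list \<Rightarrow> 'k, 'q, 'n) resolution"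
  assumes fd_M: "fd_module K Q M" and res_M: "minimal_resolution K Q M r"
    and fd_N: "fd_module K Q N" and res_N: "minimal_resolution K Q N s"
begin

abbreviation (input) "P \<equiv> res_P r" abbreviation (input) "W \<equiv> res_Omega r"
abbreviation (input) "\<delta> \<equiv> res_delta r" abbreviation (input) "\<pi> \<equiv> res_pi r"
abbreviation (input) "P' \<equiv> res_P s" abbreviation (input) "W' \<equiv> res_Omega s"
abbreviation (input) "\<delta>' \<equiv> res_delta s" abbreviation (input) "\<pi>' \<equiv> res_pi s"

lemmas RM = resolutionD[OF res_M fd_M]
lemmas RN = resolutionD[OF res_N fd_N]

lemmas module_simps [simp] = left_module_rules[OF RM(3)] left_module_rules[OF RM(4)] left_module_rules[OF RM(5)]
  left_module_rules[OF RN(3)] left_module_rules[OF RN(4)] left_module_rules[OF RN(5)]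
lemmas hom_simps [simp] = hom_rules[OF RM(6,4,3)] hom_rules[OF RM(7,3,5)] RM(11,12)
  hom_rules[OF RN(6,4,3)] hom_rules[OF RN(7,3,5)] RN(11,12)

lemma delta_eq_iff:
  "\<lbrakk>w \<in> carrier W'; w' \<in> carrier W'\<rbrakk> \<Longrightarrow> \<delta>' w = \<delta>' w' \<longleftrightarrow> w = w'"
  using RN(8) by (meson inj_onD)

lemma lift_hom:
  assumes f: "f \<in> module_hom A M N"
  shows "\<exists>a \<in> module_hom A P P'. \<forall>p \<in> carrier P. \<pi>' (a p) = f (\<pi> p)"
proof (rule projective_lift[OF RM(1) projective_fd[OF RN(1)] fd_N RN(7)])
  show "(\<lambda>p. f (\<pi> p)) \<in> module_hom A P N" by (rule hom_comp[OF RM(7) f])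
  show "(\<lambda>p. f (\<pi> p)) ` carrier P \<subseteq> \<pi>' ` carrier P'"
    unfolding RN(9) using hom_rules(1)[OF f RM(5) RN(5)] by auto
qed

lemma syzygy_map:
  assumes a: "a \<in> module_hom A P P'" and zero: "\<And>w. w \<in> carrier W \<Longrightarrow> \<pi>' (a (\<delta> w)) = \<zero>\<^bsub>N\<^esub>"
  shows "\<exists>e \<in> module_hom A W W'. \<forall>w \<in> carrier W. \<delta>' (e w) = a (\<delta> w)"
proof (rule factor_through_injection[OF RN(6) RN(8) hom_comp[OF RM(6) a] RN(4,3) RM(4)])
  have "a (\<delta> w) \<in> \<delta>' ` carrier W'" if "w \<in> carrier W" for w
    using RN(10)[of "a (\<delta> w)"] zero[OF that] hom_rules(1)[OF a RM(3) RN(3)] that by auto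
  then show "(\<lambda>w. a (\<delta> w)) ` carrier W \<subseteq> \<delta>' ` carrier W'" by auto
qed

lemma lift_hom_syzygy:
  assumes f: "f \<in> module_hom A M N"
  obtains a e where "a \<in> module_hom A P P'" "e \<in> module_hom A W W'"
    "\<And>p. p \<in> carrier P \<Longrightarrow> \<pi>' (a p) = f (\<pi> p)" "\<And>w. w \<in> carrier W \<Longrightarrow> a (\<delta> w) = \<delta>' (e w)"
proof -
  obtain a where a: "a \<in> module_hom A P P'" "\<And>p. p \<in> carrier P \<Longrightarrow> \<pi>' (a p) = f (\<pi> p)"
    using lift_hom[OF f] by auto
  have "\<pi>' (a (\<delta> w)) = \<zero>\<^bsub>N\<^esub>" if "w \<in> carrier W" for w
    using that by (simp add: a(2) hom_rules(4)[OF f RM(5) RN(5)])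
  then obtain e where e: "e \<in> module_hom A W W'" "\<And>w. w \<in> carrier W \<Longrightarrow> \<delta>' (e w) = a (\<delta> w)"
    using syzygy_map[OF a(1)] by auto
  show thesis by (rule that[OF a(1) e(1) a(2)]) (simp_all add: e(2))
qed

lemma induced_hom:
  assumes a: "a \<in> module_hom A P P'" and zero: "\<And>w. w \<in> carrier W \<Longrightarrow> \<pi>' (a (\<delta> w)) = \<zero>\<^bsub>N\<^esub>"
  shows "\<exists>f \<in> mod_homs A M N. \<forall>p \<in> carrier P. f (\<pi> p) = \<pi>' (a p)"
proof -
  obtain f where f: "f \<in> module_hom A M N" "\<And>p. p \<in> carrier P \<Longrightarrow> f (\<pi> p) = \<pi>' (a p)"
  proof -
    have "\<pi>' (a p) = \<zero>\<^bsub>N\<^esub>" if "p \<in> carrier P" "\<pi> p = \<zero>\<^bsub>M\<^esub>" for p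
      using RM(10)[OF that(1)] that(2) zero by auto
    then show thesis
      using factor_through_surjection[OF RM(7,9) hom_comp[OF a RN(7)] RM(5,3) RN(5)] that by auto
  qed
  then show ?thesis by (intro bexI[OF _ restrict_hom[OF f(1) RM(5)]]) simp
qed

lemma chain_mapI:
  assumes a: "a \<in> module_hom A P P'" and b: "b \<in> module_hom A W P'" and e: "e \<in> module_hom A W W'"
    and comm: "\<And>w. w \<in> carrier W \<Longrightarrow> a (\<delta> w) = \<delta>' (e w)"
  shows "chain_map r s a b e \<in> c1_homs K Q (C_cplx r) (C_cplx s)"
proof -
  note [simp] = hom_rules[OF a RM(3) RN(3)] hom_rules[OF b RM(4) RN(3)] hom_rules[OF e RM(4) RN(4)]
  have "(\<lambda>v. (a (fst v) \<oplus>\<^bsub>P'\<^esub> b (snd v), e (snd v))) \<in> module_hom A (direct_sum P W) (direct_sum P' W')"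
    by (intro hom_pair hom_copair a b RM RN hom_comp[OF hom_snd e])
  then have "chain_map r s a b e \<in> mod_homs A (direct_sum P W) (direct_sum P' W')"
    using restrict_hom[OF _ left_module_direct_sum[OF RM(3,4)]] by (simp add: chain_map_def)
  then show ?thesis by (auto simp: c1_homs_def chain_map_def comm)
qed

text \<open>
  The matrix entries of \<open>g\<close>.  Applied to a cycle \<open>(p, 0)\<close>, compatibility with the differentials says that
  \<open>\<delta>\<close> kills the second component of \<open>g (p, 0)\<close>.
\<close>
lemma chain_mapE:
  assumes g: "g \<in> c1_homs K Q (C_cplx r) (C_cplx s)"
  obtains a b e where "a \<in> module_hom A P P'" "b \<in> module_hom A W P'" "e \<in> module_hom A W W'"
    "\<And>w. w \<in> carrier W \<Longrightarrow> a (\<delta> w) = \<delta>' (e w)" "g = chain_map r s a b e"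
proof -
  note lm = left_module_direct_sum[OF RM(3,4)] left_module_direct_sum[OF RN(3,4)]
  note G = c1_homsD[OF g, simplified]
  note Gr = hom_rules[OF G(1) lm, simplified]
  define a where "a p = fst (g (p, \<zero>\<^bsub>W\<^esub>))" for p
  define b where "b w = fst (g (\<zero>\<^bsub>P\<^esub>, w))" for w
  define e where "e w = snd (g (\<zero>\<^bsub>P\<^esub>, w))" for w
  have a: "a \<in> module_hom A P P'" and b: "b \<in> module_hom A W P'" and e: "e \<in> module_hom A W W'"
    unfolding a_def b_def e_def
    by (intro hom_comp[OF hom_comp[OF hom_inl G(1)] hom_fst] hom_comp[OF hom_comp[OF hom_inr G(1)] hom_fst]
        hom_comp[OF hom_comp[OF hom_inr G(1)] hom_snd] RM)+
  note [simp] = hom_rules[OF a RM(3) RN(3)] hom_rules[OF b RM(4) RN(3)] hom_rules[OF e RM(4) RN(4)]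
  have z: "snd (g (p, \<zero>\<^bsub>W\<^esub>)) = \<zero>\<^bsub>W'\<^esub>" if p: "p \<in> carrier P" for p
  proof -
    have "snd (g (p, \<zero>\<^bsub>W\<^esub>)) \<in> carrier W'" using Gr(1)[of "(p, \<zero>\<^bsub>W\<^esub>)"] p by (auto simp: mem_Times_iff)
    moreover have "\<delta>' (snd (g (p, \<zero>\<^bsub>W\<^esub>))) = \<zero>\<^bsub>P'\<^esub>"
      using G(3)[of "(p, \<zero>\<^bsub>W\<^esub>)"] p Gr(4) by simp
    ultimately show ?thesis by simp
  qed
  have comm: "a (\<delta> w) = \<delta>' (e w)" if "w \<in> carrier W" for w
    using G(3)[of "(\<zero>\<^bsub>P\<^esub>, w)"] that by (simp add: a_def e_def)
  have "g = chain_map r s a b e"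
  proof (rule extensionalityI[OF G(2)])
    fix v assume "v \<in> carrier P \<times> carrier W"
    then obtain p w where v: "v = (p, w)" "p \<in> carrier P" "w \<in> carrier W" by auto
    have "g v = g (p, \<zero>\<^bsub>W\<^esub>) \<oplus>\<^bsub>direct_sum P' W'\<^esub> g (\<zero>\<^bsub>P\<^esub>, w)"
      using Gr(2)[of "(p, \<zero>\<^bsub>W\<^esub>)" "(\<zero>\<^bsub>P\<^esub>, w)"] v by simp
    then show "g v = chain_map r s a b e v"
      using v z[OF v(2)] hom_rules(1)[OF e RM(4) RN(4) v(3)] by (simp add: chain_map_def a_def b_def e_def)
  qed (simp add: chain_map_def)
  then show thesis using that[OF a b e comm] by simp
qed

lemma homology_chain_map:
  assumes a: "a \<in> module_hom A P P'" and b: "b \<in> module_hom A W P'" and e: "e \<in> module_hom A W W'"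
    and comm: "\<And>w. w \<in> carrier W \<Longrightarrow> a (\<delta> w) = \<delta>' (e w)"
  shows "homology_map M r s (chain_map r s a b e) \<in> mod_homs A M N"
    and "\<And>p. p \<in> carrier P \<Longrightarrow> homology_map M r s (chain_map r s a b e) (\<pi> p) = \<pi>' (a p)"
proof -
  note [simp] = hom_rules[OF a RM(3) RN(3)] hom_rules[OF b RM(4) RN(3)] hom_rules[OF e RM(4) RN(4)]
  obtain f where f: "f \<in> mod_homs A M N" "\<And>p. p \<in> carrier P \<Longrightarrow> f (\<pi> p) = \<pi>' (a p)"
    using induced_hom[OF a] by (auto simp: comm)
  have "homology_map M r s (chain_map r s a b e) = f"
  proof (rule extensionalityI)
    show "f \<in> extensional (carrier M)" using f(1) by (simp add: mod_homs_def)
    fix m assume m: "m \<in> carrier M"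
    let ?p = "inv_into (carrier P) \<pi> m"
    have "?p \<in> carrier P" "\<pi> ?p = m" using m RM(9) by (auto intro: inv_into_into f_inv_into_f)
    then show "homology_map M r s (chain_map r s a b e) m = f m"
      using m f(2)[of ?p] by (simp add: homology_map_def chain_map_def)
  qed (simp add: homology_map_def)
  then show "homology_map M r s (chain_map r s a b e) \<in> mod_homs A M N"
    and "\<And>p. p \<in> carrier P \<Longrightarrow> homology_map M r s (chain_map r s a b e) (\<pi> p) = \<pi>' (a p)"
    using f by auto
qed

lemma homology_in: "g \<in> c1_homs K Q (C_cplx r) (C_cplx s) \<Longrightarrow> homology_map M r s g \<in> mod_homs A M N"
  by (elim chain_mapE) (auto intro: homology_chain_map(1))

lemma mod_homs_eqI:
  assumes "f \<in> mod_homs A M N" "f' \<in> mod_homs A M N" "\<And>p. p \<in> carrier P \<Longrightarrow> f (\<pi> p) = f' (\<pi> p)"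
  shows "f = f'"
proof (rule extensionalityI)
  fix m assume "m \<in> carrier M"
  then obtain p where "p \<in> carrier P" "m = \<pi> p" using RM(9) by auto
  then show "f m = f' m" using assms(3) by simp
qed (use assms in \<open>auto simp: mod_homs_def\<close>)

text \<open>
  The difference of two lifts maps into the kernel \<open>\<delta>(\<Omega>)\<close> of the cover, and \<open>\<delta>\<close> is injective.
\<close>
lemma lift_unique:
  assumes a: "a \<in> module_hom A P P'" and a0: "a0 \<in> module_hom A P P'"
    and eq: "\<And>p. p \<in> carrier P \<Longrightarrow> \<pi>' (a p) = \<pi>' (a0 p)"
  shows "\<exists>t \<in> module_hom A P W'. \<forall>p \<in> carrier P. a p = a0 p \<oplus>\<^bsub>P'\<^esub> \<delta>' (t p)"
proof -
  note [simp] = hom_rules[OF a RM(3) RN(3)] hom_rules[OF a0 RM(3) RN(3)]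
  have "a p \<ominus>\<^bsub>P'\<^esub> a0 p \<in> \<delta>' ` carrier W'" if p: "p \<in> carrier P" for p
  proof -
    have mem: "a p \<ominus>\<^bsub>P'\<^esub> a0 p \<in> carrier P'" using p by simp
    have "\<pi>' (a p \<ominus>\<^bsub>P'\<^esub> a0 p) = \<zero>\<^bsub>N\<^esub>" using p by (simp add: eq)
    then show ?thesis using RN(10)[OF mem] by auto
  qed
  then have im: "(\<lambda>p. a p \<ominus>\<^bsub>P'\<^esub> a0 p) ` carrier P \<subseteq> \<delta>' ` carrier W'" by auto
  obtain t where t: "t \<in> module_hom A P W'" "\<And>p. p \<in> carrier P \<Longrightarrow> \<delta>' (t p) = a p \<ominus>\<^bsub>P'\<^esub> a0 p"
    using factor_through_injection[OF RN(6,8) hom_minus[OF a a0 RM(3) RN(3)] RN(4,3) RM(3) im] by auto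
  have "a p = a0 p \<oplus>\<^bsub>P'\<^esub> \<delta>' (t p)" if p: "p \<in> carrier P" for p
    using p by (simp add: t(2) left_module_arith[OF RN(3)] left_module_cancel[OF RN(3)])
  then show ?thesis using t(1) by (intro bexI[of _ t]) auto
qed

text \<open>
  Fix a chain map with components \<open>a\<^sub>0\<close>, \<open>0\<close>, \<open>e\<^sub>0\<close> over \<open>f\<close>.  The others over \<open>f\<close> have components
  \<open>a\<^sub>0 + \<delta> t\<close>, \<open>b\<close>, \<open>e\<^sub>0 + t \<delta>\<close> with unique \<open>t: P\<^sub>M \<rightarrow> \<Omega>\<^sub>N\<close> and \<open>b: \<Omega>\<^sub>M \<rightarrow> P\<^sub>N\<close>.
\<close>
lemma card_homology_fibre:
  assumes f: "f \<in> mod_homs A M N"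
  shows "card {g \<in> c1_homs K Q (C_cplx r) (C_cplx s). homology_map M r s g = f} =
    card (mod_homs A P W') * card (mod_homs A W P')"
proof -
  let ?F = "{g \<in> c1_homs K Q (C_cplx r) (C_cplx s). homology_map M r s g = f}"
  have f': "f \<in> module_hom A M N" using f by (simp add: mod_homs_def)
  obtain a0 e0 where a0: "a0 \<in> module_hom A P P'" and e0: "e0 \<in> module_hom A W W'"
    and a0_lift: "\<And>p. p \<in> carrier P \<Longrightarrow> \<pi>' (a0 p) = f (\<pi> p)"
    and a0_e0: "\<And>w. w \<in> carrier W \<Longrightarrow> a0 (\<delta> w) = \<delta>' (e0 w)" by (rule lift_hom_syzygy[OF f']) (rule that)
  note [simp] = hom_rules[OF a0 RM(3) RN(3)] hom_rules[OF e0 RM(4) RN(4)] hom_rules[OF f' RM(5) RN(5)]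
  define \<Phi> where "\<Phi> = (\<lambda>(t, b). chain_map r s (\<lambda>p. a0 p \<oplus>\<^bsub>P'\<^esub> \<delta>' (t p)) b (\<lambda>w. e0 w \<oplus>\<^bsub>W'\<^esub> t (\<delta> w)))"
  have aH: "(\<lambda>p. a0 p \<oplus>\<^bsub>P'\<^esub> \<delta>' (t p)) \<in> module_hom A P P'"
    and eH: "(\<lambda>w. e0 w \<oplus>\<^bsub>W'\<^esub> t (\<delta> w)) \<in> module_hom A W W'"
    and cH: "\<And>w. w \<in> carrier W \<Longrightarrow> a0 (\<delta> w) \<oplus>\<^bsub>P'\<^esub> \<delta>' (t (\<delta> w)) = \<delta>' (e0 w \<oplus>\<^bsub>W'\<^esub> t (\<delta> w))"
    if t: "t \<in> module_hom A P W'" for t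
    using hom_add[OF a0 hom_comp[OF t RN(6)] RM(3) RN(3)] hom_add[OF e0 hom_comp[OF RM(6) t] RM(4) RN(4)]
      hom_rules(1)[OF t RM(3) RN(4)] by (simp_all add: a0_e0)
  have into: "\<Phi> (t, b) \<in> ?F" if t: "t \<in> module_hom A P W'" and b: "b \<in> module_hom A W P'" for t b
  proof -
    note [simp] = hom_rules(1)[OF t RM(3) RN(4)]
    have "homology_map M r s (\<Phi> (t, b)) = f"
      unfolding \<Phi>_def prod.case
      by (rule mod_homs_eqI[OF homology_chain_map(1)[OF aH[OF t] b eH[OF t] cH[OF t]] f])
        (simp_all add: homology_chain_map(2)[OF aH[OF t] b eH[OF t] cH[OF t]] a0_lift)
    then show ?thesis unfolding \<Phi>_def using chain_mapI[OF aH[OF t] b eH[OF t] cH[OF t]] by simp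
  qed
  have val: "\<Phi> (t, b) (p, w) = (a0 p \<oplus>\<^bsub>P'\<^esub> \<delta>' (t p) \<oplus>\<^bsub>P'\<^esub> b w, e0 w \<oplus>\<^bsub>W'\<^esub> t (\<delta> w))"
    if "p \<in> carrier P" "w \<in> carrier W" for t b p w
    using that by (simp add: \<Phi>_def chain_map_def)
  have "bij_betw \<Phi> (mod_homs A P W' \<times> mod_homs A W P') ?F"
    unfolding bij_betw_def
  proof (intro conjI equalityI subsetI)
    show "inj_on \<Phi> (mod_homs A P W' \<times> mod_homs A W P')"
    proof (rule inj_onI, clarify)
      fix t b t' b' assume "t \<in> mod_homs A P W'" "b \<in> mod_homs A W P'" "t' \<in> mod_homs A P W'" "b' \<in> mod_homs A W P'"
        and eq: "\<Phi> (t, b) = \<Phi> (t', b')"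
      then have H: "t \<in> module_hom A P W'" "t' \<in> module_hom A P W'" "b \<in> module_hom A W P'" "b' \<in> module_hom A W P'"
        and E: "t \<in> extensional (carrier P)" "t' \<in> extensional (carrier P)"
          "b \<in> extensional (carrier W)" "b' \<in> extensional (carrier W)" by (auto simp: mod_homs_def)
      note [simp] = hom_rules[OF H(1) RM(3) RN(4)] hom_rules[OF H(2) RM(3) RN(4)]
        hom_rules[OF H(3) RM(4) RN(3)] hom_rules[OF H(4) RM(4) RN(3)]
      have "t = t'"
      proof (rule extensionalityI[OF E(1,2)])
        fix p assume p: "p \<in> carrier P"
        have "a0 p \<oplus>\<^bsub>P'\<^esub> \<delta>' (t p) = a0 p \<oplus>\<^bsub>P'\<^esub> \<delta>' (t' p)"
          using fun_cong[OF eq, of "(p, \<zero>\<^bsub>W\<^esub>)"] p by (simp add: val)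
        then have "\<delta>' (t p) = \<delta>' (t' p)"
          using p left_module_move(4)[OF RN(3), of "\<delta>' (t p)" "\<delta>' (t' p)" "a0 p"]
          by (simp add: left_module_arith(2)[OF RN(3), of _ "a0 p"])
        then show "t p = t' p" using p by (simp add: delta_eq_iff)
      qed
      moreover have "b = b'"
      proof (rule extensionalityI[OF E(3,4)])
        fix w assume w: "w \<in> carrier W"
        then show "b w = b' w" using fun_cong[OF eq, of "(\<zero>\<^bsub>P\<^esub>, w)"] by (simp add: val)
      qed
      ultimately show "t = t' \<and> b = b'" ..
    qed
  next
    fix g assume "g \<in> \<Phi> ` (mod_homs A P W' \<times> mod_homs A W P')"
    then obtain t b where "t \<in> mod_homs A P W'" "b \<in> mod_homs A W P'" "g = \<Phi> (t, b)" by auto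
    then show "g \<in> ?F" using into[of t b] by (simp add: mod_homs_def)
  next
    fix g assume gF: "g \<in> ?F"
    then have gc: "g \<in> c1_homs K Q (C_cplx r) (C_cplx s)" by simp
    obtain a b e where g: "a \<in> module_hom A P P'" "b \<in> module_hom A W P'" "e \<in> module_hom A W W'"
      "\<And>w. w \<in> carrier W \<Longrightarrow> a (\<delta> w) = \<delta>' (e w)" "g = chain_map r s a b e" by (rule chain_mapE[OF gc]) (rule that)
    note [simp] = hom_rules[OF g(1) RM(3) RN(3)] hom_rules[OF g(2) RM(4) RN(3)] hom_rules[OF g(3) RM(4) RN(4)]
    have "\<pi>' (a p) = \<pi>' (a0 p)" if p: "p \<in> carrier P" for p
    proof -
      have "homology_map M r s g = f" using gF by simp
      then show ?thesis using homology_chain_map(2)[OF g(1-4) p] a0_lift[OF p] g(5) by simp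
    qed
    then obtain t where t: "t \<in> module_hom A P W'" "\<And>p. p \<in> carrier P \<Longrightarrow> a p = a0 p \<oplus>\<^bsub>P'\<^esub> \<delta>' (t p)"
      using lift_unique[OF g(1) a0] by auto
    note [simp] = hom_rules[OF t(1) RM(3) RN(4)]
    have e: "e w = e0 w \<oplus>\<^bsub>W'\<^esub> t (\<delta> w)" if w: "w \<in> carrier W" for w
    proof -
      have "\<delta>' (e w) = \<delta>' (e0 w \<oplus>\<^bsub>W'\<^esub> t (\<delta> w))"
        using w g(4)[OF w, symmetric] t(2)[of "\<delta> w"] by (simp add: a0_e0)
      moreover have "e w \<in> carrier W'" "e0 w \<oplus>\<^bsub>W'\<^esub> t (\<delta> w) \<in> carrier W'" using w by simp_all
      ultimately show ?thesis using delta_eq_iff by blast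
    qed
    have "g = \<Phi> (restrict t (carrier P), restrict b (carrier W))"
    proof (rule extensionalityI[of _ "carrier P \<times> carrier W"])
      fix v assume "v \<in> carrier P \<times> carrier W"
      then show "g v = \<Phi> (restrict t (carrier P), restrict b (carrier W)) v"
        by (auto simp: val g(5) chain_map_def t(2) e)
    qed (simp_all add: g(5) chain_map_def \<Phi>_def)
    moreover have "(restrict t (carrier P), restrict b (carrier W)) \<in> mod_homs A P W' \<times> mod_homs A W P'"
      using restrict_hom[OF t(1) RM(3)] restrict_hom[OF g(2) RM(4)] by simp
    ultimately show "g \<in> \<Phi> ` (mod_homs A P W' \<times> mod_homs A W P')" by (metis imageI)
  qed
  from sym[OF bij_betw_same_card[OF this]] show ?thesis by (simp add: card_cartesian_product)
qed

lemma card_homology_preimage: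
  assumes S: "S \<subseteq> mod_homs A M N"
  shows "card {g \<in> c1_homs K Q (C_cplx r) (C_cplx s). homology_map M r s g \<in> S} =
    card S * (card (mod_homs A P W') * card (mod_homs A W P'))"
proof -
  let ?G = "{g \<in> c1_homs K Q (C_cplx r) (C_cplx s). homology_map M r s g \<in> S}"
  have finS: "finite S" using finite_homs[OF fd_M fd_N] S by (rule rev_finite_subset)
  have "finite ?G"
    using finite_c1_homs[OF diff_module_object[OF c1_object_C[OF res_M fd_M]]
        diff_module_object[OF c1_object_C[OF res_N fd_N]]] by simp
  moreover have "(\<lambda>g. homology_map M r s g) ` ?G \<subseteq> S" by auto
  ultimately have "card ?G = (\<Sum>f \<in> S. card {g \<in> ?G. homology_map M r s g = f})"
    using sum.group[of ?G S "homology_map M r s" "\<lambda>_. 1::nat"] finS by simp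
  also have "\<dots> = (\<Sum>f \<in> S. card (mod_homs A P W') * card (mod_homs A W P'))"
  proof (rule sum.cong[OF refl])
    fix f assume f: "f \<in> S"
    have "{g \<in> ?G. homology_map M r s g = f} = {g \<in> c1_homs K Q (C_cplx r) (C_cplx s). homology_map M r s g = f}"
      using f by auto
    then show "card {g \<in> ?G. homology_map M r s g = f} = card (mod_homs A P W') * card (mod_homs A W P')"
      using card_homology_fibre f S by auto
  qed
  finally show ?thesis by simp
qed

end

context finite_path_algebra
begin

text \<open>
  By minimality a chain endomorphism is bijective if and only if the induced endomorphism of \<open>M\<close> is, so that
  the automorphisms are the full preimage of those of \<open>M\<close>.
\<close>
lemma card_c1_auts_C:
  assumes r: "minimal_resolution K Q M r" and M: "fd_module K Q M"
  shows "card (c1_auts K Q (C_cplx r)) = card (mod_auts A M) *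
    (card (mod_homs A (res_P r) (res_Omega r)) * card (mod_homs A (res_Omega r) (res_P r)))"
proof -
  interpret two_resolutions K Q M r M r by unfold_locales fact+
  have fin: "finite (carrier P)" "finite (carrier W)" "finite (carrier M)"
    using projective_fd[OF RM(1)] projective_fd[OF RM(2)] M by (auto dest: fdD(2))
  have "g \<in> c1_auts K Q (C_cplx r) \<longleftrightarrow> homology_map M r r g \<in> mod_auts A M"
    if gc: "g \<in> c1_homs K Q (C_cplx r) (C_cplx r)" for g
  proof -
    obtain a b e where g: "a \<in> module_hom A P P" "b \<in> module_hom A W P" "e \<in> module_hom A W W"
      "\<And>w. w \<in> carrier W \<Longrightarrow> a (\<delta> w) = \<delta> (e w)" "g = chain_map r r a b e" by (rule chain_mapE[OF gc]) (rule that)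
    note [simp] = hom_rules[OF g(1) RM(3) RM(3)] hom_rules[OF g(2) RM(4) RM(3)] hom_rules[OF g(3) RM(4) RM(4)]
    let ?f = "homology_map M r r g"
    have f: "?f \<in> module_hom A M M" using homology_in[OF gc] by (simp add: mod_homs_def)
    have fp: "?f (\<pi> p) = \<pi> (a p)" if "p \<in> carrier P" for p
      using homology_chain_map(2)[OF g(1-4) that] g(5) by simp
    have gv: "g (p, w) = (a p \<oplus>\<^bsub>P\<^esub> b w, e w)" if "p \<in> carrier P" "w \<in> carrier W" for p w
      using that by (simp add: g(5) chain_map_def)
    have lm: "left_module A (direct_sum P W)" by (rule left_module_direct_sum[OF RM(3,4)])
    have gh: "g \<in> module_hom A (direct_sum P W) (direct_sum P W)" using c1_homsD(1)[OF gc] by simp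
    have "bij_betw g (carrier P \<times> carrier W) (carrier P \<times> carrier W) \<longleftrightarrow> bij_betw ?f (carrier M) (carrier M)"
    proof
      assume bij: "bij_betw g (carrier P \<times> carrier W) (carrier P \<times> carrier W)"
      have onto: "\<exists>p \<in> carrier P. \<exists>w \<in> carrier W. a p \<oplus>\<^bsub>P\<^esub> b w = p' \<and> e w = w'"
        if "p' \<in> carrier P" "w' \<in> carrier W" for p' w'
      proof -
        have "(p', w') \<in> g ` (carrier P \<times> carrier W)" using bij that by (simp add: bij_betw_def)
        then obtain p w where "p \<in> carrier P" "w \<in> carrier W" "g (p, w) = (p', w')" by auto
        then show ?thesis using gv[of p w] by auto
      qed
      have "carrier W \<subseteq> e ` carrier W"
      proof
        fix w' assume "w' \<in> carrier W"
        then show "w' \<in> e ` carrier W" using onto[of "\<zero>\<^bsub>P\<^esub>" w'] by auto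
      qed
      then have e_inj: "inj_on e (carrier W)" by (rule finite_surj_inj[OF fin(2)])
      have "carrier M \<subseteq> ?f ` carrier M"
      proof
        fix m assume "m \<in> carrier M"
        then obtain p' where p': "p' \<in> carrier P" "m = \<pi> p'" using RM(9) by auto
        obtain p w where pw: "p \<in> carrier P" "w \<in> carrier W" "a p \<oplus>\<^bsub>P\<^esub> b w = p'" "e w = \<zero>\<^bsub>W\<^esub>"
          using onto[OF p'(1), of "\<zero>\<^bsub>W\<^esub>"] by auto
        have "w = \<zero>\<^bsub>W\<^esub>" using inj_onD[OF e_inj, of w "\<zero>\<^bsub>W\<^esub>"] pw by simp
        then have "a p = p'" using pw by simp
        then show "m \<in> ?f ` carrier M" using fp[OF pw(1)] p' pw(1) by (intro image_eqI[of _ _ "\<pi> p"]) simp_all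
      qed
      moreover have "?f ` carrier M \<subseteq> carrier M" using hom_rules(1)[OF f RM(5) RM(5)] by auto
      ultimately show "bij_betw ?f (carrier M) (carrier M)"
        using finite_surj_inj[OF fin(3), of ?f] by (simp add: bij_betw_def)
    next
      assume bij: "bij_betw ?f (carrier M) (carrier M)"
      have "a ` carrier P = carrier P"
      proof (rule cover_onto[OF res_M fd_M g(1) RM(3)])
        fix m assume "m \<in> carrier M"
        then obtain m' where m': "m' \<in> carrier M" "m = ?f m'" using bij by (auto simp: bij_betw_def)
        obtain p where "p \<in> carrier P" "m' = \<pi> p" using m'(1) RM(9) by auto
        then show "\<exists>p \<in> carrier P. \<pi> (a p) = m" using fp m'(2) by (intro bexI[of _ p]) simp_all
      qed
      then have a_inj: "inj_on a (carrier P)" by (intro finite_surj_inj[OF fin(1)]) simp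
      have a0: "p = \<zero>\<^bsub>P\<^esub>" if "p \<in> carrier P" "a p = \<zero>\<^bsub>P\<^esub>" for p
        using inj_onD[OF a_inj, of p "\<zero>\<^bsub>P\<^esub>"] that by simp
      have "inj_on g (carrier (direct_sum P W))"
        unfolding inj_on_hom_iff[OF gh lm lm]
      proof (intro ballI impI)
        fix v assume v: "v \<in> carrier (direct_sum P W)" "g v = \<zero>\<^bsub>direct_sum P W\<^esub>"
        obtain p w where pw: "v = (p, w)" "p \<in> carrier P" "w \<in> carrier W" using v(1) by auto
        have eq: "a p \<oplus>\<^bsub>P\<^esub> b w = \<zero>\<^bsub>P\<^esub>" "e w = \<zero>\<^bsub>W\<^esub>" using v(2) gv[OF pw(2,3)] pw(1) by auto
        have "a (\<delta> w) = \<zero>\<^bsub>P\<^esub>" using g(4)[OF pw(3)] eq(2) by simp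
        then have "w = \<zero>\<^bsub>W\<^esub>" using a0[of "\<delta> w"] pw(3) by simp
        then have "a p = \<zero>\<^bsub>P\<^esub>" using eq(1) pw(2) by simp
        then show "v = \<zero>\<^bsub>direct_sum P W\<^esub>" using a0[OF pw(2)] \<open>w = \<zero>\<^bsub>W\<^esub>\<close> pw(1) by simp
      qed
      moreover have "g ` (carrier P \<times> carrier W) \<subseteq> carrier P \<times> carrier W"
        using hom_rules(1)[OF gh lm lm] by (intro image_subsetI) simp
      ultimately show "bij_betw g (carrier P \<times> carrier W) (carrier P \<times> carrier W)"
        using endo_inj_surj[of "carrier P \<times> carrier W" g] fin by (simp add: bij_betw_def)
    qed
    then show ?thesis using gc homology_in[OF gc] by (simp add: c1_auts_def mod_auts_def)
  qed
  then have "c1_auts K Q (C_cplx r) = {g \<in> c1_homs K Q (C_cplx r) (C_cplx r). homology_map M r r g \<in> mod_auts A M}"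
    by (auto simp: c1_auts_def)
  moreover have "mod_auts A M \<subseteq> mod_homs A M M" by (auto simp: mod_auts_def)
  ultimately show ?thesis using card_homology_preimage by simp
qed

end

section \<open>Counting homomorphisms along split sequences\<close>

context finite_path_algebra
begin

lemma mod_homsD:
  "f \<in> mod_homs A M N \<Longrightarrow> f \<in> module_hom A M N" "f \<in> mod_homs A M N \<Longrightarrow> f \<in> extensional (carrier M)"
  by (auto simp: mod_homs_def)

lemma card_homs_direct_sum_left:
  assumes X: "fd_module K Q X" and Y: "fd_module K Q Y" and T: "fd_module K Q T"
  shows "card (mod_homs A (direct_sum X Y) T) = card (mod_homs A X T) * card (mod_homs A Y T)"
proof -
  note lX = fdD(1)[OF X] and lY = fdD(1)[OF Y] and lT = fdD(1)[OF T]
  note lD = left_module_direct_sum[OF lX lY]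
  note [simp] = left_module_rules[OF lX] left_module_rules[OF lY] left_module_rules[OF lT]
  let ?F = "\<lambda>(f, g). \<lambda>v \<in> carrier X \<times> carrier Y. f (fst v) \<oplus>\<^bsub>T\<^esub> g (snd v)"
  have "bij_betw ?F (mod_homs A X T \<times> mod_homs A Y T) (mod_homs A (direct_sum X Y) T)"
    unfolding bij_betw_def
  proof (intro conjI equalityI subsetI)
    show "inj_on ?F (mod_homs A X T \<times> mod_homs A Y T)"
    proof (rule inj_onI, clarify)
      fix f g f' g' assume H: "f \<in> mod_homs A X T" "g \<in> mod_homs A Y T" "f' \<in> mod_homs A X T" "g' \<in> mod_homs A Y T"
        and eq: "(\<lambda>v \<in> carrier X \<times> carrier Y. f (fst v) \<oplus>\<^bsub>T\<^esub> g (snd v)) =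
          (\<lambda>v \<in> carrier X \<times> carrier Y. f' (fst v) \<oplus>\<^bsub>T\<^esub> g' (snd v))"
      note [simp] = hom_rules[OF mod_homsD(1)[OF H(1)] lX lT] hom_rules[OF mod_homsD(1)[OF H(2)] lY lT]
        hom_rules[OF mod_homsD(1)[OF H(3)] lX lT] hom_rules[OF mod_homsD(1)[OF H(4)] lY lT]
      have "f = f'"
      proof (rule extensionalityI[OF mod_homsD(2)[OF H(1)] mod_homsD(2)[OF H(3)]])
        show "f x = f' x" if "x \<in> carrier X" for x using fun_cong[OF eq, of "(x, \<zero>\<^bsub>Y\<^esub>)"] that by simp
      qed
      moreover have "g = g'"
      proof (rule extensionalityI[OF mod_homsD(2)[OF H(2)] mod_homsD(2)[OF H(4)]])
        show "g y = g' y" if "y \<in> carrier Y" for y using fun_cong[OF eq, of "(\<zero>\<^bsub>X\<^esub>, y)"] that by simp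
      qed
      ultimately show "f = f' \<and> g = g'" ..
    qed
  next
    fix h assume "h \<in> ?F ` (mod_homs A X T \<times> mod_homs A Y T)"
    then obtain f g where H: "f \<in> mod_homs A X T" "g \<in> mod_homs A Y T"
      and h: "h = (\<lambda>v \<in> carrier X \<times> carrier Y. f (fst v) \<oplus>\<^bsub>T\<^esub> g (snd v))" by auto
    show "h \<in> mod_homs A (direct_sum X Y) T"
      using restrict_hom[OF hom_copair[OF mod_homsD(1)[OF H(1)] mod_homsD(1)[OF H(2)] lX lY lT] lD] by (simp add: h)
  next
    fix h assume h: "h \<in> mod_homs A (direct_sum X Y) T"
    note hr = hom_rules[OF mod_homsD(1)[OF h] lD lT]
    let ?f = "\<lambda>x \<in> carrier X. h (x, \<zero>\<^bsub>Y\<^esub>)" and ?g = "\<lambda>y \<in> carrier Y. h (\<zero>\<^bsub>X\<^esub>, y)"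
    have "?f \<in> mod_homs A X T" "?g \<in> mod_homs A Y T"
      using restrict_hom[OF hom_comp[OF hom_inl[OF lY] mod_homsD(1)[OF h]] lX]
        restrict_hom[OF hom_comp[OF hom_inr[OF lX] mod_homsD(1)[OF h]] lY] by auto
    moreover have "h = ?F (?f, ?g)"
    proof (rule extensionalityI[of _ "carrier X \<times> carrier Y"])
      fix v assume "v \<in> carrier X \<times> carrier Y"
      then show "h v = ?F (?f, ?g) v" using hr(2)[of "(fst v, \<zero>\<^bsub>Y\<^esub>)" "(\<zero>\<^bsub>X\<^esub>, snd v)"] by auto
    qed (use mod_homsD(2)[OF h] in auto)
    ultimately show "h \<in> ?F ` (mod_homs A X T \<times> mod_homs A Y T)"
      by (intro image_eqI[where x = "(?f, ?g)"]) simp_all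
  qed
  from bij_betw_same_card[OF this] show ?thesis by (simp add: card_cartesian_product)
qed

lemma card_homs_direct_sum_right:
  assumes X: "fd_module K Q X" and Y: "fd_module K Q Y" and T: "fd_module K Q T"
  shows "card (mod_homs A T (direct_sum X Y)) = card (mod_homs A T X) * card (mod_homs A T Y)"
proof -
  note lX = fdD(1)[OF X] and lY = fdD(1)[OF Y] and lT = fdD(1)[OF T]
  let ?F = "\<lambda>(f, g). \<lambda>t \<in> carrier T. (f t, g t)"
  have "bij_betw ?F (mod_homs A T X \<times> mod_homs A T Y) (mod_homs A T (direct_sum X Y))"
    unfolding bij_betw_def
  proof (intro conjI equalityI subsetI)
    show "inj_on ?F (mod_homs A T X \<times> mod_homs A T Y)"
    proof (rule inj_onI, clarify)
      fix f g f' g' assume H: "f \<in> mod_homs A T X" "g \<in> mod_homs A T Y" "f' \<in> mod_homs A T X" "g' \<in> mod_homs A T Y"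
        and eq: "(\<lambda>t \<in> carrier T. (f t, g t)) = (\<lambda>t \<in> carrier T. (f' t, g' t))"
      have "f = f'"
      proof (rule extensionalityI[OF mod_homsD(2)[OF H(1)] mod_homsD(2)[OF H(3)]])
        show "f t = f' t" if "t \<in> carrier T" for t using fun_cong[OF eq, of t] that by simp
      qed
      moreover have "g = g'"
      proof (rule extensionalityI[OF mod_homsD(2)[OF H(2)] mod_homsD(2)[OF H(4)]])
        show "g t = g' t" if "t \<in> carrier T" for t using fun_cong[OF eq, of t] that by simp
      qed
      ultimately show "f = f' \<and> g = g'" ..
    qed
  next
    fix h assume "h \<in> ?F ` (mod_homs A T X \<times> mod_homs A T Y)"
    then obtain f g where H: "f \<in> mod_homs A T X" "g \<in> mod_homs A T Y"
      and h: "h = (\<lambda>t \<in> carrier T. (f t, g t))" by auto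
    show "h \<in> mod_homs A T (direct_sum X Y)"
      unfolding h by (rule restrict_hom[OF hom_pair[OF mod_homsD(1)[OF H(1)] mod_homsD(1)[OF H(2)]] lT])
  next
    fix h assume h: "h \<in> mod_homs A T (direct_sum X Y)"
    let ?f = "\<lambda>t \<in> carrier T. fst (h t)" and ?g = "\<lambda>t \<in> carrier T. snd (h t)"
    have "?f \<in> mod_homs A T X" "?g \<in> mod_homs A T Y"
      using restrict_hom[OF hom_comp[OF mod_homsD(1)[OF h] hom_fst] lT]
        restrict_hom[OF hom_comp[OF mod_homsD(1)[OF h] hom_snd] lT] by auto
    moreover have "h = ?F (?f, ?g)"
      by (rule extensionalityI[OF mod_homsD(2)[OF h]]) auto
    ultimately show "h \<in> ?F ` (mod_homs A T X \<times> mod_homs A T Y)"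
      by (intro image_eqI[where x = "(?f, ?g)"]) simp_all
  qed
  from bij_betw_same_card[OF this] show ?thesis by (simp add: card_cartesian_product)
qed

text \<open>
  Composition with an epimorphism or with a monomorphism is injective on homomorphisms.  For an isomorphism the inequalities
  in both directions give equality.
\<close>
lemma card_homs_mono:
  assumes X: "fd_module K Q X" and Y: "fd_module K Q Y" and T: "fd_module K Q T"
    and f: "f \<in> module_hom A X Y"
  shows "f ` carrier X = carrier Y \<Longrightarrow> card (mod_homs A Y T) \<le> card (mod_homs A X T)"
    and "inj_on f (carrier X) \<Longrightarrow> card (mod_homs A T X) \<le> card (mod_homs A T Y)"
proof -
  note lX = fdD(1)[OF X] and lY = fdD(1)[OF Y] and lT = fdD(1)[OF T]
  note [simp] = hom_rules(1)[OF f lX lY]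
  show "card (mod_homs A Y T) \<le> card (mod_homs A X T)" if onto: "f ` carrier X = carrier Y"
  proof (rule card_inj_on_le[OF _ _ finite_homs[OF X T]])
    show "(\<lambda>h. \<lambda>x \<in> carrier X. h (f x)) ` mod_homs A Y T \<subseteq> mod_homs A X T"
      by (intro image_subsetI restrict_hom[OF hom_comp[OF f mod_homsD(1)] lX])
    show "inj_on (\<lambda>h. \<lambda>x \<in> carrier X. h (f x)) (mod_homs A Y T)"
    proof (rule inj_onI)
      fix h h' assume H: "h \<in> mod_homs A Y T" "h' \<in> mod_homs A Y T"
        and eq: "(\<lambda>x \<in> carrier X. h (f x)) = (\<lambda>x \<in> carrier X. h' (f x))"
      show "h = h'"
      proof (rule extensionalityI[OF mod_homsD(2)[OF H(1)] mod_homsD(2)[OF H(2)]])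
        fix y assume "y \<in> carrier Y"
        then obtain x where "x \<in> carrier X" "y = f x" using onto by auto
        then show "h y = h' y" using fun_cong[OF eq, of x] by simp
      qed
    qed
  qed
  show "card (mod_homs A T X) \<le> card (mod_homs A T Y)" if inj: "inj_on f (carrier X)"
  proof (rule card_inj_on_le[OF _ _ finite_homs[OF T Y]])
    show "(\<lambda>h. \<lambda>t \<in> carrier T. f (h t)) ` mod_homs A T X \<subseteq> mod_homs A T Y"
      by (intro image_subsetI restrict_hom[OF hom_comp[OF mod_homsD(1) f] lT])
    show "inj_on (\<lambda>h. \<lambda>t \<in> carrier T. f (h t)) (mod_homs A T X)"
    proof (rule inj_onI)
      fix h h' assume H: "h \<in> mod_homs A T X" "h' \<in> mod_homs A T X"
        and eq: "(\<lambda>t \<in> carrier T. f (h t)) = (\<lambda>t \<in> carrier T. f (h' t))"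
      show "h = h'"
      proof (rule extensionalityI[OF mod_homsD(2)[OF H(1)] mod_homsD(2)[OF H(2)]])
        fix t assume t: "t \<in> carrier T"
        have "f (h t) = f (h' t)" using fun_cong[OF eq, of t] t by simp
        moreover have "h t \<in> carrier X" "h' t \<in> carrier X"
          using t hom_rules(1)[OF mod_homsD(1)[OF H(1)] lT lX] hom_rules(1)[OF mod_homsD(1)[OF H(2)] lT lX] by auto
        ultimately show "h t = h' t" using inj by (simp add: inj_on_def)
      qed
    qed
  qed
qed

lemma card_homs_iso:
  assumes X: "fd_module K Q X" and Y: "fd_module K Q Y" and T: "fd_module K Q T" and iso: "mod_iso A X Y"
  shows "card (mod_homs A X T) = card (mod_homs A Y T)" and "card (mod_homs A T X) = card (mod_homs A T Y)"
proof -
  from iso obtain f where f: "f \<in> module_hom A X Y" "f ` carrier X = carrier Y" "inj_on f (carrier X)"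
    by (auto simp: mod_iso_def bij_betw_def)
  from mod_iso_sym[OF iso fdD(1)[OF X] fdD(1)[OF Y]] obtain g where
    g: "g \<in> module_hom A Y X" "g ` carrier Y = carrier X" "inj_on g (carrier Y)"
    by (auto simp: mod_iso_def bij_betw_def)
  show "card (mod_homs A X T) = card (mod_homs A Y T)" "card (mod_homs A T X) = card (mod_homs A T Y)"
    using card_homs_mono[OF X Y T f(1)] card_homs_mono[OF Y X T g(1)] f g by (auto intro: antisym)
qed

text \<open>
  A lift \<open>t\<close> of the identity of the projective module \<open>X\<close> along \<open>g\<close> is a section.
\<close>
lemma short_exact_split:
  assumes Y: "fd_module K Q Y" and Z: "fd_module K Q Z" and X: "projective K Q X"
    and f: "f \<in> module_hom A Y Z" and g: "g \<in> module_hom A Z X" and ex: "short_exact Y f Z g X"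
  obtains t where "t \<in> module_hom A X Z" "\<And>x. x \<in> carrier X \<Longrightarrow> g (t x) = x"
    "bij_betw (\<lambda>v. t (fst v) \<oplus>\<^bsub>Z\<^esub> f (snd v)) (carrier X \<times> carrier Y) (carrier Z)"
    "mod_iso A (direct_sum X Y) Z"
proof -
  note fX = projective_fd[OF X]
  note lX = fdD(1)[OF fX] and lY = fdD(1)[OF Y] and lZ = fdD(1)[OF Z]
  note [simp] = left_module_rules[OF lX] left_module_rules[OF lY] left_module_rules[OF lZ]
    hom_rules[OF f lY lZ] hom_rules[OF g lZ lX]
  have onto: "g ` carrier Z = carrier X" and inj: "inj_on f (carrier Y)"
    and im: "f ` carrier Y = {z \<in> carrier Z. g z = \<zero>\<^bsub>X\<^esub>}" using ex by (auto simp: short_exact_def)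
  have gf: "g (f y) = \<zero>\<^bsub>X\<^esub>" if "y \<in> carrier Y" for y
  proof -
    have "f y \<in> {z \<in> carrier Z. g z = \<zero>\<^bsub>X\<^esub>}" unfolding im[symmetric] using that by simp
    then show ?thesis by simp
  qed
  obtain t where t: "t \<in> module_hom A X Z" "\<And>x. x \<in> carrier X \<Longrightarrow> g (t x) = x"
    using projective_lift[OF X Z fX g hom_id] onto by auto
  note [simp] = hom_rules[OF t(1) lX lZ]
  let ?k = "\<lambda>v. t (fst v) \<oplus>\<^bsub>Z\<^esub> f (snd v)"
  have k: "?k \<in> module_hom A (direct_sum X Y) Z" by (rule hom_copair[OF t(1) f lX lY lZ])
  have "?k ` (carrier X \<times> carrier Y) = carrier Z"
  proof (intro equalityI subsetI)
    fix z assume z: "z \<in> carrier Z"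
    have "z \<ominus>\<^bsub>Z\<^esub> t (g z) \<in> {z \<in> carrier Z. g z = \<zero>\<^bsub>X\<^esub>}" using z by (simp add: t(2))
    then obtain y where y: "y \<in> carrier Y" "z \<ominus>\<^bsub>Z\<^esub> t (g z) = f y" unfolding im[symmetric] by auto
    have "z = f y \<oplus>\<^bsub>Z\<^esub> t (g z)" using z y left_module_move(2)[OF lZ, of z "t (g z)" "f y"] by simp
    then have "z = ?k (g z, y)" using z y left_module_arith(2)[OF lZ, of "f y" "t (g z)"] by simp
    then show "z \<in> ?k ` (carrier X \<times> carrier Y)" using z y(1) by (intro image_eqI[of _ _ "(g z, y)"]) simp_all
  qed auto
  moreover have "inj_on ?k (carrier X \<times> carrier Y)"
  proof -
    have "\<forall>v \<in> carrier (direct_sum X Y). ?k v = \<zero>\<^bsub>Z\<^esub> \<longrightarrow> v = \<zero>\<^bsub>direct_sum X Y\<^esub>"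
    proof (intro ballI impI)
      fix v assume "v \<in> carrier (direct_sum X Y)" and z: "?k v = \<zero>\<^bsub>Z\<^esub>"
      then obtain x y where v: "v = (x, y)" "x \<in> carrier X" "y \<in> carrier Y" by auto
      have "g (?k v) = x" using v by (simp add: t(2) gf)
      then have "x = \<zero>\<^bsub>X\<^esub>" using z by simp
      then have "f y = f \<zero>\<^bsub>Y\<^esub>" using z v by simp
      then have "y = \<zero>\<^bsub>Y\<^esub>" using inj v(3) by (simp add: inj_on_def)
      then show "v = \<zero>\<^bsub>direct_sum X Y\<^esub>" using v \<open>x = \<zero>\<^bsub>X\<^esub>\<close> by simp
    qed
    then show ?thesis using inj_on_hom_iff[OF k left_module_direct_sum[OF lX lY] lZ] by simp
  qed
  ultimately have bij: "bij_betw ?k (carrier X \<times> carrier Y) (carrier Z)" by (simp add: bij_betw_def)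
  moreover have "mod_iso A (direct_sum X Y) Z" using k bij by (auto simp: mod_iso_def)
  ultimately show thesis using that[OF t] by blast
qed

lemma card_homs_split:
  assumes Y: "fd_module K Q Y" and Z: "fd_module K Q Z" and X: "projective K Q X"
    and f: "f \<in> module_hom A Y Z" and g: "g \<in> module_hom A Z X" and ex: "short_exact Y f Z g X"
    and T: "fd_module K Q T"
  shows "card (mod_homs A Z T) = card (mod_homs A X T) * card (mod_homs A Y T)"
    and "card (mod_homs A T Z) = card (mod_homs A T X) * card (mod_homs A T Y)"
proof -
  note fX = projective_fd[OF X]
  have iso: "mod_iso A (direct_sum X Y) Z" by (rule short_exact_split[OF assms(1-6)])
  show "card (mod_homs A Z T) = card (mod_homs A X T) * card (mod_homs A Y T)"
    and "card (mod_homs A T Z) = card (mod_homs A T X) * card (mod_homs A T Y)"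
    using card_homs_iso[OF fd_direct_sum[OF fX Y] Z T iso]
      card_homs_direct_sum_left[OF fX Y T] card_homs_direct_sum_right[OF fX Y T] by simp_all
qed

end

section \<open>Conflations of the complexes of three resolutions\<close>

text \<open>
  For \<open>X\<close> among \<open>L\<close>, \<open>M\<close>, \<open>N\<close> the resolution is written \<open>0 \<rightarrow> WX \<rightarrow> PX \<rightarrow> X \<rightarrow> 0\<close> with maps \<open>\<delta>X\<close> and \<open>\<pi>X\<close>, and
  \<open>DX\<close> collects its properties.
\<close>
locale three_resolutions = finite_path_algebra K Q
  for K :: "'k ring" and Q :: "('v, 'e) pre_digraph" +
  fixes L M N :: "('v, 'e, 'k, 'm) pa_module" and rL rM rN :: "('v \<times> 'e list \<Rightarrow> 'k, 'p, 'm) resolution"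
  assumes fd_L: "fd_module K Q L" and res_L: "minimal_resolution K Q L rL"
    and fd_M: "fd_module K Q M" and res_M: "minimal_resolution K Q M rM"
    and fd_N: "fd_module K Q N" and res_N: "minimal_resolution K Q N rN"
begin

sublocale NL: two_resolutions K Q N rN L rL by unfold_locales (fact fd_N res_N fd_L res_L)+
sublocale LM: two_resolutions K Q L rL M rM by unfold_locales (fact fd_M res_M fd_L res_L)+
sublocale MN: two_resolutions K Q M rM N rN by unfold_locales (fact fd_N res_N fd_M res_M)+

abbreviation (input) "PL \<equiv> res_P rL" abbreviation (input) "WL \<equiv> res_Omega rL"
abbreviation (input) "PM \<equiv> res_P rM" abbreviation (input) "WM \<equiv> res_Omega rM"
abbreviation (input) "PN \<equiv> res_P rN" abbreviation (input) "WN \<equiv> res_Omega rN"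
abbreviation (input) "\<delta>L \<equiv> res_delta rL" abbreviation (input) "\<pi>L \<equiv> res_pi rL"
abbreviation (input) "\<delta>M \<equiv> res_delta rM" abbreviation (input) "\<pi>M \<equiv> res_pi rM"
abbreviation (input) "\<delta>N \<equiv> res_delta rN" abbreviation (input) "\<pi>N \<equiv> res_pi rN"

lemmas DL = resolutionD[OF res_L fd_L]
lemmas DM = resolutionD[OF res_M fd_M]
lemmas DN = resolutionD[OF res_N fd_N]

lemmas obj = c1_object_C[OF res_M fd_M] c1_object_C[OF res_N fd_N] c1_object_C[OF res_L fd_L]

lemma fd_terms: "fd_module K Q PL" "fd_module K Q WL" "fd_module K Q PM" "fd_module K Q WM"
    "fd_module K Q PN" "fd_module K Q WN"
  by (rule projective_fd[OF DL(1)], rule projective_fd[OF DL(2)], rule projective_fd[OF DM(1)],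
      rule projective_fd[OF DM(2)], rule projective_fd[OF DN(1)], rule projective_fd[OF DN(2)])

lemma fin_terms: "finite (carrier PL)" "finite (carrier WL)" "finite (carrier PM)" "finite (carrier WM)"
    "finite (carrier PN)" "finite (carrier WN)" "finite (carrier L)" "finite (carrier M)" "finite (carrier N)"
  by (rule fdD(2)[OF fd_terms(1)], rule fdD(2)[OF fd_terms(2)], rule fdD(2)[OF fd_terms(3)],
      rule fdD(2)[OF fd_terms(4)], rule fdD(2)[OF fd_terms(5)], rule fdD(2)[OF fd_terms(6)],
      rule fdD(2)[OF fd_L], rule fdD(2)[OF fd_M], rule fdD(2)[OF fd_N])

end

text \<open>
  A conflation \<open>C\<^sub>N \<rightarrow> C\<^sub>L \<rightarrow> C\<^sub>M\<close> by matrix entries.  The entries \<open>a\<close> act on the summands \<open>P\<close>, the entries \<open>e\<close>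
  on the syzygies, and the entries \<open>b\<close> lead from a syzygy to a summand \<open>P\<close>.
\<close>
locale conflation = three_resolutions K Q L M N rL rM rN
  for K :: "'k ring" and Q :: "('v, 'e) pre_digraph"
    and L M N :: "('v, 'e, 'k, 'm) pa_module" and rL rM rN :: "('v \<times> 'e list \<Rightarrow> 'k, 'p, 'm) resolution" +
  fixes af bf ef ag bg eg :: "'p \<Rightarrow> 'p"
  assumes af: "af \<in> module_hom A (res_P rN) (res_P rL)" and bf: "bf \<in> module_hom A (res_Omega rN) (res_P rL)"
    and ef: "ef \<in> module_hom A (res_Omega rN) (res_Omega rL)"
    and ag: "ag \<in> module_hom A (res_P rL) (res_P rM)" and bg: "bg \<in> module_hom A (res_Omega rL) (res_P rM)"
    and eg: "eg \<in> module_hom A (res_Omega rL) (res_Omega rM)"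
    and comm_f: "\<And>w. w \<in> carrier (res_Omega rN) \<Longrightarrow> af (res_delta rN w) = res_delta rL (ef w)"
    and comm_g: "\<And>w. w \<in> carrier (res_Omega rL) \<Longrightarrow> ag (res_delta rL w) = res_delta rM (eg w)"
    and conf: "short_exact (direct_sum (res_P rN) (res_Omega rN)) (chain_map rN rL af bf ef)
      (direct_sum (res_P rL) (res_Omega rL)) (chain_map rL rM ag bg eg) (direct_sum (res_P rM) (res_Omega rM))"
begin

lemmas map_simps [simp] = hom_rules[OF af DN(3) DL(3)] hom_rules[OF bf DN(4) DL(3)] hom_rules[OF ef DN(4) DL(4)]
  hom_rules[OF ag DL(3) DM(3)] hom_rules[OF bg DL(4) DM(3)] hom_rules[OF eg DL(4) DM(4)]

lemma exact_inj:
  assumes n: "n \<in> carrier PN" and w: "w \<in> carrier WN" and eq: "af n \<oplus>\<^bsub>PL\<^esub> bf w = \<zero>\<^bsub>PL\<^esub>" "ef w = \<zero>\<^bsub>WL\<^esub>"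
  shows "n = \<zero>\<^bsub>PN\<^esub>" "w = \<zero>\<^bsub>WN\<^esub>"
proof -
  have "inj_on (chain_map rN rL af bf ef) (carrier PN \<times> carrier WN)" using conf by (simp add: short_exact_def)
  moreover have "chain_map rN rL af bf ef (n, w) = chain_map rN rL af bf ef (\<zero>\<^bsub>PN\<^esub>, \<zero>\<^bsub>WN\<^esub>)"
    using n w eq by (simp add: chain_map_def)
  ultimately have "(n, w) = (\<zero>\<^bsub>PN\<^esub>, \<zero>\<^bsub>WN\<^esub>)" by (rule inj_onD) (use n w in simp_all)
  then show "n = \<zero>\<^bsub>PN\<^esub>" "w = \<zero>\<^bsub>WN\<^esub>" by simp_all
qed

lemma exact_onto:
  assumes "p \<in> carrier PM" "w \<in> carrier WM"
  obtains p' v where "p' \<in> carrier PL" "v \<in> carrier WL" "ag p' \<oplus>\<^bsub>PM\<^esub> bg v = p" "eg v = w"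
proof -
  have "chain_map rL rM ag bg eg ` (carrier PL \<times> carrier WL) = carrier PM \<times> carrier WM"
    using conf by (simp add: short_exact_def)
  then have "(p, w) \<in> chain_map rL rM ag bg eg ` (carrier PL \<times> carrier WL)" using assms by simp
  then show thesis using that by (auto simp: chain_map_def)
qed

lemma exact_middle:
  assumes "p \<in> carrier PL" "v \<in> carrier WL"
  shows "ag p \<oplus>\<^bsub>PM\<^esub> bg v = \<zero>\<^bsub>PM\<^esub> \<and> eg v = \<zero>\<^bsub>WM\<^esub> \<longleftrightarrow>
    (\<exists>n \<in> carrier PN. \<exists>w \<in> carrier WN. p = af n \<oplus>\<^bsub>PL\<^esub> bf w \<and> v = ef w)"
proof -
  have "chain_map rN rL af bf ef ` (carrier PN \<times> carrier WN) =
      {z \<in> carrier PL \<times> carrier WL. chain_map rL rM ag bg eg z = (\<zero>\<^bsub>PM\<^esub>, \<zero>\<^bsub>WM\<^esub>)}"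
    using conf by (simp add: short_exact_def)
  then have "(p, v) \<in> chain_map rN rL af bf ef ` (carrier PN \<times> carrier WN) \<longleftrightarrow>
      chain_map rL rM ag bg eg (p, v) = (\<zero>\<^bsub>PM\<^esub>, \<zero>\<^bsub>WM\<^esub>)" using assms by simp
  moreover have "(p, v) \<in> chain_map rN rL af bf ef ` (carrier PN \<times> carrier WN) \<longleftrightarrow>
    (\<exists>n \<in> carrier PN. \<exists>w \<in> carrier WN. p = af n \<oplus>\<^bsub>PL\<^esub> bf w \<and> v = ef w)"
    by (auto simp: chain_map_def image_iff)
  ultimately show ?thesis using assms by (simp add: chain_map_def)
qed

lemma gf_zero:
  shows "n \<in> carrier PN \<Longrightarrow> ag (af n) = \<zero>\<^bsub>PM\<^esub>"
    and "w \<in> carrier WN \<Longrightarrow> ag (bf w) \<oplus>\<^bsub>PM\<^esub> bg (ef w) = \<zero>\<^bsub>PM\<^esub>"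
    and "w \<in> carrier WN \<Longrightarrow> eg (ef w) = \<zero>\<^bsub>WM\<^esub>"
proof -
  have *: "ag (af n \<oplus>\<^bsub>PL\<^esub> bf w) \<oplus>\<^bsub>PM\<^esub> bg (ef w) = \<zero>\<^bsub>PM\<^esub> \<and> eg (ef w) = \<zero>\<^bsub>WM\<^esub>"
    if "n \<in> carrier PN" "w \<in> carrier WN" for n w
  proof (rule exact_middle[THEN iffD2])
    show "\<exists>n' \<in> carrier PN. \<exists>w' \<in> carrier WN. af n \<oplus>\<^bsub>PL\<^esub> bf w = af n' \<oplus>\<^bsub>PL\<^esub> bf w' \<and> ef w = ef w'"
      by (intro bexI[OF _ that(1)] bexI[OF _ that(2)] conjI refl)
  qed (use that in simp_all)
  show "n \<in> carrier PN \<Longrightarrow> ag (af n) = \<zero>\<^bsub>PM\<^esub>" using *[of n "\<zero>\<^bsub>WN\<^esub>"] by simp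
  show "w \<in> carrier WN \<Longrightarrow> ag (bf w) \<oplus>\<^bsub>PM\<^esub> bg (ef w) = \<zero>\<^bsub>PM\<^esub>"
    and "w \<in> carrier WN \<Longrightarrow> eg (ef w) = \<zero>\<^bsub>WM\<^esub>" using *[of "\<zero>\<^bsub>PN\<^esub>" w] by simp_all
qed

lemma af_zero: "n \<in> carrier PN \<Longrightarrow> af n = \<zero>\<^bsub>PL\<^esub> \<Longrightarrow> n = \<zero>\<^bsub>PN\<^esub>"
  using exact_inj(1)[of n "\<zero>\<^bsub>WN\<^esub>"] by simp

text \<open>If \<open>ef w = 0\<close> then \<open>f\<close> kills the boundary \<open>\<delta>\<^sub>N w\<close>.\<close>
lemma ef_zero: assumes w: "w \<in> carrier WN" and z: "ef w = \<zero>\<^bsub>WL\<^esub>" shows "w = \<zero>\<^bsub>WN\<^esub>"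
proof -
  have "af (\<delta>N w) = \<zero>\<^bsub>PL\<^esub>" using comm_f[OF w] z by simp
  then show ?thesis using af_zero[of "\<delta>N w"] w by simp
qed

lemma af_inj: "inj_on af (carrier PN)"
  using af_zero unfolding inj_on_hom_iff[OF af DN(3) DL(3)] by blast

lemma ef_inj: "inj_on ef (carrier WN)"
  using ef_zero unfolding inj_on_hom_iff[OF ef DN(4) DL(4)] by blast

lemma eg_onto: "eg ` carrier WL = carrier WM"
proof (intro equalityI subsetI)
  fix w assume w: "w \<in> carrier WM"
  obtain p v where "p \<in> carrier PL" "v \<in> carrier WL" "eg v = w"
    by (rule exact_onto[of "\<zero>\<^bsub>PM\<^esub>" w]) (use w that in simp_all)
  then show "w \<in> eg ` carrier WL" by auto
qed auto

lemma cycle_kernel: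
  assumes p: "p \<in> carrier PL" and z: "ag p = \<zero>\<^bsub>PM\<^esub>"
  shows "\<exists>n \<in> carrier PN. p = af n"
proof -
  have "ag p \<oplus>\<^bsub>PM\<^esub> bg \<zero>\<^bsub>WL\<^esub> = \<zero>\<^bsub>PM\<^esub> \<and> eg \<zero>\<^bsub>WL\<^esub> = \<zero>\<^bsub>WM\<^esub>" using z by simp
  then obtain n w where nw: "n \<in> carrier PN" "w \<in> carrier WN" "p = af n \<oplus>\<^bsub>PL\<^esub> bf w" "\<zero>\<^bsub>WL\<^esub> = ef w"
    using exact_middle[OF p, of "\<zero>\<^bsub>WL\<^esub>"] by auto
  then have "w = \<zero>\<^bsub>WN\<^esub>" using ef_zero[of w] by simp
  then show ?thesis using nw by auto
qed

text \<open>
  Lift the cycles of \<open>C\<^sub>M\<close> to \<open>C\<^sub>L\<close> by a homomorphism \<open>(s\<^sub>1, s\<^sub>2)\<close>.  The boundary \<open>\<delta>\<^sub>L s\<^sub>2\<close> then lies in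
  \<open>f(P\<^sub>N)\<close>; as a map \<open>a: P\<^sub>M \<rightarrow> P\<^sub>N\<close> it induces the connecting homomorphism \<open>M \<rightarrow> N\<close>.
\<close>
lemma cycle_section:
  obtains s1 s2 a where "s1 \<in> module_hom A PM PL" "s2 \<in> module_hom A PM WL" "a \<in> module_hom A PM PN"
    "\<And>p. p \<in> carrier PM \<Longrightarrow> ag (s1 p) \<oplus>\<^bsub>PM\<^esub> bg (s2 p) = p"
    "\<And>p. p \<in> carrier PM \<Longrightarrow> eg (s2 p) = \<zero>\<^bsub>WM\<^esub>"
    "\<And>p. p \<in> carrier PM \<Longrightarrow> af (a p) = \<delta>L (s2 p)"
proof -
  let ?g = "\<lambda>v. (ag (fst v) \<oplus>\<^bsub>PM\<^esub> bg (snd v), eg (snd v))"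
  have g: "?g \<in> module_hom A (direct_sum PL WL) (direct_sum PM WM)"
    by (intro hom_pair hom_copair ag bg DL DM hom_comp[OF hom_snd eg])
  have im: "(\<lambda>p. (p, \<zero>\<^bsub>WM\<^esub>)) ` carrier PM \<subseteq> ?g ` carrier (direct_sum PL WL)"
  proof (rule image_subsetI)
    fix p assume p: "p \<in> carrier PM"
    obtain p' v where "p' \<in> carrier PL" "v \<in> carrier WL" "ag p' \<oplus>\<^bsub>PM\<^esub> bg v = p" "eg v = \<zero>\<^bsub>WM\<^esub>"
      by (rule exact_onto[of p "\<zero>\<^bsub>WM\<^esub>"]) (use p that in simp_all)
    then show "(p, \<zero>\<^bsub>WM\<^esub>) \<in> ?g ` carrier (direct_sum PL WL)" by (intro image_eqI[of _ _ "(p', v)"]) simp_all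
  qed
  obtain h where h: "h \<in> module_hom A PM (direct_sum PL WL)" "\<And>p. p \<in> carrier PM \<Longrightarrow> ?g (h p) = (p, \<zero>\<^bsub>WM\<^esub>)"
    using projective_lift[OF DM(1) fd_direct_sum[OF fd_terms(1,2)] fd_direct_sum[OF fd_terms(3,4)] g
        hom_inl[OF DM(4)] im] by auto
  define s1 s2 where "s1 p = fst (h p)" and "s2 p = snd (h p)" for p
  have s1: "s1 \<in> module_hom A PM PL" and s2: "s2 \<in> module_hom A PM WL"
    unfolding s1_def s2_def by (rule hom_comp[OF h(1) hom_fst], rule hom_comp[OF h(1) hom_snd])
  note [simp] = hom_rules[OF s1 DM(3) DL(3)] hom_rules[OF s2 DM(3) DL(4)]
  have sec: "ag (s1 p) \<oplus>\<^bsub>PM\<^esub> bg (s2 p) = p" "eg (s2 p) = \<zero>\<^bsub>WM\<^esub>" if "p \<in> carrier PM" for p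
    using h(2)[OF that] by (simp_all add: s1_def s2_def)
  have "\<delta>L (s2 p) \<in> af ` carrier PN" if p: "p \<in> carrier PM" for p
    using cycle_kernel[of "\<delta>L (s2 p)"] p by (auto simp: comm_g sec(2))
  then have im2: "(\<lambda>p. \<delta>L (s2 p)) ` carrier PM \<subseteq> af ` carrier PN" by auto
  obtain a where a: "a \<in> module_hom A PM PN" "\<And>p. p \<in> carrier PM \<Longrightarrow> af (a p) = \<delta>L (s2 p)"
    using factor_through_injection[OF af af_inj hom_comp[OF s2 DL(6)] DN(3) DL(3) DM(3) im2] by auto
  show thesis by (rule that[OF s1 s2 a(1) sec a(2)])
qed

text \<open>With vanishing connecting homomorphism every cycle of \<open>C\<^sub>M\<close> lifts to a cycle of \<open>C\<^sub>L\<close>.\<close>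
lemma cycles_exact:
  assumes zero: "\<forall>h \<in> module_hom A M N. \<forall>m \<in> carrier M. h m = \<zero>\<^bsub>N\<^esub>"
  shows "short_exact PN af PL ag PM"
proof -
  obtain s1 s2 a where s: "s1 \<in> module_hom A PM PL" "s2 \<in> module_hom A PM WL" "a \<in> module_hom A PM PN"
    and sec: "\<And>p. p \<in> carrier PM \<Longrightarrow> ag (s1 p) \<oplus>\<^bsub>PM\<^esub> bg (s2 p) = p"
      "\<And>p. p \<in> carrier PM \<Longrightarrow> eg (s2 p) = \<zero>\<^bsub>WM\<^esub>" "\<And>p. p \<in> carrier PM \<Longrightarrow> af (a p) = \<delta>L (s2 p)"
    by (rule cycle_section) (rule that)
  note [simp] = hom_rules[OF s(1) DM(3) DL(3)] hom_rules[OF s(2) DM(3) DL(4)] hom_rules[OF s(3) DM(3) DN(3)]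
  have "\<pi>N (a (\<delta>M w)) = \<zero>\<^bsub>N\<^esub>" if w: "w \<in> carrier WM" for w
  proof -
    obtain t1 t2 where t: "t1 \<in> carrier PL" "t2 \<in> carrier WL" "ag t1 \<oplus>\<^bsub>PM\<^esub> bg t2 = \<zero>\<^bsub>PM\<^esub>" "eg t2 = w"
      by (rule exact_onto[of "\<zero>\<^bsub>PM\<^esub>" w]) (use w that in simp_all)
    have "ag (s1 (\<delta>M w) \<ominus>\<^bsub>PL\<^esub> \<delta>L t2) \<oplus>\<^bsub>PM\<^esub> bg (s2 (\<delta>M w)) =
        (ag (s1 (\<delta>M w)) \<oplus>\<^bsub>PM\<^esub> bg (s2 (\<delta>M w))) \<ominus>\<^bsub>PM\<^esub> \<delta>M w"
      using w t by (simp add: comm_g left_module_arith(1-4)[OF DM(3)])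
    also have "\<dots> = \<zero>\<^bsub>PM\<^esub>" using w by (simp add: sec(1))
    finally obtain n v where "n \<in> carrier PN" "v \<in> carrier WN" "s2 (\<delta>M w) = ef v"
      using exact_middle[of "s1 (\<delta>M w) \<ominus>\<^bsub>PL\<^esub> \<delta>L t2" "s2 (\<delta>M w)"] w t sec(2)[of "\<delta>M w"] by auto
    then have "af (a (\<delta>M w)) = af (\<delta>N v)" using w by (simp add: sec(3) comm_f)
    then have "a (\<delta>M w) = \<delta>N v" using af_inj \<open>v \<in> carrier WN\<close> w by (simp add: inj_on_def)
    then show ?thesis using \<open>v \<in> carrier WN\<close> by simp
  qed
  then obtain \<phi> where \<phi>: "\<phi> \<in> mod_homs A M N" "\<And>p. p \<in> carrier PM \<Longrightarrow> \<phi> (\<pi>M p) = \<pi>N (a p)"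
    using MN.induced_hom[OF s(3)] by auto
  have "p \<in> ag ` carrier PL" if p: "p \<in> carrier PM" for p
  proof -
    have "\<pi>N (a p) = \<zero>\<^bsub>N\<^esub>" using \<phi>(2)[OF p] bspec[OF bspec[OF zero mod_homsD(1)[OF \<phi>(1)]], of "\<pi>M p"] p by simp
    then obtain w where w: "w \<in> carrier WN" "a p = \<delta>N w" using DN(10)[of "a p"] p by auto
    have "\<delta>L (s2 p) = \<delta>L (ef w)" using sec(3)[OF p] w comm_f by simp
    then have s2: "s2 p = ef w" using NL.delta_eq_iff[of "s2 p" "ef w"] p w by simp
    have "bg (ef w) = \<ominus>\<^bsub>PM\<^esub> ag (bf w)"
      using gf_zero(2)[OF w(1)] left_module_move(3)[OF DM(3), of "bg (ef w)" "ag (bf w)"] w(1)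
        left_module_arith(2)[OF DM(3), of "bg (ef w)" "ag (bf w)"] by simp
    then have "p = ag (s1 p \<ominus>\<^bsub>PL\<^esub> bf w)"
      using sec(1)[OF p] p w s2 by (simp add: left_module_arith(4)[OF DM(3)])
    then show ?thesis using p w by (intro image_eqI[of _ _ "s1 p \<ominus>\<^bsub>PL\<^esub> bf w"]) simp_all
  qed
  then have "ag ` carrier PL = carrier PM" by auto
  moreover have "af ` carrier PN = {p \<in> carrier PL. ag p = \<zero>\<^bsub>PM\<^esub>}"
  proof (intro equalityI subsetI)
    fix p assume "p \<in> af ` carrier PN"
    then show "p \<in> {p \<in> carrier PL. ag p = \<zero>\<^bsub>PM\<^esub>}" using gf_zero(1) by auto
  next
    fix p assume "p \<in> {p \<in> carrier PL. ag p = \<zero>\<^bsub>PM\<^esub>}"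
    then show "p \<in> af ` carrier PN" using cycle_kernel[of p] by auto
  qed
  ultimately show ?thesis using af_inj by (simp add: short_exact_def)
qed

lemma card_conflation:
  "card (carrier PL) * card (carrier WL) = (card (carrier PN) * card (carrier WN)) * (card (carrier PM) * card (carrier WM))"
proof -
  note lN = left_module_direct_sum[OF DN(3,4)] and lL = left_module_direct_sum[OF DL(3,4)]
    and lM = left_module_direct_sum[OF DM(3,4)]
  have "chain_map rN rL af bf ef \<in> module_hom A (direct_sum PN WN) (direct_sum PL WL)"
    using c1_homsD(1)[OF NL.chain_mapI[OF af bf ef comm_f]] by simp
  moreover have "chain_map rL rM ag bg eg \<in> module_hom A (direct_sum PL WL) (direct_sum PM WM)"
    using c1_homsD(1)[OF LM.chain_mapI[OF ag bg eg comm_g]] by simp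
  ultimately show ?thesis
    using card_short_exact[OF _ _ lL lM _ conf] fin_terms by (simp add: card_cartesian_product)
qed

lemma syzygies_exact:
  assumes P: "short_exact PN af PL ag PM"
  shows "short_exact WN ef WL eg WM"
proof (rule short_exactI_card[OF ef eg DN(4) DL(4) DM(4) fin_terms(2) ef_inj eg_onto gf_zero(3)])
  have "card (carrier PL) = card (carrier PN) * card (carrier PM)"
    by (rule card_short_exact[OF af ag DL(3) DM(3) fin_terms(1) P])
  then show "card (carrier WL) = card (carrier WN) * card (carrier WM)"
    using card_conflation card_carrier_pos[OF DN(3) fin_terms(5)] card_carrier_pos[OF DM(3) fin_terms(3)] by simp
qed

text \<open>
  The nine lemma for the columns \<open>\<Omega> \<rightarrow> P \<rightarrow> H\<close>, with exactness in the middle again by counting.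
\<close>
lemma homology_exact:
  assumes P: "short_exact PN af PL ag PM" and F: "F \<in> module_hom A N L" and G: "G \<in> module_hom A L M"
    and FF: "\<And>n. n \<in> carrier PN \<Longrightarrow> F (\<pi>N n) = \<pi>L (af n)"
    and GG: "\<And>p. p \<in> carrier PL \<Longrightarrow> G (\<pi>L p) = \<pi>M (ag p)"
  shows "short_exact N F L G M"
proof (rule short_exactI_card[OF F G DN(5) DL(5) DM(5) fin_terms(7)])
  have W: "short_exact WN ef WL eg WM" by (rule syzygies_exact[OF P])
  have Wker: "ef ` carrier WN = {z \<in> carrier WL. eg z = \<zero>\<^bsub>WM\<^esub>}" using W by (simp add: short_exact_def)
  show "inj_on F (carrier N)"
    unfolding inj_on_hom_iff[OF F DN(5) DL(5)]
  proof (intro ballI impI)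
    fix y assume "y \<in> carrier N" and z: "F y = \<zero>\<^bsub>L\<^esub>"
    then obtain n where n: "n \<in> carrier PN" "y = \<pi>N n" using DN(9) by auto
    have "\<pi>L (af n) = \<zero>\<^bsub>L\<^esub>" using FF[OF n(1)] z n(2) by simp
    then obtain v where v: "v \<in> carrier WL" "af n = \<delta>L v" using DL(10)[of "af n"] n(1) by auto
    have "\<delta>M (eg v) = \<zero>\<^bsub>PM\<^esub>" using comm_g[OF v(1)] gf_zero(1)[OF n(1)] v(2) by simp
    then have "v \<in> {z \<in> carrier WL. eg z = \<zero>\<^bsub>WM\<^esub>}" using v(1) by simp
    then obtain w where w: "w \<in> carrier WN" "v = ef w" unfolding Wker[symmetric] by auto
    have "af n = af (\<delta>N w)" using v w comm_f by simp
    then have "n = \<delta>N w" using af_inj n(1) w(1) by (simp add: inj_on_def)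
    then show "y = \<zero>\<^bsub>N\<^esub>" using n w by simp
  qed
  show "G ` carrier L = carrier M"
  proof (intro equalityI subsetI)
    fix m assume "m \<in> carrier M"
    then obtain p where p: "p \<in> carrier PM" "m = \<pi>M p" using DM(9) by auto
    have "p \<in> ag ` carrier PL" using P p(1) by (simp add: short_exact_def)
    then obtain p' where "p' \<in> carrier PL" "p = ag p'" by auto
    then show "m \<in> G ` carrier L" using GG[of p'] p by (intro image_eqI[of _ _ "\<pi>L p'"]) simp_all
  qed (use hom_rules(1)[OF G DL(5) DM(5)] in auto)
  show "G (F y) = \<zero>\<^bsub>M\<^esub>" if y: "y \<in> carrier N" for y
  proof -
    have "y \<in> \<pi>N ` carrier PN" unfolding DN(9) by (rule y)
    then obtain n where n: "n \<in> carrier PN" "y = \<pi>N n" by auto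
    then show ?thesis using FF[OF n(1)] GG[of "af n"] gf_zero(1)[OF n(1)] by simp
  qed
  have 1: "card (carrier PL) = card (carrier PN) * card (carrier PM)"
    by (rule card_short_exact[OF af ag DL(3) DM(3) fin_terms(1) P])
  have 2: "card (carrier WL) = card (carrier WN) * card (carrier WM)"
    by (rule card_short_exact[OF ef eg DL(4) DM(4) fin_terms(2) W])
  show "card (carrier L) = card (carrier N) * card (carrier M)"
    using 1 unfolding DL(13) DM(13) DN(13) 2
    using card_carrier_pos[OF DN(4) fin_terms(6)] card_carrier_pos[OF DM(4) fin_terms(4)] by simp
qed

end

context three_resolutions
begin

lemma conflationE:
  assumes "(f, g) \<in> c1_ses K Q (C_cplx rM) (C_cplx rN) (C_cplx rL)"
  obtains af bf ef ag bg eg where "conflation K Q L M N rL rM rN af bf ef ag bg eg"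
    "f = chain_map rN rL af bf ef" "g = chain_map rL rM ag bg eg"
proof -
  have f: "f \<in> c1_homs K Q (C_cplx rN) (C_cplx rL)" and g: "g \<in> c1_homs K Q (C_cplx rL) (C_cplx rM)"
    and ex: "short_exact (direct_sum PN WN) f (direct_sum PL WL) g (direct_sum PM WM)"
    using assms by (auto simp: c1_ses_def)
  obtain af bf ef where F: "af \<in> module_hom A PN PL" "bf \<in> module_hom A WN PL" "ef \<in> module_hom A WN WL"
    "\<And>w. w \<in> carrier WN \<Longrightarrow> af (\<delta>N w) = \<delta>L (ef w)" "f = chain_map rN rL af bf ef"
    by (rule NL.chain_mapE[OF f]) (rule that)
  obtain ag bg eg where G: "ag \<in> module_hom A PL PM" "bg \<in> module_hom A WL PM" "eg \<in> module_hom A WL WM"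
    "\<And>w. w \<in> carrier WL \<Longrightarrow> ag (\<delta>L w) = \<delta>M (eg w)" "g = chain_map rL rM ag bg eg"
    by (rule LM.chain_mapE[OF g]) (rule that)
  have "conflation K Q L M N rL rM rN af bf ef ag bg eg"
    by unfold_locales (use F G ex in auto)
  then show thesis using F(5) G(5) by (rule that)
qed

text \<open>
  Injectivity of \<open>a\<^sub>f\<close> suffices on the left, because \<open>\<delta>\<^sub>L e\<^sub>f = a\<^sub>f \<delta>\<^sub>N\<close> then makes \<open>e\<^sub>f\<close> injective; in the
  middle the cardinalities decide.
\<close>
lemma conflationI:
  assumes af: "af \<in> module_hom A PN PL" and bf: "bf \<in> module_hom A WN PL" and ef: "ef \<in> module_hom A WN WL"
    and ag: "ag \<in> module_hom A PL PM" and bg: "bg \<in> module_hom A WL PM" and eg: "eg \<in> module_hom A WL WM"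
    and comm_f: "\<And>w. w \<in> carrier WN \<Longrightarrow> af (\<delta>N w) = \<delta>L (ef w)"
    and comm_g: "\<And>w. w \<in> carrier WL \<Longrightarrow> ag (\<delta>L w) = \<delta>M (eg w)"
    and af_inj: "inj_on af (carrier PN)"
    and onto: "\<And>p w. \<lbrakk>p \<in> carrier PM; w \<in> carrier WM\<rbrakk> \<Longrightarrow>
      \<exists>y \<in> carrier PL. \<exists>x \<in> carrier WL. p = ag y \<oplus>\<^bsub>PM\<^esub> bg x \<and> w = eg x"
    and zero: "\<And>n. n \<in> carrier PN \<Longrightarrow> ag (af n) = \<zero>\<^bsub>PM\<^esub>"
      "\<And>w. w \<in> carrier WN \<Longrightarrow> ag (bf w) \<oplus>\<^bsub>PM\<^esub> bg (ef w) = \<zero>\<^bsub>PM\<^esub>" "\<And>w. w \<in> carrier WN \<Longrightarrow> eg (ef w) = \<zero>\<^bsub>WM\<^esub>"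
    and card: "card (carrier PL) * card (carrier WL) =
      card (carrier PN) * card (carrier WN) * (card (carrier PM) * card (carrier WM))"
  shows "(chain_map rN rL af bf ef, chain_map rL rM ag bg eg) \<in> c1_ses K Q (C_cplx rM) (C_cplx rN) (C_cplx rL)"
proof -
  let ?f = "chain_map rN rL af bf ef" and ?g = "chain_map rL rM ag bg eg"
  note [simp] = hom_rules[OF af DN(3) DL(3)] hom_rules[OF bf DN(4) DL(3)] hom_rules[OF ef DN(4) DL(4)]
    hom_rules[OF ag DL(3) DM(3)] hom_rules[OF bg DL(4) DM(3)] hom_rules[OF eg DL(4) DM(4)]
  have f: "?f \<in> c1_homs K Q (C_cplx rN) (C_cplx rL)" by (rule NL.chain_mapI[OF af bf ef comm_f])
  have g: "?g \<in> c1_homs K Q (C_cplx rL) (C_cplx rM)" by (rule LM.chain_mapI[OF ag bg eg comm_g])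
  note lm = left_module_direct_sum[OF DN(3,4)] left_module_direct_sum[OF DL(3,4)] left_module_direct_sum[OF DM(3,4)]
  note fh = c1_homsD(1)[OF f, simplified] and gh = c1_homsD(1)[OF g, simplified]
  have af_zero: "x = \<zero>\<^bsub>PN\<^esub>" if "x \<in> carrier PN" "af x = \<zero>\<^bsub>PL\<^esub>" for x
    using inj_onD[OF af_inj, of x "\<zero>\<^bsub>PN\<^esub>"] that by simp
  have "short_exact (direct_sum PN WN) ?f (direct_sum PL WL) ?g (direct_sum PM WM)"
  proof (rule short_exactI_card[OF fh gh lm])
    show "finite (carrier (direct_sum PL WL))" using fin_terms by simp
    show "inj_on ?f (carrier (direct_sum PN WN))"
      unfolding inj_on_hom_iff[OF fh lm(1,2)]
    proof (intro ballI impI)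
      fix v assume "v \<in> carrier (direct_sum PN WN)" and z: "?f v = \<zero>\<^bsub>direct_sum PL WL\<^esub>"
      then obtain n w where v: "v = (n, w)" "n \<in> carrier PN" "w \<in> carrier WN" by auto
      have eq: "af n \<oplus>\<^bsub>PL\<^esub> bf w = \<zero>\<^bsub>PL\<^esub>" "ef w = \<zero>\<^bsub>WL\<^esub>" using z v by (simp_all add: chain_map_def)
      have "af (\<delta>N w) = \<zero>\<^bsub>PL\<^esub>" using comm_f[OF v(3)] eq(2) by simp
      then have w: "w = \<zero>\<^bsub>WN\<^esub>" using af_zero[of "\<delta>N w"] v(3) by simp
      then have "af n = \<zero>\<^bsub>PL\<^esub>" using eq(1) v(2) by simp
      then show "v = \<zero>\<^bsub>direct_sum PN WN\<^esub>" using af_zero[OF v(2)] w v(1) by simp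
    qed
    show "?g ` carrier (direct_sum PL WL) = carrier (direct_sum PM WM)"
    proof (intro equalityI subsetI)
      fix v assume "v \<in> carrier (direct_sum PM WM)"
      then obtain p w where v: "v = (p, w)" "p \<in> carrier PM" "w \<in> carrier WM" by auto
      obtain y x where yx: "y \<in> carrier PL" "x \<in> carrier WL" "p = ag y \<oplus>\<^bsub>PM\<^esub> bg x" "w = eg x"
        using onto[OF v(2,3)] by auto
      have "v = ?g (y, x)" using v(1) yx by (simp add: chain_map_def)
      then show "v \<in> ?g ` carrier (direct_sum PL WL)" using yx(1,2) by (intro image_eqI[of _ _ "(y, x)"]) simp_all
    next
      fix v assume "v \<in> ?g ` carrier (direct_sum PL WL)"
      then show "v \<in> carrier (direct_sum PM WM)" using hom_rules(1)[OF gh lm(2,3)] by auto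
    qed
    show "?g (?f v) = \<zero>\<^bsub>direct_sum PM WM\<^esub>" if "v \<in> carrier (direct_sum PN WN)" for v
    proof -
      obtain n w where v: "v = (n, w)" "n \<in> carrier PN" "w \<in> carrier WN"
        using \<open>v \<in> carrier (direct_sum PN WN)\<close> by auto
      then show ?thesis by (simp add: chain_map_def zero)
    qed
    show "card (carrier (direct_sum PL WL)) = card (carrier (direct_sum PN WN)) * card (carrier (direct_sum PM WM))"
      using card by (simp add: card_cartesian_product)
  qed
  then show ?thesis using f g obj by (simp add: c1_ses_def)
qed

section \<open>Extensions without connecting homomorphism\<close>

lemma mod_sesD:
  assumes "(F, G) \<in> mod_ses K Q M N L"
  shows "F \<in> module_hom A N L" "G \<in> module_hom A L M" "short_exact N F L G M"
    "G ` carrier L = carrier M" "F ` carrier N = {x \<in> carrier L. G x = \<zero>\<^bsub>M\<^esub>}"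
    "\<And>y. y \<in> carrier N \<Longrightarrow> G (F y) = \<zero>\<^bsub>M\<^esub>"
    "card (carrier L) = card (carrier N) * card (carrier M)"
proof -
  show F: "F \<in> module_hom A N L" and G: "G \<in> module_hom A L M" and ex: "short_exact N F L G M"
    using assms by (auto simp: mod_ses_def mod_homs_def)
  show "G ` carrier L = carrier M" and im: "F ` carrier N = {x \<in> carrier L. G x = \<zero>\<^bsub>M\<^esub>}"
    using ex by (auto simp: short_exact_def)
  show "G (F y) = \<zero>\<^bsub>M\<^esub>" if "y \<in> carrier N" for y
  proof -
    have "F y \<in> {x \<in> carrier L. G x = \<zero>\<^bsub>M\<^esub>}" unfolding im[symmetric] using that by simp
    then show ?thesis by simp
  qed
  show "card (carrier L) = card (carrier N) * card (carrier M)"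
    by (rule card_short_exact[OF F G DL(5) DM(5) fin_terms(7) ex])
qed

text \<open>
  Surjectivity onto the kernel of the cover: if \<open>t\<close> lifts \<open>M\<close> along \<open>G\<close> and \<open>c\<close> lifts \<open>N \<rightarrow> L\<close>, then
  \<open>P\<^sub>M \<oplus> P\<^sub>N \<rightarrow> P\<^sub>L\<close> is onto by minimality and hence bijective by counting.
\<close>
lemma horseshoe_bij:
  assumes ses: "(F, G) \<in> mod_ses K Q M N L"
    and cardP: "card (carrier PL) = card (carrier PM) * card (carrier PN)"
    and t: "t \<in> module_hom A PM PL" and c: "c \<in> module_hom A PN PL"
    and tG: "\<And>m. m \<in> carrier PM \<Longrightarrow> G (\<pi>L (t m)) = \<pi>M m"
    and cF: "\<And>n. n \<in> carrier PN \<Longrightarrow> \<pi>L (c n) = F (\<pi>N n)"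
  shows "bij_betw (\<lambda>v. t (fst v) \<oplus>\<^bsub>PL\<^esub> c (snd v)) (carrier PM \<times> carrier PN) (carrier PL)"
proof -
  note S = mod_sesD[OF ses]
  note [simp] = hom_rules[OF t DM(3) DL(3)] hom_rules[OF c DN(3) DL(3)]
    hom_rules[OF S(1) DN(5) DL(5)] hom_rules[OF S(2) DL(5) DM(5)]
  let ?k = "\<lambda>v. t (fst v) \<oplus>\<^bsub>PL\<^esub> c (snd v)"
  have k: "?k \<in> module_hom A (direct_sum PM PN) PL" by (rule hom_copair[OF t c DM(3) DN(3) DL(3)])
  have "?k ` carrier (direct_sum PM PN) = carrier PL"
  proof (rule cover_onto[OF res_L fd_L k left_module_direct_sum[OF DM(3) DN(3)]])
    fix x assume x: "x \<in> carrier L"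
    have "G x \<in> \<pi>M ` carrier PM" unfolding DM(9) using x by simp
    then obtain m where m: "m \<in> carrier PM" "G x = \<pi>M m" by auto
    have "x \<ominus>\<^bsub>L\<^esub> \<pi>L (t m) \<in> {x \<in> carrier L. G x = \<zero>\<^bsub>M\<^esub>}" using x m by (simp add: tG)
    then obtain y where y: "y \<in> carrier N" "x \<ominus>\<^bsub>L\<^esub> \<pi>L (t m) = F y" unfolding S(5)[symmetric] by auto
    have "y \<in> \<pi>N ` carrier PN" unfolding DN(9) by (rule y(1))
    then obtain n where n: "n \<in> carrier PN" "y = \<pi>N n" by auto
    have "x = F y \<oplus>\<^bsub>L\<^esub> \<pi>L (t m)"
      using left_module_move(2)[OF DL(5) x, of "\<pi>L (t m)" "F y"] m(1) y by simp
    also have "\<dots> = \<pi>L (t m) \<oplus>\<^bsub>L\<^esub> F y"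
      using m(1) y(1) by (intro left_module_arith(2)[OF DL(5)]) simp_all
    finally have "\<pi>L (?k (m, n)) = x" using m(1) n by (simp add: cF)
    then show "\<exists>v \<in> carrier (direct_sum PM PN). \<pi>L (?k v) = x"
      using m(1) n(1) by (intro bexI[of _ "(m, n)"]) simp_all
  qed
  then have onto: "?k ` (carrier PM \<times> carrier PN) = carrier PL" by simp
  have "inj_on ?k (carrier PM \<times> carrier PN)"
    by (rule eq_card_imp_inj_on) (simp_all add: onto cardP card_cartesian_product fin_terms)
  then show ?thesis using onto by (simp add: bij_betw_def)
qed

text \<open>
  The inverse of the bijection \<open>P\<^sub>M \<oplus> P\<^sub>N \<rightarrow> P\<^sub>L\<close>, followed by the projection to \<open>P\<^sub>M\<close>, is a lift of \<open>G\<close>.  The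
  snake lemma makes it surjective on syzygies because its kernel \<open>P\<^sub>N\<close> covers \<open>N\<close>.
\<close>
lemma horseshoe_special:
  assumes ses: "(F, G) \<in> mod_ses K Q M N L"
    and cardP: "card (carrier PL) = card (carrier PM) * card (carrier PN)"
  obtains a0 e0 c0 where "a0 \<in> module_hom A PL PM" "e0 \<in> module_hom A WL WM" "c0 \<in> module_hom A PN PL"
    "\<And>x. x \<in> carrier PL \<Longrightarrow> \<pi>M (a0 x) = G (\<pi>L x)"
    "\<And>w. w \<in> carrier WL \<Longrightarrow> a0 (\<delta>L w) = \<delta>M (e0 w)"
    "\<And>n. n \<in> carrier PN \<Longrightarrow> \<pi>L (c0 n) = F (\<pi>N n)"
    "a0 ` carrier PL = carrier PM" "e0 ` carrier WL = carrier WM"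
proof -
  note S = mod_sesD[OF ses]
  note [simp] = hom_rules[OF S(1) DN(5) DL(5)] hom_rules[OF S(2) DL(5) DM(5)]
  have im: "\<pi>M ` carrier PM \<subseteq> (\<lambda>x. G (\<pi>L x)) ` carrier PL"
  proof -
    have "(\<lambda>x. G (\<pi>L x)) ` carrier PL = G ` (\<pi>L ` carrier PL)" by (simp add: image_image)
    then show ?thesis unfolding DM(9) DL(9) S(4) by simp
  qed
  obtain t where t: "t \<in> module_hom A PM PL" "\<And>m. m \<in> carrier PM \<Longrightarrow> G (\<pi>L (t m)) = \<pi>M m"
    using projective_lift[OF DM(1) fd_terms(1) fd_M hom_comp[OF DL(7) S(2)] DM(7) im] by auto
  obtain c0 where c0: "c0 \<in> module_hom A PN PL" "\<And>n. n \<in> carrier PN \<Longrightarrow> \<pi>L (c0 n) = F (\<pi>N n)"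
    using NL.lift_hom[OF S(1)] by auto
  note [simp] = hom_rules[OF t(1) DM(3) DL(3)] hom_rules[OF c0(1) DN(3) DL(3)]
  let ?k = "\<lambda>v. t (fst v) \<oplus>\<^bsub>PL\<^esub> c0 (snd v)"
  note lD = left_module_direct_sum[OF DM(3) DN(3)]
  have k: "?k \<in> module_hom A (direct_sum PM PN) PL" by (rule hom_copair[OF t(1) c0(1) DM(3) DN(3) DL(3)])
  have bij: "bij_betw ?k (carrier PM \<times> carrier PN) (carrier PL)"
    by (rule horseshoe_bij[OF ses cardP t(1) c0(1) t(2) c0(2)])
  obtain j where j: "j \<in> module_hom A PL (direct_sum PM PN)" "\<And>x. x \<in> carrier PL \<Longrightarrow> ?k (j x) = x"
    using hom_inverse[OF k _ lD DL(3)] bij by auto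
  note [simp] = hom_rules(1)[OF j(1) DL(3) lD]
  have jk: "j (?k v) = v" if "v \<in> carrier PM \<times> carrier PN" for v
  proof (rule inj_onD[OF bij_betw_imp_inj_on[OF bij]])
    have "?k v \<in> carrier PL" using bij that by (auto simp: bij_betw_def)
    then show "?k (j (?k v)) = ?k v" "j (?k v) \<in> carrier PM \<times> carrier PN"
      using j(2) hom_rules(1)[OF j(1) DL(3) lD] by simp_all
  qed (rule that)
  define a0 where "a0 x = fst (j x)" for x
  have a0: "a0 \<in> module_hom A PL PM" unfolding a0_def by (rule hom_comp[OF j(1) hom_fst])
  note [simp] = hom_rules[OF a0 DL(3) DM(3)]
  have a0t: "a0 (t m) = m" if "m \<in> carrier PM" for m using jk[of "(m, \<zero>\<^bsub>PN\<^esub>)"] that by (simp add: a0_def)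
  have a0c: "a0 (c0 n) = \<zero>\<^bsub>PM\<^esub>" if "n \<in> carrier PN" for n using jk[of "(\<zero>\<^bsub>PM\<^esub>, n)"] that by (simp add: a0_def)
  have lift: "\<pi>M (a0 x) = G (\<pi>L x)" if x: "x \<in> carrier PL" for x
  proof -
    obtain m n where jx: "j x = (m, n)" "m \<in> carrier PM" "n \<in> carrier PN"
      using hom_rules(1)[OF j(1) DL(3) lD x] by auto
    have xe: "x = t m \<oplus>\<^bsub>PL\<^esub> c0 n" using j(2)[OF x] jx(1) by simp
    have "a0 x = m" using jx(1) by (simp add: a0_def)
    moreover have "G (\<pi>L x) = \<pi>M m" unfolding xe using jx(2,3) by (simp add: t(2) c0(2) S(6))
    ultimately show ?thesis by simp
  qed
  have "\<pi>M (a0 (\<delta>L w)) = \<zero>\<^bsub>M\<^esub>" if "w \<in> carrier WL" for w using that by (simp add: lift)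
  then obtain e0 where e0: "e0 \<in> module_hom A WL WM" "\<And>w. w \<in> carrier WL \<Longrightarrow> \<delta>M (e0 w) = a0 (\<delta>L w)"
    using LM.syzygy_map[OF a0] by auto
  note [simp] = hom_rules[OF e0(1) DL(4) DM(4)]
  have "carrier PM \<subseteq> a0 ` carrier PL"
  proof
    fix m assume "m \<in> carrier PM"
    then show "m \<in> a0 ` carrier PL" using a0t by (intro image_eqI[of _ _ "t m"]) simp_all
  qed
  then have a0_onto: "a0 ` carrier PL = carrier PM" by auto
  have "carrier WM \<subseteq> e0 ` carrier WL"
  proof
    fix w assume w: "w \<in> carrier WM"
    have "\<pi>L (t (\<delta>M w)) \<in> {x \<in> carrier L. G x = \<zero>\<^bsub>M\<^esub>}" using w by (simp add: t(2))
    then obtain y where y: "y \<in> carrier N" "\<pi>L (t (\<delta>M w)) = F y" unfolding S(5)[symmetric] by auto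
    have "y \<in> \<pi>N ` carrier PN" unfolding DN(9) by (rule y(1))
    then obtain n where n: "n \<in> carrier PN" "y = \<pi>N n" by auto
    have mem: "t (\<delta>M w) \<ominus>\<^bsub>PL\<^esub> c0 n \<in> carrier PL" using w n(1) by simp
    have "\<pi>L (t (\<delta>M w) \<ominus>\<^bsub>PL\<^esub> c0 n) = \<zero>\<^bsub>L\<^esub>" using w n y by (simp add: c0(2))
    then obtain v where v: "v \<in> carrier WL" "t (\<delta>M w) \<ominus>\<^bsub>PL\<^esub> c0 n = \<delta>L v" using DL(10)[OF mem] by auto
    have "\<delta>M (e0 v) = a0 (t (\<delta>M w) \<ominus>\<^bsub>PL\<^esub> c0 n)" using v e0(2) by simp
    also have "\<dots> = \<delta>M w" using w n(1) by (simp add: a0t a0c)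
    finally have "e0 v = w" using v(1) w LM.delta_eq_iff[of "e0 v" w] by simp
    then show "w \<in> e0 ` carrier WL" using v(1) by auto
  qed
  then have e0_onto: "e0 ` carrier WL = carrier WM" by auto
  show thesis by (rule that[OF a0 e0(1) c0(1) lift e0(2)[symmetric] c0(2) a0_onto e0_onto])
qed

text \<open>
  Two lifts of \<open>G\<close> differ by some \<open>\<delta> t\<close>, and \<open>t\<close> lifts along the epimorphism of syzygies.  Hence any lift is
  the special one composed with an endomorphism \<open>\<theta>\<close> of \<open>P\<^sub>L\<close> over \<open>L\<close>, which is bijective by minimality, and
  shares its surjectivity properties.
\<close>
lemma horseshoe_conflation:
  assumes ses: "(F, G) \<in> mod_ses K Q M N L"
    and cardP: "card (carrier PL) = card (carrier PM) * card (carrier PN)"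
    and g: "g \<in> c1_homs K Q (C_cplx rL) (C_cplx rM)" and hom: "homology_map L rL rM g = G"
  shows "g \<in> snd ` c1_ses K Q (C_cplx rM) (C_cplx rN) (C_cplx rL)"
proof -
  note S = mod_sesD[OF ses]
  note [simp] = hom_rules[OF S(1) DN(5) DL(5)] hom_rules[OF S(2) DL(5) DM(5)]
  obtain a b e where C: "a \<in> module_hom A PL PM" "b \<in> module_hom A WL PM" "e \<in> module_hom A WL WM"
    "\<And>w. w \<in> carrier WL \<Longrightarrow> a (\<delta>L w) = \<delta>M (e w)" "g = chain_map rL rM a b e"
    by (rule LM.chain_mapE[OF g]) (rule that)
  note [simp] = hom_rules[OF C(1) DL(3) DM(3)] hom_rules[OF C(2) DL(4) DM(3)] hom_rules[OF C(3) DL(4) DM(4)]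
  have lift: "\<pi>M (a x) = G (\<pi>L x)" if "x \<in> carrier PL" for x
    using LM.homology_chain_map(2)[OF C(1-4) that] hom C(5) by simp
  obtain a0 e0 c0 where a0: "a0 \<in> module_hom A PL PM" and e0: "e0 \<in> module_hom A WL WM"
    and c0: "c0 \<in> module_hom A PN PL"
    and a0_lift: "\<And>x. x \<in> carrier PL \<Longrightarrow> \<pi>M (a0 x) = G (\<pi>L x)"
    and a0_comm: "\<And>w. w \<in> carrier WL \<Longrightarrow> a0 (\<delta>L w) = \<delta>M (e0 w)"
    and c0_lift: "\<And>n. n \<in> carrier PN \<Longrightarrow> \<pi>L (c0 n) = F (\<pi>N n)"
    and a0_onto: "a0 ` carrier PL = carrier PM" and e0_onto: "e0 ` carrier WL = carrier WM"
    by (rule horseshoe_special[OF ses cardP]) (rule that)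
  note [simp] = hom_rules[OF a0 DL(3) DM(3)] hom_rules[OF e0 DL(4) DM(4)] hom_rules[OF c0 DN(3) DL(3)]

  \<comment> \<open>The endomorphism \<open>\<theta>\<close> of \<open>P\<^sub>L\<close> with \<open>a = a\<^sub>0 \<theta>\<close>, and \<open>\<theta>'\<close> induced by it on \<open>\<Omega>\<^sub>L\<close>.\<close>
  have "\<pi>M (a x) = \<pi>M (a0 x)" if "x \<in> carrier PL" for x using that by (simp add: lift a0_lift)
  then obtain t where t: "t \<in> module_hom A PL WM" "\<And>x. x \<in> carrier PL \<Longrightarrow> a x = a0 x \<oplus>\<^bsub>PM\<^esub> \<delta>M (t x)"
    using LM.lift_unique[OF C(1) a0] by auto
  have "t ` carrier PL \<subseteq> e0 ` carrier WL" unfolding e0_onto using hom_rules(1)[OF t(1) DL(3) DM(4)] by auto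
  then obtain t' where t': "t' \<in> module_hom A PL WL" "\<And>x. x \<in> carrier PL \<Longrightarrow> e0 (t' x) = t x"
    using projective_lift[OF DL(1) fd_terms(2,4) e0 t(1)] by auto
  note [simp] = hom_rules[OF t' (1) DL(3) DL(4)]
  define \<theta> where "\<theta> x = x \<oplus>\<^bsub>PL\<^esub> \<delta>L (t' x)" for x
  have \<theta>: "\<theta> \<in> module_hom A PL PL"
    using hom_add[OF hom_id hom_comp[OF t'(1) DL(6)] DL(3) DL(3)] by (simp add: \<theta>_def[abs_def])
  note [simp] = hom_rules[OF \<theta> DL(3) DL(3)]
  have a_\<theta>: "a x = a0 (\<theta> x)" if "x \<in> carrier PL" for x
    using that by (simp add: t(2) \<theta>_def a0_comm t'(2))
  have \<theta>_onto: "\<theta> ` carrier PL = carrier PL"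
  proof (rule cover_onto[OF res_L fd_L \<theta> DL(3)])
    fix m assume "m \<in> carrier L"
    then have "m \<in> \<pi>L ` carrier PL" using DL(9) by simp
    then obtain x where "x \<in> carrier PL" "m = \<pi>L x" by auto
    then show "\<exists>x \<in> carrier PL. \<pi>L (\<theta> x) = m" by (intro bexI[of _ x]) (simp_all add: \<theta>_def)
  qed
  then have \<theta>_inj: "inj_on \<theta> (carrier PL)" by (intro finite_surj_inj[OF fin_terms(1)]) simp
  define \<theta>' where "\<theta>' w = w \<oplus>\<^bsub>WL\<^esub> t' (\<delta>L w)" for w
  have \<theta>': "\<theta>' \<in> module_hom A WL WL"
    using hom_add[OF hom_id hom_comp[OF DL(6) t'(1)] DL(4) DL(4)] by (simp add: \<theta>'_def[abs_def])
  note [simp] = hom_rules[OF \<theta>' DL(4) DL(4)]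
  have \<theta>\<theta>': "\<theta> (\<delta>L w) = \<delta>L (\<theta>' w)" if "w \<in> carrier WL" for w using that by (simp add: \<theta>_def \<theta>'_def)
  have "inj_on \<theta>' (carrier WL)"
    unfolding inj_on_hom_iff[OF \<theta>' DL(4) DL(4)]
  proof (intro ballI impI)
    fix w assume w: "w \<in> carrier WL" "\<theta>' w = \<zero>\<^bsub>WL\<^esub>"
    have "\<theta> (\<delta>L w) = \<theta> \<zero>\<^bsub>PL\<^esub>" using \<theta>\<theta>'[OF w(1)] w(2) by simp
    then have "\<delta>L w = \<zero>\<^bsub>PL\<^esub>" using \<theta>_inj w(1) by (simp add: inj_on_def)
    then show "w = \<zero>\<^bsub>WL\<^esub>" using w(1) by simp
  qed
  moreover have "\<theta>' ` carrier WL \<subseteq> carrier WL" by auto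
  ultimately have \<theta>'_onto: "\<theta>' ` carrier WL = carrier WL" using endo_inj_surj[OF fin_terms(2)] by simp
  have e_\<theta>: "e w = e0 (\<theta>' w)" if w: "w \<in> carrier WL" for w
  proof -
    have "\<delta>M (e w) = \<delta>M (e0 (\<theta>' w))"
      using w C(4)[OF w, symmetric] a_\<theta>[of "\<delta>L w"] \<theta>\<theta>'[OF w] a0_comm[of "\<theta>' w"] by simp
    then show ?thesis using w LM.delta_eq_iff[of "e w" "e0 (\<theta>' w)"] by simp
  qed
  have a_onto: "a ` carrier PL = carrier PM"
  proof -
    have "a ` carrier PL = a0 ` (\<theta> ` carrier PL)" unfolding image_image by (rule image_cong[OF refl a_\<theta>])
    then show ?thesis unfolding \<theta>_onto a0_onto .
  qed
  have e_onto: "e ` carrier WL = carrier WM"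
  proof -
    have "e ` carrier WL = e0 ` (\<theta>' ` carrier WL)" unfolding image_image by (rule image_cong[OF refl e_\<theta>])
    then show ?thesis unfolding \<theta>'_onto e0_onto .
  qed

  \<comment> \<open>Correct \<open>c\<^sub>0\<close> by a map into \<open>\<delta>\<^sub>L(\<Omega>\<^sub>L)\<close> so that it lands in the kernel of \<open>a\<close>.\<close>
  have "\<pi>M (a (c0 n)) = \<pi>M \<zero>\<^bsub>PM\<^esub>" if "n \<in> carrier PN" for n using that by (simp add: lift c0_lift S(6))
  then have "a (c0 n) \<in> \<delta>M ` carrier WM" if "n \<in> carrier PN" for n
    using DM(10)[of "a (c0 n)"] that by auto
  then have im: "(\<lambda>n. a (c0 n)) ` carrier PN \<subseteq> \<delta>M ` carrier WM" by auto
  obtain u where u: "u \<in> module_hom A PN WM" "\<And>n. n \<in> carrier PN \<Longrightarrow> \<delta>M (u n) = a (c0 n)"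
    using factor_through_injection[OF DM(6,8) hom_comp[OF c0 C(1)] DM(4,3) DN(3) im] by auto
  have "u ` carrier PN \<subseteq> e ` carrier WL" unfolding e_onto using hom_rules(1)[OF u(1) DN(3) DM(4)] by auto
  then obtain u' where u': "u' \<in> module_hom A PN WL" "\<And>n. n \<in> carrier PN \<Longrightarrow> e (u' n) = u n"
    using projective_lift[OF DN(1) fd_terms(2,4) C(3) u(1)] by auto
  note [simp] = hom_rules[OF u'(1) DN(3) DL(4)]
  define c where "c n = c0 n \<ominus>\<^bsub>PL\<^esub> \<delta>L (u' n)" for n
  have c: "c \<in> module_hom A PN PL"
    using hom_minus[OF c0 hom_comp[OF u'(1) DL(6)] DN(3) DL(3)] by (simp add: c_def[abs_def])
  note [simp] = hom_rules[OF c DN(3) DL(3)]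
  have ac: "a (c n) = \<zero>\<^bsub>PM\<^esub>" if "n \<in> carrier PN" for n
    using that by (simp add: c_def C(4) u'(2) u(2))
  have c_lift: "\<pi>L (c n) = F (\<pi>N n)" if "n \<in> carrier PN" for n
    using that by (simp add: c_def c0_lift)

  have "carrier PM \<subseteq> a ` carrier PL" using a_onto by simp
  then obtain \<tau> where \<tau>: "\<tau> \<in> module_hom A PM PL" "\<And>m. m \<in> carrier PM \<Longrightarrow> a (\<tau> m) = m"
    using projective_lift[OF DM(1) fd_terms(1,3) C(1) hom_id] by auto
  note [simp] = hom_rules[OF \<tau>(1) DM(3) DL(3)]
  have "G (\<pi>L (\<tau> m)) = \<pi>M m" if "m \<in> carrier PM" for m using lift[of "\<tau> m"] that \<tau>(2) by simp
  then have bij: "bij_betw (\<lambda>v. \<tau> (fst v) \<oplus>\<^bsub>PL\<^esub> c (snd v)) (carrier PM \<times> carrier PN) (carrier PL)"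
    by (intro horseshoe_bij[OF ses cardP \<tau>(1) c _ c_lift])
  have c_zero: "n = \<zero>\<^bsub>PN\<^esub>" if n: "n \<in> carrier PN" "c n = \<zero>\<^bsub>PL\<^esub>" for n
    using inj_onD[OF bij_betw_imp_inj_on[OF bij], of "(\<zero>\<^bsub>PM\<^esub>, n)" "(\<zero>\<^bsub>PM\<^esub>, \<zero>\<^bsub>PN\<^esub>)"] n by simp

  have "\<pi>L (c (\<delta>N w)) = \<zero>\<^bsub>L\<^esub>" if "w \<in> carrier WN" for w using that by (simp add: c_lift)
  then obtain ef where ef: "ef \<in> module_hom A WN WL" "\<And>w. w \<in> carrier WN \<Longrightarrow> \<delta>L (ef w) = c (\<delta>N w)"
    using NL.syzygy_map[OF c] by auto
  note [simp] = hom_rules[OF ef(1) DN(4) DL(4)]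
  have eef: "e (ef w) = \<zero>\<^bsub>WM\<^esub>" if w: "w \<in> carrier WN" for w
  proof -
    have "\<delta>M (e (ef w)) = \<zero>\<^bsub>PM\<^esub>" using C(4)[of "ef w", symmetric] w by (simp add: ef(2) ac)
    then show ?thesis using w by simp
  qed
  have im2: "(\<lambda>w. \<ominus>\<^bsub>PM\<^esub> b (ef w)) ` carrier WN \<subseteq> a ` carrier PL" unfolding a_onto by auto
  obtain bf where bf: "bf \<in> module_hom A WN PL" "\<And>w. w \<in> carrier WN \<Longrightarrow> a (bf w) = \<ominus>\<^bsub>PM\<^esub> b (ef w)"
    using projective_lift[OF DN(2) fd_terms(1,3) C(1) hom_neg[OF hom_comp[OF ef(1) C(2)] DN(4) DM(3)] im2] by auto
  note [simp] = hom_rules[OF bf(1) DN(4) DL(3)]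

  have onto: "\<exists>y \<in> carrier PL. \<exists>x \<in> carrier WL. p = a y \<oplus>\<^bsub>PM\<^esub> b x \<and> w = e x"
    if p: "p \<in> carrier PM" and w: "w \<in> carrier WM" for p w
  proof -
    have "w \<in> e ` carrier WL" unfolding e_onto by (rule w)
    then obtain x where x: "x \<in> carrier WL" "w = e x" by auto
    have "p \<ominus>\<^bsub>PM\<^esub> b x \<in> a ` carrier PL" unfolding a_onto using p x(1) by simp
    then obtain y where y: "y \<in> carrier PL" "p \<ominus>\<^bsub>PM\<^esub> b x = a y" by auto
    have "p = a y \<oplus>\<^bsub>PM\<^esub> b x" using left_module_move(2)[OF DM(3) p, of "b x" "a y"] x(1) y by simp
    then show ?thesis using x y(1) by (intro bexI[of _ y] bexI[of _ x]) simp_all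
  qed
  have c_inj: "inj_on c (carrier PN)" unfolding inj_on_hom_iff[OF c DN(3) DL(3)] by (intro ballI impI c_zero)
  have abf: "a (bf w) \<oplus>\<^bsub>PM\<^esub> b (ef w) = \<zero>\<^bsub>PM\<^esub>" if "w \<in> carrier WN" for w
    using that left_module_arith(7)[OF DM(3), of "b (ef w)"] by (simp add: bf(2))
  have "card (carrier WL) * card (carrier L) = (card (carrier WN) * card (carrier WM)) * card (carrier L)"
    using cardP S(7) DL(13) DM(13) DN(13) by (simp add: ac_simps)
  then have "card (carrier WL) = card (carrier WN) * card (carrier WM)"
    using card_carrier_pos[OF DL(5) fin_terms(7)] by simp
  then have card: "card (carrier PL) * card (carrier WL) =
      card (carrier PN) * card (carrier WN) * (card (carrier PM) * card (carrier WM))"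
    using cardP by simp
  have "(chain_map rN rL c bf ef, g) \<in> c1_ses K Q (C_cplx rM) (C_cplx rN) (C_cplx rL)"
    unfolding C(5)
    by (rule conflationI[OF c bf(1) ef(1) C(1-3) ef(2)[symmetric] C(4) c_inj onto ac abf eef card])
  then show ?thesis by (rule rev_image_eqI) simp
qed

lemma mod_ses_snd_homs: "snd ` mod_ses K Q M N L \<subseteq> mod_homs A L M"
  by (auto simp: mod_ses_def)

text \<open>
  Without a nonzero homomorphism \<open>M \<rightarrow> N\<close> the connecting homomorphism vanishes; the sequences of cycles and of
  syzygies are then exact and split, and the homology sequence is short exact.
\<close>
lemma conflation_homology:
  assumes zero: "\<forall>h \<in> module_hom A M N. \<forall>m \<in> carrier M. h m = \<zero>\<^bsub>N\<^esub>"
    and fg: "(f, g) \<in> c1_ses K Q (C_cplx rM) (C_cplx rN) (C_cplx rL)"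
  shows "homology_map L rL rM g \<in> snd ` mod_ses K Q M N L"
    and "mod_iso A PL (direct_sum PM PN)"
    and "\<And>T. fd_module K Q T \<Longrightarrow> card (mod_homs A PL T) = card (mod_homs A PM T) * card (mod_homs A PN T)"
    and "\<And>T. fd_module K Q T \<Longrightarrow> card (mod_homs A WL T) = card (mod_homs A WM T) * card (mod_homs A WN T)"
proof -
  obtain af bf ef ag bg eg where conf: "conflation K Q L M N rL rM rN af bf ef ag bg eg"
    and f: "f = chain_map rN rL af bf ef" and g: "g = chain_map rL rM ag bg eg"
    by (rule conflationE[OF fg]) (rule that)
  interpret conflation K Q L M N rL rM rN af bf ef ag bg eg by (rule conf)
  have P: "short_exact PN af PL ag PM" by (rule cycles_exact[OF zero])
  have W: "short_exact WN ef WL eg WM" by (rule syzygies_exact[OF P])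
  have iso: "mod_iso A (direct_sum PM PN) PL"
    by (rule short_exact_split[OF fd_terms(5,1) DM(1) af ag P])
  show "mod_iso A PL (direct_sum PM PN)"
    by (rule mod_iso_sym[OF iso left_module_direct_sum[OF DM(3) DN(3)] DL(3)])
  show "card (mod_homs A PL T) = card (mod_homs A PM T) * card (mod_homs A PN T)" if "fd_module K Q T" for T
    by (rule card_homs_split(1)[OF fd_terms(5,1) DM(1) af ag P that])
  show "card (mod_homs A WL T) = card (mod_homs A WM T) * card (mod_homs A WN T)" if "fd_module K Q T" for T
    by (rule card_homs_split(1)[OF fd_terms(6,2) DM(2) ef eg W that])
  note Hf = NL.homology_chain_map[OF af bf ef comm_f] and Hg = LM.homology_chain_map[OF ag bg eg comm_g]
  have "short_exact N (homology_map N rN rL f) L (homology_map L rL rM g) M"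
    unfolding f g by (rule homology_exact[OF P mod_homsD(1)[OF Hf(1)] mod_homsD(1)[OF Hg(1)] Hf(2) Hg(2)])
  then have "(homology_map N rN rL f, homology_map L rL rM g) \<in> mod_ses K Q M N L"
    using Hf(1) Hg(1) fd_L fd_M fd_N by (simp add: mod_ses_def f g)
  then show "homology_map L rL rM g \<in> snd ` mod_ses K Q M N L" by (rule rev_image_eqI) simp
qed

text \<open>
  If \<open>P\<^sub>L = P\<^sub>M \<oplus> P\<^sub>N\<close>, then the deflations \<open>C\<^sub>L \<rightarrow> C\<^sub>M\<close> with kernel \<open>C\<^sub>N\<close> are the chain maps whose effect on homology is an epimorphism
  \<open>L \<rightarrow> M\<close> with kernel \<open>N\<close>.  The fibres of this correspondence have \<open>|Hom(P\<^sub>L, \<Omega>\<^sub>M)| |Hom(\<Omega>\<^sub>L, P\<^sub>M)|\<close> elements,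
  which the splittings factor into the contribution of \<open>M\<close>, cancelled by the automorphisms of \<open>C\<^sub>M\<close>, and
  the contribution of \<open>N\<close>, which is the power of \<open>q\<close>.
\<close>
theorem conflation_iff_extension:
  assumes zero: "\<forall>h \<in> module_hom A M N. \<forall>m \<in> carrier M. h m = \<zero>\<^bsub>N\<^esub>"
  shows "c1_ses K Q (C_cplx rM) (C_cplx rN) (C_cplx rL) \<noteq> {} \<longleftrightarrow>
      mod_iso A PL (direct_sum PM PN) \<and> mod_ses K Q M N L \<noteq> {}"
    and "c1_ses K Q (C_cplx rM) (C_cplx rN) (C_cplx rL) \<noteq> {} \<Longrightarrow>
      c1_hall K Q (C_cplx rM) (C_cplx rN) (C_cplx rL) =
        real (card (carrier K)) ^ (hom_dim K Q PN WM + hom_dim K Q WN PM) * mod_hall K Q M N L"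
proof -
  let ?C = "c1_ses K Q (C_cplx rM) (C_cplx rN) (C_cplx rL)"
  have card_of_iso: "card (carrier PL) = card (carrier PM) * card (carrier PN)"
    if "mod_iso A PL (direct_sum PM PN)"
    using that bij_betw_same_card by (fastforce simp: mod_iso_def card_cartesian_product)
  have lifts: "{g \<in> c1_homs K Q (C_cplx rL) (C_cplx rM). homology_map L rL rM g \<in> snd ` mod_ses K Q M N L} \<subseteq> snd ` ?C"
    if iso: "mod_iso A PL (direct_sum PM PN)"
  proof
    fix g assume "g \<in> {g \<in> c1_homs K Q (C_cplx rL) (C_cplx rM). homology_map L rL rM g \<in> snd ` mod_ses K Q M N L}"
    then obtain F G where ses: "(F, G) \<in> mod_ses K Q M N L" and gG: "g \<in> c1_homs K Q (C_cplx rL) (C_cplx rM)"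
      "homology_map L rL rM g = G" by auto
    show "g \<in> snd ` ?C" by (rule horseshoe_conflation[OF ses card_of_iso[OF iso] gG])
  qed
  show "?C \<noteq> {} \<longleftrightarrow> mod_iso A PL (direct_sum PM PN) \<and> mod_ses K Q M N L \<noteq> {}"
  proof
    assume "?C \<noteq> {}"
    then obtain f g where "(f, g) \<in> ?C" by auto
    from conflation_homology(1,2)[OF zero this]
    show "mod_iso A PL (direct_sum PM PN) \<and> mod_ses K Q M N L \<noteq> {}" by auto
  next
    assume R: "mod_iso A PL (direct_sum PM PN) \<and> mod_ses K Q M N L \<noteq> {}"
    then obtain F G where ses: "(F, G) \<in> mod_ses K Q M N L" by auto
    have G: "G \<in> mod_homs A L M" using ses by (simp add: mod_ses_def)
    obtain a e where ae: "a \<in> module_hom A PL PM" "e \<in> module_hom A WL WM"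
      "\<And>p. p \<in> carrier PL \<Longrightarrow> \<pi>M (a p) = G (\<pi>L p)" "\<And>w. w \<in> carrier WL \<Longrightarrow> a (\<delta>L w) = \<delta>M (e w)"
      by (rule LM.lift_hom_syzygy[OF mod_homsD(1)[OF G]]) (rule that)
    note H = LM.homology_chain_map[OF ae(1) hom_zero[OF DM(3)] ae(2,4)]
    have "homology_map L rL rM (chain_map rL rM a (\<lambda>_. \<zero>\<^bsub>PM\<^esub>) e) = G"
    proof (rule LM.mod_homs_eqI[OF H(1) G])
      fix p assume p: "p \<in> carrier PL"
      show "homology_map L rL rM (chain_map rL rM a (\<lambda>_. \<zero>\<^bsub>PM\<^esub>) e) (\<pi>L p) = G (\<pi>L p)"
        using H(2)[OF _ p] ae(3)[OF p] by simp
    qed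
    moreover have "chain_map rL rM a (\<lambda>_. \<zero>\<^bsub>PM\<^esub>) e \<in> c1_homs K Q (C_cplx rL) (C_cplx rM)"
      by (rule LM.chain_mapI[OF ae(1) hom_zero[OF DM(3)] ae(2,4)])
    ultimately have "chain_map rL rM a (\<lambda>_. \<zero>\<^bsub>PM\<^esub>) e \<in> snd ` ?C"
      using horseshoe_conflation[OF ses card_of_iso] R by simp
    then show "?C \<noteq> {}" by auto
  qed
  assume ne: "?C \<noteq> {}"
  then obtain f g where fg: "(f, g) \<in> ?C" by auto
  note H = conflation_homology[OF zero fg]
  have "snd ` ?C = {g \<in> c1_homs K Q (C_cplx rL) (C_cplx rM). homology_map L rL rM g \<in> snd ` mod_ses K Q M N L}"
  proof (intro equalityI subsetI lifts[THEN subsetD, OF H(2)])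
    fix g assume "g \<in> snd ` ?C"
    then obtain f where fg: "(f, g) \<in> ?C" by auto
    then show "g \<in> {g \<in> c1_homs K Q (C_cplx rL) (C_cplx rM). homology_map L rL rM g \<in> snd ` mod_ses K Q M N L}"
      using conflation_homology(1)[OF zero fg] by (simp add: c1_ses_def)
  qed
  then have card_snd: "card (snd ` ?C) = card (snd ` mod_ses K Q M N L) *
      (card (mod_homs A PL WM) * card (mod_homs A WL PM))"
    using LM.card_homology_preimage[OF mod_ses_snd_homs] by simp
  let ?h = "card (mod_homs A PM WM) * card (mod_homs A WM PM)"
  have pos: "?h > 0"
    using finite_homs[OF fd_terms(3,4)] finite_homs[OF fd_terms(4,3)]
      restrict_hom[OF hom_zero[OF DM(4)] DM(3)] restrict_hom[OF hom_zero[OF DM(3)] DM(4)]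
    by (auto simp: card_gt_0_iff)
  have "c1_hall K Q (C_cplx rM) (C_cplx rN) (C_cplx rL) =
      real (card (snd ` mod_ses K Q M N L) * (card (mod_homs A PN WM) * card (mod_homs A WN PM)) * ?h) /
      real (card (mod_auts A M) * ?h)"
    unfolding c1_hall_eq(1)[OF obj] card_snd card_c1_auts_C[OF res_M fd_M] H(3)[OF fd_terms(4)] H(4)[OF fd_terms(3)]
    by (simp add: ac_simps)
  also have "\<dots> = real (card (mod_homs A PN WM) * card (mod_homs A WN PM)) * mod_hall K Q M N L"
    using pos by (simp add: mod_hall_eq[OF fd_M fd_N fd_L])
  also have "card (mod_homs A PN WM) * card (mod_homs A WN PM) =
      card (carrier K) ^ (hom_dim K Q PN WM + hom_dim K Q WN PM)"
    by (simp add: card_homs[OF fd_terms(5,4)] card_homs[OF fd_terms(6,3)] power_add)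
  finally show "c1_hall K Q (C_cplx rM) (C_cplx rN) (C_cplx rL) =
      real (card (carrier K)) ^ (hom_dim K Q PN WM + hom_dim K Q WN PM) * mod_hall K Q M N L" by simp
qed

end

section \<open>Conflations for vanishing extension groups\<close>

lemma submodule_image_of_submodule:
  assumes U: "Module.submodule U R M" and f: "f \<in> module_hom R M N"
    and M: "left_module R M" and N: "left_module R N"
  shows "Module.submodule (f ` U) R N"
proof -
  have "f \<in> module_hom R (M\<lparr>carrier := U\<rparr>) N"
    using f submoduleD(1)[OF U M] by (auto simp: module_hom_def subset_iff)
  from submodule_image[OF this left_module_submodule[OF U M] N] show ?thesis by simp
qed

context conflation
begin

lemma f_hom: "(\<lambda>v. (af (fst v) \<oplus>\<^bsub>PL\<^esub> bf (snd v), ef (snd v))) \<in> module_hom A (direct_sum PN WN) (direct_sum PL WL)"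
  by (intro hom_pair hom_copair af bf DN DL hom_comp[OF hom_snd ef])

lemma f_inj: "inj_on (\<lambda>v. (af (fst v) \<oplus>\<^bsub>PL\<^esub> bf (snd v), ef (snd v))) (carrier (direct_sum PN WN))"
  unfolding inj_on_hom_iff[OF f_hom left_module_direct_sum[OF DN(3,4)] left_module_direct_sum[OF DL(3,4)]]
proof (intro ballI impI)
  fix v assume v: "v \<in> carrier (direct_sum PN WN)"
    "(af (fst v) \<oplus>\<^bsub>PL\<^esub> bf (snd v), ef (snd v)) = \<zero>\<^bsub>direct_sum PL WL\<^esub>"
  then show "v = \<zero>\<^bsub>direct_sum PN WN\<^esub>" using exact_inj[of "fst v" "snd v"] by (auto simp: prod_eq_iff)
qed

lemma factor_through_f:
  assumes h: "h1 \<in> module_hom A X PL" "h2 \<in> module_hom A X WL" and X: "left_module A X"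
    and z: "\<And>x. x \<in> carrier X \<Longrightarrow> ag (h1 x) \<oplus>\<^bsub>PM\<^esub> bg (h2 x) = \<zero>\<^bsub>PM\<^esub>" "\<And>x. x \<in> carrier X \<Longrightarrow> eg (h2 x) = \<zero>\<^bsub>WM\<^esub>"
  obtains k1 k2 where "k1 \<in> module_hom A X PN" "k2 \<in> module_hom A X WN"
    "\<And>x. x \<in> carrier X \<Longrightarrow> h1 x = af (k1 x) \<oplus>\<^bsub>PL\<^esub> bf (k2 x)" "\<And>x. x \<in> carrier X \<Longrightarrow> h2 x = ef (k2 x)"
proof -
  let ?f = "\<lambda>v. (af (fst v) \<oplus>\<^bsub>PL\<^esub> bf (snd v), ef (snd v))"
  note [simp] = hom_rules(1)[OF h(1) X DL(3)] hom_rules(1)[OF h(2) X DL(4)]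
  have im: "(\<lambda>x. (h1 x, h2 x)) ` carrier X \<subseteq> ?f ` carrier (direct_sum PN WN)"
  proof (rule image_subsetI)
    fix x assume x: "x \<in> carrier X"
    obtain n w where nw: "n \<in> carrier PN" "w \<in> carrier WN" "h1 x = af n \<oplus>\<^bsub>PL\<^esub> bf w" "h2 x = ef w"
      using exact_middle[of "h1 x" "h2 x"] x z by auto
    then show "(h1 x, h2 x) \<in> ?f ` carrier (direct_sum PN WN)" by (intro image_eqI[of _ _ "(n, w)"]) simp_all
  qed
  obtain k where k: "k \<in> module_hom A X (direct_sum PN WN)" "\<And>x. x \<in> carrier X \<Longrightarrow> ?f (k x) = (h1 x, h2 x)"
    using factor_through_injection[OF f_hom f_inj hom_pair[OF h] left_module_direct_sum[OF DN(3,4)]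
        left_module_direct_sum[OF DL(3,4)] X im] by auto
  show thesis
    by (rule that[OF hom_comp[OF k(1) hom_fst] hom_comp[OF k(1) hom_snd]]) (use k(2) in simp_all)
qed

text \<open>The image of \<open>N \<rightarrow> L\<close> is zero only if \<open>N\<close> is, since \<open>f(P\<^sub>N)\<close> is a direct summand and so not superfluous in \<open>P\<^sub>L\<close>.\<close>
lemma image_nonzero:
  assumes zero: "\<And>n. n \<in> carrier PN \<Longrightarrow> \<pi>L (af n) = \<zero>\<^bsub>L\<^esub>"
  shows "carrier N = {\<zero>\<^bsub>N\<^esub>}"
proof -
  obtain s1 s2 a where s: "s1 \<in> module_hom A PM PL" "s2 \<in> module_hom A PM WL" "a \<in> module_hom A PM PN"
    and sec: "\<And>p. p \<in> carrier PM \<Longrightarrow> ag (s1 p) \<oplus>\<^bsub>PM\<^esub> bg (s2 p) = p"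
      "\<And>p. p \<in> carrier PM \<Longrightarrow> eg (s2 p) = \<zero>\<^bsub>WM\<^esub>" "\<And>p. p \<in> carrier PM \<Longrightarrow> af (a p) = \<delta>L (s2 p)"
    by (rule cycle_section) (rule that)
  note [simp] = hom_rules[OF s(1) DM(3) DL(3)] hom_rules[OF s(2) DM(3) DL(4)]
  have h1: "(\<lambda>p. p \<ominus>\<^bsub>PL\<^esub> s1 (ag p)) \<in> module_hom A PL PL"
    by (rule hom_minus[OF hom_id hom_comp[OF ag s(1)] DL(3) DL(3)])
  have h2: "(\<lambda>p. \<ominus>\<^bsub>WL\<^esub> s2 (ag p)) \<in> module_hom A PL WL"
    by (rule hom_neg[OF hom_comp[OF ag s(2)] DL(3) DL(4)])
  have z1: "ag (p \<ominus>\<^bsub>PL\<^esub> s1 (ag p)) \<oplus>\<^bsub>PM\<^esub> bg (\<ominus>\<^bsub>WL\<^esub> s2 (ag p)) = \<zero>\<^bsub>PM\<^esub>" if p: "p \<in> carrier PL" for p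
  proof -
    have "ag (p \<ominus>\<^bsub>PL\<^esub> s1 (ag p)) \<oplus>\<^bsub>PM\<^esub> bg (\<ominus>\<^bsub>WL\<^esub> s2 (ag p)) =
        ag p \<ominus>\<^bsub>PM\<^esub> (ag (s1 (ag p)) \<oplus>\<^bsub>PM\<^esub> bg (s2 (ag p)))"
      using p by (simp add: left_module_arith(1,4,5)[OF DM(3)])
    also have "\<dots> = \<zero>\<^bsub>PM\<^esub>" using p by (simp add: sec(1))
    finally show ?thesis .
  qed
  obtain r w where r: "r \<in> module_hom A PL PN" "w \<in> module_hom A PL WN"
    "\<And>p. p \<in> carrier PL \<Longrightarrow> p \<ominus>\<^bsub>PL\<^esub> s1 (ag p) = af (r p) \<oplus>\<^bsub>PL\<^esub> bf (w p)"
    "\<And>p. p \<in> carrier PL \<Longrightarrow> \<ominus>\<^bsub>WL\<^esub> s2 (ag p) = ef (w p)"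
    by (rule factor_through_f[OF h1 h2 DL(3) z1]) (simp_all add: sec(2) that)
  note [simp] = hom_rules[OF r(1) DL(3) DN(3)] hom_rules[OF r(2) DL(3) DN(4)]
  have retr: "r (af n) = n" if n: "n \<in> carrier PN" for n
  proof -
    have "ef (w (af n)) = \<zero>\<^bsub>WL\<^esub>" using r(4)[of "af n", symmetric] n by (simp add: gf_zero(1))
    then have "w (af n) = \<zero>\<^bsub>WN\<^esub>" using ef_zero[of "w (af n)"] n by simp
    then have "af n = af (r (af n))" using r(3)[of "af n"] n by (simp add: gf_zero(1))
    then show ?thesis using af_inj n by (simp add: inj_on_def)
  qed
  have "{p \<in> carrier PL. r p = \<zero>\<^bsub>PN\<^esub>} = carrier PL"
  proof (rule cover_submodule[OF res_L fd_L submodule_kernel[OF r(1) DL(3) DN(3)]])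
    fix p assume p: "p \<in> carrier PL"
    then show "\<exists>u \<in> {p \<in> carrier PL. r p = \<zero>\<^bsub>PN\<^esub>}. \<pi>L u = \<pi>L p"
      by (intro bexI[of _ "p \<ominus>\<^bsub>PL\<^esub> af (r p)"]) (simp_all add: retr zero)
  qed
  then have r0: "r p = \<zero>\<^bsub>PN\<^esub>" if "p \<in> carrier PL" for p using that by blast
  have "n = \<zero>\<^bsub>PN\<^esub>" if n: "n \<in> carrier PN" for n using retr[OF n] r0[of "af n"] n by simp
  then have "carrier PN = {\<zero>\<^bsub>PN\<^esub>}" by auto
  then show ?thesis using DN(9) by simp
qed

text \<open>
  The connecting homomorphism is the obstruction to lifting classes of \<open>M\<close> to cycles of \<open>C\<^sub>L\<close>; its kernel is
  the cokernel of \<open>N \<rightarrow> L\<close>.  The section \<open>(s\<^sub>1, s\<^sub>2)\<close> chooses cycles over this kernel, but on a boundary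
  \<open>\<delta>\<^sub>M w\<close> the choice differs from a boundary by a class \<open>\<beta> w\<close> of \<open>N\<close>.  If \<open>\<beta>: \<Omega>\<^sub>M \<rightarrow> N\<close> extends to \<open>P\<^sub>M\<close>,
  subtracting the extension from \<open>s\<^sub>1\<close> makes the choice a homomorphism from the kernel to \<open>L\<close>, whose image is
  the complement.
\<close>
lemma image_has_complement:
  assumes extend: "\<forall>b \<in> module_hom A WM N. \<exists>h \<in> module_hom A PM N. \<forall>w \<in> carrier WM. h (\<delta>M w) = b w"
  shows "\<exists>V. Module.submodule V A L \<and> ((\<lambda>n. \<pi>L (af n)) ` carrier PN) \<inter> V = {\<zero>\<^bsub>L\<^esub>} \<and>
    ((\<lambda>n. \<pi>L (af n)) ` carrier PN) <+>\<^bsub>L\<^esub> V = carrier L"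
proof -
  let ?U = "(\<lambda>n. \<pi>L (af n)) ` carrier PN"
  obtain s1 s2 a where s: "s1 \<in> module_hom A PM PL" "s2 \<in> module_hom A PM WL" "a \<in> module_hom A PM PN"
    and sec: "\<And>p. p \<in> carrier PM \<Longrightarrow> ag (s1 p) \<oplus>\<^bsub>PM\<^esub> bg (s2 p) = p"
      "\<And>p. p \<in> carrier PM \<Longrightarrow> eg (s2 p) = \<zero>\<^bsub>WM\<^esub>" "\<And>p. p \<in> carrier PM \<Longrightarrow> af (a p) = \<delta>L (s2 p)"
    by (rule cycle_section) (rule that)
  note [simp] = hom_rules[OF s(1) DM(3) DL(3)] hom_rules[OF s(2) DM(3) DL(4)]
  \<comment> \<open>On a boundary \<open>\<delta>\<^sub>M w\<close> the section takes the boundary value \<open>\<delta>\<^sub>L (t w)\<close> up to the image of \<open>(\<beta> w, \<epsilon> w)\<close>.\<close>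
  obtain t where t: "t \<in> module_hom A WM WL" "\<And>w. w \<in> carrier WM \<Longrightarrow> eg (t w) = w"
    using projective_lift[OF DM(2) fd_terms(2,4) eg hom_id] eg_onto by auto
  note [simp] = hom_rules[OF t(1) DM(4) DL(4)]
  have h1: "(\<lambda>w. s1 (\<delta>M w) \<ominus>\<^bsub>PL\<^esub> \<delta>L (t w)) \<in> module_hom A WM PL"
    by (rule hom_minus[OF hom_comp[OF DM(6) s(1)] hom_comp[OF t(1) DL(6)] DM(4) DL(3)])
  have z1: "ag (s1 (\<delta>M w) \<ominus>\<^bsub>PL\<^esub> \<delta>L (t w)) \<oplus>\<^bsub>PM\<^esub> bg (s2 (\<delta>M w)) = \<zero>\<^bsub>PM\<^esub>" if w: "w \<in> carrier WM" for w
  proof -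
    have "ag (s1 (\<delta>M w) \<ominus>\<^bsub>PL\<^esub> \<delta>L (t w)) \<oplus>\<^bsub>PM\<^esub> bg (s2 (\<delta>M w)) =
        (ag (s1 (\<delta>M w)) \<oplus>\<^bsub>PM\<^esub> bg (s2 (\<delta>M w))) \<ominus>\<^bsub>PM\<^esub> \<delta>M w"
      using w by (simp add: comm_g t(2) left_module_arith(1-4)[OF DM(3)])
    also have "\<dots> = \<zero>\<^bsub>PM\<^esub>" using w by (simp add: sec(1))
    finally show ?thesis .
  qed
  obtain \<beta> \<epsilon> where be: "\<beta> \<in> module_hom A WM PN" "\<epsilon> \<in> module_hom A WM WN"
    "\<And>w. w \<in> carrier WM \<Longrightarrow> s1 (\<delta>M w) \<ominus>\<^bsub>PL\<^esub> \<delta>L (t w) = af (\<beta> w) \<oplus>\<^bsub>PL\<^esub> bf (\<epsilon> w)"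
    "\<And>w. w \<in> carrier WM \<Longrightarrow> s2 (\<delta>M w) = ef (\<epsilon> w)"
    by (rule factor_through_f[OF h1 hom_comp[OF DM(6) s(2)] DM(4) z1]) (simp_all add: sec(2) that)
  note [simp] = hom_rules[OF be(1) DM(4) DN(3)] hom_rules[OF be(2) DM(4) DN(4)]
  \<comment> \<open>The extension \<open>h\<close> of the class of \<open>\<beta>\<close> to \<open>P\<^sub>M\<close>, lifted to \<open>k: P\<^sub>M \<rightarrow> P\<^sub>N\<close>, corrects the section.\<close>
  obtain h where h: "h \<in> module_hom A PM N" "\<And>w. w \<in> carrier WM \<Longrightarrow> h (\<delta>M w) = \<pi>N (\<beta> w)"
    using bspec[OF extend hom_comp[OF be(1) DN(7)]] by auto
  have "h ` carrier PM \<subseteq> \<pi>N ` carrier PN" unfolding DN(9) using hom_rules(1)[OF h(1) DM(3) DN(5)] by auto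
  then obtain k where k: "k \<in> module_hom A PM PN" "\<And>p. p \<in> carrier PM \<Longrightarrow> \<pi>N (k p) = h p"
    using projective_lift[OF DM(1) fd_terms(5) fd_N DN(7) h(1)] by auto
  note [simp] = hom_rules[OF k(1) DM(3) DN(3)]
  define s' where "s' p = s1 p \<ominus>\<^bsub>PL\<^esub> af (k p)" for p
  have s': "s' \<in> module_hom A PM PL"
    using hom_minus[OF s(1) hom_comp[OF k(1) af] DM(3) DL(3)] by (simp add: s'_def[abs_def])
  note [simp] = hom_rules[OF s' DM(3) DL(3)]
  have sec': "ag (s' p) \<oplus>\<^bsub>PM\<^esub> bg (s2 p) = p" if "p \<in> carrier PM" for p
    using that sec(1)[OF that] by (simp add: s'_def gf_zero(1))
  have boundary: "\<exists>v \<in> carrier WL. s' (\<delta>M w) \<ominus>\<^bsub>PL\<^esub> bf (\<epsilon> w) = \<delta>L v" if w: "w \<in> carrier WM" for w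
  proof -
    have mem: "\<beta> w \<ominus>\<^bsub>PN\<^esub> k (\<delta>M w) \<in> carrier PN" using w by simp
    have "\<pi>N (\<beta> w \<ominus>\<^bsub>PN\<^esub> k (\<delta>M w)) = \<zero>\<^bsub>N\<^esub>" using w by (simp add: k(2) h(2))
    then obtain u where u: "u \<in> carrier WN" "\<beta> w \<ominus>\<^bsub>PN\<^esub> k (\<delta>M w) = \<delta>N u" using DN(10)[OF mem] by auto
    have "s1 (\<delta>M w) = (af (\<beta> w) \<oplus>\<^bsub>PL\<^esub> bf (\<epsilon> w)) \<oplus>\<^bsub>PL\<^esub> \<delta>L (t w)"
      using be(3)[OF w] w
        left_module_move(2)[OF DL(3), of "s1 (\<delta>M w)" "\<delta>L (t w)" "af (\<beta> w) \<oplus>\<^bsub>PL\<^esub> bf (\<epsilon> w)"] by simp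
    then have "s' (\<delta>M w) \<ominus>\<^bsub>PL\<^esub> bf (\<epsilon> w) =
        ((af (\<beta> w) \<oplus>\<^bsub>PL\<^esub> bf (\<epsilon> w)) \<oplus>\<^bsub>PL\<^esub> \<delta>L (t w)) \<ominus>\<^bsub>PL\<^esub> af (k (\<delta>M w)) \<ominus>\<^bsub>PL\<^esub> bf (\<epsilon> w)"
      by (simp add: s'_def)
    also have "\<dots> = \<delta>L (t w) \<oplus>\<^bsub>PL\<^esub> (af (\<beta> w) \<ominus>\<^bsub>PL\<^esub> af (k (\<delta>M w)))"
      using w by (simp add: left_module_arith[OF DL(3)] left_module_cancel[OF DL(3)])
    also have "af (\<beta> w) \<ominus>\<^bsub>PL\<^esub> af (k (\<delta>M w)) = af (\<beta> w \<ominus>\<^bsub>PN\<^esub> k (\<delta>M w))" using w by simp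
    also have "\<dots> = \<delta>L (ef u)" unfolding u(2) by (rule comm_f[OF u(1)])
    also have "\<delta>L (t w) \<oplus>\<^bsub>PL\<^esub> \<delta>L (ef u) = \<delta>L (t w \<oplus>\<^bsub>WL\<^esub> ef u)" using w u(1) by simp
    finally show ?thesis using w u(1) by (intro bexI[of _ "t w \<oplus>\<^bsub>WL\<^esub> ef u"]) simp_all
  qed

  note lD = left_module_direct_sum[OF DM(3) DN(4)]
  have zh: "(\<lambda>v. s2 (fst v) \<oplus>\<^bsub>WL\<^esub> ef (snd v)) \<in> module_hom A (direct_sum PM WN) WL"
    by (rule hom_copair[OF s(2) ef DM(3) DN(4) DL(4)])
  have vh: "(\<lambda>v. \<pi>L (s' (fst v) \<oplus>\<^bsub>PL\<^esub> bf (snd v))) \<in> module_hom A (direct_sum PM WN) L"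
    by (rule hom_comp[OF hom_copair[OF s' bf DM(3) DN(4) DL(3)] DL(7)])
  let ?Z = "{v \<in> carrier (direct_sum PM WN). s2 (fst v) \<oplus>\<^bsub>WL\<^esub> ef (snd v) = \<zero>\<^bsub>WL\<^esub>}"
  let ?V = "(\<lambda>v. \<pi>L (s' (fst v) \<oplus>\<^bsub>PL\<^esub> bf (snd v))) ` ?Z"
  have V: "Module.submodule ?V A L"
    by (rule submodule_image_of_submodule[OF submodule_kernel[OF zh lD DL(4)] vh lD DL(5)])
  have U: "Module.submodule ?U A L" by (rule submodule_image[OF hom_comp[OF af DL(7)] DN(3) DL(5)])
  \<comment> \<open>If a chosen cycle over \<open>p\<close> has its class in the image of \<open>N\<close>, then \<open>p\<close> is a boundary \<open>\<delta>\<^sub>M w\<close>, where the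
    corrected section takes boundary values.\<close>
  have "?U \<inter> ?V \<subseteq> {\<zero>\<^bsub>L\<^esub>}"
  proof
    fix x assume x: "x \<in> ?U \<inter> ?V"
    then obtain n where n: "n \<in> carrier PN" "x = \<pi>L (af n)" by auto
    from x obtain v where "v \<in> ?Z" "x = \<pi>L (s' (fst v) \<oplus>\<^bsub>PL\<^esub> bf (snd v))" by blast
    then obtain p u where pu: "p \<in> carrier PM" "u \<in> carrier WN" "s2 p \<oplus>\<^bsub>WL\<^esub> ef u = \<zero>\<^bsub>WL\<^esub>"
      "x = \<pi>L (s' p \<oplus>\<^bsub>PL\<^esub> bf u)" by auto
    let ?z = "s' p \<oplus>\<^bsub>PL\<^esub> bf u"
    have mem: "?z \<ominus>\<^bsub>PL\<^esub> af n \<in> carrier PL" using pu n by simp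
    have "\<pi>L (?z \<ominus>\<^bsub>PL\<^esub> af n) = \<pi>L ?z \<ominus>\<^bsub>L\<^esub> \<pi>L (af n)" using pu(1,2) n(1) by simp
    also have "\<dots> = \<zero>\<^bsub>L\<^esub>" unfolding pu(4)[symmetric] n(2)[symmetric] using n by simp
    finally obtain v where v: "v \<in> carrier WL" "?z \<ominus>\<^bsub>PL\<^esub> af n = \<delta>L v" using DL(10)[OF mem] by auto
    have s2p: "s2 p = \<ominus>\<^bsub>WL\<^esub> ef u" using left_module_move(3)[OF DL(4), of "s2 p" "ef u"] pu by simp
    have agbf: "ag (bf u) = bg (s2 p)"
    proof -
      have "bg (s2 p) = \<ominus>\<^bsub>PM\<^esub> bg (ef u)" using pu(2) by (simp add: s2p)
      then show ?thesis using left_module_move(3)[OF DM(3), of "ag (bf u)" "bg (ef u)"] gf_zero(2)[OF pu(2)] pu(2) by simp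
    qed
    have "\<delta>M (eg v) = ag (?z \<ominus>\<^bsub>PL\<^esub> af n)" using v comm_g by simp
    also have "\<dots> = ag (s' p) \<oplus>\<^bsub>PM\<^esub> bg (s2 p)" using pu(1,2) n(1) agbf by (simp add: gf_zero(1))
    also have "\<dots> = p" by (rule sec'[OF pu(1)])
    finally have p: "p = \<delta>M (eg v)" by simp
    let ?w = "eg v"
    have w: "?w \<in> carrier WM" using v by simp
    have "ef (\<epsilon> ?w \<oplus>\<^bsub>WN\<^esub> u) = \<zero>\<^bsub>WL\<^esub>" using be(4)[OF w] pu(2,3) w p by simp
    then have "\<epsilon> ?w \<oplus>\<^bsub>WN\<^esub> u = \<zero>\<^bsub>WN\<^esub>" using ef_zero[of "\<epsilon> ?w \<oplus>\<^bsub>WN\<^esub> u"] w pu(2) by simp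
    then have "\<epsilon> ?w = \<ominus>\<^bsub>WN\<^esub> u" using left_module_move(3)[OF DN(4), of "\<epsilon> ?w" u] w pu(2) by simp
    then have "?z = s' (\<delta>M ?w) \<ominus>\<^bsub>PL\<^esub> bf (\<epsilon> ?w)" using p pu(2) by (simp add: left_module_arith(4)[OF DL(3)])
    then obtain v' where "v' \<in> carrier WL" "?z = \<delta>L v'" using boundary[OF w] by auto
    then show "x \<in> {\<zero>\<^bsub>L\<^esub>}" using pu(4) by simp
  qed
  moreover have "\<zero>\<^bsub>L\<^esub> \<in> ?U \<inter> ?V" using submoduleD(2)[OF U DL(5)] submoduleD(2)[OF V DL(5)] by (rule IntI)
  ultimately have inter: "?U \<inter> ?V = {\<zero>\<^bsub>L\<^esub>}" by (intro equalityI) simp_all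
  have "x \<in> ?U <+>\<^bsub>L\<^esub> ?V" if x: "x \<in> carrier L" for x
  proof -
    have "x \<in> \<pi>L ` carrier PL" unfolding DL(9) by (rule x)
    then obtain z where z: "z \<in> carrier PL" "x = \<pi>L z" by auto
    let ?p = "ag z"
    have "ag (z \<ominus>\<^bsub>PL\<^esub> s' ?p) \<oplus>\<^bsub>PM\<^esub> bg (\<ominus>\<^bsub>WL\<^esub> s2 ?p) = ?p \<ominus>\<^bsub>PM\<^esub> (ag (s' ?p) \<oplus>\<^bsub>PM\<^esub> bg (s2 ?p))"
      using z by (simp add: left_module_arith(1,4,5)[OF DM(3)])
    also have "\<dots> = \<zero>\<^bsub>PM\<^esub>" using z by (simp add: sec')
    finally obtain n w where nw: "n \<in> carrier PN" "w \<in> carrier WN" "z \<ominus>\<^bsub>PL\<^esub> s' ?p = af n \<oplus>\<^bsub>PL\<^esub> bf w" "\<ominus>\<^bsub>WL\<^esub> s2 ?p = ef w"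
      using exact_middle[of "z \<ominus>\<^bsub>PL\<^esub> s' ?p" "\<ominus>\<^bsub>WL\<^esub> s2 ?p"] z sec(2)[of ?p] by auto
    have "z = (af n \<oplus>\<^bsub>PL\<^esub> bf w) \<oplus>\<^bsub>PL\<^esub> s' ?p"
      using left_module_move(2)[OF DL(3) z(1), of "s' ?p" "af n \<oplus>\<^bsub>PL\<^esub> bf w"] z nw by simp
    also have "\<dots> = af n \<oplus>\<^bsub>PL\<^esub> (s' ?p \<oplus>\<^bsub>PL\<^esub> bf w)"
      using z nw by (simp add: left_module_arith(1-3)[OF DL(3)])
    finally have "\<pi>L z = \<pi>L (af n \<oplus>\<^bsub>PL\<^esub> (s' ?p \<oplus>\<^bsub>PL\<^esub> bf w))" by (rule arg_cong)
    also have "\<dots> = \<pi>L (af n) \<oplus>\<^bsub>L\<^esub> \<pi>L (s' ?p \<oplus>\<^bsub>PL\<^esub> bf w)"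
      by (rule hom_rules(2)[OF DL(7,3,5)]) (use z(1) nw(1,2) in simp_all)
    finally have xz: "x = \<pi>L (af n) \<oplus>\<^bsub>L\<^esub> \<pi>L (s' ?p \<oplus>\<^bsub>PL\<^esub> bf w)" unfolding z(2) .
    have "(?p, w) \<in> ?Z" using z nw(2) left_module_arith(6)[OF DL(4), of "s2 ?p"] by (simp add: nw(4)[symmetric])
    then have "\<pi>L (s' ?p \<oplus>\<^bsub>PL\<^esub> bf w) \<in> ?V" by (rule rev_image_eqI) simp
    then show ?thesis unfolding set_add_def' xz by (intro UN_I[OF imageI[OF nw(1)]]) (rule UN_I, assumption, simp)
  qed
  moreover have "?U <+>\<^bsub>L\<^esub> ?V \<subseteq> carrier L"
    unfolding set_add_def'
    by (intro UN_least) (use subsetD[OF submoduleD(1)[OF U DL(5)]] subsetD[OF submoduleD(1)[OF V DL(5)]] in simp)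
  ultimately have "?U <+>\<^bsub>L\<^esub> ?V = carrier L" by (intro equalityI subsetI) auto
  then show ?thesis using V inter by (intro exI[of _ ?V] conjI)
qed

text \<open>
  The image of \<open>N \<rightarrow> L\<close> is a nonzero direct summand of the indecomposable module \<open>L\<close>, so that \<open>N \<rightarrow> L\<close> is onto.
  By minimality \<open>P\<^sub>N \<rightarrow> P\<^sub>L\<close> is onto as well, hence \<open>a\<^sub>g = 0\<close>.  Then \<open>\<delta>\<^sub>M e\<^sub>g = a\<^sub>g \<delta>\<^sub>L = 0\<close> shows that \<open>\<Omega>\<^sub>M = 0\<close>, and
  \<open>P\<^sub>M\<close> is the image of \<open>\<Omega>\<^sub>L\<close> under \<open>b\<^sub>g\<close>.
\<close>
lemma rigid_conflation:
  assumes extend: "\<forall>b \<in> module_hom A WM N. \<exists>h \<in> module_hom A PM N. \<forall>w \<in> carrier WM. h (\<delta>M w) = b w"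
    and indec: "indecomposable A L" and nonzero: "carrier N \<noteq> {\<zero>\<^bsub>N\<^esub>}"
  shows "af ` carrier PN = carrier PL" "carrier WM = {\<zero>\<^bsub>WM\<^esub>}" "short_exact WN ef WL bg PM"
proof -
  let ?U = "(\<lambda>n. \<pi>L (af n)) ` carrier PN"
  have U: "Module.submodule ?U A L" by (rule submodule_image[OF hom_comp[OF af DL(7)] DN(3) DL(5)])
  obtain V where V: "Module.submodule V A L" "?U \<inter> V = {\<zero>\<^bsub>L\<^esub>}" "?U <+>\<^bsub>L\<^esub> V = carrier L"
    using image_has_complement[OF extend] by auto
  have "?U \<noteq> {\<zero>\<^bsub>L\<^esub>}"
  proof
    assume "?U = {\<zero>\<^bsub>L\<^esub>}"
    then have "\<pi>L (af n) = \<zero>\<^bsub>L\<^esub>" if "n \<in> carrier PN" for n using that by blast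
    then show False using image_nonzero nonzero by blast
  qed
  then have V0: "V = {\<zero>\<^bsub>L\<^esub>}" using indec U V unfolding indecomposable_def by metis
  have UL: "\<exists>n \<in> carrier PN. x = \<pi>L (af n)" if x: "x \<in> carrier L" for x
  proof -
    have "x \<in> ?U <+>\<^bsub>L\<^esub> {\<zero>\<^bsub>L\<^esub>}" using V(3) V0 x by simp
    then show ?thesis unfolding set_add_def' by auto
  qed
  show af_onto: "af ` carrier PN = carrier PL"
  proof (rule cover_submodule[OF res_L fd_L submodule_image[OF af DN(3) DL(3)]])
    fix p assume "p \<in> carrier PL"
    then obtain n where "n \<in> carrier PN" "\<pi>L p = \<pi>L (af n)" using UL[of "\<pi>L p"] by auto
    then show "\<exists>u \<in> af ` carrier PN. \<pi>L u = \<pi>L p" by (intro bexI[of _ "af n"]) simp_all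
  qed
  have ag0: "ag p = \<zero>\<^bsub>PM\<^esub>" if "p \<in> carrier PL" for p
  proof -
    have "p \<in> af ` carrier PN" unfolding af_onto by (rule that)
    then show ?thesis using gf_zero(1) by auto
  qed
  have W0: "w = \<zero>\<^bsub>WM\<^esub>" if w: "w \<in> carrier WM" for w
  proof -
    have "w \<in> eg ` carrier WL" unfolding eg_onto by (rule w)
    then obtain v where v: "v \<in> carrier WL" "w = eg v" by auto
    then have "\<delta>M w = \<zero>\<^bsub>PM\<^esub>" using comm_g[OF v(1)] ag0[of "\<delta>L v"] by simp
    then show ?thesis using w by simp
  qed
  then show "carrier WM = {\<zero>\<^bsub>WM\<^esub>}" by auto
  have "p \<in> bg ` carrier WL" if p: "p \<in> carrier PM" for p
  proof -
    obtain p' v where "p' \<in> carrier PL" "v \<in> carrier WL" "ag p' \<oplus>\<^bsub>PM\<^esub> bg v = p"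
      by (rule exact_onto[of p "\<zero>\<^bsub>WM\<^esub>"]) (use p that in simp_all)
    then show ?thesis using ag0 by auto
  qed
  then have "bg ` carrier WL = carrier PM" by auto
  moreover have "v \<in> ef ` carrier WN \<longleftrightarrow> bg v = \<zero>\<^bsub>PM\<^esub>" if v: "v \<in> carrier WL" for v
  proof
    assume "v \<in> ef ` carrier WN"
    then obtain w where w: "w \<in> carrier WN" "v = ef w" by auto
    then show "bg v = \<zero>\<^bsub>PM\<^esub>" using gf_zero(2)[OF w(1)] ag0[of "bf w"] by simp
  next
    assume z: "bg v = \<zero>\<^bsub>PM\<^esub>"
    have "ag \<zero>\<^bsub>PL\<^esub> \<oplus>\<^bsub>PM\<^esub> bg v = \<zero>\<^bsub>PM\<^esub> \<and> eg v = \<zero>\<^bsub>WM\<^esub>" using z W0[of "eg v"] v by simp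
    then show "v \<in> ef ` carrier WN" using exact_middle[of "\<zero>\<^bsub>PL\<^esub>" v] v by auto
  qed
  then have "v \<in> ef ` carrier WN \<longleftrightarrow> v \<in> {v \<in> carrier WL. bg v = \<zero>\<^bsub>PM\<^esub>}" for v
    by (cases "v \<in> carrier WL") auto
  then have "ef ` carrier WN = {v \<in> carrier WL. bg v = \<zero>\<^bsub>PM\<^esub>}" by (rule Set.set_eqI)
  ultimately show "short_exact WN ef WL bg PM" using ef_inj by (simp add: short_exact_def)
qed

text \<open>
  The kernel of \<open>N \<rightarrow> L\<close> consists of the classes in \<open>N\<close> of \<open>\<delta>\<^sub>L(\<Omega>\<^sub>L)\<close>, pulled back along the isomorphism
  \<open>P\<^sub>N \<rightarrow> P\<^sub>L\<close>.  As a module it is \<open>\<Omega>\<^sub>L / \<Omega>\<^sub>N = P\<^sub>M = M\<close>, and its embedding \<open>\<phi>: M \<rightarrow> N\<close> is the connecting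
  homomorphism.
\<close>
lemma rigid_homology:
  assumes af_onto: "af ` carrier PN = carrier PL" and W0: "carrier WM = {\<zero>\<^bsub>WM\<^esub>}"
    and W: "short_exact WN ef WL bg PM"
  shows "homology_map N rN rL (chain_map rN rL af bf ef) \<in> snd ` mod_ses K Q L M N"
proof -
  let ?F = "homology_map N rN rL (chain_map rN rL af bf ef)"
  note H = NL.homology_chain_map[OF af bf ef comm_f]
  have F: "?F \<in> module_hom A N L" using H(1) by (rule mod_homsD)
  obtain j where j: "j \<in> module_hom A PL PN" "\<And>x. x \<in> carrier PL \<Longrightarrow> af (j x) = x"
    using factor_through_injection[OF af af_inj hom_id DN(3) DL(3) DL(3)] af_onto by auto
  note [simp] = hom_rules[OF j(1) DL(3) DN(3)] hom_rules[OF F DN(5) DL(5)]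
  have jaf: "j (af n) = n" if n: "n \<in> carrier PN" for n
    by (rule inj_onD[OF af_inj]) (use n j(2)[of "af n"] in simp_all)
  have bg_onto: "bg ` carrier WL = carrier PM" and Wker: "ef ` carrier WN = {v \<in> carrier WL. bg v = \<zero>\<^bsub>PM\<^esub>}"
    using W by (auto simp: short_exact_def)
  have piM: "\<pi>M p = \<zero>\<^bsub>M\<^esub> \<longleftrightarrow> p = \<zero>\<^bsub>PM\<^esub>" if "p \<in> carrier PM" for p
    using DM(10)[OF that] W0 by auto
  have M_onto: "(\<lambda>v. \<pi>M (bg v)) ` carrier WL = carrier M"
  proof -
    have "(\<lambda>v. \<pi>M (bg v)) ` carrier WL = \<pi>M ` (bg ` carrier WL)" by (simp add: image_image)
    then show ?thesis unfolding bg_onto DM(9) .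
  qed
  have ker: "\<exists>w \<in> carrier WN. v = ef w" if v: "v \<in> carrier WL" "bg v = \<zero>\<^bsub>PM\<^esub>" for v
  proof -
    have "v \<in> ef ` carrier WN" unfolding Wker using v by simp
    then show ?thesis by auto
  qed
  have psi0: "\<pi>N (j (\<delta>L v)) = \<zero>\<^bsub>N\<^esub>" if v: "v \<in> carrier WL" "\<pi>M (bg v) = \<zero>\<^bsub>M\<^esub>" for v
  proof -
    obtain w where w: "w \<in> carrier WN" "v = ef w" using ker[OF v(1)] v piM[of "bg v"] by auto
    then have "\<delta>L v = af (\<delta>N w)" using comm_f by simp
    then show ?thesis using w jaf[of "\<delta>N w"] by simp
  qed
  obtain \<phi> where \<phi>: "\<phi> \<in> module_hom A M N" "\<And>v. v \<in> carrier WL \<Longrightarrow> \<phi> (\<pi>M (bg v)) = \<pi>N (j (\<delta>L v))"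
    using factor_through_surjection[OF hom_comp[OF bg DM(7)] M_onto hom_comp[OF hom_comp[OF DL(6) j(1)] DN(7)]
        DM(5) DL(4) DN(5) psi0] by auto
  have ex: "\<exists>v \<in> carrier WL. m = \<pi>M (bg v)" if "m \<in> carrier M" for m
  proof -
    have "m \<in> (\<lambda>v. \<pi>M (bg v)) ` carrier WL" unfolding M_onto by (rule that)
    then show ?thesis by auto
  qed
  have "short_exact M \<phi> N ?F L"
  proof (rule short_exactI_card[OF \<phi>(1) F DM(5) DN(5) DL(5) fin_terms(9)])
    show "inj_on \<phi> (carrier M)"
      unfolding inj_on_hom_iff[OF \<phi>(1) DM(5) DN(5)]
    proof (intro ballI impI)
      fix m assume m: "m \<in> carrier M" "\<phi> m = \<zero>\<^bsub>N\<^esub>"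
      then obtain v where v: "v \<in> carrier WL" "m = \<pi>M (bg v)" using ex by auto
      have "\<pi>N (j (\<delta>L v)) = \<zero>\<^bsub>N\<^esub>" using \<phi>(2)[OF v(1)] m(2) v(2) by simp
      then obtain w where w: "w \<in> carrier WN" "j (\<delta>L v) = \<delta>N w" using DN(10)[of "j (\<delta>L v)"] v(1) by auto
      have "\<delta>L v = \<delta>L (ef w)" using j(2)[of "\<delta>L v"] v(1) w comm_f by simp
      then have "v = ef w" using NL.delta_eq_iff[of v "ef w"] v(1) w(1) by simp
      then have "v \<in> {v \<in> carrier WL. bg v = \<zero>\<^bsub>PM\<^esub>}" unfolding Wker[symmetric] using w(1) by simp
      then show "m = \<zero>\<^bsub>M\<^esub>" using v(2) by simp
    qed
    have "carrier L \<subseteq> ?F ` carrier N"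
    proof
      fix x assume "x \<in> carrier L"
      then have "x \<in> \<pi>L ` carrier PL" unfolding DL(9) .
      then have "x \<in> \<pi>L ` (af ` carrier PN)" unfolding af_onto .
      then obtain n where n: "n \<in> carrier PN" "x = \<pi>L (af n)" by auto
      then show "x \<in> ?F ` carrier N" using H(2)[OF _ n(1)] by (intro image_eqI[of _ _ "\<pi>N n"]) simp_all
    qed
    then show "?F ` carrier N = carrier L" by auto
    show "?F (\<phi> m) = \<zero>\<^bsub>L\<^esub>" if m: "m \<in> carrier M" for m
    proof -
      obtain v where v: "v \<in> carrier WL" "m = \<pi>M (bg v)" using ex[OF m] by auto
      have "?F (\<phi> m) = \<pi>L (af (j (\<delta>L v)))" using \<phi>(2)[OF v(1)] H(2)[of "j (\<delta>L v)"] v by simp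
      then show ?thesis using v(1) j(2)[of "\<delta>L v"] by simp
    qed
    have "card (carrier PL) = card (carrier PN)" using card_image[OF af_inj] af_onto by simp
    moreover have "card (carrier WL) = card (carrier WN) * card (carrier PM)"
      by (rule card_short_exact[OF ef bg DL(4) DM(3) fin_terms(2) W])
    ultimately have "card (carrier WN) * card (carrier N) = card (carrier WN) * (card (carrier M) * card (carrier L))"
      using DL(13) DM(13) DN(13) W0 by (auto simp: mult.commute mult.left_commute)
    then show "card (carrier N) = card (carrier M) * card (carrier L)"
      using card_carrier_pos[OF DN(4) fin_terms(6)] by simp
  qed
  moreover have "restrict \<phi> (carrier M) \<in> mod_homs A M N" by (rule restrict_hom[OF \<phi>(1) DM(5)])
  moreover have "short_exact M (restrict \<phi> (carrier M)) N ?F L \<longleftrightarrow> short_exact M \<phi> N ?F L"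
    by (simp add: short_exact_def inj_on_restrict_eq)
  ultimately have "(restrict \<phi> (carrier M), ?F) \<in> mod_ses K Q L M N"
    using H(1) fd_L fd_M fd_N by (simp add: mod_ses_def)
  then show ?thesis by (rule rev_image_eqI) simp
qed

end

context finite_path_algebra
begin

lemma mod_ses_nonempty_iff:
  assumes L: "fd_module K Q L" and M: "fd_module K Q M" and N: "fd_module K Q N"
  shows "mod_ses K Q L M N \<noteq> {} \<longleftrightarrow>
    (\<exists>f \<in> module_hom A M N. inj_on f (carrier M) \<and> mod_iso A (coker M N f) L)"
proof
  assume "mod_ses K Q L M N \<noteq> {}"
  then obtain f g where fg: "f \<in> module_hom A M N" "g \<in> module_hom A N L" "short_exact M f N g L"
    by (auto simp: mod_ses_def mod_homs_def)
  have "mod_iso A (coker M N f) L"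
    unfolding coker_iso_iff[OF fg(1) fdD(1)[OF M] fdD(1)[OF N] fdD(1)[OF L]]
    using fg(2,3) by (intro bexI[of _ g]) (simp_all add: short_exact_def)
  then show "\<exists>f \<in> module_hom A M N. inj_on f (carrier M) \<and> mod_iso A (coker M N f) L"
    using fg(1,3) by (intro bexI[of _ f]) (simp_all add: short_exact_def)
next
  assume "\<exists>f \<in> module_hom A M N. inj_on f (carrier M) \<and> mod_iso A (coker M N f) L"
  then obtain f where f: "f \<in> module_hom A M N" "inj_on f (carrier M)" "mod_iso A (coker M N f) L" by auto
  obtain g where g: "g \<in> module_hom A N L" "g ` carrier N = carrier L" "{x \<in> carrier N. g x = \<zero>\<^bsub>L\<^esub>} = f ` carrier M"
    using f(3) unfolding coker_iso_iff[OF f(1) fdD(1)[OF M] fdD(1)[OF N] fdD(1)[OF L]] by auto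
  have "{x \<in> carrier N. restrict g (carrier N) x = \<zero>\<^bsub>L\<^esub>} = {x \<in> carrier N. g x = \<zero>\<^bsub>L\<^esub>}" by auto
  then have "short_exact M (restrict f (carrier M)) N (restrict g (carrier N)) L"
    unfolding short_exact_def using f(2) g(2,3) by (simp add: inj_on_restrict_eq)
  then have "(restrict f (carrier M), restrict g (carrier N)) \<in> mod_ses K Q L M N"
    using restrict_hom[OF f(1) fdD(1)[OF M]] restrict_hom[OF g(1) fdD(1)[OF N]] L M N by (simp add: mod_ses_def)
  then show "mod_ses K Q L M N \<noteq> {}" by auto
qed

end

context three_resolutions
begin

section \<open>Quotients of a module by a submodule\<close>

text \<open>
  Equality of the cardinalities forces \<open>\<Omega>\<^sub>M = 0\<close>, since a lift \<open>a: P\<^sub>N \<rightarrow> P\<^sub>L\<close> of an epimorphism \<open>N \<rightarrow> L\<close>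
  is onto.  Then \<open>a\<close> is bijective, and \<open>M = P\<^sub>M\<close> is the cokernel of \<open>\<Omega>\<^sub>N \<rightarrow> \<Omega>\<^sub>L\<close> by the snake lemma.
\<close>
lemma quotient_conflation:
  assumes ses: "(\<phi>, F) \<in> mod_ses K Q L M N"
    and cardP: "card (carrier PL) * card (carrier WL) =
      card (carrier PM) * card (carrier PN) * card (carrier WM) * card (carrier WN)"
    and f: "f \<in> c1_homs K Q (C_cplx rN) (C_cplx rL)" and hom: "homology_map N rN rL f = F"
  shows "f \<in> fst ` c1_ses K Q (C_cplx rM) (C_cplx rN) (C_cplx rL)"
proof -
  have \<phi>: "\<phi> \<in> module_hom A M N" and F: "F \<in> module_hom A N L" and ex: "short_exact M \<phi> N F L"
    using ses by (auto simp: mod_ses_def mod_homs_def)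
  have F_onto: "F ` carrier N = carrier L" and im: "\<phi> ` carrier M = {x \<in> carrier N. F x = \<zero>\<^bsub>L\<^esub>}"
    and \<phi>_inj: "inj_on \<phi> (carrier M)"
    using ex by (auto simp: short_exact_def)
  have cardN: "card (carrier N) = card (carrier M) * card (carrier L)"
    by (rule card_short_exact[OF \<phi> F DN(5) DL(5) fin_terms(9) ex])
  obtain a b e where C: "a \<in> module_hom A PN PL" "b \<in> module_hom A WN PL" "e \<in> module_hom A WN WL"
    "\<And>w. w \<in> carrier WN \<Longrightarrow> a (\<delta>N w) = \<delta>L (e w)" "f = chain_map rN rL a b e"
    by (rule NL.chain_mapE[OF f]) (rule that)
  note [simp] = hom_rules[OF C(1) DN(3) DL(3)] hom_rules[OF C(2) DN(4) DL(3)] hom_rules[OF C(3) DN(4) DL(4)]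
    hom_rules[OF \<phi> DM(5) DN(5)] hom_rules[OF F DN(5) DL(5)]
  have lift: "\<pi>L (a x) = F (\<pi>N x)" if "x \<in> carrier PN" for x
    using NL.homology_chain_map(2)[OF C(1-4) that] hom C(5) by simp
  have a_onto: "a ` carrier PN = carrier PL"
  proof (rule cover_onto[OF res_L fd_L C(1) DN(3)])
    fix x assume "x \<in> carrier L"
    then have "x \<in> F ` (\<pi>N ` carrier PN)" unfolding DN(9) F_onto .
    then obtain p where "p \<in> carrier PN" "x = F (\<pi>N p)" by auto
    then show "\<exists>p \<in> carrier PN. \<pi>L (a p) = x" using lift by (intro bexI[of _ p]) simp_all
  qed
  \<comment> \<open>As \<open>|N| = |M| |L|\<close>, the equation of cardinalities says \<open>|\<Omega>\<^sub>L| = |\<Omega>\<^sub>M| |\<Omega>\<^sub>N| |M|\<close>, and surjectivity of \<open>a\<close> says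
    \<open>|\<Omega>\<^sub>L| \<le> |\<Omega>\<^sub>N| |M|\<close>.\<close>
  have cards: "card (carrier WM) = 1" "card (carrier PN) = card (carrier PL)"
  proof -
    let ?l = "card (carrier L)" and ?m = "card (carrier M)" and ?wl = "card (carrier WL)"
      and ?wm = "card (carrier WM)" and ?wn = "card (carrier WN)"
    have pos: "?l > 0" "?m > 0" "?wm > 0" "?wn > 0"
      using card_carrier_pos[OF DL(5) fin_terms(7)] card_carrier_pos[OF DM(5) fin_terms(8)]
        card_carrier_pos[OF DM(4) fin_terms(4)] card_carrier_pos[OF DN(4) fin_terms(6)] by auto
    have "?wl * ?l * ?wl = (?wm * ?m) * (?wn * (?m * ?l)) * ?wm * ?wn"
      using cardP unfolding DL(13) DM(13) DN(13) cardN .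
    then have "?l * ?wl ^ 2 = ?l * (?wm * ?wn * ?m) ^ 2" by (simp add: power2_eq_square algebra_simps)
    then have "?wl ^ 2 = (?wm * ?wn * ?m) ^ 2" using pos(1) by simp
    then have wl: "?wl = ?wm * ?wn * ?m" by (simp add: power2_eq_iff_nonneg)
    have "card (carrier PL) \<le> card (carrier PN)"
      using card_image_le[OF fin_terms(5), of a] unfolding a_onto .
    then have "?wm * (?wn * ?m * ?l) \<le> 1 * (?wn * ?m * ?l)"
      unfolding DL(13) DN(13) cardN wl by (simp add: algebra_simps)
    then have "?wm \<le> 1" using pos by (simp only: mult_le_cancel2) simp
    then show wm: "?wm = 1" using pos(3) by simp
    show "card (carrier PN) = card (carrier PL)"
      unfolding DL(13) DN(13) cardN wl wm by (simp add: algebra_simps)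
  qed
  have W0: "carrier WM = {\<zero>\<^bsub>WM\<^esub>}" using cards(1) card_carrier_1_iff[OF DM(4)] by simp
  have piM: "\<pi>M p = \<zero>\<^bsub>M\<^esub> \<longleftrightarrow> p = \<zero>\<^bsub>PM\<^esub>" if "p \<in> carrier PM" for p
    using DM(10)[OF that] W0 by auto
  have a_inj: "inj_on a (carrier PN)" by (rule eq_card_imp_inj_on[OF fin_terms(5)]) (simp add: a_onto cards(2))
  obtain j where j: "j \<in> module_hom A PL PN" "\<And>x. x \<in> carrier PL \<Longrightarrow> a (j x) = x"
    using factor_through_injection[OF C(1) a_inj hom_id DN(3) DL(3) DL(3)] a_onto by auto
  note [simp] = hom_rules[OF j(1) DL(3) DN(3)]
  have ja: "j (a n) = n" if n: "n \<in> carrier PN" for n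
    by (rule inj_onD[OF a_inj]) (use n j(2)[of "a n"] in simp_all)
  have \<phi>M: "(\<lambda>p. \<phi> (\<pi>M p)) \<in> module_hom A PM N" by (rule hom_comp[OF DM(7) \<phi>])
  have \<phi>_zero: "m = \<zero>\<^bsub>M\<^esub>" if "m \<in> carrier M" "\<phi> m = \<zero>\<^bsub>N\<^esub>" for m
    using inj_onD[OF \<phi>_inj, of m "\<zero>\<^bsub>M\<^esub>"] that by simp
  have \<phi>M_inj: "inj_on (\<lambda>p. \<phi> (\<pi>M p)) (carrier PM)"
    unfolding inj_on_hom_iff[OF \<phi>M DM(3) DN(5)]
  proof (intro ballI impI)
    fix p assume p: "p \<in> carrier PM" "\<phi> (\<pi>M p) = \<zero>\<^bsub>N\<^esub>"
    then show "p = \<zero>\<^bsub>PM\<^esub>" using \<phi>_zero[of "\<pi>M p"] piM by simp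
  qed
  \<comment> \<open>The map \<open>\<beta>\<close> from \<open>\<Omega>\<^sub>L\<close> to \<open>M = P\<^sub>M\<close> is the one that defines the connecting homomorphism \<open>M \<rightarrow> N\<close> of the conflation.\<close>
  have mem: "\<pi>N (j (\<delta>L v)) \<in> (\<lambda>p. \<phi> (\<pi>M p)) ` carrier PM" if v: "v \<in> carrier WL" for v
  proof -
    have "F (\<pi>N (j (\<delta>L v))) = \<zero>\<^bsub>L\<^esub>" using lift[of "j (\<delta>L v)"] v by (simp add: j(2))
    then have "\<pi>N (j (\<delta>L v)) \<in> \<phi> ` carrier M" unfolding im using v by simp
    then obtain m where m: "m \<in> carrier M" "\<pi>N (j (\<delta>L v)) = \<phi> m" by auto
    have "m \<in> \<pi>M ` carrier PM" unfolding DM(9) by (rule m(1))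
    then show ?thesis using m(2) by auto
  qed
  then have sub: "(\<lambda>v. \<pi>N (j (\<delta>L v))) ` carrier WL \<subseteq> (\<lambda>p. \<phi> (\<pi>M p)) ` carrier PM" by (rule image_subsetI)
  obtain \<beta> where \<beta>: "\<beta> \<in> module_hom A WL PM" "\<And>v. v \<in> carrier WL \<Longrightarrow> \<phi> (\<pi>M (\<beta> v)) = \<pi>N (j (\<delta>L v))"
    using factor_through_injection[OF \<phi>M \<phi>M_inj hom_comp[OF hom_comp[OF DL(6) j(1)] DN(7)] DM(3) DN(5) DL(4) sub] by auto
  note [simp] = hom_rules[OF \<beta>(1) DL(4) DM(3)]
  have \<beta>e: "\<beta> (e w) = \<zero>\<^bsub>PM\<^esub>" if w: "w \<in> carrier WN" for w
  proof (rule inj_onD[OF \<phi>M_inj])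
    show "\<phi> (\<pi>M (\<beta> (e w))) = \<phi> (\<pi>M \<zero>\<^bsub>PM\<^esub>)" using w by (simp add: \<beta>(2) C(4)[symmetric] ja)
  qed (use w in simp_all)
  have \<beta>_onto: "\<exists>v \<in> carrier WL. \<beta> v = p" if p: "p \<in> carrier PM" for p
  proof -
    have "\<phi> (\<pi>M p) \<in> \<phi> ` carrier M" using p by simp
    then have z: "F (\<phi> (\<pi>M p)) = \<zero>\<^bsub>L\<^esub>" unfolding im by simp
    have "\<phi> (\<pi>M p) \<in> \<pi>N ` carrier PN" unfolding DN(9) using p by simp
    then obtain x where x: "x \<in> carrier PN" "\<phi> (\<pi>M p) = \<pi>N x" by auto
    have "\<pi>L (a x) = \<zero>\<^bsub>L\<^esub>" using lift[OF x(1)] x(2) z by simp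
    then obtain v where v: "v \<in> carrier WL" "a x = \<delta>L v" using DL(10)[of "a x"] x(1) by auto
    have "\<phi> (\<pi>M (\<beta> v)) = \<phi> (\<pi>M p)" using \<beta>(2)[OF v(1)] v(2)[symmetric] x ja by simp
    then have "\<beta> v = p" using inj_onD[OF \<phi>M_inj] v(1) p by simp
    then show ?thesis using v(1) by auto
  qed

  have onto: "\<exists>y \<in> carrier PL. \<exists>x \<in> carrier WL. p = \<zero>\<^bsub>PM\<^esub> \<oplus>\<^bsub>PM\<^esub> \<beta> x \<and> w = \<zero>\<^bsub>WM\<^esub>"
    if p: "p \<in> carrier PM" and w: "w \<in> carrier WM" for p w
  proof -
    obtain x where x: "x \<in> carrier WL" "\<beta> x = p" using \<beta>_onto[OF p] by auto
    show ?thesis by (rule bexI[of _ "\<zero>\<^bsub>PL\<^esub>"], rule bexI[of _ x]) (use x p w W0 in simp_all)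
  qed
  have card: "card (carrier PL) * card (carrier WL) =
      card (carrier PN) * card (carrier WN) * (card (carrier PM) * card (carrier WM))"
    using cardP by (simp add: mult.commute mult.left_commute)
  have "(f, chain_map rL rM (\<lambda>_. \<zero>\<^bsub>PM\<^esub>) \<beta> (\<lambda>_. \<zero>\<^bsub>WM\<^esub>)) \<in> c1_ses K Q (C_cplx rM) (C_cplx rN) (C_cplx rL)"
    unfolding C(5)
    by (rule conflationI[OF C(1-3) hom_zero[OF DM(3)] \<beta>(1) hom_zero[OF DM(4)] C(4) _ a_inj onto _ _ _ card])
      (simp_all add: \<beta>e)
  then show ?thesis by (rule rev_image_eqI) simp
qed

lemma conflation_rigid_structure:
  assumes extend: "\<forall>b \<in> module_hom A WM N. \<exists>h \<in> module_hom A PM N. \<forall>w \<in> carrier WM. h (\<delta>M w) = b w"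
    and indec: "indecomposable A L" and nonzero: "carrier N \<noteq> {\<zero>\<^bsub>N\<^esub>}"
    and fg: "(f, g) \<in> c1_ses K Q (C_cplx rM) (C_cplx rN) (C_cplx rL)"
  obtains e b where "homology_map N rN rL f \<in> snd ` mod_ses K Q L M N" "mod_iso A PN PL" "carrier WM = {\<zero>\<^bsub>WM\<^esub>}"
    "e \<in> module_hom A WN WL" "b \<in> module_hom A WL PM" "short_exact WN e WL b PM"
proof -
  obtain af bf ef ag bg eg where conf: "conflation K Q L M N rL rM rN af bf ef ag bg eg"
    and f: "f = chain_map rN rL af bf ef" and g: "g = chain_map rL rM ag bg eg"
    by (rule conflationE[OF fg]) (rule that)
  interpret conflation K Q L M N rL rM rN af bf ef ag bg eg by (rule conf)
  note R = rigid_conflation[OF extend indec nonzero]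
  have "mod_iso A PN PL" unfolding mod_iso_def using R(1) af_inj by (intro bexI[OF _ af]) (simp add: bij_betw_def)
  then show thesis using that rigid_homology[OF R] R(2,3) ef bg unfolding f by blast
qed

text \<open>The underlying sequence of projective modules splits.\<close>
lemma conflation_sum_iso:
  assumes fg: "(f, g) \<in> c1_ses K Q (C_cplx rM) (C_cplx rN) (C_cplx rL)"
  shows "mod_iso A (direct_sum PL WL) (direct_sum (direct_sum (direct_sum PM PN) WM) WN)"
proof -
  let ?S = "direct_sum (direct_sum (direct_sum PM PN) WM) WN"
    and ?T = "direct_sum (direct_sum PM WM) (direct_sum PN WN)"
  have F: "f \<in> module_hom A (direct_sum PN WN) (direct_sum PL WL)" "g \<in> module_hom A (direct_sum PL WL) (direct_sum PM WM)"
    "short_exact (direct_sum PN WN) f (direct_sum PL WL) g (direct_sum PM WM)"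
    using fg by (auto simp: c1_ses_def c1_homs_def mod_homs_def)
  have 1: "mod_iso A ?T (direct_sum PL WL)"
    by (rule short_exact_split[OF fd_direct_sum[OF fd_terms(5,6)] fd_direct_sum[OF fd_terms(1,2)]
        projective_direct_sum[OF DM(1,2)] F])
  have lT: "left_module A ?T" and lS: "left_module A ?S" by (intro left_module_direct_sum DM(3,4) DN(3,4))+
  have l: "left_module A (direct_sum PL WL)" by (rule left_module_direct_sum[OF DL(3,4)])
  have h: "(\<lambda>v. (((fst (fst v), fst (snd v)), snd (fst v)), snd (snd v))) \<in> module_hom A ?T ?S"
    by (intro hom_pair hom_comp[OF hom_fst hom_fst] hom_comp[OF hom_fst hom_snd] hom_comp[OF hom_snd hom_fst]
        hom_comp[OF hom_snd hom_snd])
  have 2: "mod_iso A ?T ?S"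
    unfolding mod_iso_def
    by (rule bexI[OF _ h], rule bij_betw_byWitness[where f' = "\<lambda>v. ((fst (fst (fst v)), snd (fst v)), (snd (fst (fst v)), snd v))"])
      auto
  show ?thesis by (rule mod_iso_trans[OF mod_iso_sym[OF 1 lT l] 2])
qed

text \<open>
  If there is a conflation at all, then the inflations \<open>C\<^sub>N \<rightarrow> C\<^sub>L\<close> with cokernel \<open>C\<^sub>M\<close> are the chain maps whose effect on homology is an epimorphism
  \<open>N \<rightarrow> L\<close> with kernel \<open>M\<close>.  Dividing the size \<open>|Hom(P\<^sub>N, \<Omega>\<^sub>L)| |Hom(\<Omega>\<^sub>N, P\<^sub>L)|\<close> of the fibres by the
  corresponding factor of the automorphism group of \<open>C\<^sub>N\<close> leaves \<open>|Hom(P\<^sub>N, P\<^sub>M)|\<close>, because \<open>P\<^sub>L = P\<^sub>N\<close> and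
  \<open>\<Omega>\<^sub>L = \<Omega>\<^sub>N \<oplus> P\<^sub>M\<close>.
\<close>
theorem conflation_iff_quotient:
  assumes extend: "\<forall>b \<in> module_hom A WM N. \<exists>h \<in> module_hom A PM N. \<forall>w \<in> carrier WM. h (\<delta>M w) = b w"
    and indec: "indecomposable A L" and nonzero: "carrier N \<noteq> {\<zero>\<^bsub>N\<^esub>}"
  shows "c1_ses K Q (C_cplx rM) (C_cplx rN) (C_cplx rL) \<noteq> {} \<longleftrightarrow>
      mod_iso A (direct_sum PL WL) (direct_sum (direct_sum (direct_sum PM PN) WM) WN) \<and> mod_ses K Q L M N \<noteq> {}"
    and "c1_ses K Q (C_cplx rM) (C_cplx rN) (C_cplx rL) \<noteq> {} \<Longrightarrow>
      c1_hall K Q (C_cplx rM) (C_cplx rN) (C_cplx rL) =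
        real (card (mod_homs A PN PM)) * (real (card (mod_auts A L)) / real (card (mod_auts A N))) * mod_hall K Q L M N"
proof -
  let ?C = "c1_ses K Q (C_cplx rM) (C_cplx rN) (C_cplx rL)"
  let ?iso = "mod_iso A (direct_sum PL WL) (direct_sum (direct_sum (direct_sum PM PN) WM) WN)"
  have card_of_iso: "card (carrier PL) * card (carrier WL) =
      card (carrier PM) * card (carrier PN) * card (carrier WM) * card (carrier WN)" if ?iso
    using that bij_betw_same_card by (fastforce simp: mod_iso_def card_cartesian_product)
  have lifts: "{f \<in> c1_homs K Q (C_cplx rN) (C_cplx rL). homology_map N rN rL f \<in> snd ` mod_ses K Q L M N} \<subseteq> fst ` ?C"
    if iso: ?iso
  proof
    fix f assume "f \<in> {f \<in> c1_homs K Q (C_cplx rN) (C_cplx rL). homology_map N rN rL f \<in> snd ` mod_ses K Q L M N}"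
    then obtain \<phi> F where ses: "(\<phi>, F) \<in> mod_ses K Q L M N" and fF: "f \<in> c1_homs K Q (C_cplx rN) (C_cplx rL)"
      "homology_map N rN rL f = F" by auto
    show "f \<in> fst ` ?C" by (rule quotient_conflation[OF ses card_of_iso[OF iso] fF])
  qed
  show "?C \<noteq> {} \<longleftrightarrow> ?iso \<and> mod_ses K Q L M N \<noteq> {}"
  proof
    assume "?C \<noteq> {}"
    then obtain f g where fg: "(f, g) \<in> ?C" by auto
    have "homology_map N rN rL f \<in> snd ` mod_ses K Q L M N"
      by (rule conflation_rigid_structure[OF extend indec nonzero fg])
    then show "?iso \<and> mod_ses K Q L M N \<noteq> {}" using conflation_sum_iso[OF fg] by auto
  next
    assume R: "?iso \<and> mod_ses K Q L M N \<noteq> {}"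
    then obtain \<phi> F where ses: "(\<phi>, F) \<in> mod_ses K Q L M N" by auto
    have F: "F \<in> mod_homs A N L" using ses by (simp add: mod_ses_def)
    obtain a e where ae: "a \<in> module_hom A PN PL" "e \<in> module_hom A WN WL"
      "\<And>p. p \<in> carrier PN \<Longrightarrow> \<pi>L (a p) = F (\<pi>N p)" "\<And>w. w \<in> carrier WN \<Longrightarrow> a (\<delta>N w) = \<delta>L (e w)"
      by (rule NL.lift_hom_syzygy[OF mod_homsD(1)[OF F]]) (rule that)
    note H = NL.homology_chain_map[OF ae(1) hom_zero[OF DL(3)] ae(2,4)]
    have "homology_map N rN rL (chain_map rN rL a (\<lambda>_. \<zero>\<^bsub>PL\<^esub>) e) = F"
    proof (rule NL.mod_homs_eqI[OF H(1) F])
      fix p assume p: "p \<in> carrier PN"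
      show "homology_map N rN rL (chain_map rN rL a (\<lambda>_. \<zero>\<^bsub>PL\<^esub>) e) (\<pi>N p) = F (\<pi>N p)"
        using H(2)[OF _ p] ae(3)[OF p] by simp
    qed
    moreover have "chain_map rN rL a (\<lambda>_. \<zero>\<^bsub>PL\<^esub>) e \<in> c1_homs K Q (C_cplx rN) (C_cplx rL)"
      by (rule NL.chain_mapI[OF ae(1) hom_zero[OF DL(3)] ae(2,4)])
    ultimately have "chain_map rN rL a (\<lambda>_. \<zero>\<^bsub>PL\<^esub>) e \<in> fst ` ?C"
      using quotient_conflation[OF ses card_of_iso] R by simp
    then show "?C \<noteq> {}" by auto
  qed
  assume "?C \<noteq> {}"
  then obtain f g where fg: "(f, g) \<in> ?C" by auto
  obtain e b where S: "mod_iso A PN PL" "e \<in> module_hom A WN WL" "b \<in> module_hom A WL PM" "short_exact WN e WL b PM"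
    by (rule conflation_rigid_structure[OF extend indec nonzero fg]) (rule that)
  have "fst ` ?C = {f \<in> c1_homs K Q (C_cplx rN) (C_cplx rL). homology_map N rN rL f \<in> snd ` mod_ses K Q L M N}"
  proof (intro equalityI subsetI lifts[THEN subsetD, OF conflation_sum_iso[OF fg]])
    fix f assume "f \<in> fst ` ?C"
    then obtain g where fg: "(f, g) \<in> ?C" by auto
    have "homology_map N rN rL f \<in> snd ` mod_ses K Q L M N"
      by (rule conflation_rigid_structure[OF extend indec nonzero fg])
    then show "f \<in> {f \<in> c1_homs K Q (C_cplx rN) (C_cplx rL). homology_map N rN rL f \<in> snd ` mod_ses K Q L M N}"
      using fg by (simp add: c1_ses_def)
  qed
  moreover have "snd ` mod_ses K Q L M N \<subseteq> mod_homs A N L" by (auto simp: mod_ses_def)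
  ultimately have card_fst: "card (fst ` ?C) = card (snd ` mod_ses K Q L M N) *
      (card (mod_homs A PN WL) * card (mod_homs A WN PL))"
    using NL.card_homology_preimage by simp
  let ?h = "card (mod_homs A PN WN) * card (mod_homs A WN PN)"
  have pos: "?h > 0"
    using finite_homs[OF fd_terms(5,6)] finite_homs[OF fd_terms(6,5)]
      restrict_hom[OF hom_zero[OF DN(4)] DN(3)] restrict_hom[OF hom_zero[OF DN(3)] DN(4)]
    by (auto simp: card_gt_0_iff)
  have posL: "card (mod_auts A L) > 0"
    using card_c1_auts_pos[OF diff_module_stalk[OF fd_L]] by (simp add: stalk_auts fd_L)
  have hom1: "card (mod_homs A PN WL) = card (mod_homs A PN PM) * card (mod_homs A PN WN)"
    by (rule card_homs_split(2)[OF fd_terms(6,2) DM(1) S(2-4) fd_terms(5)])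
  have hom2: "card (mod_homs A WN PL) = card (mod_homs A WN PN)"
    by (rule sym[OF card_homs_iso(2)[OF fd_terms(5,1,6) S(1)]])
  have "c1_hall K Q (C_cplx rM) (C_cplx rN) (C_cplx rL) =
      real (card (snd ` mod_ses K Q L M N) * card (mod_homs A PN PM) * ?h) / real (card (mod_auts A N) * ?h)"
    unfolding c1_hall_eq(2)[OF obj] card_fst card_c1_auts_C[OF res_N fd_N] hom1 hom2
    by (simp add: ac_simps)
  also have "\<dots> = real (card (mod_homs A PN PM)) * (real (card (mod_auts A L)) / real (card (mod_auts A N))) * mod_hall K Q L M N"
    using pos posL by (simp add: mod_hall_eq[OF fd_L fd_M fd_N])
  finally show "c1_hall K Q (C_cplx rM) (C_cplx rN) (C_cplx rL) =
    real (card (mod_homs A PN PM)) * (real (card (mod_auts A L)) / real (card (mod_auts A N))) * mod_hall K Q L M N" .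
qed

end

context finite_path_algebra
begin

section \<open>Self-extensions with contractible middle term\<close>

lemma K_cplx_simps [simp]:
  "fst (K_cplx P) = direct_sum P P" "snd (K_cplx P) v = (snd v, \<zero>\<^bsub>P\<^esub>)"
  by (simp_all add: K_cplx_def case_prod_unfold)

lemma c1_object_K:
  assumes P: "projective K Q P" shows "c1_object K Q (K_cplx P)"
proof -
  note lP = fdD(1)[OF projective_fd[OF P]]
  have "(\<lambda>v. (snd v, \<zero>\<^bsub>P\<^esub>)) \<in> module_hom A (direct_sum P P) (direct_sum P P)"
    by (intro hom_pair hom_snd hom_zero lP)
  then have "snd (K_cplx P) \<in> module_hom A (direct_sum P P) (direct_sum P P)"
    by (rule hom_cong) (simp_all add: left_module_direct_sum lP)
  then show ?thesis using projective_direct_sum[OF P P] by (simp add: c1_object_def)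
qed

text \<open>
  A projective module is its own projective cover: the cover of \<open>M\<close> is no larger than \<open>P\<close>.
\<close>
lemma cover_of_projective:
  assumes P: "projective K Q P" and M: "fd_module K Q M" and r: "minimal_resolution K Q M r" and iso: "mod_iso A M P"
  obtains h where "h \<in> module_hom A P (res_P r)" "bij_betw h (carrier P) (carrier (res_P r))"
    "carrier (res_Omega r) = {\<zero>\<^bsub>res_Omega r\<^esub>}"
proof -
  note R = resolutionD[OF r M]
  note fP = projective_fd[OF P] and fR = projective_fd[OF R(1)]
  note lP = fdD(1)[OF fP]
  obtain j where j: "j \<in> module_hom A P M" "bij_betw j (carrier P) (carrier M)"
    using mod_iso_sym[OF iso R(5) lP] by (auto simp: mod_iso_def)
  have sub: "j ` carrier P \<subseteq> res_pi r ` carrier (res_P r)" unfolding R(9) using j(2) by (simp add: bij_betw_def)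
  obtain h where h: "h \<in> module_hom A P (res_P r)" "\<And>p. p \<in> carrier P \<Longrightarrow> res_pi r (h p) = j p"
    using projective_lift[OF P fR M R(7) j(1) sub] by auto
  have onto: "h ` carrier P = carrier (res_P r)"
  proof (rule cover_onto[OF r M h(1) lP])
    fix m assume "m \<in> carrier M"
    then have "m \<in> j ` carrier P" using j(2) by (simp add: bij_betw_def)
    then obtain p where "p \<in> carrier P" "m = j p" by auto
    then show "\<exists>p \<in> carrier P. res_pi r (h p) = m" using h(2) by (intro bexI[of _ p]) simp_all
  qed
  note fin = fdD(2)[OF fP]
  have cardM: "card (carrier P) = card (carrier M)" by (rule bij_betw_same_card[OF j(2)])
  have "card (carrier (res_P r)) \<le> card (carrier P)" using card_image_le[OF fin, of h] unfolding onto .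
  then have "card (carrier (res_Omega r)) * card (carrier M) \<le> 1 * card (carrier M)" unfolding R(13) cardM by simp
  then have "card (carrier (res_Omega r)) \<le> 1"
    using card_carrier_pos[OF R(5) fdD(2)[OF M]] by (simp only: mult_le_cancel2)
  then have 1: "card (carrier (res_Omega r)) = 1"
    using card_carrier_pos[OF R(4) fdD(2)[OF projective_fd[OF R(2)]]] by simp
  have "inj_on h (carrier P)" by (rule eq_card_imp_inj_on[OF fin]) (simp add: onto R(13) 1 cardM)
  then show thesis using that[OF h(1)] onto 1 card_carrier_1_iff[OF R(4)] by (simp add: bij_betw_def)
qed

text \<open>
  Comparing the cycles and boundaries of \<open>K\<^sub>P\<close> with those of \<open>C\<^sub>M\<close> gives an exact sequence
  \<open>0 \<rightarrow> P\<^sub>M \<rightarrow> P \<rightarrow> \<Omega>\<^sub>M \<rightarrow> 0\<close>, which splits.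
\<close>
lemma contractible_conflation_iso:
  assumes P: "projective K Q P" and indec: "indecomposable A P"
    and M: "fd_module K Q M" and r: "minimal_resolution K Q M r" and nonzero: "carrier M \<noteq> {\<zero>\<^bsub>M\<^esub>}"
    and fg: "(f, g) \<in> c1_ses K Q (C_cplx r) (C_cplx r) (K_cplx P)"
  shows "mod_iso A M P"
proof -
  note R = resolutionD[OF r M]
  note fP = projective_fd[OF P] and fR = projective_fd[OF R(1)] and fW = projective_fd[OF R(2)]
  note lP = fdD(1)[OF fP]
  let ?P = "res_P r" and ?W = "res_Omega r" and ?\<delta> = "res_delta r"
  note [simp] = left_module_rules[OF lP] left_module_rules[OF R(3)] left_module_rules[OF R(4)] hom_rules[OF R(6,4,3)] R(12)
  have fc: "f \<in> c1_homs K Q (C_cplx r) (K_cplx P)" and gc: "g \<in> c1_homs K Q (K_cplx P) (C_cplx r)"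
    and ex: "short_exact (direct_sum ?P ?W) f (direct_sum P P) g (direct_sum ?P ?W)"
    using fg by (auto simp: c1_ses_def)
  note fh = c1_homsD(1)[OF fc, simplified] and gh = c1_homsD(1)[OF gc, simplified]
  note l1 = left_module_direct_sum[OF R(3,4)] and l2 = left_module_direct_sum[OF lP lP]
  note Fr = hom_rules[OF fh l1 l2, simplified] and Gr = hom_rules[OF gh l2 l1, simplified]
  define u where "u p = fst (f (p, \<zero>\<^bsub>?W\<^esub>))" for p
  define c where "c x = snd (g (\<zero>\<^bsub>P\<^esub>, x))" for x
  have u: "u \<in> module_hom A ?P P"
    unfolding u_def by (rule hom_comp[OF hom_comp[OF hom_inl[OF R(4)] fh] hom_fst])
  have c: "c \<in> module_hom A P ?W"
    unfolding c_def by (rule hom_comp[OF hom_comp[OF hom_inr[OF lP] gh] hom_snd])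
  note [simp] = hom_rules[OF u R(3) lP] hom_rules[OF c lP R(4)]
  have fu: "f (p, \<zero>\<^bsub>?W\<^esub>) = (u p, \<zero>\<^bsub>P\<^esub>)" if p: "p \<in> carrier ?P" for p
    using c1_homsD(3)[OF fc, of "(p, \<zero>\<^bsub>?W\<^esub>)"] p Fr(4) by (auto simp: u_def prod_eq_iff)
  have gx: "g (x, \<zero>\<^bsub>P\<^esub>) = (?\<delta> (c x), \<zero>\<^bsub>?W\<^esub>)" if "x \<in> carrier P" for x
    using c1_homsD(3)[OF gc, of "(\<zero>\<^bsub>P\<^esub>, x)"] that by (simp add: c_def)
  have inj: "inj_on f (carrier ?P \<times> carrier ?W)" and onto: "g ` (carrier P \<times> carrier P) = carrier ?P \<times> carrier ?W"
    and im: "f ` (carrier ?P \<times> carrier ?W) = {z \<in> carrier P \<times> carrier P. g z = (\<zero>\<^bsub>?P\<^esub>, \<zero>\<^bsub>?W\<^esub>)}"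
    using ex by (simp_all add: short_exact_def)
  have S: "short_exact ?P u P c ?W"
  proof (rule short_exactI_card[OF u c R(3) lP R(4) fdD(2)[OF fP]])
    show "inj_on u (carrier ?P)"
    proof (rule inj_onI)
      fix p p' assume p: "p \<in> carrier ?P" "p' \<in> carrier ?P" "u p = u p'"
      then have "f (p, \<zero>\<^bsub>?W\<^esub>) = f (p', \<zero>\<^bsub>?W\<^esub>)" by (simp add: fu)
      then have "(p, \<zero>\<^bsub>?W\<^esub>) = (p', \<zero>\<^bsub>?W\<^esub>)" by (rule inj_onD[OF inj]) (use p in simp_all)
      then show "p = p'" by simp
    qed
    have "carrier ?W \<subseteq> c ` carrier P"
    proof
      fix w assume w: "w \<in> carrier ?W"
      have "(\<zero>\<^bsub>?P\<^esub>, w) \<in> g ` (carrier P \<times> carrier P)" unfolding onto using w by simp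
      then obtain x y where xy: "x \<in> carrier P" "y \<in> carrier P" "g (x, y) = (\<zero>\<^bsub>?P\<^esub>, w)" by auto
      have "g (x, y) = g (x, \<zero>\<^bsub>P\<^esub>) \<oplus>\<^bsub>direct_sum ?P ?W\<^esub> g (\<zero>\<^bsub>P\<^esub>, y)"
        using Gr(2)[of "(x, \<zero>\<^bsub>P\<^esub>)" "(\<zero>\<^bsub>P\<^esub>, y)"] xy by simp
      moreover have "g (\<zero>\<^bsub>P\<^esub>, y) \<in> carrier ?P \<times> carrier ?W" using Gr(1)[of "(\<zero>\<^bsub>P\<^esub>, y)"] xy by simp
      ultimately have "snd (g (x, y)) = c y" using xy by (auto simp: gx c_def prod_eq_iff)
      then show "w \<in> c ` carrier P" using xy by auto
    qed
    then show "c ` carrier P = carrier ?W" by auto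
    show "c (u p) = \<zero>\<^bsub>?W\<^esub>" if p: "p \<in> carrier ?P" for p
    proof -
      have "f (p, \<zero>\<^bsub>?W\<^esub>) \<in> {z \<in> carrier P \<times> carrier P. g z = (\<zero>\<^bsub>?P\<^esub>, \<zero>\<^bsub>?W\<^esub>)}"
        unfolding im[symmetric] using p by simp
      then have "g (u p, \<zero>\<^bsub>P\<^esub>) = (\<zero>\<^bsub>?P\<^esub>, \<zero>\<^bsub>?W\<^esub>)" using p by (simp add: fu)
      then show ?thesis using p gx[of "u p"] by simp
    qed
    have "card (carrier P \<times> carrier P) = card (carrier ?P \<times> carrier ?W) * card (carrier ?P \<times> carrier ?W)"
      using card_short_exact[OF fh gh l2 l1 _ ex] fdD(2)[OF fP] by simp
    then have "card (carrier P) ^ 2 = (card (carrier ?P) * card (carrier ?W)) ^ 2"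
      by (simp add: card_cartesian_product power2_eq_square)
    then show "card (carrier P) = card (carrier ?P) * card (carrier ?W)" by (simp add: power2_eq_iff_nonneg)
  qed
  obtain t where t: "t \<in> module_hom A ?W P" "\<And>w. w \<in> carrier ?W \<Longrightarrow> c (t w) = w"
    and bij: "bij_betw (\<lambda>v. t (fst v) \<oplus>\<^bsub>P\<^esub> u (snd v)) (carrier ?W \<times> carrier ?P) (carrier P)"
    by (rule short_exact_split[OF fR fP R(2) u c S]) (rule that)
  note [simp] = hom_rules[OF t(1) R(4) lP]
  have U: "Module.submodule (u ` carrier ?P) A P" by (rule submodule_image[OF u R(3) lP])
  have T: "Module.submodule (t ` carrier ?W) A P" by (rule submodule_image[OF t(1) R(4) lP])
  have cu: "c (u p) = \<zero>\<^bsub>?W\<^esub>" if "p \<in> carrier ?P" for p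
  proof -
    have "u p \<in> {z \<in> carrier P. c z = \<zero>\<^bsub>?W\<^esub>}" using S that unfolding short_exact_def by blast
    then show ?thesis by simp
  qed
  have int0: "x = \<zero>\<^bsub>P\<^esub>" if x: "x \<in> t ` carrier ?W \<inter> u ` carrier ?P" for x
  proof -
    obtain w p where "w \<in> carrier ?W" "x = t w" "p \<in> carrier ?P" "x = u p" using x by auto
    then show ?thesis using t(2)[of w] cu[of p] by simp
  qed
  have int1: "\<zero>\<^bsub>P\<^esub> \<in> t ` carrier ?W \<inter> u ` carrier ?P" using submoduleD(2)[OF U lP] submoduleD(2)[OF T lP] by simp
  have inter: "t ` carrier ?W \<inter> u ` carrier ?P = {\<zero>\<^bsub>P\<^esub>}"
  proof (intro equalityI subsetI)
    fix x assume "x \<in> t ` carrier ?W \<inter> u ` carrier ?P"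
    from int0[OF this] show "x \<in> {\<zero>\<^bsub>P\<^esub>}" by simp
  next
    fix x assume "x \<in> {\<zero>\<^bsub>P\<^esub>}"
    then show "x \<in> t ` carrier ?W \<inter> u ` carrier ?P" using int1 by (simp only: singleton_iff)
  qed
  have "t ` carrier ?W <+>\<^bsub>P\<^esub> u ` carrier ?P = (\<lambda>v. t (fst v) \<oplus>\<^bsub>P\<^esub> u (snd v)) ` (carrier ?W \<times> carrier ?P)"
    unfolding set_add_def' by force
  then have sum: "t ` carrier ?W <+>\<^bsub>P\<^esub> u ` carrier ?P = carrier P" using bij by (simp add: bij_betw_def)
  have alt: "t ` carrier ?W = {\<zero>\<^bsub>P\<^esub>} \<or> u ` carrier ?P = {\<zero>\<^bsub>P\<^esub>}"
    using indec T U inter sum unfolding indecomposable_def by metis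
  have u_inj: "inj_on u (carrier ?P)" using S by (simp add: short_exact_def)
  have "u ` carrier ?P \<noteq> {\<zero>\<^bsub>P\<^esub>}"
  proof
    assume z: "u ` carrier ?P = {\<zero>\<^bsub>P\<^esub>}"
    have "p = \<zero>\<^bsub>?P\<^esub>" if "p \<in> carrier ?P" for p
    proof -
      have "u p = u \<zero>\<^bsub>?P\<^esub>" using z that by auto
      then show ?thesis by (rule inj_onD[OF u_inj]) (use that in simp_all)
    qed
    then have "carrier ?P = {\<zero>\<^bsub>?P\<^esub>}" by auto
    then have "carrier M = {\<zero>\<^bsub>M\<^esub>}" using R(9) hom_rules(4)[OF R(7,3,5)] by auto
    then show False using nonzero by simp
  qed
  then have t_im: "t ` carrier ?W = {\<zero>\<^bsub>P\<^esub>}" using alt by simp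
  have t0: "t w = \<zero>\<^bsub>P\<^esub>" if "w \<in> carrier ?W" for w using imageI[OF that, of t] unfolding t_im by simp
  have W0: "w = \<zero>\<^bsub>?W\<^esub>" if "w \<in> carrier ?W" for w using t0[OF that] t(2)[OF that] by simp
  have "u ` carrier ?P = carrier P"
  proof
    show "carrier P \<subseteq> u ` carrier ?P"
    proof
      fix x assume "x \<in> carrier P"
      then have "x \<in> {z \<in> carrier P. c z = \<zero>\<^bsub>?W\<^esub>}" using W0[of "c x"] by simp
      then show "x \<in> u ` carrier ?P" using S by (simp add: short_exact_def)
    qed
  qed auto
  then have "mod_iso A ?P P" unfolding mod_iso_def using u_inj by (intro bexI[OF _ u]) (simp add: bij_betw_def)
  moreover have "mod_iso A ?P M"
  proof -
    have "inj_on (res_pi r) (carrier ?P)"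
      unfolding inj_on_hom_iff[OF R(7,3,5)] using R(10) W0 by (metis hom_rules(4)[OF R(6,4,3)])
    then show ?thesis unfolding mod_iso_def using R(9) by (intro bexI[OF _ R(7)]) (simp add: bij_betw_def)
  qed
  ultimately show ?thesis using mod_iso_trans[OF mod_iso_sym[OF _ R(3,5)]] by blast
qed

text \<open>
  All inflations \<open>C\<^sub>M \<rightarrow> K\<^sub>P\<close> have the same image \<open>P \<times> 0\<close>, the cycles of \<open>K\<^sub>P\<close>, and so differ by an automorphism
  of \<open>C\<^sub>M\<close>.
\<close>
theorem contractible_conflations:
  assumes P: "projective K Q P" and M: "fd_module K Q M" and r: "minimal_resolution K Q M r" and iso: "mod_iso A M P"
  shows "c1_ses K Q (C_cplx r) (C_cplx r) (K_cplx P) \<noteq> {}"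
    and "c1_hall K Q (C_cplx r) (C_cplx r) (K_cplx P) = 1"
proof -
  note R = resolutionD[OF r M]
  note fP = projective_fd[OF P] and fR = projective_fd[OF R(1)]
  note lP = fdD(1)[OF fP] and finP = fdD(2)[OF fP]
  let ?P = "res_P r" and ?W = "res_Omega r" and ?\<delta> = "res_delta r"
  note [simp] = left_module_rules[OF lP] left_module_rules[OF R(3)] left_module_rules[OF R(4)] hom_rules[OF R(6,4,3)]
  obtain h where h: "h \<in> module_hom A P ?P" "bij_betw h (carrier P) (carrier ?P)" and W: "carrier ?W = {\<zero>\<^bsub>?W\<^esub>}"
    by (rule cover_of_projective[OF P M r iso]) (rule that)
  note [simp] = hom_rules[OF h(1) lP R(3)]
  obtain u where u: "u \<in> module_hom A ?P P" "\<And>p. p \<in> carrier ?P \<Longrightarrow> h (u p) = p"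
    using hom_inverse[OF h(1,2) lP R(3)] by auto
  note [simp] = hom_rules[OF u(1) R(3) lP]
  have hu: "u (h x) = x" if "x \<in> carrier P" for x
    by (rule inj_onD[OF bij_betw_imp_inj_on[OF h(2)]]) (use that u(2) in simp_all)
  have h0: "h x = \<zero>\<^bsub>?P\<^esub> \<longleftrightarrow> x = \<zero>\<^bsub>P\<^esub>" if "x \<in> carrier P" for x
    using hu[OF that] by auto
  have \<delta>0: "?\<delta> w = \<zero>\<^bsub>?P\<^esub>" if "w \<in> carrier ?W" for w using that W by auto
  note l1 = left_module_direct_sum[OF R(3,4)] and l2 = left_module_direct_sum[OF lP lP]
  note obj = c1_object_C[OF r M] c1_object_K[OF P]
  let ?f = "\<lambda>v \<in> carrier ?P \<times> carrier ?W. (u (fst v), \<zero>\<^bsub>P\<^esub>)"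
  let ?g = "\<lambda>v \<in> carrier P \<times> carrier P. (h (snd v), \<zero>\<^bsub>?W\<^esub>)"
  have "(\<lambda>v. (u (fst v), \<zero>\<^bsub>P\<^esub>)) \<in> module_hom A (direct_sum ?P ?W) (direct_sum P P)"
    by (intro hom_pair hom_comp[OF hom_fst u(1)] hom_zero lP)
  from restrict_hom[OF this l1] have f: "?f \<in> c1_homs K Q (C_cplx r) (K_cplx P)"
    by (simp add: c1_homs_def \<delta>0)
  have "(\<lambda>v. (h (snd v), \<zero>\<^bsub>?W\<^esub>)) \<in> module_hom A (direct_sum P P) (direct_sum ?P ?W)"
    by (intro hom_pair hom_comp[OF hom_snd h(1)] hom_zero R(4))
  from restrict_hom[OF this l2] have g: "?g \<in> c1_homs K Q (K_cplx P) (C_cplx r)"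
    by (simp add: c1_homs_def)
  have f_inj: "inj_on ?f (carrier ?P \<times> carrier ?W)"
  proof (rule inj_onI, clarify)
    fix p w p' w' assume v: "p \<in> carrier ?P" "w \<in> carrier ?W" "p' \<in> carrier ?P" "w' \<in> carrier ?W"
      and eq: "?f (p, w) = ?f (p', w')"
    have "u p = u p'" using eq v by simp
    then have "h (u p) = h (u p')" by (rule arg_cong)
    then have "p = p'" unfolding u(2)[OF v(1)] u(2)[OF v(3)] .
    moreover have "w = w'" using v(2,4) W by simp
    ultimately show "p = p' \<and> w = w'" ..
  qed
  have f_im: "?f ` (carrier ?P \<times> carrier ?W) = carrier P \<times> {\<zero>\<^bsub>P\<^esub>}"
  proof (intro equalityI subsetI)
    fix z assume "z \<in> carrier P \<times> {\<zero>\<^bsub>P\<^esub>}"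
    then obtain x where x: "z = (x, \<zero>\<^bsub>P\<^esub>)" "x \<in> carrier P" by auto
    show "z \<in> ?f ` (carrier ?P \<times> carrier ?W)"
      by (rule image_eqI[of _ _ "(h x, \<zero>\<^bsub>?W\<^esub>)"]) (use x hu in simp_all)
  qed auto
  have g_onto: "?g ` (carrier P \<times> carrier P) = carrier ?P \<times> carrier ?W"
  proof (intro equalityI subsetI)
    fix z assume "z \<in> carrier ?P \<times> carrier ?W"
    then obtain p where p: "z = (p, \<zero>\<^bsub>?W\<^esub>)" "p \<in> carrier ?P" using W by auto
    show "z \<in> ?g ` (carrier P \<times> carrier P)"
      by (rule image_eqI[of _ _ "(\<zero>\<^bsub>P\<^esub>, u p)"]) (use p u(2) in simp_all)
  qed auto
  have g_ker: "{z \<in> carrier P \<times> carrier P. ?g z = (\<zero>\<^bsub>?P\<^esub>, \<zero>\<^bsub>?W\<^esub>)} = carrier P \<times> {\<zero>\<^bsub>P\<^esub>}"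
    using h0 by auto
  have ses: "(f, ?g) \<in> c1_ses K Q (C_cplx r) (C_cplx r) (K_cplx P)"
    if "f \<in> c1_homs K Q (C_cplx r) (K_cplx P)" "inj_on f (carrier ?P \<times> carrier ?W)"
      "f ` (carrier ?P \<times> carrier ?W) = carrier P \<times> {\<zero>\<^bsub>P\<^esub>}" for f
    unfolding c1_ses_def mem_Collect_eq prod.case short_exact_def C_cplx_simps(1) K_cplx_simps(1) direct_sum_simps
    using that obj g g_onto g_ker by (intro conjI) simp_all
  show "c1_ses K Q (C_cplx r) (C_cplx r) (K_cplx P) \<noteq> {}" using ses[OF f f_inj f_im] by blast
  have image: "f ` (carrier ?P \<times> carrier ?W) = carrier P \<times> {\<zero>\<^bsub>P\<^esub>}"
    if f: "f \<in> c1_homs K Q (C_cplx r) (K_cplx P)" and inj: "inj_on f (carrier ?P \<times> carrier ?W)" for f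
  proof (rule card_subset_eq)
    note fh = c1_homsD(1)[OF f, simplified]
    note Fr = hom_rules[OF fh l1 l2, simplified]
    show "f ` (carrier ?P \<times> carrier ?W) \<subseteq> carrier P \<times> {\<zero>\<^bsub>P\<^esub>}"
    proof (rule image_subsetI)
      fix v assume v: "v \<in> carrier ?P \<times> carrier ?W"
      then have "f (?\<delta> (snd v), \<zero>\<^bsub>?W\<^esub>) = (snd (f v), \<zero>\<^bsub>P\<^esub>)" using c1_homsD(3)[OF f, of v] by simp
      moreover have "f (?\<delta> (snd v), \<zero>\<^bsub>?W\<^esub>) = (\<zero>\<^bsub>P\<^esub>, \<zero>\<^bsub>P\<^esub>)" using v Fr(4) by (auto simp: \<delta>0)
      moreover have "f v \<in> carrier P \<times> carrier P" using Fr(1)[of v] v by simp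
      ultimately show "f v \<in> carrier P \<times> {\<zero>\<^bsub>P\<^esub>}" by (auto simp: prod_eq_iff mem_Times_iff)
    qed
    show "card (f ` (carrier ?P \<times> carrier ?W)) = card (carrier P \<times> {\<zero>\<^bsub>P\<^esub>})"
      unfolding card_image[OF inj] using W bij_betw_same_card[OF h(2)] by (simp add: card_cartesian_product)
  qed (use finP in simp)
  have "fst ` c1_ses K Q (C_cplx r) (C_cplx r) (K_cplx P) = {f \<in> c1_homs K Q (C_cplx r) (K_cplx P).
      inj_on f (carrier (fst (C_cplx r))) \<and> f ` carrier (fst (C_cplx r)) = ?f ` carrier (fst (C_cplx r))}"
    (is "?L = ?R")
  proof (intro equalityI subsetI)
    fix f assume "f \<in> ?L"
    then have "f \<in> c1_homs K Q (C_cplx r) (K_cplx P)" "inj_on f (carrier ?P \<times> carrier ?W)"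
      by (auto simp: c1_ses_def short_exact_def)
    then show "f \<in> ?R" using image f_im by simp
  next
    fix f assume "f \<in> ?R"
    then have "f \<in> c1_homs K Q (C_cplx r) (K_cplx P)" "inj_on f (carrier ?P \<times> carrier ?W)" by auto
    then have "(f, ?g) \<in> c1_ses K Q (C_cplx r) (C_cplx r) (K_cplx P)" using ses image by simp
    then show "f \<in> ?L" by (rule rev_image_eqI) simp
  qed
  moreover have "card ?R = card (c1_auts K Q (C_cplx r))"
    by (rule card_monos_same_image[OF diff_module_object[OF obj(1)] diff_module_object[OF obj(2)] f]) (use f_inj in simp)
  ultimately show "c1_hall K Q (C_cplx r) (C_cplx r) (K_cplx P) = 1"
    unfolding c1_hall_eq(2)[OF obj(1) obj(1) obj(2)]
    using card_c1_auts_pos[OF diff_module_object[OF obj(1)]] by simp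
qed

end

section \<open>Modules as representations of the quiver\<close>

context finite_path_algebra
begin

subsection \<open>Generation by scalars, vertices and arrows\<close>

text \<open>
  An element is a linear combination of finitely many paths, and a path is a product of arrows; the last
  arrow of a path is split off on the left.
\<close>
lemma generated_by_arrows:
  assumes a: "a \<in> carrier A"
    and scalar: "\<And>c. c \<in> carrier K \<Longrightarrow> S (pa_scalar K Q c)"
    and vertex: "\<And>i. i \<in> verts Q \<Longrightarrow> S (pa_vertex K i)"
    and arrow: "\<And>\<rho>. \<rho> \<in> arcs Q \<Longrightarrow> S (pa_arrow K Q \<rho>)"
    and add: "\<And>a b. \<lbrakk>a \<in> carrier A; b \<in> carrier A; S a; S b\<rbrakk> \<Longrightarrow> S (a \<oplus>\<^bsub>A\<^esub> b)"
    and mult: "\<And>a b. \<lbrakk>a \<in> carrier A; b \<in> carrier A; S a; S b\<rbrakk> \<Longrightarrow> S (a \<otimes>\<^bsub>A\<^esub> b)"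
  shows "S a"
proof -
  let ?path = "\<lambda>p q. if q = p then \<one>\<^bsub>K\<^esub> else \<zero>\<^bsub>K\<^esub>"
  have path_closed: "?path p \<in> carrier A" if "p \<in> qpaths Q" for p using that by (auto simp: carrier_A)
  have path: "S (?path (u, es))" if "(u, es) \<in> qpaths Q" for u es
    using that
  proof (induction es rule: rev_induct)
    case Nil
    then show ?case using vertex[of u] by (simp add: pa_vertex_def)
  next
    case (snoc \<rho> es)
    have p: "(u, es) \<in> qpaths Q" "\<rho> \<in> arcs Q" using snoc.prems by (auto simp: path_append)
    have "?path (u, es @ [\<rho>]) = pa_arrow K Q \<rho> \<otimes>\<^bsub>A\<^esub> ?path (u, es)"
      unfolding arrow_mult[OF p(2) path_closed[OF p(1)]]
    proof (rule ext, clarify)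
      fix v fs show "?path (u, es @ [\<rho>]) (v, fs) = (if (v, fs) \<in> qpaths Q \<and> fs \<noteq> [] \<and> last fs = \<rho>
          then ?path (u, es) (v, butlast fs) else \<zero>\<^bsub>K\<^esub>)"
        using snoc.prems by (cases fs rule: rev_exhaust) auto
    qed
    then show ?case using mult[OF arrow_closed[OF p(2)] path_closed[OF p(1)] arrow[OF p(2)] snoc.IH[OF p(1)]] by simp
  qed
  have zero: "S \<zero>\<^bsub>A\<^esub>" using scalar[of "\<zero>\<^bsub>K\<^esub>"] by (simp add: pa_scalar_def A_zero case_prod_unfold)
  have fin: "S a" if "finite F" "a \<in> carrier A" "\<And>p. p \<notin> F \<Longrightarrow> a p = \<zero>\<^bsub>K\<^esub>" for F a
    using that
  proof (induction F arbitrary: a rule: finite_induct)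
    case empty
    then have "a = \<zero>\<^bsub>A\<^esub>" by (auto simp: A_zero)
    then show ?case using zero by simp
  next
    case (insert p F)
    note acl = coeff_closed[OF insert.prems(1)]
    show ?case
    proof (cases "p \<in> qpaths Q")
      case True
      let ?a = "a(p := \<zero>\<^bsub>K\<^esub>)"
      have a': "?a \<in> carrier A" using insert.prems(1) by (auto simp: carrier_A)
      have S1: "S ?a" by (rule insert.IH[OF a']) (use insert.prems(2) in auto)
      have S2: "S (pa_scalar K Q (a p) \<otimes>\<^bsub>A\<^esub> ?path p)"
        using mult[OF scalar_closed[OF acl] path_closed[OF True] scalar[OF acl]] path[of "fst p" "snd p"] True by simp
      have eq: "?a \<oplus>\<^bsub>A\<^esub> (pa_scalar K Q (a p) \<otimes>\<^bsub>A\<^esub> ?path p) = a"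
      proof
        fix q show "(?a \<oplus>\<^bsub>A\<^esub> (pa_scalar K Q (a p) \<otimes>\<^bsub>A\<^esub> ?path p)) q = a q"
          using acl by (cases "q = p") (simp_all add: scalar_mult[OF acl path_closed[OF True]] A_add)
      qed
      show ?thesis
        using add[OF a' A.m_closed[OF scalar_closed[OF acl] path_closed[OF True]] S1 S2] unfolding eq .
    next
      case False
      have "a q = \<zero>\<^bsub>K\<^esub>" if "q \<notin> F" for q
        using coeff_outside[OF insert.prems(1) False] insert.prems(2)[of q] that by (cases "q = p") simp_all
      then show ?thesis by (rule insert.IH[OF insert.prems(1)])
    qed
  qed
  show ?thesis by (rule fin[OF finite_paths a coeff_outside[OF a]])
qed

lemma hom_of_generators:
  assumes M: "left_module A M" and N: "left_module A N"
    and f: "f \<in> module_hom K (k_space K Q M) (k_space K Q N)"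
    and vertex: "\<And>i x. \<lbrakk>i \<in> verts Q; x \<in> carrier M\<rbrakk> \<Longrightarrow> f (pa_vertex K i \<odot>\<^bsub>M\<^esub> x) = pa_vertex K i \<odot>\<^bsub>N\<^esub> f x"
    and arrow: "\<And>\<rho> x. \<lbrakk>\<rho> \<in> arcs Q; x \<in> carrier M\<rbrakk> \<Longrightarrow> f (pa_arrow K Q \<rho> \<odot>\<^bsub>M\<^esub> x) = pa_arrow K Q \<rho> \<odot>\<^bsub>N\<^esub> f x"
  shows "f \<in> module_hom A M N"
proof (rule homI)
  note [simp] = left_module_rules[OF M] left_module_rules[OF N]
  have F: "\<And>x. x \<in> carrier M \<Longrightarrow> f x \<in> carrier N"
    "\<And>x y. \<lbrakk>x \<in> carrier M; y \<in> carrier M\<rbrakk> \<Longrightarrow> f (x \<oplus>\<^bsub>M\<^esub> y) = f x \<oplus>\<^bsub>N\<^esub> f y"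
    "\<And>c x. \<lbrakk>c \<in> carrier K; x \<in> carrier M\<rbrakk> \<Longrightarrow> f (pa_scalar K Q c \<odot>\<^bsub>M\<^esub> x) = pa_scalar K Q c \<odot>\<^bsub>N\<^esub> f x"
    using f by (auto simp: module_hom_def Pi_iff)
  fix a x assume a: "a \<in> carrier A" and x: "x \<in> carrier M"
  have "\<forall>x \<in> carrier M. f (a \<odot>\<^bsub>M\<^esub> x) = a \<odot>\<^bsub>N\<^esub> f x"
    using a by (rule generated_by_arrows)
      (simp_all add: F vertex arrow left_module_smult[OF M] left_module_smult[OF N])
  then show "f (a \<odot>\<^bsub>M\<^esub> x) = a \<odot>\<^bsub>N\<^esub> f x" using x by simp
qed (use f in \<open>auto simp: module_hom_def Pi_iff\<close>)

subsection \<open>Decomposition into vertex spaces\<close>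

abbreviation vertex_space :: "('v, 'e, 'k, 'm) pa_module \<Rightarrow> 'v \<Rightarrow> ('k, 'm) module" where
  "vertex_space M i \<equiv> k_space K Q M \<lparr>carrier := (\<lambda>x. pa_vertex K i \<odot>\<^bsub>M\<^esub> x) ` carrier M\<rparr>"

lemma vertex_mult_vertex:
  assumes "i \<in> verts Q" "j \<in> verts Q"
  shows "pa_vertex K i \<otimes>\<^bsub>A\<^esub> pa_vertex K j = (if i = j then pa_vertex K i else \<zero>\<^bsub>A\<^esub>)"
  unfolding vertex_mult[OF assms(1) vertex_closed[OF assms(2)]]
  by (rule ext) (auto simp: pa_vertex_def A_zero split: if_splits)

lemma vertex_mult_arrow:
  assumes "i \<in> verts Q" "\<rho> \<in> arcs Q"
  shows "pa_vertex K i \<otimes>\<^bsub>A\<^esub> pa_arrow K Q \<rho> = (if i = head Q \<rho> then pa_arrow K Q \<rho> else \<zero>\<^bsub>A\<^esub>)"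
  unfolding vertex_mult[OF assms(1) arrow_closed[OF assms(2)]]
  by (rule ext) (auto simp: pa_arrow_def A_zero split: if_splits)

lemma arrow_mult_tail:
  assumes "\<rho> \<in> arcs Q"
  shows "pa_arrow K Q \<rho> \<otimes>\<^bsub>A\<^esub> pa_vertex K (tail Q \<rho>) = pa_arrow K Q \<rho>"
proof -
  have t: "tail Q \<rho> \<in> verts Q" using assms by simp
  show ?thesis
    unfolding arrow_mult[OF assms vertex_closed[OF t]]
  proof (rule ext, clarify)
    fix u es show "(if (u, es) \<in> qpaths Q \<and> es \<noteq> [] \<and> last es = \<rho> then pa_vertex K (tail Q \<rho>) (u, butlast es) else \<zero>\<^bsub>K\<^esub>) =
        pa_arrow K Q \<rho> (u, es)"
    proof (cases es rule: rev_exhaust)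
      case (snoc fs \<sigma>)
      show ?thesis unfolding snoc using assms
        by (cases "fs = []"; cases "\<sigma> = \<rho>") (simp_all add: pa_vertex_def pa_arrow_def)
    qed (simp add: pa_arrow_def)
  qed
qed

lemma vertex_action:
  assumes M: "left_module A M"
  shows "\<lbrakk>i \<in> verts Q; j \<in> verts Q; x \<in> carrier M\<rbrakk> \<Longrightarrow>
      pa_vertex K i \<odot>\<^bsub>M\<^esub> (pa_vertex K j \<odot>\<^bsub>M\<^esub> x) = (if i = j then pa_vertex K i \<odot>\<^bsub>M\<^esub> x else \<zero>\<^bsub>M\<^esub>)"
    and "\<lbrakk>i \<in> verts Q; \<rho> \<in> arcs Q; x \<in> carrier M\<rbrakk> \<Longrightarrow>
      pa_vertex K i \<odot>\<^bsub>M\<^esub> (pa_arrow K Q \<rho> \<odot>\<^bsub>M\<^esub> x) = (if i = head Q \<rho> then pa_arrow K Q \<rho> \<odot>\<^bsub>M\<^esub> x else \<zero>\<^bsub>M\<^esub>)"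
    and "\<lbrakk>\<rho> \<in> arcs Q; x \<in> carrier M\<rbrakk> \<Longrightarrow>
      pa_arrow K Q \<rho> \<odot>\<^bsub>M\<^esub> (pa_vertex K (tail Q \<rho>) \<odot>\<^bsub>M\<^esub> x) = pa_arrow K Q \<rho> \<odot>\<^bsub>M\<^esub> x"
    and "\<lbrakk>i \<in> verts Q; c \<in> carrier K; x \<in> carrier M\<rbrakk> \<Longrightarrow>
      pa_vertex K i \<odot>\<^bsub>M\<^esub> (pa_scalar K Q c \<odot>\<^bsub>M\<^esub> x) = pa_scalar K Q c \<odot>\<^bsub>M\<^esub> (pa_vertex K i \<odot>\<^bsub>M\<^esub> x)"
    and "\<lbrakk>\<rho> \<in> arcs Q; c \<in> carrier K; x \<in> carrier M\<rbrakk> \<Longrightarrow>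
      pa_arrow K Q \<rho> \<odot>\<^bsub>M\<^esub> (pa_scalar K Q c \<odot>\<^bsub>M\<^esub> x) = pa_scalar K Q c \<odot>\<^bsub>M\<^esub> (pa_arrow K Q \<rho> \<odot>\<^bsub>M\<^esub> x)"
  by (simp_all add: left_module_smult(3)[OF M, symmetric] left_module_smult(5)[OF M] vertex_closed arrow_closed
      scalar_closed vertex_mult_vertex vertex_mult_arrow arrow_mult_tail scalar_central)

lemma vertex_space_iff:
  assumes M: "left_module A M" and i: "i \<in> verts Q"
  shows "x \<in> carrier (vertex_space M i) \<longleftrightarrow> x \<in> carrier M \<and> pa_vertex K i \<odot>\<^bsub>M\<^esub> x = x"
proof -
  have "x \<in> (\<lambda>x. pa_vertex K i \<odot>\<^bsub>M\<^esub> x) ` carrier M" if "x \<in> carrier M" "pa_vertex K i \<odot>\<^bsub>M\<^esub> x = x"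
    using that by (metis imageI)
  then show ?thesis
    using vertex_action(1)[OF M i i] left_module_rules(5)[OF M vertex_closed[OF i]] by auto
qed

lemma vertex_space_vectorspace:
  assumes M: "left_module A M" and i: "i \<in> verts Q"
  shows "vectorspace K (vertex_space M i)"
proof (rule k_subspace[OF M])
  note [simp] = left_module_rules[OF M] vertex_closed[OF i]
  show "(\<lambda>x. pa_vertex K i \<odot>\<^bsub>M\<^esub> x) ` carrier M \<subseteq> carrier M" by auto
qed (simp_all add: vertex_space_iff[OF M i, simplified] left_module_rules[OF M] left_module_smult(1,4,6)[OF M]
    vertex_closed[OF i] scalar_closed vertex_action(4)[OF M i])

lemma left_module_vertex_space: "left_module A M \<Longrightarrow> i \<in> verts Q \<Longrightarrow> left_module K (vertex_space M i)"
  by (rule left_module_of_module) (rule vectorspace.axioms[OF vertex_space_vectorspace])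

text \<open>
  Negatives are defined relative to the carrier, so those of a vertex space have to be compared with those
  of the whole module.
\<close>
lemma vertex_space_minus:
  assumes M: "left_module A M" and i: "i \<in> verts Q"
    and x: "x \<in> carrier (vertex_space M i)" and y: "y \<in> carrier (vertex_space M i)"
  shows "x \<ominus>\<^bsub>vertex_space M i\<^esub> y = x \<ominus>\<^bsub>M\<^esub> y"
proof -
  note [simp] = left_module_rules[OF M] vertex_closed[OF i]
  have xy: "x \<in> carrier M" "y \<in> carrier M" "pa_vertex K i \<odot>\<^bsub>M\<^esub> x = x" "pa_vertex K i \<odot>\<^bsub>M\<^esub> y = y"
    using x y unfolding vertex_space_iff[OF M i] by auto
  then have z: "x \<ominus>\<^bsub>M\<^esub> y \<in> carrier (vertex_space M i)"
    unfolding vertex_space_iff[OF M i] by (simp add: left_module_arith(4)[OF M] left_module_smult(1,6)[OF M])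
  have "x = (x \<ominus>\<^bsub>M\<^esub> y) \<oplus>\<^bsub>vertex_space M i\<^esub> y"
    using left_module_move(2)[OF M xy(1,2), of "x \<ominus>\<^bsub>M\<^esub> y"] xy by simp
  then show ?thesis using left_module_move(2)[OF left_module_vertex_space[OF M i] x y z] by simp
qed

text \<open>The vertices sum up to the unit of the path algebra.\<close>
lemma components_unique:
  assumes M: "left_module A M" and x: "x \<in> carrier M" and y: "y \<in> carrier M"
    and eq: "\<And>i. i \<in> verts Q \<Longrightarrow> pa_vertex K i \<odot>\<^bsub>M\<^esub> x = pa_vertex K i \<odot>\<^bsub>M\<^esub> y"
  shows "x = y"
proof -
  note [simp] = left_module_rules[OF M]
  let ?e = "\<lambda>I (u, es). if u \<in> I \<and> es = [] then \<one>\<^bsub>K\<^esub> else \<zero>\<^bsub>K\<^esub>"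
  have "?e I \<in> carrier A \<and> ?e I \<odot>\<^bsub>M\<^esub> x = ?e I \<odot>\<^bsub>M\<^esub> y" if "finite I" "I \<subseteq> verts Q" for I
    using that
  proof (induction I rule: finite_induct)
    case empty
    have "?e {} = \<zero>\<^bsub>A\<^esub>" by (auto simp: A_zero)
    then show ?case using x y by (simp add: left_module_smult(5)[OF M])
  next
    case (insert i I)
    have "?e (insert i I) = pa_vertex K i \<oplus>\<^bsub>A\<^esub> ?e I" using insert.hyps by (auto simp: A_add pa_vertex_def)
    then show ?case using insert x y by (simp add: left_module_smult(2)[OF M] vertex_closed eq)
  qed
  from this[OF finite_verts order_refl] have "?e (verts Q) \<odot>\<^bsub>M\<^esub> x = ?e (verts Q) \<odot>\<^bsub>M\<^esub> y" by simp
  moreover have "?e (verts Q) = \<one>\<^bsub>A\<^esub>" by (simp add: A_one pa_scalar_def)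
  ultimately show ?thesis using x y by simp
qed

lemma components_exist:
  assumes M: "left_module A M" and f: "\<And>i. i \<in> verts Q \<Longrightarrow> f i \<in> carrier (vertex_space M i)"
  shows "\<exists>x \<in> carrier M. \<forall>i \<in> verts Q. pa_vertex K i \<odot>\<^bsub>M\<^esub> x = f i"
proof -
  note [simp] = left_module_rules[OF M]
  have F: "f i \<in> carrier M" "pa_vertex K i \<odot>\<^bsub>M\<^esub> f i = f i" if "i \<in> verts Q" for i
    using f[OF that] unfolding vertex_space_iff[OF M that] by auto
  have off: "pa_vertex K i \<odot>\<^bsub>M\<^esub> f j = \<zero>\<^bsub>M\<^esub>" if "i \<in> verts Q" "j \<in> verts Q" "i \<noteq> j" for i j
    using vertex_action(1)[OF M that(1,2) F(1)[OF that(2)]] F(2)[OF that(2)] that(3) by simp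
  have "\<exists>x \<in> carrier M. \<forall>i \<in> verts Q. pa_vertex K i \<odot>\<^bsub>M\<^esub> x = (if i \<in> I then f i else \<zero>\<^bsub>M\<^esub>)"
    if "finite I" "I \<subseteq> verts Q" for I
    using that
  proof (induction I rule: finite_induct)
    case empty
    then show ?case by (intro bexI[of _ "\<zero>\<^bsub>M\<^esub>"]) (simp_all add: left_module_smult(4)[OF M] vertex_closed)
  next
    case (insert j I)
    then obtain x where x: "x \<in> carrier M" "\<And>i. i \<in> verts Q \<Longrightarrow> pa_vertex K i \<odot>\<^bsub>M\<^esub> x = (if i \<in> I then f i else \<zero>\<^bsub>M\<^esub>)"
      by auto
    have j: "j \<in> verts Q" using insert.prems by simp
    have "pa_vertex K i \<odot>\<^bsub>M\<^esub> (x \<oplus>\<^bsub>M\<^esub> f j) = (if i \<in> insert j I then f i else \<zero>\<^bsub>M\<^esub>)" if i: "i \<in> verts Q" for i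
      using insert.hyps(2) x(1) x(2)[OF i] F[OF i] F[OF j] off[OF i j]
      by (cases "i = j") (simp_all add: left_module_smult(1)[OF M] vertex_closed[OF i] vertex_closed[OF j])
    then show ?case using x(1) F(1)[OF j] by (intro bexI[of _ "x \<oplus>\<^bsub>M\<^esub> f j"]) simp_all
  qed
  from this[OF finite_verts order_refl] show ?thesis by auto
qed

end

lemma left_module_difference:
  assumes M: "left_module R M" and cl: "a \<in> carrier M" "b \<in> carrier M" "c \<in> carrier M" "d \<in> carrier M"
    and eq: "a \<ominus>\<^bsub>M\<^esub> b = c \<ominus>\<^bsub>M\<^esub> d"
  shows "a \<ominus>\<^bsub>M\<^esub> c = b \<ominus>\<^bsub>M\<^esub> d"
proof -
  note [simp] = left_module_rules[OF M] and ar = left_module_arith[OF M]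
  have "a = (c \<ominus>\<^bsub>M\<^esub> d) \<oplus>\<^bsub>M\<^esub> b" using left_module_move(2)[OF M cl(1,2), of "c \<ominus>\<^bsub>M\<^esub> d"] eq cl by simp
  also have "\<dots> = (b \<ominus>\<^bsub>M\<^esub> d) \<oplus>\<^bsub>M\<^esub> c" using cl by (simp add: ar(1-4))
  finally show ?thesis using left_module_move(2)[OF M cl(1,3), of "b \<ominus>\<^bsub>M\<^esub> d"] cl by simp
qed

context finite_path_algebra
begin

subsection \<open>Dimension vectors\<close>

definition vdim :: "('v, 'e, 'k, 'm) pa_module \<Rightarrow> 'v \<Rightarrow> nat" where
  "vdim M i = vectorspace.dim K (vertex_space M i)"

lemma card_K_gt_1: "card (carrier K) > 1"
proof -
  have "card {\<zero>\<^bsub>K\<^esub>, \<one>\<^bsub>K\<^esub>} \<le> card (carrier K)" by (rule card_mono[OF finite_K]) simp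
  then show ?thesis using K.one_not_zero by simp
qed

lemma finite_vertex_space: "fd_module K Q M \<Longrightarrow> finite (carrier (vertex_space M i))"
  by (simp add: fdD(2))

lemma card_vertex_space:
  assumes "fd_module K Q M" "i \<in> verts Q"
  shows "card (carrier (vertex_space M i)) = card (carrier K) ^ vdim M i"
  unfolding vdim_def
  by (rule vectorspace.card_carrier_finite[OF vertex_space_vectorspace[OF fdD(1)[OF assms(1)] assms(2)]
      finite_vertex_space[OF assms(1)] finite_K])

lemma card_le_components:
  assumes X: "fd_module K Q X"
  shows "card (carrier X) \<le> card (carrier K) ^ (\<Sum>i \<in> verts Q. vdim X i)"
proof -
  note lX = fdD(1)[OF X]
  let ?V = "PiE (verts Q) (\<lambda>i. carrier (vertex_space X i))"
  have "card (carrier X) \<le> card ?V"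
  proof (rule card_inj_on_le)
    show "inj_on (\<lambda>x. \<lambda>i \<in> verts Q. pa_vertex K i \<odot>\<^bsub>X\<^esub> x) (carrier X)"
    proof (rule inj_onI)
      fix x y assume xy: "x \<in> carrier X" "y \<in> carrier X"
        and eq: "(\<lambda>i \<in> verts Q. pa_vertex K i \<odot>\<^bsub>X\<^esub> x) = (\<lambda>i \<in> verts Q. pa_vertex K i \<odot>\<^bsub>X\<^esub> y)"
      show "x = y"
      proof (rule components_unique[OF lX xy])
        fix i assume "i \<in> verts Q"
        then show "pa_vertex K i \<odot>\<^bsub>X\<^esub> x = pa_vertex K i \<odot>\<^bsub>X\<^esub> y" using fun_cong[OF eq, of i] by simp
      qed
    qed
    show "(\<lambda>x. \<lambda>i \<in> verts Q. pa_vertex K i \<odot>\<^bsub>X\<^esub> x) ` carrier X \<subseteq> ?V" by auto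
    show "finite ?V" by (rule finite_PiE[OF finite_verts finite_vertex_space[OF X]])
  qed
  also have "card ?V = (\<Prod>i \<in> verts Q. card (carrier (vertex_space X i)))" by (rule card_PiE[OF finite_verts])
  also have "\<dots> = card (carrier K) ^ (\<Sum>i \<in> verts Q. vdim X i)"
    unfolding power_sum by (rule prod.cong[OF refl card_vertex_space[OF X]])
  finally show ?thesis .
qed

lemma hom_vertex_space:
  assumes f: "f \<in> module_hom A M N" and M: "left_module A M" and N: "left_module A N" and i: "i \<in> verts Q"
  shows "f \<in> module_hom K (vertex_space M i) (vertex_space N i)"
proof (rule homI)
  note F = hom_rules[OF f M N]
  note V = vertex_space_iff[OF M i] and W = vertex_space_iff[OF N i]
  show "f x \<in> carrier (vertex_space N i)" if "x \<in> carrier (vertex_space M i)" for x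
    using that F(3)[OF vertex_closed[OF i], of x] unfolding V W by (simp add: F(1))
  show "f (x \<oplus>\<^bsub>vertex_space M i\<^esub> y) = f x \<oplus>\<^bsub>vertex_space N i\<^esub> f y"
    if "x \<in> carrier (vertex_space M i)" "y \<in> carrier (vertex_space M i)" for x y
    using that unfolding V by (simp add: F(2))
  show "f (c \<odot>\<^bsub>vertex_space M i\<^esub> x) = c \<odot>\<^bsub>vertex_space N i\<^esub> f x"
    if "c \<in> carrier K" "x \<in> carrier (vertex_space M i)" for c x
    using that unfolding V by (simp add: F(3) scalar_closed)
qed

text \<open>The vertex spaces of an exact sequence form exact sequences of vector spaces.\<close>
lemma vdim_additive:
  assumes Y: "fd_module K Q Y" and Z: "fd_module K Q Z" and X: "fd_module K Q X"
    and f: "f \<in> module_hom A Y Z" and g: "g \<in> module_hom A Z X" and ex: "short_exact Y f Z g X"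
    and i: "i \<in> verts Q"
  shows "vdim Z i = vdim Y i + vdim X i"
proof -
  note lY = fdD(1)[OF Y] and lZ = fdD(1)[OF Z] and lX = fdD(1)[OF X]
  note V = vertex_space_iff[OF lY i] vertex_space_iff[OF lZ i] vertex_space_iff[OF lX i]
  note [simp] = hom_rules[OF f lY lZ] hom_rules[OF g lZ lX] left_module_rules[OF lZ] left_module_rules[OF lX]
    left_module_rules[OF lY] vertex_closed[OF i]
  have inj: "inj_on f (carrier Y)" and onto: "g ` carrier Z = carrier X"
    and im: "f ` carrier Y = {z \<in> carrier Z. g z = \<zero>\<^bsub>X\<^esub>}" using ex by (auto simp: short_exact_def)
  have "short_exact (vertex_space Y i) f (vertex_space Z i) g (vertex_space X i)"
    unfolding short_exact_def
  proof (intro conjI)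
    have sub: "carrier (vertex_space Y i) \<subseteq> carrier Y" unfolding V(1) subset_iff by simp
    show "inj_on f (carrier (vertex_space Y i))" by (rule inj_on_subset[OF inj sub])
    show "g ` carrier (vertex_space Z i) = carrier (vertex_space X i)"
    proof (intro equalityI subsetI)
      fix x assume "x \<in> carrier (vertex_space X i)"
      then have x: "x \<in> carrier X" "pa_vertex K i \<odot>\<^bsub>X\<^esub> x = x" unfolding V(3) by auto
      have "x \<in> g ` carrier Z" unfolding onto by (rule x(1))
      then obtain z where z: "z \<in> carrier Z" "x = g z" by auto
      have "pa_vertex K i \<odot>\<^bsub>Z\<^esub> z \<in> carrier (vertex_space Z i)" using z(1) by simp
      moreover have "x = g (pa_vertex K i \<odot>\<^bsub>Z\<^esub> z)" using z x(2) by simp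
      ultimately show "x \<in> g ` carrier (vertex_space Z i)" by (intro image_eqI)
    next
      fix x assume "x \<in> g ` carrier (vertex_space Z i)"
      then obtain z where z: "z \<in> carrier (vertex_space Z i)" "x = g z" by (rule imageE) auto
      then have "z \<in> carrier Z" "pa_vertex K i \<odot>\<^bsub>Z\<^esub> z = z" unfolding V(2) by auto
      then have "g z \<in> carrier X" "pa_vertex K i \<odot>\<^bsub>X\<^esub> g z = g z"
        using hom_rules(3)[OF g lZ lX vertex_closed[OF i], of z] by simp_all
      then show "x \<in> carrier (vertex_space X i)" unfolding V(3) z(2) by simp
    qed
    show "f ` carrier (vertex_space Y i) = {z \<in> carrier (vertex_space Z i). g z = \<zero>\<^bsub>vertex_space X i\<^esub>}"
    proof (intro equalityI subsetI)
      fix z assume "z \<in> {z \<in> carrier (vertex_space Z i). g z = \<zero>\<^bsub>vertex_space X i\<^esub>}"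
      then have z: "z \<in> carrier Z" "pa_vertex K i \<odot>\<^bsub>Z\<^esub> z = z" "g z = \<zero>\<^bsub>X\<^esub>" unfolding V(2) mem_Collect_eq by auto
      have "z \<in> f ` carrier Y" unfolding im using z by simp
      then obtain y where y: "y \<in> carrier Y" "z = f y" by auto
      have "pa_vertex K i \<odot>\<^bsub>Y\<^esub> y \<in> carrier (vertex_space Y i)" using y(1) by simp
      moreover have "z = f (pa_vertex K i \<odot>\<^bsub>Y\<^esub> y)" using y z(2) by simp
      ultimately show "z \<in> f ` carrier (vertex_space Y i)" by (intro image_eqI)
    next
      fix z assume "z \<in> f ` carrier (vertex_space Y i)"
      then obtain y where y: "y \<in> carrier (vertex_space Y i)" "z = f y" by (rule imageE) auto
      then have y': "y \<in> carrier Y" "pa_vertex K i \<odot>\<^bsub>Y\<^esub> y = y" unfolding V(1) by auto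
      then have "f y \<in> carrier Z" "pa_vertex K i \<odot>\<^bsub>Z\<^esub> f y = f y"
        using hom_rules(3)[OF f lY lZ vertex_closed[OF i], of y] by simp_all
      moreover have "g (f y) = \<zero>\<^bsub>X\<^esub>"
      proof -
        have "f y \<in> {z \<in> carrier Z. g z = \<zero>\<^bsub>X\<^esub>}" unfolding im[symmetric] using y'(1) by simp
        then show ?thesis by simp
      qed
      ultimately show "z \<in> {z \<in> carrier (vertex_space Z i). g z = \<zero>\<^bsub>vertex_space X i\<^esub>}"
        unfolding V(2) mem_Collect_eq y(2) by simp
    qed
  qed
  from card_short_exact[OF hom_vertex_space[OF f lY lZ i] hom_vertex_space[OF g lZ lX i]
      left_module_vertex_space[OF lZ i] left_module_vertex_space[OF lX i] finite_vertex_space[OF Z] this]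
  have "card (carrier K) ^ vdim Z i = card (carrier K) ^ (vdim Y i + vdim X i)"
    unfolding card_vertex_space[OF X i] card_vertex_space[OF Y i] card_vertex_space[OF Z i] by (simp add: power_add)
  then show ?thesis using card_K_gt_1 by (simp only: power_inject_exp)
qed

subsection \<open>The Euler form bounds the number of homomorphisms\<close>

lemma arrow_vertex_space:
  assumes M: "left_module A M" and \<rho>: "\<rho> \<in> arcs Q"
  shows "(\<lambda>x. pa_arrow K Q \<rho> \<odot>\<^bsub>M\<^esub> x) \<in> module_hom K (vertex_space M (tail Q \<rho>)) (vertex_space M (head Q \<rho>))"
proof (rule homI)
  have t: "tail Q \<rho> \<in> verts Q" and h: "head Q \<rho> \<in> verts Q" using \<rho> by auto
  note [simp] = left_module_rules[OF M] left_module_smult(1)[OF M] arrow_closed[OF \<rho>]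
  note V = vertex_space_iff[OF M t] vertex_space_iff[OF M h]
  show "pa_arrow K Q \<rho> \<odot>\<^bsub>M\<^esub> x \<in> carrier (vertex_space M (head Q \<rho>))" if "x \<in> carrier (vertex_space M (tail Q \<rho>))" for x
    using that vertex_action(2)[OF M h \<rho>, of x] unfolding V by simp
  show "pa_arrow K Q \<rho> \<odot>\<^bsub>M\<^esub> (x \<oplus>\<^bsub>vertex_space M (tail Q \<rho>)\<^esub> y) =
      pa_arrow K Q \<rho> \<odot>\<^bsub>M\<^esub> x \<oplus>\<^bsub>vertex_space M (head Q \<rho>)\<^esub> pa_arrow K Q \<rho> \<odot>\<^bsub>M\<^esub> y"
    if "x \<in> carrier (vertex_space M (tail Q \<rho>))" "y \<in> carrier (vertex_space M (tail Q \<rho>))" for x y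
    using that unfolding V by simp
  show "pa_arrow K Q \<rho> \<odot>\<^bsub>M\<^esub> (c \<odot>\<^bsub>vertex_space M (tail Q \<rho>)\<^esub> x) = c \<odot>\<^bsub>vertex_space M (head Q \<rho>)\<^esub> (pa_arrow K Q \<rho> \<odot>\<^bsub>M\<^esub> x)"
    if "c \<in> carrier K" "x \<in> carrier (vertex_space M (tail Q \<rho>))" for c x
    using that unfolding V by (simp add: vertex_action(5)[OF M \<rho>])
qed

text \<open>
  The family glues to a linear map because a module is the product of its vertex spaces, and compatibility
  with the path algebra has to be tested on the vertices and arrows only.
\<close>
lemma hom_of_components:
  assumes M: "left_module A M" and X: "left_module A X"
    and \<psi>: "\<And>i. i \<in> verts Q \<Longrightarrow> \<psi> i \<in> module_hom K (vertex_space M i) (vertex_space X i)"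
    and comm: "\<And>\<rho> x. \<lbrakk>\<rho> \<in> arcs Q; x \<in> carrier (vertex_space M (tail Q \<rho>))\<rbrakk> \<Longrightarrow>
      \<psi> (head Q \<rho>) (pa_arrow K Q \<rho> \<odot>\<^bsub>M\<^esub> x) = pa_arrow K Q \<rho> \<odot>\<^bsub>X\<^esub> \<psi> (tail Q \<rho>) x"
  obtains h where "h \<in> module_hom A M X"
    "\<And>i x. \<lbrakk>i \<in> verts Q; x \<in> carrier M\<rbrakk> \<Longrightarrow> pa_vertex K i \<odot>\<^bsub>X\<^esub> h x = \<psi> i (pa_vertex K i \<odot>\<^bsub>M\<^esub> x)"
proof -
  note [simp] = left_module_rules[OF M] left_module_rules[OF X] vertex_closed arrow_closed scalar_closed
    left_module_smult(1)[OF M] left_module_smult(1)[OF X]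
  have eM: "pa_vertex K i \<odot>\<^bsub>M\<^esub> x \<in> carrier (vertex_space M i)" if "x \<in> carrier M" for i x using that by simp
  note P = hom_rules[OF \<psi> left_module_vertex_space[OF M] left_module_vertex_space[OF X]]
  have "\<exists>y \<in> carrier X. \<forall>i \<in> verts Q. pa_vertex K i \<odot>\<^bsub>X\<^esub> y = \<psi> i (pa_vertex K i \<odot>\<^bsub>M\<^esub> x)" if x: "x \<in> carrier M" for x
    by (rule components_exist[OF X]) (rule P(1)[OF _ _ _ eM[OF x]])
  then obtain h where h: "\<And>x. x \<in> carrier M \<Longrightarrow> h x \<in> carrier X"
    "\<And>i x. \<lbrakk>x \<in> carrier M; i \<in> verts Q\<rbrakk> \<Longrightarrow> pa_vertex K i \<odot>\<^bsub>X\<^esub> h x = \<psi> i (pa_vertex K i \<odot>\<^bsub>M\<^esub> x)"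
    by metis
  have \<psi>X: "\<psi> i y \<in> carrier X" "pa_vertex K i \<odot>\<^bsub>X\<^esub> \<psi> i y = \<psi> i y" if "i \<in> verts Q" "y \<in> carrier (vertex_space M i)" for i y
    using P(1)[OF that(1) that(1) that(1) that(2)] unfolding vertex_space_iff[OF X that(1)] by auto
  have \<psi>0: "\<psi> i \<zero>\<^bsub>M\<^esub> = \<zero>\<^bsub>X\<^esub>" if "i \<in> verts Q" for i using P(4)[OF that that that] by simp
  have "h \<in> module_hom A M X"
  proof (rule hom_of_generators[OF M X])
    show "h \<in> module_hom K (k_space K Q M) (k_space K Q X)"
    proof (rule homI, unfold k_space_simps)
      show "h x \<in> carrier X" if "x \<in> carrier M" for x by (rule h(1)[OF that])
      show "h (x \<oplus>\<^bsub>M\<^esub> y) = h x \<oplus>\<^bsub>X\<^esub> h y" if xy: "x \<in> carrier M" "y \<in> carrier M" for x y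
      proof (rule components_unique[OF X])
        fix i assume i: "i \<in> verts Q"
        show "pa_vertex K i \<odot>\<^bsub>X\<^esub> h (x \<oplus>\<^bsub>M\<^esub> y) = pa_vertex K i \<odot>\<^bsub>X\<^esub> (h x \<oplus>\<^bsub>X\<^esub> h y)"
          using P(2)[OF i i i eM[OF xy(1)] eM[OF xy(2)]] i xy h(1) by (simp add: h(2))
      qed (use xy h(1) in simp_all)
      show "h (pa_scalar K Q c \<odot>\<^bsub>M\<^esub> x) = pa_scalar K Q c \<odot>\<^bsub>X\<^esub> h x" if cx: "c \<in> carrier K" "x \<in> carrier M" for c x
      proof (rule components_unique[OF X])
        fix i assume i: "i \<in> verts Q"
        show "pa_vertex K i \<odot>\<^bsub>X\<^esub> h (pa_scalar K Q c \<odot>\<^bsub>M\<^esub> x) = pa_vertex K i \<odot>\<^bsub>X\<^esub> (pa_scalar K Q c \<odot>\<^bsub>X\<^esub> h x)"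
          using P(3)[OF i i i cx(1) eM[OF cx(2)]] i cx h(1)
          by (simp add: h(2) vertex_action(4)[OF M] vertex_action(4)[OF X])
      qed (use cx h(1) in simp_all)
    qed
    show "h (pa_vertex K j \<odot>\<^bsub>M\<^esub> x) = pa_vertex K j \<odot>\<^bsub>X\<^esub> h x" if jx: "j \<in> verts Q" "x \<in> carrier M" for j x
    proof (rule components_unique[OF X])
      fix i assume i: "i \<in> verts Q"
      show "pa_vertex K i \<odot>\<^bsub>X\<^esub> h (pa_vertex K j \<odot>\<^bsub>M\<^esub> x) = pa_vertex K i \<odot>\<^bsub>X\<^esub> (pa_vertex K j \<odot>\<^bsub>X\<^esub> h x)"
        unfolding vertex_action(1)[OF X i jx(1) h(1)[OF jx(2)]] h(2)[OF left_module_rules(5)[OF M vertex_closed[OF jx(1)] jx(2)] i]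
          vertex_action(1)[OF M i jx] using h(2)[OF jx(2) i] \<psi>0[OF i] by (cases "i = j") simp_all
    qed (use jx h(1) in simp_all)
    show "h (pa_arrow K Q \<rho> \<odot>\<^bsub>M\<^esub> x) = pa_arrow K Q \<rho> \<odot>\<^bsub>X\<^esub> h x" if rx: "\<rho> \<in> arcs Q" "x \<in> carrier M" for \<rho> x
    proof (rule components_unique[OF X])
      have t: "tail Q \<rho> \<in> verts Q" and hd: "head Q \<rho> \<in> verts Q" using rx(1) by auto
      have c: "\<psi> (head Q \<rho>) (pa_arrow K Q \<rho> \<odot>\<^bsub>M\<^esub> x) = pa_arrow K Q \<rho> \<odot>\<^bsub>X\<^esub> h x"
        using comm[OF rx(1) eM[OF rx(2)]] h(2)[OF rx(2) t, symmetric] rx h(1)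
        by (simp add: vertex_action(3)[OF M] vertex_action(3)[OF X])
      fix i assume i: "i \<in> verts Q"
      show "pa_vertex K i \<odot>\<^bsub>X\<^esub> h (pa_arrow K Q \<rho> \<odot>\<^bsub>M\<^esub> x) = pa_vertex K i \<odot>\<^bsub>X\<^esub> (pa_arrow K Q \<rho> \<odot>\<^bsub>X\<^esub> h x)"
        unfolding vertex_action(2)[OF X i rx(1) h(1)[OF rx(2)]] h(2)[OF left_module_rules(5)[OF M arrow_closed[OF rx(1)] rx(2)] i]
          vertex_action(2)[OF M i rx] using c \<psi>0[OF i] by (cases "i = head Q \<rho>") simp_all
    qed (use rx h(1) in simp_all)
  qed
  then show thesis using that h(2) by blast
qed

text \<open>
  \<open>Hom(M, X)\<close> is the kernel of the linear map \<open>\<Delta>\<close> from the families of linear maps at the vertices to the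
  families indexed by the arrows, which measures the failure to commute with the arrows.  Its fibres are
  no larger than its kernel.
\<close>
lemma card_homs_ge_euler:
  assumes M: "fd_module K Q M" and X: "fd_module K Q X"
  shows "card (carrier K) ^ (\<Sum>i \<in> verts Q. vdim M i * vdim X i) \<le>
    card (mod_homs A M X) * card (carrier K) ^ (\<Sum>\<rho> \<in> arcs Q. vdim M (tail Q \<rho>) * vdim X (head Q \<rho>))"
proof -
  note lM = fdD(1)[OF M] and lX = fdD(1)[OF X]
  let ?H = "\<lambda>i j. mod_homs K (vertex_space M i) (vertex_space X j)"
  let ?D = "PiE (verts Q) (\<lambda>i. ?H i i)" and ?C = "PiE (arcs Q) (\<lambda>\<rho>. ?H (tail Q \<rho>) (head Q \<rho>))"
  have cardH: "card (?H i j) = card (carrier K) ^ (vdim M i * vdim X j)" if "i \<in> verts Q" "j \<in> verts Q" for i j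
    unfolding card_linear_maps[OF vertex_space_vectorspace[OF lM that(1)] vertex_space_vectorspace[OF lX that(2)]
        finite_vertex_space[OF M]] card_vertex_space[OF X that(2)] vdim_def[symmetric] by (simp add: power_mult[symmetric] mult.commute)
  have finH: "finite (?H i j)" if "i \<in> verts Q" "j \<in> verts Q" for i j
    using card_gt_0_iff[of "?H i j"] cardH[OF that] card_K_gt_1 by simp
  have cardD: "card ?D = card (carrier K) ^ (\<Sum>i \<in> verts Q. vdim M i * vdim X i)"
    unfolding card_PiE[OF finite_verts] power_sum by (rule prod.cong[OF refl cardH])
  have cardC: "card ?C = card (carrier K) ^ (\<Sum>\<rho> \<in> arcs Q. vdim M (tail Q \<rho>) * vdim X (head Q \<rho>))"
    unfolding card_PiE[OF finite_arcs] power_sum by (rule prod.cong[OF refl cardH]) simp_all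
  have finD: "finite ?D" by (rule finite_PiE[OF finite_verts finH])
  have finC: "finite ?C" by (rule finite_PiE[OF finite_arcs finH]) simp_all
  define \<Delta> where "\<Delta> \<theta> = (\<lambda>\<rho> \<in> arcs Q. \<lambda>x \<in> carrier (vertex_space M (tail Q \<rho>)).
    (pa_arrow K Q \<rho> \<odot>\<^bsub>X\<^esub> \<theta> (tail Q \<rho>) x) \<ominus>\<^bsub>vertex_space X (head Q \<rho>)\<^esub> \<theta> (head Q \<rho>) (pa_arrow K Q \<rho> \<odot>\<^bsub>M\<^esub> x))" for \<theta>
  have D: "\<theta> i \<in> module_hom K (vertex_space M i) (vertex_space X i)" "\<theta> i \<in> extensional (carrier (vertex_space M i))"
    if "\<theta> \<in> ?D" "i \<in> verts Q" for \<theta> i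
    using PiE_mem[OF that] by (auto simp: mod_homs_def)
  have \<Delta>C: "\<Delta> \<theta> \<in> ?C" if \<theta>: "\<theta> \<in> ?D" for \<theta>
    unfolding \<Delta>_def
  proof (rule restrict_PiE_iff[THEN iffD2], rule ballI)
    fix \<rho> assume \<rho>: "\<rho> \<in> arcs Q"
    then have t: "tail Q \<rho> \<in> verts Q" and h: "head Q \<rho> \<in> verts Q" by auto
    have m: "(\<lambda>x. (pa_arrow K Q \<rho> \<odot>\<^bsub>X\<^esub> \<theta> (tail Q \<rho>) x) \<ominus>\<^bsub>vertex_space X (head Q \<rho>)\<^esub> \<theta> (head Q \<rho>) (pa_arrow K Q \<rho> \<odot>\<^bsub>M\<^esub> x))
        \<in> module_hom K (vertex_space M (tail Q \<rho>)) (vertex_space X (head Q \<rho>))"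
      by (rule hom_minus[OF hom_comp[OF D(1)[OF \<theta> t] arrow_vertex_space[OF lX \<rho>]]
          hom_comp[OF arrow_vertex_space[OF lM \<rho>] D(1)[OF \<theta> h]]
          left_module_vertex_space[OF lM t] left_module_vertex_space[OF lX h]])
    show "(\<lambda>x \<in> carrier (vertex_space M (tail Q \<rho>)).
        (pa_arrow K Q \<rho> \<odot>\<^bsub>X\<^esub> \<theta> (tail Q \<rho>) x) \<ominus>\<^bsub>vertex_space X (head Q \<rho>)\<^esub> \<theta> (head Q \<rho>) (pa_arrow K Q \<rho> \<odot>\<^bsub>M\<^esub> x)) \<in> ?H (tail Q \<rho>) (head Q \<rho>)"
      unfolding mod_homs_def by (intro IntI restrict_extensional hom_cong[OF m left_module_vertex_space[OF lM t]] restrict_apply')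
  qed
  have fibre: "card {\<theta> \<in> ?D. \<Delta> \<theta> = c} \<le> card (mod_homs A M X)" for c
  proof (cases "\<exists>\<theta>0 \<in> ?D. \<Delta> \<theta>0 = c")
    case False
    then have "{\<theta> \<in> ?D. \<Delta> \<theta> = c} = {}" by blast
    then show ?thesis by (simp only: card.empty)
  next
    case True
    then obtain \<theta>0 where \<theta>0: "\<theta>0 \<in> ?D" "\<Delta> \<theta>0 = c" by auto
    \<comment> \<open>The difference to a fixed family \<open>\<theta>0\<close> in the same fibre commutes with the arrows.\<close>
    have ex: "\<exists>h \<in> mod_homs A M X. \<forall>i \<in> verts Q. \<forall>x \<in> carrier (vertex_space M i). pa_vertex K i \<odot>\<^bsub>X\<^esub> h x = \<theta> i x \<ominus>\<^bsub>X\<^esub> \<theta>0 i x"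
      if \<theta>: "\<theta> \<in> ?D" "\<Delta> \<theta> = c" for \<theta>
    proof -
      let ?\<psi> = "\<lambda>i x. \<theta> i x \<ominus>\<^bsub>vertex_space X i\<^esub> \<theta>0 i x"
      have \<psi>: "?\<psi> i \<in> module_hom K (vertex_space M i) (vertex_space X i)" if i: "i \<in> verts Q" for i
        by (rule hom_minus[OF D(1)[OF \<theta>(1) i] D(1)[OF \<theta>0(1) i] left_module_vertex_space[OF lM i] left_module_vertex_space[OF lX i]])
      have comm: "?\<psi> (head Q \<rho>) (pa_arrow K Q \<rho> \<odot>\<^bsub>M\<^esub> x) = pa_arrow K Q \<rho> \<odot>\<^bsub>X\<^esub> ?\<psi> (tail Q \<rho>) x"
        if \<rho>: "\<rho> \<in> arcs Q" and x: "x \<in> carrier (vertex_space M (tail Q \<rho>))" for \<rho> x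
      proof -
        have t: "tail Q \<rho> \<in> verts Q" and h: "head Q \<rho> \<in> verts Q" using \<rho> by auto
        note lt = left_module_vertex_space[OF lM t] left_module_vertex_space[OF lX t]
        note lh = left_module_vertex_space[OF lM h] left_module_vertex_space[OF lX h]
        note ar = arrow_vertex_space[OF lX \<rho>]
        let ?V = "vertex_space X (head Q \<rho>)" and ?y = "pa_arrow K Q \<rho> \<odot>\<^bsub>M\<^esub> x"
        have y: "?y \<in> carrier (vertex_space M (head Q \<rho>))"
          by (rule hom_rules(1)[OF arrow_vertex_space[OF lM \<rho>] lt(1) lh(1) x])
        have cl: "\<theta> (tail Q \<rho>) x \<in> carrier (vertex_space X (tail Q \<rho>))" "\<theta>0 (tail Q \<rho>) x \<in> carrier (vertex_space X (tail Q \<rho>))"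
          "\<theta> (head Q \<rho>) ?y \<in> carrier ?V" "\<theta>0 (head Q \<rho>) ?y \<in> carrier ?V"
          by (rule hom_rules(1)[OF D(1)[OF \<theta>(1) t] lt x], rule hom_rules(1)[OF D(1)[OF \<theta>0(1) t] lt x],
              rule hom_rules(1)[OF D(1)[OF \<theta>(1) h] lh y], rule hom_rules(1)[OF D(1)[OF \<theta>0(1) h] lh y])
        note acl = hom_rules(1)[OF ar lt(2) lh(2) cl(1)] hom_rules(1)[OF ar lt(2) lh(2) cl(2)]
        have eq: "(pa_arrow K Q \<rho> \<odot>\<^bsub>X\<^esub> \<theta> (tail Q \<rho>) x) \<ominus>\<^bsub>?V\<^esub> \<theta> (head Q \<rho>) ?y =
            (pa_arrow K Q \<rho> \<odot>\<^bsub>X\<^esub> \<theta>0 (tail Q \<rho>) x) \<ominus>\<^bsub>?V\<^esub> \<theta>0 (head Q \<rho>) ?y"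
          using fun_cong[OF fun_cong[OF trans[OF \<theta>(2) sym[OF \<theta>0(2)]], of \<rho>], of x]
          unfolding \<Delta>_def restrict_apply'[OF \<rho>] restrict_apply'[OF x] .
        have "pa_arrow K Q \<rho> \<odot>\<^bsub>X\<^esub> ?\<psi> (tail Q \<rho>) x =
            (pa_arrow K Q \<rho> \<odot>\<^bsub>X\<^esub> \<theta> (tail Q \<rho>) x) \<ominus>\<^bsub>?V\<^esub> (pa_arrow K Q \<rho> \<odot>\<^bsub>X\<^esub> \<theta>0 (tail Q \<rho>) x)"
          by (rule hom_rules(6)[OF ar lt(2) lh(2) cl(1,2)])
        also have "\<dots> = \<theta> (head Q \<rho>) ?y \<ominus>\<^bsub>?V\<^esub> \<theta>0 (head Q \<rho>) ?y"
          by (rule left_module_difference[OF lh(2) acl(1) cl(3) acl(2) cl(4) eq])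
        finally show ?thesis by (rule sym)
      qed
      obtain h where h: "h \<in> module_hom A M X"
        "\<And>i x. \<lbrakk>i \<in> verts Q; x \<in> carrier M\<rbrakk> \<Longrightarrow> pa_vertex K i \<odot>\<^bsub>X\<^esub> h x = ?\<psi> i (pa_vertex K i \<odot>\<^bsub>M\<^esub> x)"
        by (rule hom_of_components[OF lM lX \<psi> comm]) (assumption+, rule that)
      show ?thesis
      proof (intro bexI[OF _ restrict_hom[OF h(1) lM]] ballI)
        fix i x assume i: "i \<in> verts Q" and x: "x \<in> carrier (vertex_space M i)"
        have x': "x \<in> carrier M" "pa_vertex K i \<odot>\<^bsub>M\<^esub> x = x" using x unfolding vertex_space_iff[OF lM i] by auto
        note li = left_module_vertex_space[OF lM i] left_module_vertex_space[OF lX i]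
        have "pa_vertex K i \<odot>\<^bsub>X\<^esub> h x = \<theta> i x \<ominus>\<^bsub>X\<^esub> \<theta>0 i x"
          unfolding h(2)[OF i x'(1)] x'(2)
          by (rule vertex_space_minus[OF lX i hom_rules(1)[OF D(1)[OF \<theta>(1) i] li x] hom_rules(1)[OF D(1)[OF \<theta>0(1) i] li x]])
        then show "pa_vertex K i \<odot>\<^bsub>X\<^esub> restrict h (carrier M) x = \<theta> i x \<ominus>\<^bsub>X\<^esub> \<theta>0 i x" using x'(1) by simp
      qed
    qed
    define \<Psi> where "\<Psi> \<theta> = (SOME h. h \<in> mod_homs A M X \<and>
      (\<forall>i \<in> verts Q. \<forall>x \<in> carrier (vertex_space M i). pa_vertex K i \<odot>\<^bsub>X\<^esub> h x = \<theta> i x \<ominus>\<^bsub>X\<^esub> \<theta>0 i x))" for \<theta>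
    have R: "\<Psi> \<theta> \<in> mod_homs A M X \<and>
        (\<forall>i \<in> verts Q. \<forall>x \<in> carrier (vertex_space M i). pa_vertex K i \<odot>\<^bsub>X\<^esub> \<Psi> \<theta> x = \<theta> i x \<ominus>\<^bsub>X\<^esub> \<theta>0 i x)"
      if "\<theta> \<in> ?D" "\<Delta> \<theta> = c" for \<theta>
      unfolding \<Psi>_def by (rule someI_ex[OF ex[OF that, unfolded Bex_def]])
    note \<Psi> = conjunct1[OF R] bspec[OF bspec[OF conjunct2[OF R]]]
    show ?thesis
    proof (rule card_inj_on_le[OF _ _ finite_homs[OF M X]])
      show "\<Psi> ` {\<theta> \<in> ?D. \<Delta> \<theta> = c} \<subseteq> mod_homs A M X" by (rule image_subsetI) (simp only: mem_Collect_eq \<Psi>(1))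
      show "inj_on \<Psi> {\<theta> \<in> ?D. \<Delta> \<theta> = c}"
      proof (rule inj_onI, unfold mem_Collect_eq, elim conjE)
        fix \<theta> \<theta>' assume \<theta>: "\<theta> \<in> ?D" "\<Delta> \<theta> = c" and \<theta>': "\<theta>' \<in> ?D" "\<Delta> \<theta>' = c" and eq: "\<Psi> \<theta> = \<Psi> \<theta>'"
        show "\<theta> = \<theta>'"
        proof (rule PiE_ext[OF \<theta>(1) \<theta>'(1)])
          fix i assume i: "i \<in> verts Q"
          show "\<theta> i = \<theta>' i"
          proof (rule extensionalityI[OF D(2)[OF \<theta>(1) i] D(2)[OF \<theta>'(1) i]])
            fix x assume x: "x \<in> carrier (vertex_space M i)"
            note li = left_module_vertex_space[OF lM i] left_module_vertex_space[OF lX i]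
            have cl: "\<theta> i x \<in> carrier X" "\<theta>' i x \<in> carrier X" "\<theta>0 i x \<in> carrier X"
              using hom_rules(1)[OF D(1)[OF \<theta>(1) i] li x] hom_rules(1)[OF D(1)[OF \<theta>'(1) i] li x]
                hom_rules(1)[OF D(1)[OF \<theta>0(1) i] li x] unfolding vertex_space_iff[OF lX i] by auto
            have "\<theta> i x \<ominus>\<^bsub>X\<^esub> \<theta>0 i x = \<theta>' i x \<ominus>\<^bsub>X\<^esub> \<theta>0 i x"
              using \<Psi>(2)[OF \<theta> i x] \<Psi>(2)[OF \<theta>' i x] eq by simp
            then show "\<theta> i x = \<theta>' i x"
              using left_module_move(4)[OF lX cl(1,2) left_module_rules(3)[OF lX cl(3)]] by (simp add: a_minus_def)
          qed
        qed
      qed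
    qed
  qed
  have "card ?D = (\<Sum>c \<in> ?C. card {\<theta> \<in> ?D. \<Delta> \<theta> = c})"
    using sum.group[OF finD finC image_subsetI[OF \<Delta>C], where h = "\<lambda>_. 1::nat"] by simp
  also have "\<dots> \<le> (\<Sum>c \<in> ?C. card (mod_homs A M X))" by (rule sum_mono[OF fibre])
  finally show ?thesis unfolding cardD[symmetric] cardC[symmetric] by (simp add: mult.commute)
qed

end

subsection \<open>Free modules\<close>

definition free_module :: "'a ring \<Rightarrow> 'b set \<Rightarrow> ('a, 'b \<Rightarrow> 'a) module" where
  "free_module R B = \<lparr>carrier = B \<rightarrow>\<^sub>E carrier R, mult = (\<lambda>f g. f), one = (\<lambda>b \<in> B. \<zero>\<^bsub>R\<^esub>),
     zero = (\<lambda>b \<in> B. \<zero>\<^bsub>R\<^esub>), add = (\<lambda>f g. \<lambda>b \<in> B. f b \<oplus>\<^bsub>R\<^esub> g b), smult = (\<lambda>a f. \<lambda>b \<in> B. a \<otimes>\<^bsub>R\<^esub> f b)\<rparr>"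

definition unit_vector :: "'a ring \<Rightarrow> 'b set \<Rightarrow> 'b \<Rightarrow> ('b \<Rightarrow> 'a)" where
  "unit_vector R B b = (\<lambda>c \<in> B. if c = b then \<one>\<^bsub>R\<^esub> else \<zero>\<^bsub>R\<^esub>)"

lemma free_module_simps [simp]:
  "carrier (free_module R B) = B \<rightarrow>\<^sub>E carrier R" "\<zero>\<^bsub>free_module R B\<^esub> = (\<lambda>b \<in> B. \<zero>\<^bsub>R\<^esub>)"
  "f \<oplus>\<^bsub>free_module R B\<^esub> g = (\<lambda>b \<in> B. f b \<oplus>\<^bsub>R\<^esub> g b)" "a \<odot>\<^bsub>free_module R B\<^esub> f = (\<lambda>b \<in> B. a \<otimes>\<^bsub>R\<^esub> f b)"
  by (simp_all add: free_module_def)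

lemma left_module_free:
  assumes "ring R" shows "left_module R (free_module R B)"
proof -
  interpret ring R by fact
  have cl: "f b \<in> carrier R" if "f \<in> B \<rightarrow>\<^sub>E carrier R" "b \<in> B" for f b using that by (rule PiE_mem)
  have eqI: "f = g" if "f \<in> B \<rightarrow>\<^sub>E carrier R" "g \<in> B \<rightarrow>\<^sub>E carrier R" "\<And>b. b \<in> B \<Longrightarrow> f b = g b" for f g
    using that by (rule PiE_ext)
  have "abelian_group (free_module R B)"
  proof (rule abelian_groupI, unfold free_module_simps, goal_cases)
    case (3 f g h)
    show ?case by (rule eqI) (use 3 in \<open>simp_all add: cl restrict_PiE_iff a_assoc\<close>)
  next
    case (4 f g)
    show ?case by (rule eqI) (use 4 in \<open>simp_all add: cl restrict_PiE_iff a_comm\<close>)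
  next
    case (5 f)
    show ?case by (rule eqI) (use 5 in \<open>simp_all add: cl restrict_PiE_iff\<close>)
  next
    case (6 f)
    show ?case by (rule bexI[of _ "\<lambda>b \<in> B. \<ominus>\<^bsub>R\<^esub> f b"], rule eqI) (use 6 in \<open>simp_all add: cl restrict_PiE_iff l_neg\<close>)
  qed (simp_all add: cl restrict_PiE_iff)
  moreover have "left_module_axioms R (free_module R B)"
  proof (unfold_locales, unfold free_module_simps, goal_cases)
    case (1 a f)
    then show ?case by (simp add: cl restrict_PiE_iff)
  next
    case (2 a b f)
    show ?case by (rule eqI) (use 2 in \<open>simp_all add: cl restrict_PiE_iff l_distr\<close>)
  next
    case (3 a f g)
    show ?case by (rule eqI) (use 3 in \<open>simp_all add: cl restrict_PiE_iff r_distr\<close>)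
  next
    case (4 a b f)
    show ?case by (rule eqI) (use 4 in \<open>simp_all add: cl restrict_PiE_iff m_assoc\<close>)
  next
    case (5 f)
    show ?case by (rule eqI) (use 5 in \<open>simp_all add: cl restrict_PiE_iff\<close>)
  qed
  ultimately show ?thesis using assms by (simp add: left_module_def)
qed

lemma unit_vector_closed: "ring R \<Longrightarrow> unit_vector R B b \<in> B \<rightarrow>\<^sub>E carrier R"
  by (simp add: unit_vector_def restrict_PiE_iff ring.ring_simprules)

lemma free_hom_exists:
  assumes R: "ring R" and B: "finite B" and X: "left_module R X" and c: "\<And>b. b \<in> B \<Longrightarrow> c b \<in> carrier X"
  shows "\<exists>h \<in> module_hom R (free_module R B) X. \<forall>b \<in> B. h (unit_vector R B b) = c b"
proof -
  interpret ring R by fact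
  note [simp] = left_module_rules[OF X]
  note lF = left_module_free[OF R]
  have "\<exists>h \<in> module_hom R (free_module R B) X. \<forall>b \<in> B. h (unit_vector R B b) = (if b \<in> I then c b else \<zero>\<^bsub>X\<^esub>)"
    if "finite I" "I \<subseteq> B" for I
    using that
  proof (induction I rule: finite_induct)
    case empty
    show ?case by (rule bexI[OF _ hom_zero[OF X]]) simp
  next
    case (insert j I)
    then obtain h where h: "h \<in> module_hom R (free_module R B) X"
      "\<And>b. b \<in> B \<Longrightarrow> h (unit_vector R B b) = (if b \<in> I then c b else \<zero>\<^bsub>X\<^esub>)" by auto
    have j: "j \<in> B" using insert.prems by simp
    have g: "(\<lambda>f. f j \<odot>\<^bsub>X\<^esub> c j) \<in> module_hom R (free_module R B) X"
    proof (rule homI, unfold free_module_simps)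
      fix f assume f: "f \<in> B \<rightarrow>\<^sub>E carrier R"
      show "f j \<odot>\<^bsub>X\<^esub> c j \<in> carrier X" using PiE_mem[OF f j] c[OF j] by simp
      show "(\<lambda>b \<in> B. a \<otimes>\<^bsub>R\<^esub> f b) j \<odot>\<^bsub>X\<^esub> c j = a \<odot>\<^bsub>X\<^esub> (f j \<odot>\<^bsub>X\<^esub> c j)" if "a \<in> carrier R" for a
        using PiE_mem[OF f j] c[OF j] j that by (simp add: left_module_smult(3)[OF X])
      fix g assume g: "g \<in> B \<rightarrow>\<^sub>E carrier R"
      show "(\<lambda>b \<in> B. f b \<oplus>\<^bsub>R\<^esub> g b) j \<odot>\<^bsub>X\<^esub> c j = f j \<odot>\<^bsub>X\<^esub> c j \<oplus>\<^bsub>X\<^esub> g j \<odot>\<^bsub>X\<^esub> c j"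
        using PiE_mem[OF f j] PiE_mem[OF g j] c[OF j] j by (simp add: left_module_smult(2)[OF X])
    qed
    have "h (unit_vector R B b) \<oplus>\<^bsub>X\<^esub> unit_vector R B b j \<odot>\<^bsub>X\<^esub> c j = (if b \<in> insert j I then c b else \<zero>\<^bsub>X\<^esub>)" if b: "b \<in> B" for b
      using insert.hyps(2) h(2)[OF b] c[OF b] c[OF j] j
      by (cases "b = j") (simp_all add: unit_vector_def left_module_smult(5)[OF X])
    then show ?case by (intro bexI[OF _ hom_add[OF h(1) g lF X]]) simp
  qed
  from this[OF B order_refl] show ?thesis by auto
qed

lemma free_hom_unique:
  assumes R: "ring R" and B: "finite B" and X: "left_module R X"
    and h: "h \<in> module_hom R (free_module R B) X" and h': "h' \<in> module_hom R (free_module R B) X"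
    and eq: "\<And>b. b \<in> B \<Longrightarrow> h (unit_vector R B b) = h' (unit_vector R B b)"
    and f: "f \<in> B \<rightarrow>\<^sub>E carrier R"
  shows "h f = h' f"
proof -
  interpret ring R by fact
  note lF = left_module_free[OF R, of B]
  note H = hom_rules[OF h lF X, unfolded free_module_simps] and H' = hom_rules[OF h' lF X, unfolded free_module_simps]
  have "h f = h' f" if "finite I" "f \<in> B \<rightarrow>\<^sub>E carrier R" "\<And>b. b \<in> B \<Longrightarrow> b \<notin> I \<Longrightarrow> f b = \<zero>\<^bsub>R\<^esub>" for I f
    using that
  proof (induction I arbitrary: f rule: finite_induct)
    case empty
    have f0: "f = (\<lambda>b \<in> B. \<zero>\<^bsub>R\<^esub>)" by (rule PiE_ext[OF empty.prems(1)]) (use empty.prems(2) in \<open>simp_all add: restrict_PiE_iff\<close>)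
    show ?case unfolding f0 H(4) H'(4) by (rule refl)
  next
    case (insert j I)
    show ?case
    proof (cases "j \<in> B")
      case j: True
      let ?g = "\<lambda>b \<in> B. if b = j then \<zero>\<^bsub>R\<^esub> else f b"
      have fcl: "f b \<in> carrier R" if "b \<in> B" for b using insert.prems(1) that by (rule PiE_mem)
      have g: "?g \<in> B \<rightarrow>\<^sub>E carrier R" using fcl by (simp add: restrict_PiE_iff)
      have u: "unit_vector R B j \<in> B \<rightarrow>\<^sub>E carrier R" by (rule unit_vector_closed[OF R])
      have fj: "(\<lambda>b \<in> B. f j \<otimes>\<^bsub>R\<^esub> unit_vector R B j b) \<in> B \<rightarrow>\<^sub>E carrier R"
        using fcl[OF j] PiE_mem[OF u] by (simp add: restrict_PiE_iff)
      have split: "f = (\<lambda>b \<in> B. ?g b \<oplus>\<^bsub>R\<^esub> (\<lambda>b \<in> B. f j \<otimes>\<^bsub>R\<^esub> unit_vector R B j b) b)"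
        by (rule PiE_ext[OF insert.prems(1)]) (use fcl j in \<open>simp_all add: restrict_PiE_iff unit_vector_def\<close>)
      have "h ?g = h' ?g" by (rule insert.IH[OF g]) (use insert.prems(2) in simp)
      moreover have "h (\<lambda>b \<in> B. f j \<otimes>\<^bsub>R\<^esub> unit_vector R B j b) = h' (\<lambda>b \<in> B. f j \<otimes>\<^bsub>R\<^esub> unit_vector R B j b)"
        using H(3)[OF fcl[OF j] u] H'(3)[OF fcl[OF j] u] eq[OF j] by simp
      ultimately show ?thesis using H(2)[OF g fj] H'(2)[OF g fj] arg_cong[OF split, of h] arg_cong[OF split, of h'] by simp
    next
      case False
      have "f b = \<zero>\<^bsub>R\<^esub>" if "b \<in> B" "b \<notin> I" for b using insert.prems(2)[of b] that False by (cases "b = j") simp_all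
      then show ?thesis by (rule insert.IH[OF insert.prems(1)])
    qed
  qed
  from this[OF B f] show ?thesis by simp
qed

subsection \<open>Homomorphisms out of a projective module\<close>

context finite_path_algebra
begin

definition paths_to :: "'v \<Rightarrow> ('v \<times> 'e list) set" where
  "paths_to i = {(u, es) \<in> qpaths Q. walk_end u es = i}"

lemma finite_paths_to: "finite (paths_to i)"
  by (rule finite_subset[OF _ finite_paths]) (auto simp: paths_to_def)

text \<open>Sort the nontrivial paths by their last arrow.\<close>
lemma card_paths_to:
  assumes i: "i \<in> verts Q"
  shows "card (paths_to i) = 1 + (\<Sum>\<rho> \<in> {\<rho> \<in> arcs Q. head Q \<rho> = i}. card (paths_to (tail Q \<rho>)))"
proof -
  let ?I = "{\<rho> \<in> arcs Q. head Q \<rho> = i}"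
  let ?S = "\<lambda>\<rho>. (\<lambda>p. (fst p, snd p @ [\<rho>])) ` paths_to (tail Q \<rho>)"
  have "paths_to i = insert (i, []) (\<Union>\<rho> \<in> ?I. ?S \<rho>)"
  proof (rule Set.set_eqI)
    fix p :: "'v \<times> 'e list"
    obtain u es where p: "p = (u, es)" by force
    show "p \<in> paths_to i \<longleftrightarrow> p \<in> insert (i, []) (\<Union>\<rho> \<in> ?I. ?S \<rho>)"
    proof (cases es rule: rev_exhaust)
      case Nil
      then show ?thesis using i unfolding p by (auto simp: paths_to_def)
    next
      case (snoc fs \<sigma>)
      have end_snoc: "walk_end u (fs @ [\<sigma>]) = head Q \<sigma>" by (simp add: Q.awlast_append)
      have "(u, fs @ [\<sigma>]) \<in> paths_to i \<longleftrightarrow> \<sigma> \<in> ?I \<and> (u, fs) \<in> paths_to (tail Q \<sigma>)"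
        using end_snoc by (auto simp: paths_to_def path_append)
      then show ?thesis unfolding p snoc by (force simp: image_iff)
    qed
  qed
  then have "card (paths_to i) = Suc (card (\<Union>\<rho> \<in> ?I. ?S \<rho>))"
    using finite_arcs finite_paths_to by (subst card_insert_disjoint[symmetric]) auto
  also have "card (\<Union>\<rho> \<in> ?I. ?S \<rho>) = (\<Sum>\<rho> \<in> ?I. card (?S \<rho>))"
    by (rule card_UN_disjoint) (use finite_arcs finite_paths_to in auto)
  also have "\<dots> = (\<Sum>\<rho> \<in> ?I. card (paths_to (tail Q \<rho>)))"
    by (intro sum.cong refl card_image) (auto simp: inj_on_def prod_eq_iff)
  finally show ?thesis by simp
qed

text \<open>
  The Euler form of the dimension vector \<open>c\<close> of the regular module with \<open>x\<close> is the total dimension of \<open>x\<close>,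
  because \<open>c\<^sub>i\<close> counts the paths ending at \<open>i\<close>.
\<close>
lemma sum_paths_to:
  fixes x :: "'v \<Rightarrow> nat"
  shows "(\<Sum>i \<in> verts Q. card (paths_to i) * x i) =
    (\<Sum>i \<in> verts Q. x i) + (\<Sum>\<rho> \<in> arcs Q. card (paths_to (tail Q \<rho>)) * x (head Q \<rho>))"
proof -
  let ?c = "\<lambda>i. card (paths_to i)"
  have "(\<Sum>i \<in> verts Q. ?c i * x i) = (\<Sum>i \<in> verts Q. x i + (\<Sum>\<rho> \<in> {\<rho> \<in> arcs Q. head Q \<rho> = i}. ?c (tail Q \<rho>) * x (head Q \<rho>)))"
  proof (rule sum.cong[OF refl])
    fix i assume i: "i \<in> verts Q"
    have "(\<Sum>\<rho> \<in> {\<rho> \<in> arcs Q. head Q \<rho> = i}. ?c (tail Q \<rho>) * x (head Q \<rho>)) =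
        (\<Sum>\<rho> \<in> {\<rho> \<in> arcs Q. head Q \<rho> = i}. ?c (tail Q \<rho>)) * x i"
      unfolding sum_distrib_right by (rule sum.cong) auto
    then show "?c i * x i = x i + (\<Sum>\<rho> \<in> {\<rho> \<in> arcs Q. head Q \<rho> = i}. ?c (tail Q \<rho>) * x (head Q \<rho>))"
      unfolding card_paths_to[OF i] by (simp add: algebra_simps)
  qed
  also have "\<dots> = (\<Sum>i \<in> verts Q. x i) + (\<Sum>i \<in> verts Q. \<Sum>\<rho> \<in> {\<rho> \<in> arcs Q. head Q \<rho> = i}. ?c (tail Q \<rho>) * x (head Q \<rho>))"
    by (rule sum.distrib)
  also have "(\<Sum>i \<in> verts Q. \<Sum>\<rho> \<in> {\<rho> \<in> arcs Q. head Q \<rho> = i}. ?c (tail Q \<rho>) * x (head Q \<rho>)) =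
      (\<Sum>\<rho> \<in> arcs Q. ?c (tail Q \<rho>) * x (head Q \<rho>))"
    by (rule sum.group[OF finite_arcs finite_verts]) auto
  finally show ?thesis .
qed

lemma card_support:
  assumes S: "S \<subseteq> qpaths Q"
  shows "card {x \<in> carrier A. \<forall>p. p \<notin> S \<longrightarrow> x p = \<zero>\<^bsub>K\<^esub>} = card (carrier K) ^ card S"
proof -
  have fin: "finite S" by (rule finite_subset[OF S finite_paths])
  have "bij_betw (\<lambda>x. restrict x S) {x \<in> carrier A. \<forall>p. p \<notin> S \<longrightarrow> x p = \<zero>\<^bsub>K\<^esub>} (S \<rightarrow>\<^sub>E carrier K)"
  proof (rule bij_betw_byWitness[where f' = "\<lambda>y p. if p \<in> S then y p else \<zero>\<^bsub>K\<^esub>"])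
    show "\<forall>x \<in> {x \<in> carrier A. \<forall>p. p \<notin> S \<longrightarrow> x p = \<zero>\<^bsub>K\<^esub>}. (\<lambda>p. if p \<in> S then restrict x S p else \<zero>\<^bsub>K\<^esub>) = x"
      by (auto intro!: ext)
    show "\<forall>y \<in> S \<rightarrow>\<^sub>E carrier K. restrict (\<lambda>p. if p \<in> S then y p else \<zero>\<^bsub>K\<^esub>) S = y"
      by (auto intro!: ext simp: PiE_def extensional_def)
    show "(\<lambda>x. restrict x S) ` {x \<in> carrier A. \<forall>p. p \<notin> S \<longrightarrow> x p = \<zero>\<^bsub>K\<^esub>} \<subseteq> S \<rightarrow>\<^sub>E carrier K"
      by (auto simp: coeff_closed)
    show "(\<lambda>y p. if p \<in> S then y p else \<zero>\<^bsub>K\<^esub>) ` (S \<rightarrow>\<^sub>E carrier K) \<subseteq> {x \<in> carrier A. \<forall>p. p \<notin> S \<longrightarrow> x p = \<zero>\<^bsub>K\<^esub>}"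
      using S by (auto simp: carrier_A)
  qed
  from bij_betw_same_card[OF this] show ?thesis by (simp add: card_PiE fin)
qed

lemma finite_A: "finite (carrier A)"
proof -
  have "{x \<in> carrier A. \<forall>p. p \<notin> qpaths Q \<longrightarrow> x p = \<zero>\<^bsub>K\<^esub>} = carrier A" using coeff_outside by auto
  then have "card (carrier A) > 0" using card_support[OF order_refl] card_K_gt_1 by simp
  then show ?thesis by (rule card_ge_0_finite)
qed

lemma fd_free: "finite B \<Longrightarrow> fd_module K Q (free_module A B)"
  unfolding fd_iff using left_module_free[OF ring_A] finite_A by (simp add: finite_PiE)

lemma vdim_free:
  assumes B: "finite B" and i: "i \<in> verts Q"
  shows "vdim (free_module A B) i = card B * card (paths_to i)"
proof -
  let ?E = "{x \<in> carrier A. \<forall>p. p \<notin> paths_to i \<longrightarrow> x p = \<zero>\<^bsub>K\<^esub>}"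
  have E: "x \<in> ?E \<longleftrightarrow> x \<in> carrier A \<and> pa_vertex K i \<otimes>\<^bsub>A\<^esub> x = x" for x
  proof (cases "x \<in> carrier A")
    case True
    have "pa_vertex K i \<otimes>\<^bsub>A\<^esub> x = x \<longleftrightarrow> (\<forall>u es. walk_end u es \<noteq> i \<longrightarrow> x (u, es) = \<zero>\<^bsub>K\<^esub>)"
      unfolding vertex_mult[OF i True] fun_eq_iff by auto
    also have "\<dots> \<longleftrightarrow> (\<forall>p. p \<notin> paths_to i \<longrightarrow> x p = \<zero>\<^bsub>K\<^esub>)"
      using coeff_outside[OF True] by (auto simp: paths_to_def)
    finally show ?thesis using True by simp
  qed simp
  have "carrier (vertex_space (free_module A B) i) = B \<rightarrow>\<^sub>E ?E"
  proof (rule Set.set_eqI)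
    fix f
    have "f \<in> carrier (vertex_space (free_module A B) i) \<longleftrightarrow>
        f \<in> B \<rightarrow>\<^sub>E carrier A \<and> (\<lambda>b \<in> B. pa_vertex K i \<otimes>\<^bsub>A\<^esub> f b) = f"
      unfolding vertex_space_iff[OF left_module_free[OF ring_A] i] by simp
    also have "\<dots> \<longleftrightarrow> f \<in> B \<rightarrow>\<^sub>E carrier A \<and> (\<forall>b \<in> B. pa_vertex K i \<otimes>\<^bsub>A\<^esub> f b = f b)"
      by (auto simp: fun_eq_iff PiE_def extensional_def)
    also have "\<dots> \<longleftrightarrow> f \<in> B \<rightarrow>\<^sub>E ?E" unfolding PiE_iff E by auto
    finally show "f \<in> carrier (vertex_space (free_module A B) i) \<longleftrightarrow> f \<in> B \<rightarrow>\<^sub>E ?E" .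
  qed
  then have "card (carrier K) ^ vdim (free_module A B) i = card (B \<rightarrow>\<^sub>E ?E)"
    using card_vertex_space[OF fd_free[OF B] i] by simp
  also have "\<dots> = (card (carrier K) ^ card (paths_to i)) ^ card B"
  proof -
    have "paths_to i \<subseteq> qpaths Q" by (auto simp: paths_to_def)
    then show ?thesis using card_support[of "paths_to i"] B by (simp add: card_PiE)
  qed
  also have "\<dots> = card (carrier K) ^ (card B * card (paths_to i))" by (simp add: power_mult[symmetric] mult.commute)
  finally show ?thesis using card_K_gt_1 by (simp only: power_inject_exp)
qed

lemma card_homs_free_le:
  assumes B: "finite B" and X: "fd_module K Q X"
  shows "card (mod_homs A (free_module A B) X) \<le> card (carrier X) ^ card B"
proof -
  have "card (mod_homs A (free_module A B) X) \<le> card (B \<rightarrow>\<^sub>E carrier X)"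
  proof (rule card_inj_on_le)
    show "inj_on (\<lambda>h. \<lambda>b \<in> B. h (unit_vector A B b)) (mod_homs A (free_module A B) X)"
    proof (rule inj_onI)
      fix h h' assume H: "h \<in> mod_homs A (free_module A B) X" "h' \<in> mod_homs A (free_module A B) X"
        and eq: "(\<lambda>b \<in> B. h (unit_vector A B b)) = (\<lambda>b \<in> B. h' (unit_vector A B b))"
      have u: "h (unit_vector A B b) = h' (unit_vector A B b)" if "b \<in> B" for b using fun_cong[OF eq, of b] that by simp
      have H': "h \<in> module_hom A (free_module A B) X" "h' \<in> module_hom A (free_module A B) X"
        and E: "h \<in> extensional (B \<rightarrow>\<^sub>E carrier A)" "h' \<in> extensional (B \<rightarrow>\<^sub>E carrier A)"
        using H by (auto simp: mod_homs_def)
      show "h = h'"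
        by (rule extensionalityI[OF E], rule free_hom_unique[OF ring_A B fdD(1)[OF X] H']) (rule u, assumption+)
    qed
    show "(\<lambda>h. \<lambda>b \<in> B. h (unit_vector A B b)) ` mod_homs A (free_module A B) X \<subseteq> B \<rightarrow>\<^sub>E carrier X"
    proof (rule image_subsetI)
      fix h assume "h \<in> mod_homs A (free_module A B) X"
      then have h: "h \<in> module_hom A (free_module A B) X" by (simp add: mod_homs_def)
      show "(\<lambda>b \<in> B. h (unit_vector A B b)) \<in> B \<rightarrow>\<^sub>E carrier X"
        unfolding restrict_PiE_iff
        by (intro ballI hom_rules(1)[OF h left_module_free[OF ring_A] fdD(1)[OF X]])
          (simp only: free_module_simps unit_vector_closed[OF ring_A])
    qed
    show "finite (B \<rightarrow>\<^sub>E carrier X)" by (rule finite_PiE[OF B fdD(2)[OF X]])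
  qed
  then show ?thesis by (simp add: card_PiE B)
qed

text \<open>
  The Euler form is a lower bound for \<open>dim Hom(-, X)\<close>, additive on exact sequences.  It is attained for the
  free module \<open>F\<close> on the elements of \<open>P\<close>, whose homomorphisms are determined by the images of the unit vectors.
  Since \<open>P\<close> is projective, \<open>Hom(F, X)\<close> is the product of \<open>Hom(P, X)\<close> and \<open>Hom(P', X)\<close> for the kernel \<open>P'\<close> of
  \<open>F \<rightarrow> P\<close>, and so the bound is attained for \<open>P\<close> too.
\<close>
lemma card_homs_projective:
  assumes P: "projective K Q P" and X: "fd_module K Q X"
  shows "card (mod_homs A P X) * card (carrier K) ^ (\<Sum>\<rho> \<in> arcs Q. vdim P (tail Q \<rho>) * vdim X (head Q \<rho>)) =
    card (carrier K) ^ (\<Sum>i \<in> verts Q. vdim P i * vdim X i)"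
proof -
  let ?q = "card (carrier K)" and ?B = "carrier P"
  let ?F = "free_module A ?B"
  note fP = projective_fd[OF P]
  note lP = fdD(1)[OF fP] and B = fdD(2)[OF fP]
  note fF = fd_free[OF B]
  note lF = fdD(1)[OF fF]
  obtain g where g: "g \<in> module_hom A ?F P" "\<And>b. b \<in> ?B \<Longrightarrow> g (unit_vector A ?B b) = b"
    using free_hom_exists[OF ring_A B lP, of "\<lambda>b. b"] by auto
  let ?k = "{x \<in> carrier ?F. g x = \<zero>\<^bsub>P\<^esub>}"
  let ?P' = "?F \<lparr>carrier := ?k\<rparr>"
  have fP': "fd_module K Q ?P'" by (rule fd_submodule[OF fF submodule_kernel[OF g(1) lF lP]])
  have inc: "(\<lambda>x. x) \<in> module_hom A ?P' ?F" by (rule homI) simp_all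
  have "?B \<subseteq> g ` carrier ?F"
  proof
    fix b assume "b \<in> ?B"
    then show "b \<in> g ` carrier ?F"
      using g(2)[of b] unit_vector_closed[OF ring_A] by (intro image_eqI[of _ _ "unit_vector A ?B b"]) simp_all
  qed
  moreover have "g ` carrier ?F \<subseteq> ?B" using hom_rules(1)[OF g(1) lF lP] by (rule image_subsetI)
  ultimately have ex: "short_exact ?P' (\<lambda>x. x) ?F g P" unfolding short_exact_def by auto
  have dim: "vdim ?F i = vdim ?P' i + vdim P i" if "i \<in> verts Q" for i
    by (rule vdim_additive[OF fP' fF fP inc g(1) ex that])
  let ?V = "\<lambda>m. \<Sum>i \<in> verts Q. m i * vdim X i" and ?E = "\<lambda>m. \<Sum>\<rho> \<in> arcs Q. m (tail Q \<rho>) * vdim X (head Q \<rho>)"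
  have V: "?V (vdim ?F) = ?V (vdim ?P') + ?V (vdim P)"
    unfolding sum.distrib[symmetric] by (rule sum.cong[OF refl]) (simp add: dim algebra_simps)
  have E: "?E (vdim ?F) = ?E (vdim ?P') + ?E (vdim P)"
    unfolding sum.distrib[symmetric] by (rule sum.cong[OF refl]) (simp add: dim algebra_simps)
  have VE: "?V (vdim ?F) = card ?B * (\<Sum>i \<in> verts Q. vdim X i) + ?E (vdim ?F)"
  proof -
    have "?V (vdim ?F) = card ?B * (\<Sum>i \<in> verts Q. card (paths_to i) * vdim X i)"
      unfolding sum_distrib_left by (rule sum.cong[OF refl]) (simp add: vdim_free[OF B])
    moreover have "?E (vdim ?F) = card ?B * (\<Sum>\<rho> \<in> arcs Q. card (paths_to (tail Q \<rho>)) * vdim X (head Q \<rho>))"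
      unfolding sum_distrib_left by (rule sum.cong[OF refl]) (simp add: vdim_free[OF B])
    ultimately show ?thesis unfolding sum_paths_to by (simp add: algebra_simps)
  qed
  let ?a = "card (mod_homs A P X)" and ?a' = "card (mod_homs A ?P' X)"
  have ge: "?q ^ ?V (vdim P) \<le> ?a * ?q ^ ?E (vdim P)" and ge': "?q ^ ?V (vdim ?P') \<le> ?a' * ?q ^ ?E (vdim ?P')"
    by (rule card_homs_ge_euler[OF fP X], rule card_homs_ge_euler[OF fP' X])
  have "?a * ?a' = card (mod_homs A ?F X)" by (rule sym[OF card_homs_split(1)[OF fP' fF P inc g(1) ex X]])
  also have "\<dots> \<le> card (carrier X) ^ card ?B" by (rule card_homs_free_le[OF B X])
  also have "\<dots> \<le> (?q ^ (\<Sum>i \<in> verts Q. vdim X i)) ^ card ?B" by (rule power_mono[OF card_le_components[OF X]]) simp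
  finally have "?a * ?a' * ?q ^ ?E (vdim ?F) \<le> (?q ^ (\<Sum>i \<in> verts Q. vdim X i)) ^ card ?B * ?q ^ ?E (vdim ?F)"
    by (rule mult_right_mono) simp
  also have "\<dots> = ?q ^ ?V (vdim ?F)" unfolding VE power_add by (simp add: power_mult[symmetric] mult.commute)
  finally have le: "(?a * ?q ^ ?E (vdim P)) * (?a' * ?q ^ ?E (vdim ?P')) \<le> ?q ^ ?V (vdim P) * ?q ^ ?V (vdim ?P')"
    unfolding V E power_add by (simp only: ac_simps)
  have "?a * ?q ^ ?E (vdim P) \<le> ?q ^ ?V (vdim P)"
  proof (rule ccontr)
    assume "\<not> ?a * ?q ^ ?E (vdim P) \<le> ?q ^ ?V (vdim P)"
    then have "?q ^ ?V (vdim P) * ?q ^ ?V (vdim ?P') < ?a * ?q ^ ?E (vdim P) * ?q ^ ?V (vdim ?P')"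
      using card_K_gt_1 by simp
    also have "\<dots> \<le> ?a * ?q ^ ?E (vdim P) * (?a' * ?q ^ ?E (vdim ?P'))" by (rule mult_left_mono[OF ge']) simp
    finally show False using le by simp
  qed
  then show ?thesis using ge by (rule antisym)
qed

lemma dim_vec_eq: "dim_vec K Q M i = int (vdim M i)"
  by (simp add: dim_vec_def vdim_def)

lemma card_homs_euler_form:
  assumes P: "projective K Q P" and X: "fd_module K Q X"
  shows "real (card (mod_homs A P X)) = real (card (carrier K)) powi euler_form Q (dim_vec K Q P) (dim_vec K Q X)"
proof -
  let ?q = "real (card (carrier K))"
  let ?V = "\<Sum>i \<in> verts Q. vdim P i * vdim X i" and ?E = "\<Sum>\<rho> \<in> arcs Q. vdim P (tail Q \<rho>) * vdim X (head Q \<rho>)"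
  have q: "?q \<noteq> 0" using card_K_gt_1 by simp
  have "real (card (mod_homs A P X)) * ?q ^ ?E = ?q ^ ?V"
    using arg_cong[OF card_homs_projective[OF P X], of real] by simp
  then have "real (card (mod_homs A P X)) = ?q ^ ?V / ?q ^ ?E"
    using q by (simp add: field_simps)
  also have "\<dots> = ?q powi (int ?V - int ?E)" unfolding power_int_diff[OF disjI1[OF q]] power_int_of_nat by (rule refl)
  also have "int ?V - int ?E = euler_form Q (dim_vec K Q P) (dim_vec K Q X)"
    by (simp add: euler_form_def dim_vec_eq)
  finally show ?thesis .
qed

lemma vdim_zero:
  assumes M: "fd_module K Q M" and zero: "carrier M = {\<zero>\<^bsub>M\<^esub>}" and i: "i \<in> verts Q"
  shows "vdim M i = 0"
proof -
  have "card (carrier (vertex_space M i)) = 1" by (simp add: zero)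
  then have "card (carrier K) ^ vdim M i = card (carrier K) ^ 0" using card_vertex_space[OF M i] by simp
  then show ?thesis using card_K_gt_1 by (simp only: power_inject_exp)
qed

end

lemma euler_form_add:
  "euler_form Q (\<lambda>i. x i + x' i) y = euler_form Q x y + euler_form Q x' y"
  "euler_form Q x (\<lambda>i. y i + y' i) = euler_form Q x y + euler_form Q x y'"
  by (simp_all add: euler_form_def algebra_simps sum.distrib)

lemma euler_form_cong:
  assumes "wf_digraph Q" "\<And>i. i \<in> verts Q \<Longrightarrow> x i = x' i" "\<And>i. i \<in> verts Q \<Longrightarrow> y i = y' i"
  shows "euler_form Q x y = euler_form Q x' y'"
proof -
  interpret wf_digraph Q by fact
  show ?thesis unfolding euler_form_def
    by (intro arg_cong2[where f = "(-)"] sum.cong refl) (simp_all add: assms(2,3))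
qed

context three_resolutions
begin

text \<open>Here \<open>\<Omega>\<^sub>M = 0\<close>, \<open>P\<^sub>L = P\<^sub>N\<close> and \<open>\<Omega>\<^sub>L\<close> is an extension of \<open>P\<^sub>M\<close> by \<open>\<Omega>\<^sub>N\<close>, so that all but one term cancel.\<close>
lemma rigid_exponent:
  assumes iso: "mod_iso A PN PL" and W0: "carrier WM = {\<zero>\<^bsub>WM\<^esub>}"
    and e: "e \<in> module_hom A WN WL" and b: "b \<in> module_hom A WL PM" and ex: "short_exact WN e WL b PM"
  shows "sym_euler_form Q (dim_vec K Q PL) (dim_vec K Q WL)
      - sym_euler_form Q (dim_vec K Q PM) (dim_vec K Q WM)
      - sym_euler_form Q (dim_vec K Q PN) (dim_vec K Q WN)
      - euler_form Q (dim_vec K Q PM) (dim_vec K Q PN)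
      - euler_form Q (dim_vec K Q WM) (dim_vec K Q WN) = euler_form Q (dim_vec K Q PN) (dim_vec K Q PM)"
proof -
  let ?d = "\<lambda>X. dim_vec K Q X"
  obtain f where f: "f \<in> module_hom A PN PL" "bij_betw f (carrier PN) (carrier PL)" using iso by (auto simp: mod_iso_def)
  have ex0: "short_exact WM (\<lambda>_. \<zero>\<^bsub>PN\<^esub>) PN f PL"
  proof -
    have f0: "f n = \<zero>\<^bsub>PL\<^esub> \<longleftrightarrow> n = \<zero>\<^bsub>PN\<^esub>" if n: "n \<in> carrier PN" for n
    proof
      assume "f n = \<zero>\<^bsub>PL\<^esub>"
      then have "f n = f \<zero>\<^bsub>PN\<^esub>" using hom_rules(4)[OF f(1) DN(3) DL(3)] by simp
      then show "n = \<zero>\<^bsub>PN\<^esub>" by (rule inj_onD[OF bij_betw_imp_inj_on[OF f(2)]]) (use n left_module_rules(1)[OF DN(3)] in simp_all)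
    qed (use hom_rules(4)[OF f(1) DN(3) DL(3)] in simp)
    have "{z \<in> carrier PN. f z = \<zero>\<^bsub>PL\<^esub>} = {\<zero>\<^bsub>PN\<^esub>}" using f0 left_module_rules(1)[OF DN(3)] by auto
    then show ?thesis using f(2) by (simp add: short_exact_def W0 bij_betw_def)
  qed
  have wm: "?d WM i = 0" if "i \<in> verts Q" for i
    using vdim_zero[OF fd_terms(4) W0 that] by (simp add: dim_vec_eq)
  have pl: "?d PL i = ?d PN i" if "i \<in> verts Q" for i
    using vdim_additive[OF fd_terms(4,5,1) hom_zero[OF DN(3)] f(1) ex0 that] vdim_zero[OF fd_terms(4) W0 that]
    by (simp add: dim_vec_eq)
  have wl: "?d WL i = ?d WN i + ?d PM i" if "i \<in> verts Q" for i
    using vdim_additive[OF fd_terms(6,2,3) e b ex that] by (simp add: dim_vec_eq)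
  note cong = euler_form_cong[OF wf_Q]
  have 1: "euler_form Q (?d PL) (?d WL) = euler_form Q (?d PN) (?d WN) + euler_form Q (?d PN) (?d PM)"
    unfolding euler_form_add(2)[symmetric] by (rule cong[OF pl wl])
  have 2: "euler_form Q (?d WL) (?d PL) = euler_form Q (?d WN) (?d PN) + euler_form Q (?d PM) (?d PN)"
    unfolding euler_form_add(1)[symmetric] by (rule cong[OF wl pl])
  have 3: "euler_form Q (?d PM) (?d WM) = 0" "euler_form Q (?d WM) (?d PM) = 0" "euler_form Q (?d WM) (?d WN) = 0"
    using cong[of "?d PM" "?d PM" "?d WM" "\<lambda>_. 0"] cong[of "?d WM" "\<lambda>_. 0" "?d PM" "?d PM"]
      cong[of "?d WM" "\<lambda>_. 0" "?d WN" "?d WN"] by (simp_all add: wm) (simp_all add: euler_form_def)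
  show ?thesis unfolding sym_euler_form_def 1 2 3 by simp
qed

end

section \<open>Dynkin quivers have finitely many paths\<close>

text \<open>Each diagram is contained in a chain with at most one further vertex attached to it.\<close>
lemma dynkin_edges_subset:
  assumes "dynkin_admissible D"
  shows "\<exists>m b. b < m \<and> dynkin_edges D \<subseteq> insert {b, m} {{i, Suc i} | i. Suc i < m}"
proof (cases D)
  case (Dynkin_A n)
  then show ?thesis using assms by (intro exI[of _ n] exI[of _ 0]) auto
next
  case (Dynkin_D n)
  then show ?thesis using assms by (intro exI[of _ "n - 1"] exI[of _ "n - 3"]) auto
next
  case (Dynkin_E n)
  then show ?thesis using assms by (intro exI[of _ "n - 1"] exI[of _ 2]) auto
qed

text \<open>The diagrams are trees, so that any prescribed differences along the edges come from a potential.\<close>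
lemma tree_potential:
  fixes s :: "nat \<Rightarrow> nat \<Rightarrow> int"
  assumes "b < m"
  obtains h where "\<And>i. Suc i < m \<Longrightarrow> h (Suc i) - h i = s i (Suc i)" "h m - h b = s b m"
proof -
  define h where "h k = (if k = m then (\<Sum>j<b. s j (Suc j)) + s b m else (\<Sum>j<k. s j (Suc j)))" for k
  show thesis by (rule that[of h]) (use assms in \<open>simp_all add: h_def\<close>)
qed

text \<open>Prescribe the difference along each edge by the orientation of its unique arrow.\<close>
lemma dynkin_potential:
  assumes Q: "dynkin_quiver Q"
  obtains h :: "'v \<Rightarrow> int" where "\<And>\<rho>. \<rho> \<in> arcs Q \<Longrightarrow> h (head Q \<rho>) = h (tail Q \<rho>) + 1"
proof -
  obtain D f where D: "dynkin_admissible D" and inj: "inj_on (\<lambda>\<rho>. {f (tail Q \<rho>), f (head Q \<rho>)}) (arcs Q)"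
    and edges: "(\<lambda>\<rho>. {f (tail Q \<rho>), f (head Q \<rho>)}) ` arcs Q = dynkin_edges D"
    using Q by (auto simp: dynkin_quiver_def bij_betw_def)
  obtain m b where mb: "b < m" "dynkin_edges D \<subseteq> insert {b, m} {{i, Suc i} | i. Suc i < m}"
    using dynkin_edges_subset[OF D] by auto
  define s where "s x y = (if \<exists>\<rho> \<in> arcs Q. f (tail Q \<rho>) = x \<and> f (head Q \<rho>) = y then 1 else - 1 :: int)" for x y
  obtain h where h: "\<And>i. Suc i < m \<Longrightarrow> h (Suc i) - h i = s i (Suc i)" "h m - h b = s b m"
    by (rule tree_potential[OF mb(1), of s]) (rule that)
  have "h (f (head Q \<rho>)) = h (f (tail Q \<rho>)) + 1" if \<rho>: "\<rho> \<in> arcs Q" for \<rho>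
  proof -
    let ?e = "{f (tail Q \<rho>), f (head Q \<rho>)}"
    have "?e \<in> dynkin_edges D" unfolding edges[symmetric] using \<rho> by (rule imageI)
    then have "?e \<in> insert {b, m} {{i, Suc i} | i. Suc i < m}" using mb(2) by (rule rev_subsetD)
    then obtain x y where xy: "?e = {x, y}" "x \<noteq> y" "h y - h x = s x y"
    proof (rule insertE)
      assume "?e = {b, m}" then show thesis using that[of b m] h(2) mb(1) by simp
    next
      assume "?e \<in> {{i, Suc i} | i. Suc i < m}"
      then obtain i where "?e = {i, Suc i}" "Suc i < m" by auto
      then show thesis using that[of i "Suc i"] h(1) by simp
    qed
    then consider "f (tail Q \<rho>) = x" "f (head Q \<rho>) = y" | "f (tail Q \<rho>) = y" "f (head Q \<rho>) = x"
      by (auto simp: doubleton_eq_iff)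
    then show ?thesis
    proof cases
      case 1
      then have "s x y = 1" using \<rho> by (auto simp: s_def)
      then show ?thesis using xy(3) 1 by simp
    next
      case 2
      have "\<not> (\<exists>\<sigma> \<in> arcs Q. f (tail Q \<sigma>) = x \<and> f (head Q \<sigma>) = y)"
      proof
        assume "\<exists>\<sigma> \<in> arcs Q. f (tail Q \<sigma>) = x \<and> f (head Q \<sigma>) = y"
        then obtain \<sigma> where \<sigma>: "\<sigma> \<in> arcs Q" "f (tail Q \<sigma>) = x" "f (head Q \<sigma>) = y" by auto
        have "\<sigma> = \<rho>" by (rule inj_onD[OF inj _ \<sigma>(1) \<rho>]) (simp add: \<sigma> xy(1))
        then show False using \<sigma> 2 xy(2) by simp
      qed
      then have "s x y = - 1" by (simp add: s_def)
      then show ?thesis using xy(3) 2 by simp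
    qed
  qed
  then show thesis by (rule that[of "\<lambda>v. h (f v)"])
qed

lemma dynkin_finite:
  assumes Q: "dynkin_quiver Q"
  shows "finite (verts Q)" "finite (arcs Q)"
proof -
  obtain D f where D: "dynkin_admissible D" and v: "bij_betw f (verts Q) {..<dynkin_rank D}"
    and e: "bij_betw (\<lambda>\<rho>. {f (tail Q \<rho>), f (head Q \<rho>)}) (arcs Q) (dynkin_edges D)"
    using Q by (auto simp: dynkin_quiver_def)
  show "finite (verts Q)" using bij_betw_finite[OF v] by simp
  obtain m b where "b < m" "dynkin_edges D \<subseteq> insert {b, m} {{i, Suc i} | i. Suc i < m}"
    using dynkin_edges_subset[OF D] by auto
  then have "dynkin_edges D \<subseteq> Pow {..m}" by force
  then have "finite (dynkin_edges D)" by (rule finite_subset) simp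
  then show "finite (arcs Q)" using bij_betw_finite[OF e] by simp
qed

text \<open>The potential grows by one along each arrow of a path, so that its values bound the length.\<close>
lemma dynkin_finite_paths:
  fixes Q :: "('v, 'e) pre_digraph"
  assumes Q: "dynkin_quiver Q"
  shows "finite (qpaths Q)"
proof -
  interpret wf_digraph Q using Q by (simp add: dynkin_quiver_def)
  obtain h :: "'v \<Rightarrow> int" where h: "\<And>\<rho>. \<rho> \<in> arcs Q \<Longrightarrow> h (head Q \<rho>) = h (tail Q \<rho>) + 1"
    using dynkin_potential[OF Q] by blast
  have len: "h v = h u + int (length es)" if "awalk u es v" for u es v
    using that by (induction es arbitrary: u) (auto simp: awalk_simps h)
  let ?L = "nat (Max (h ` verts Q) - Min (h ` verts Q))"
  have "length es \<le> ?L" if w: "awalk u es v" for u es v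
  proof -
    have "u \<in> verts Q" "v \<in> verts Q" using w by auto
    then have "h v \<le> Max (h ` verts Q)" "Min (h ` verts Q) \<le> h u" using dynkin_finite(1)[OF Q] by auto
    then show ?thesis using len[OF w] by linarith
  qed
  moreover have "set es \<subseteq> arcs Q" "u \<in> verts Q" if "awalk u es v" for u es v using that by auto
  ultimately have "qpaths Q \<subseteq> verts Q \<times> {es. set es \<subseteq> arcs Q \<and> length es \<le> ?L}" by (auto simp: qpaths_def)
  then show ?thesis
    by (rule finite_subset) (intro finite_cartesian_product finite_lists_length_le dynkin_finite[OF Q])
qed

theorem proposition3p12:
  fixes Q :: "('v, 'e) pre_digraph"
    and K :: "'k ring"
    and q :: nat
    and P L M N :: "('v, 'e, 'k, 'm) pa_module"
    and RP RL RM RN :: "('v \<times> 'e list \<Rightarrow> 'k, 'p, 'm) resolution"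
  defines "A \<equiv> path_algebra K Q"
    and "P\<^sub>L \<equiv> res_P RL" and "\<Omega>\<^sub>L \<equiv> res_Omega RL"
    and "P\<^sub>M \<equiv> res_P RM" and "\<Omega>\<^sub>M \<equiv> res_Omega RM"
    and "P\<^sub>N \<equiv> res_P RN" and "\<Omega>\<^sub>N \<equiv> res_Omega RN"
    and "C\<^sub>L \<equiv> C_cplx RL" and "C\<^sub>M \<equiv> C_cplx RM" and "C\<^sub>N \<equiv> C_cplx RN"
    and "C\<^sub>P \<equiv> C_cplx RP" and "K\<^sub>P \<equiv> K_cplx P"
  assumes "dynkin_quiver Q"
    and "field K" and "finite (carrier K)" and "card (carrier K) = q"
    and "fd_module K Q P" and "indecomposable A P" and "projective K Q P"
    and "fd_module K Q L" and "indecomposable A L"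
    and "fd_module K Q M" and "indecomposable A M"
    and "fd_module K Q N" and "indecomposable A N"
    and "minimal_resolution K Q P RP" and "minimal_resolution K Q L RL"
    and "minimal_resolution K Q M RM" and "minimal_resolution K Q N RN"
  shows
    "(carrier (hom_space K Q M N) = {\<zero>\<^bsub>hom_space K Q M N\<^esub>} \<longrightarrow>
        (c1_ses K Q C\<^sub>M C\<^sub>N C\<^sub>L \<noteq> {} \<longleftrightarrow>
           mod_iso A P\<^sub>L (direct_sum P\<^sub>M P\<^sub>N) \<and> mod_ses K Q M N L \<noteq> {}) \<and>
        (c1_ses K Q C\<^sub>M C\<^sub>N C\<^sub>L \<noteq> {} \<longrightarrow>
           c1_hall K Q C\<^sub>M C\<^sub>N C\<^sub>L =
             real q ^ (hom_dim K Q P\<^sub>N \<Omega>\<^sub>M + hom_dim K Q \<Omega>\<^sub>N P\<^sub>M) * mod_hall K Q M N L)) \<and>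
     (\<not> mod_iso A M N \<and> carrier (Ext1 K Q RM N) = {\<zero>\<^bsub>Ext1 K Q RM N\<^esub>} \<longrightarrow>
        (c1_ses K Q C\<^sub>M C\<^sub>N C\<^sub>L \<noteq> {} \<longleftrightarrow>
           mod_iso A (direct_sum P\<^sub>L \<Omega>\<^sub>L)
             (direct_sum (direct_sum (direct_sum P\<^sub>M P\<^sub>N) \<Omega>\<^sub>M) \<Omega>\<^sub>N) \<and>
           (\<exists>f \<in> module_hom A M N. inj_on f (carrier M) \<and> mod_iso A (coker M N f) L)) \<and>
        (c1_ses K Q C\<^sub>M C\<^sub>N C\<^sub>L \<noteq> {} \<longrightarrow>
           c1_hall K Q C\<^sub>M C\<^sub>N C\<^sub>L =
             real q powi
               (sym_euler_form Q (dim_vec K Q P\<^sub>L) (dim_vec K Q \<Omega>\<^sub>L)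
                - sym_euler_form Q (dim_vec K Q P\<^sub>M) (dim_vec K Q \<Omega>\<^sub>M)
                - sym_euler_form Q (dim_vec K Q P\<^sub>N) (dim_vec K Q \<Omega>\<^sub>N)
                - euler_form Q (dim_vec K Q P\<^sub>M) (dim_vec K Q P\<^sub>N)
                - euler_form Q (dim_vec K Q \<Omega>\<^sub>M) (dim_vec K Q \<Omega>\<^sub>N))
             * (real (card (mod_auts A L)) / real (card (mod_auts A N)))
             * mod_hall K Q L M N)) \<and>
     ((c1_ses K Q C\<^sub>M C\<^sub>M K\<^sub>P \<noteq> {} \<longleftrightarrow> mod_iso A M P) \<and>
        c1_hall K Q C\<^sub>P C\<^sub>P K\<^sub>P = 1)"
proof -
  note [simp] = assms(1-12)
  note hyps = assms(13-)
  have fd: "fd_module K Q P" "fd_module K Q L" "fd_module K Q M" "fd_module K Q N" by fact+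
  have indec: "indecomposable (path_algebra K Q) P" "indecomposable (path_algebra K Q) L"
    "indecomposable (path_algebra K Q) M" "indecomposable (path_algebra K Q) N" using hyps by simp_all
  have res: "minimal_resolution K Q P RP" "minimal_resolution K Q L RL" "minimal_resolution K Q M RM" "minimal_resolution K Q N RN"
    by fact+
  have proj: "projective K Q P" by fact
  have ring: "ring (path_algebra K Q)" using fd(1) by (auto simp: fd_module_def left_module_def)
  have wf: "wf_digraph Q" using hyps by (simp add: dynkin_quiver_def)
  have paths: "finite (qpaths Q)" by (rule dynkin_finite_paths) fact
  interpret finite_path_algebra K Q by (rule finite_path_algebra.intro) fact+
  interpret three_resolutions K Q L M N RL RM RN by unfold_locales (fact fd res)+
  have q: "q = card (carrier K)" using hyps by simp
  have nonzero: "carrier M \<noteq> {\<zero>\<^bsub>M\<^esub>}" "carrier N \<noteq> {\<zero>\<^bsub>N\<^esub>}"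
    using indec(3,4) unfolding indecomposable_def by auto

  have 1: "(c1_ses K Q C\<^sub>M C\<^sub>N C\<^sub>L \<noteq> {} \<longleftrightarrow> mod_iso A P\<^sub>L (direct_sum P\<^sub>M P\<^sub>N) \<and> mod_ses K Q M N L \<noteq> {}) \<and>
      (c1_ses K Q C\<^sub>M C\<^sub>N C\<^sub>L \<noteq> {} \<longrightarrow> c1_hall K Q C\<^sub>M C\<^sub>N C\<^sub>L =
         real q ^ (hom_dim K Q P\<^sub>N \<Omega>\<^sub>M + hom_dim K Q \<Omega>\<^sub>N P\<^sub>M) * mod_hall K Q M N L)"
    if "carrier (hom_space K Q M N) = {\<zero>\<^bsub>hom_space K Q M N\<^esub>}"
  proof -
    have homs: "mod_homs (path_algebra K Q) M N = {\<lambda>x \<in> carrier M. \<zero>\<^bsub>N\<^esub>}" using that by (simp add: hom_space_def)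
    have "\<forall>h \<in> module_hom (path_algebra K Q) M N. \<forall>m \<in> carrier M. h m = \<zero>\<^bsub>N\<^esub>"
    proof (intro ballI)
      fix h m assume h: "h \<in> module_hom (path_algebra K Q) M N" and m: "m \<in> carrier M"
      have "restrict h (carrier M) = (\<lambda>x \<in> carrier M. \<zero>\<^bsub>N\<^esub>)"
        using restrict_hom[OF h DM(5)] unfolding homs by simp
      from fun_cong[OF this, of m] show "h m = \<zero>\<^bsub>N\<^esub>" using m by simp
    qed
    from conflation_iff_extension[OF this] show ?thesis unfolding q assms(1-12) by (intro conjI impI)
  qed

  have 2: "(c1_ses K Q C\<^sub>M C\<^sub>N C\<^sub>L \<noteq> {} \<longleftrightarrow>
        mod_iso A (direct_sum P\<^sub>L \<Omega>\<^sub>L) (direct_sum (direct_sum (direct_sum P\<^sub>M P\<^sub>N) \<Omega>\<^sub>M) \<Omega>\<^sub>N) \<and>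
        (\<exists>f \<in> module_hom A M N. inj_on f (carrier M) \<and> mod_iso A (coker M N f) L)) \<and>
      (c1_ses K Q C\<^sub>M C\<^sub>N C\<^sub>L \<noteq> {} \<longrightarrow> c1_hall K Q C\<^sub>M C\<^sub>N C\<^sub>L =
         real q powi
           (sym_euler_form Q (dim_vec K Q P\<^sub>L) (dim_vec K Q \<Omega>\<^sub>L)
            - sym_euler_form Q (dim_vec K Q P\<^sub>M) (dim_vec K Q \<Omega>\<^sub>M)
            - sym_euler_form Q (dim_vec K Q P\<^sub>N) (dim_vec K Q \<Omega>\<^sub>N)
            - euler_form Q (dim_vec K Q P\<^sub>M) (dim_vec K Q P\<^sub>N)
            - euler_form Q (dim_vec K Q \<Omega>\<^sub>M) (dim_vec K Q \<Omega>\<^sub>N))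
         * (real (card (mod_auts A L)) / real (card (mod_auts A N))) * mod_hall K Q L M N)"
    if "carrier (Ext1 K Q RM N) = {\<zero>\<^bsub>Ext1 K Q RM N\<^esub>}"
  proof -
    have extend: "\<forall>b \<in> module_hom (path_algebra K Q) (res_Omega RM) N.
        \<exists>h \<in> module_hom (path_algebra K Q) (res_P RM) N. \<forall>w \<in> carrier (res_Omega RM). h (res_delta RM w) = b w"
      by (intro ballI Ext1_zeroD[OF res(3) fd(3,4) that])
    note iff = conflation_iff_quotient[OF extend indec(2) nonzero(2)]
    show ?thesis
      unfolding q assms(1-12)
    proof (intro conjI impI)
      show "c1_ses K Q (C_cplx RM) (C_cplx RN) (C_cplx RL) \<noteq> {} \<longleftrightarrow>
        mod_iso (path_algebra K Q) (direct_sum (res_P RL) (res_Omega RL))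
          (direct_sum (direct_sum (direct_sum (res_P RM) (res_P RN)) (res_Omega RM)) (res_Omega RN)) \<and>
        (\<exists>f \<in> module_hom (path_algebra K Q) M N. inj_on f (carrier M) \<and> mod_iso (path_algebra K Q) (coker M N f) L)"
        unfolding iff(1) mod_ses_nonempty_iff[OF fd(2-4)] by (rule refl)
    next
      assume ne: "c1_ses K Q (C_cplx RM) (C_cplx RN) (C_cplx RL) \<noteq> {}"
      then obtain f g where fg: "(f, g) \<in> c1_ses K Q (C_cplx RM) (C_cplx RN) (C_cplx RL)" by auto
      obtain e b where S: "mod_iso (path_algebra K Q) (res_P RN) (res_P RL)"
        "carrier (res_Omega RM) = {\<zero>\<^bsub>res_Omega RM\<^esub>}"
        "e \<in> module_hom (path_algebra K Q) (res_Omega RN) (res_Omega RL)"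
        "b \<in> module_hom (path_algebra K Q) (res_Omega RL) (res_P RM)"
        "short_exact (res_Omega RN) e (res_Omega RL) b (res_P RM)"
        by (rule conflation_rigid_structure[OF extend indec(2) nonzero(2) fg]) (rule that)
      show "c1_hall K Q (C_cplx RM) (C_cplx RN) (C_cplx RL) =
        real (card (carrier K)) powi
          (sym_euler_form Q (dim_vec K Q (res_P RL)) (dim_vec K Q (res_Omega RL))
           - sym_euler_form Q (dim_vec K Q (res_P RM)) (dim_vec K Q (res_Omega RM))
           - sym_euler_form Q (dim_vec K Q (res_P RN)) (dim_vec K Q (res_Omega RN))
           - euler_form Q (dim_vec K Q (res_P RM)) (dim_vec K Q (res_P RN))
           - euler_form Q (dim_vec K Q (res_Omega RM)) (dim_vec K Q (res_Omega RN)))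
        * (real (card (mod_auts (path_algebra K Q) L)) / real (card (mod_auts (path_algebra K Q) N))) * mod_hall K Q L M N"
        unfolding rigid_exponent[OF S] card_homs_euler_form[OF DN(1) fd_terms(3), symmetric] by (rule iff(2)[OF ne])
    qed
  qed

  have 3: "c1_ses K Q C\<^sub>M C\<^sub>M K\<^sub>P \<noteq> {} \<longleftrightarrow> mod_iso A M P"
  proof
    assume "c1_ses K Q C\<^sub>M C\<^sub>M K\<^sub>P \<noteq> {}"
    then obtain f g where "(f, g) \<in> c1_ses K Q (C_cplx RM) (C_cplx RM) (K_cplx P)" unfolding assms(1-12) by auto
    then show "mod_iso A M P"
      unfolding assms(1-12) by (rule contractible_conflation_iso[OF proj indec(1) fd(3) res(3) nonzero(1)])
  next
    assume "mod_iso A M P"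
    then show "c1_ses K Q C\<^sub>M C\<^sub>M K\<^sub>P \<noteq> {}"
      unfolding assms(1-12) by (rule contractible_conflations(1)[OF proj fd(3) res(3)])
  qed

  have "mod_iso (path_algebra K Q) P P" unfolding mod_iso_def by (rule bexI[OF _ hom_id]) (simp add: bij_betw_def)
  from contractible_conflations(2)[OF proj fd(1) res(1) this]
  have 4: "c1_hall K Q C\<^sub>P C\<^sub>P K\<^sub>P = 1" unfolding assms(1-12) .
  show ?thesis
    by (rule conjI, rule impI, erule 1, rule conjI, rule impI, erule conjE, erule 2, rule conjI[OF 3 4])
qed

end
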